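(* Let $a_0,a_1,a_2,a_3\in\,]0,\pi[$ and let $C$ be a connected component of $S(a_0,a_1,a_2,a_3)$ (points of different types with the same $(t_1,t_2,t_3)$ being identified) that does not consist of a single point. The group $M_3$ generated by the modifications $n_1,n_2,n_3$ acts discretely on $C$ if and only if all of the following hold: (i) $C$ is noncompact; (ii) $a_j+a_k\leqslant\pi$ for all $j\ne k$ in $\{0,1,2,3\}$, or $\pi\leqslant a_j+a_k$ for all $j\ne k$ in $\{0,1,2,3\}$; (iii) $a_j\ne\frac\pi2$ for some $0\leqslant j\leqslant3$. In this case, the quotient $C/M$ is (homeomorphic to) a $3$-holed $2$-sphere and $M$ is a free group of rank $2$, where $M$ is the index $2$ subgroup of $M_3$ formed by the elements that preserve the type of hexagons (the products of an even number of the $n_j$'s).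
   Context: Let $V$ be a $2$-dimensional complex vector space with a hermitian form $\langle-,-\rangle$ (linear in the first argument) of signature $(1,1)$, and let $\mathrm BV:=\{p\in\mathbb P_{\mathbb C}V\mid\langle p,p\rangle>0\}$. This is the hyperbolic plane of curvature $-1$, oriented by its complex structure, with $\cosh^2\frac{\mathrm{dist}(p,q)}2=\mathrm{ta}(p,q):=\frac{\langle p,q\rangle\langle q,p\rangle}{\langle p,p\rangle\langle q,q\rangle}$; $\mathrm{PU}V$ is its group of orientation-preserving isometries. For $c\in\mathrm BV$ and $k\in\mathbb C$, $|k|=1$, the map $R_{c,k}:p\mapsto(\overline k-k)\frac{\langle p,c\rangle}{\langle c,c\rangle}c+kp$ lies in $\mathrm{SU}V$ and acts on $\mathrm BV$ as the counterclockwise rotation about $c$ by the angle $2\arg k$. The space $S(a_0,a_1,a_2,a_3)$. Put $k_j:=e^{a_ji}$. A hexagon of the first (respectively, second) type is a quadruple $(c_0,c_1,c_2,c_3)\in(\mathrm BV)^4$, considered up to the diagonal action of $\mathrm{PU}V$, such that $R_3R_2R_1R_0=1$ (respectively, $R_0R_1R_2R_3=1$) in $\mathrm{PU}V$, where $R_j:=R_{c_j,k_j}$. $S(a_0,a_1,a_2,a_3)$ is the disjoint union of the spaces of hexagons of the two types, with the natural topology. For a hexagon $P$ put $p_3:=c_0$ and $p_1:=R_1p_3$, $p_2:=R_2p_1$ (then $p_3=R_3p_2$) for the first type; $p_1:=R_1^{-1}p_3$, $p_2:=R_2^{-1}p_1$ (then $p_3=R_3^{-1}p_2$) for the second type. Put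 $t_jP:=\mathrm{ta}(c_j,p_j)\geqslant1$ for $j=1,2,3$. Modifications. Write $A^B:=BAB^{-1}$. The involutions $n_1,n_2,n_3$ of $S(a_0,a_1,a_2,a_3)$ (acting from the right) interchange the types: on hexagons of the first type they send the relation $R_3R_2R_1R_0=1$ respectively to the second-type relations $R_0^{R_3^{-1}}R_1R_2^{R_1^{-1}}R_3=1$, $R_0^{R_3^{-1}}R_1^{R_2}R_2R_3=1$, $R_0^{R_1}R_1R_2^{R_3}R_3=1$; on hexagons of the second type they send $R_0R_1R_2R_3=1$ respectively to the first-type relations $R_3R_2^{R_1}R_1R_0^{R_3}=1$, $R_3R_2R_1^{R_2^{-1}}R_0^{R_3}=1$, $R_3R_2^{R_3^{-1}}R_1R_0^{R_1^{-1}}=1$. (In each relation the factor that is a conjugate of $R_j$ is the new $R_j$, and its fixed point is the new $c_j$.) The involution $n_j$ preserves $t_l$ for $l\ne j$. $M_3$ is the group generated by $n_1,n_2,n_3$. Identification of types. On the hexagons of each fixed type the map $P\mapsto(t_1P,t_2P,t_3P)\in\mathbb R^3$ is injective, and its image is the same for both types. Hexagons of different types with the same $(t_1,t_2,t_3)$ are identified; after this, each connected component is a subset of $\mathbb R^3$ and each $n_j$, hence $M_3$, acts on it. The action of a group of transformations on $C$ is discrete if it is properly discontinuous: for every compact $K\subset C$ there are only finitely many transformations $g$ in the group with $Kg\cap K\ne\varnothing$. A $3$-holed $2$-sphere is, topologically, a $2$-sphere with three points removed. *)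

theory Defs
  imports "HOL-Analysis.Analysis" "HOL-Algebra.Bij" "HOL-Algebra.Generated_Groups"
begin

definition quotient_topology :: "'a topology \<Rightarrow> ('a \<Rightarrow> 'b) \<Rightarrow> 'b topology" where
  "quotient_topology X f =
     topology (\<lambda>U. U \<subseteq> f ` topspace X \<and> openin X {x \<in> topspace X. f x \<in> U})"

lemma openin_quotient_topology:
  "openin (quotient_topology X f) U \<longleftrightarrow>
     U \<subseteq> f ` topspace X \<and> openin X {x \<in> topspace X. f x \<in> U}"
proof -
  have "istopology (\<lambda>U. U \<subseteq> f ` topspace X \<and> openin X {x \<in> topspace X. f x \<in> U})"
    (is "istopology ?P")
    unfolding istopology_def
  proof (intro conjI allI impI)
    fix S T assume "?P S" "?P T"
    moreover have "{x \<in> topspace X. f x \<in> S \<inter> T} =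
        {x \<in> topspace X. f x \<in> S} \<inter> {x \<in> topspace X. f x \<in> T}" by auto
    ultimately show "S \<inter> T \<subseteq> f ` topspace X" "openin X {x \<in> topspace X. f x \<in> S \<inter> T}"
      by (auto simp: openin_Int)
  next
    fix \<K> assume K: "\<forall>S\<in>\<K>. ?P S"
    then show "\<Union>\<K> \<subseteq> f ` topspace X" by auto
    have "{x \<in> topspace X. f x \<in> \<Union>\<K>} = (\<Union>S\<in>\<K>. {x \<in> topspace X. f x \<in> S})" by auto
    with K show "openin X {x \<in> topspace X. f x \<in> \<Union>\<K>}" by auto
  qed
  then show ?thesis by (simp add: quotient_topology_def)
qed

lemma topspace_quotient_topology: "topspace (quotient_topology X f) = f ` topspace X"
proof -
  have "{x \<in> topspace X. f x \<in> f ` topspace X} = topspace X" by auto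
  then have "openin (quotient_topology X f) (f ` topspace X)"
    by (simp add: openin_quotient_topology)
  then show ?thesis
    by (metis openin_quotient_topology openin_subset openin_topspace subset_antisym)
qed

lemma quotient_map_quotient_topology: "quotient_map X (quotient_topology X f) f"
  by (auto simp: quotient_map_def topspace_quotient_topology openin_quotient_topology)

text \<open>A letter \<open>(x, True)\<close> stands for the generator \<open>x\<close> and \<open>(x, False)\<close> for its inverse.\<close>

definition reduced_word :: "('a \<times> bool) list \<Rightarrow> bool" where
  "reduced_word w \<longleftrightarrow> successively (\<lambda>(x, b) (y, c). \<not> (x = y \<and> b \<noteq> c)) w"

definition word_value :: "('a, 'b) monoid_scheme \<Rightarrow> ('a \<times> bool) list \<Rightarrow> 'a" where
  "word_value G w =
     foldr (\<lambda>(x, b) g. (if b then x else inv\<^bsub>G\<^esub> x) \<otimes>\<^bsub>G\<^esub> g) w \<one>\<^bsub>G\<^esub>"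

definition free_group_of_rank :: "('a, 'b) monoid_scheme \<Rightarrow> nat \<Rightarrow> bool" where
  "free_group_of_rank G n \<longleftrightarrow> group G \<and>
     (\<exists>X \<subseteq> carrier G. finite X \<and> card X = n \<and>
        bij_betw (word_value G) {w. set w \<subseteq> X \<times> UNIV \<and> reduced_word w} (carrier G))"

definition hermitian_form :: "(complex^2 \<Rightarrow> complex^2 \<Rightarrow> complex) \<Rightarrow> bool" where
  "hermitian_form h \<longleftrightarrow>
     (\<forall>u v w. h (u + v) w = h u w + h v w) \<and>
     (\<forall>z u v. h (z *s u) v = z * h u v) \<and>
     (\<forall>u v. h v u = cnj (h u v))"

definition signature_1_1 :: "(complex^2 \<Rightarrow> complex^2 \<Rightarrow> complex) \<Rightarrow> bool" where
  "signature_1_1 h \<longleftrightarrow> (\<exists>u v. h u u = 1 \<and> h v v = -1 \<and> h u v = 0)"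

text \<open>Points of the projective line are one-dimensional subspaces.\<close>

type_synonym pt = "(complex^2) set"

definition proj_line_topology :: "pt topology" where
  "proj_line_topology = quotient_topology (top_of_set (- {0})) (\<lambda>v. vec.span {v})"

definition BV :: "(complex^2 \<Rightarrow> complex^2 \<Rightarrow> complex) \<Rightarrow> pt set" where
  "BV h = {vec.span {v} | v. Re (h v v) > 0}"

definition BV_topology :: "(complex^2 \<Rightarrow> complex^2 \<Rightarrow> complex) \<Rightarrow> pt topology" where
  "BV_topology h = subtopology proj_line_topology (BV h)"

text \<open>The two definitions that use this representative do not depend on its choice.\<close>

definition rep :: "pt \<Rightarrow> complex^2" where
  "rep p = (SOME v. v \<noteq> 0 \<and> v \<in> p)"

definition ta :: "(complex^2 \<Rightarrow> complex^2 \<Rightarrow> complex) \<Rightarrow> pt \<Rightarrow> pt \<Rightarrow> real" where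
  "ta h p q = (let u = rep p; v = rep q in Re (h u v * h v u / (h u u * h v v)))"

definition rot :: "(complex^2 \<Rightarrow> complex^2 \<Rightarrow> complex) \<Rightarrow> pt \<Rightarrow> complex \<Rightarrow>
    complex^2 \<Rightarrow> complex^2" where
  "rot h p k = (let c = rep p in (\<lambda>v. ((cnj k - k) * (h v c / h c c)) *s c + k *s v))"

definition unitary :: "(complex^2 \<Rightarrow> complex^2 \<Rightarrow> complex) \<Rightarrow> (complex^2 \<Rightarrow> complex^2) set" where
  "unitary h = {g. Vector_Spaces.linear (*s) (*s) g \<and> (\<forall>u v. h (g u) (g v) = h u v)}"

definition trivial_in_PU :: "(complex^2 \<Rightarrow> complex^2) \<Rightarrow> bool" where
  "trivial_in_PU g \<longleftrightarrow> (\<exists>z. z \<noteq> 0 \<and> (\<forall>v. g v = z *s v))"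

datatype hex_type = First | Second

type_synonym hexagon = "hex_type \<times> pt \<times> pt \<times> pt \<times> pt"

definition hex_rot :: "(complex^2 \<Rightarrow> complex^2 \<Rightarrow> complex) \<Rightarrow> (nat \<Rightarrow> real) \<Rightarrow> nat \<Rightarrow> pt \<Rightarrow>
    complex^2 \<Rightarrow> complex^2" where
  "hex_rot h a j c = rot h c (exp (complex_of_real (a j) * \<i>))"

fun is_hexagon :: "(complex^2 \<Rightarrow> complex^2 \<Rightarrow> complex) \<Rightarrow> (nat \<Rightarrow> real) \<Rightarrow> hexagon \<Rightarrow> bool" where
  "is_hexagon h a (ty, c0, c1, c2, c3) \<longleftrightarrow>
     c0 \<in> BV h \<and> c1 \<in> BV h \<and> c2 \<in> BV h \<and> c3 \<in> BV h \<and>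
     (let R = hex_rot h a in
      case ty of
        First \<Rightarrow> trivial_in_PU (R 3 c3 \<circ> R 2 c2 \<circ> R 1 c1 \<circ> R 0 c0)
      | Second \<Rightarrow> trivial_in_PU (R 0 c0 \<circ> R 1 c1 \<circ> R 2 c2 \<circ> R 3 c3))"

definition hexagon_topology ::
    "(complex^2 \<Rightarrow> complex^2 \<Rightarrow> complex) \<Rightarrow> (nat \<Rightarrow> real) \<Rightarrow> hexagon topology" where
  "hexagon_topology h a =
     subtopology
       (prod_topology (discrete_topology UNIV)
         (prod_topology (BV_topology h) (prod_topology (BV_topology h)
           (prod_topology (BV_topology h) (BV_topology h)))))
       {x. is_hexagon h a x}"

fun move_hexagon :: "(complex^2 \<Rightarrow> complex^2) \<Rightarrow> hexagon \<Rightarrow> hexagon" where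
  "move_hexagon g (ty, c0, c1, c2, c3) = (ty, g ` c0, g ` c1, g ` c2, g ` c3)"

definition PU_orbit :: "(complex^2 \<Rightarrow> complex^2 \<Rightarrow> complex) \<Rightarrow> hexagon \<Rightarrow> hexagon set" where
  "PU_orbit h x = {move_hexagon g x | g. g \<in> unitary h}"

definition S_topology ::
    "(complex^2 \<Rightarrow> complex^2 \<Rightarrow> complex) \<Rightarrow> (nat \<Rightarrow> real) \<Rightarrow> hexagon set topology" where
  "S_topology h a = quotient_topology (hexagon_topology h a) (PU_orbit h)"

abbreviation S_space ::
    "(complex^2 \<Rightarrow> complex^2 \<Rightarrow> complex) \<Rightarrow> (nat \<Rightarrow> real) \<Rightarrow> hexagon set set" where
  "S_space h a \<equiv> topspace (S_topology h a)"

definition type_of :: "hexagon set \<Rightarrow> hex_type" where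
  "type_of P = the_elem (fst ` P)"

fun hexagon_t :: "(complex^2 \<Rightarrow> complex^2 \<Rightarrow> complex) \<Rightarrow> (nat \<Rightarrow> real) \<Rightarrow> hexagon \<Rightarrow>
    real \<times> real \<times> real" where
  "hexagon_t h a (First, c0, c1, c2, c3) =
     (let R = hex_rot h a; p3 = c0; p1 = R 1 c1 ` p3; p2 = R 2 c2 ` p1
      in (ta h c1 p1, ta h c2 p2, ta h c3 p3))"
| "hexagon_t h a (Second, c0, c1, c2, c3) =
     (let R = hex_rot h a; p3 = c0; p1 = inv_into UNIV (R 1 c1) ` p3; p2 = inv_into UNIV (R 2 c2) ` p1
      in (ta h c1 p1, ta h c2 p2, ta h c3 p3))"

definition t_of :: "(complex^2 \<Rightarrow> complex^2 \<Rightarrow> complex) \<Rightarrow> (nat \<Rightarrow> real) \<Rightarrow> hexagon set \<Rightarrow>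
    real \<times> real \<times> real" where
  "t_of h a P = the_elem (hexagon_t h a ` P)"

text \<open>If \<open>R\<close> fixes \<open>c\<close>, then the conjugate \<open>B R B\<inverse>\<close> fixes \<open>B c\<close>; hence each conjugated
  factor of the new relation is recorded by moving its centre with the conjugating map.\<close>

fun hexagon_n1 :: "(complex^2 \<Rightarrow> complex^2 \<Rightarrow> complex) \<Rightarrow> (nat \<Rightarrow> real) \<Rightarrow> hexagon \<Rightarrow> hexagon" where
  "hexagon_n1 h a (First, c0, c1, c2, c3) =
     (let R = hex_rot h a in (Second, inv_into UNIV (R 3 c3) ` c0, c1, inv_into UNIV (R 1 c1) ` c2, c3))"
| "hexagon_n1 h a (Second, c0, c1, c2, c3) =
     (let R = hex_rot h a in (First, R 3 c3 ` c0, c1, R 1 c1 ` c2, c3))"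

fun hexagon_n2 :: "(complex^2 \<Rightarrow> complex^2 \<Rightarrow> complex) \<Rightarrow> (nat \<Rightarrow> real) \<Rightarrow> hexagon \<Rightarrow> hexagon" where
  "hexagon_n2 h a (First, c0, c1, c2, c3) =
     (let R = hex_rot h a in (Second, inv_into UNIV (R 3 c3) ` c0, R 2 c2 ` c1, c2, c3))"
| "hexagon_n2 h a (Second, c0, c1, c2, c3) =
     (let R = hex_rot h a in (First, R 3 c3 ` c0, inv_into UNIV (R 2 c2) ` c1, c2, c3))"

fun hexagon_n3 :: "(complex^2 \<Rightarrow> complex^2 \<Rightarrow> complex) \<Rightarrow> (nat \<Rightarrow> real) \<Rightarrow> hexagon \<Rightarrow> hexagon" where
  "hexagon_n3 h a (First, c0, c1, c2, c3) =
     (let R = hex_rot h a in (Second, R 1 c1 ` c0, c1, R 3 c3 ` c2, c3))"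
| "hexagon_n3 h a (Second, c0, c1, c2, c3) =
     (let R = hex_rot h a in (First, inv_into UNIV (R 1 c1) ` c0, c1, inv_into UNIV (R 3 c3) ` c2, c3))"

text \<open>The modifications commute with \<open>PU V\<close>, so they act on orbits by taking images.\<close>

definition modifications :: "(complex^2 \<Rightarrow> complex^2 \<Rightarrow> complex) \<Rightarrow> (nat \<Rightarrow> real) \<Rightarrow>
    (hexagon set \<Rightarrow> hexagon set) set" where
  "modifications h a =
     (\<lambda>n. restrict (\<lambda>P. n ` P) (S_space h a)) ` {hexagon_n1 h a, hexagon_n2 h a, hexagon_n3 h a}"

text \<open>Right actions are written as ordinary functions. This replaces the groups by their
  opposites as abstract groups, but leaves the sets of transformations unchanged.\<close>

definition M3 :: "(complex^2 \<Rightarrow> complex^2 \<Rightarrow> complex) \<Rightarrow> (nat \<Rightarrow> real) \<Rightarrow>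
    (hexagon set \<Rightarrow> hexagon set) set" where
  "M3 h a = generate (BijGroup (S_space h a)) (modifications h a)"

definition M3_even :: "(complex^2 \<Rightarrow> complex^2 \<Rightarrow> complex) \<Rightarrow> (nat \<Rightarrow> real) \<Rightarrow>
    (hexagon set \<Rightarrow> hexagon set) set" where
  "M3_even h a = {g \<in> M3 h a. \<forall>P \<in> S_space h a. type_of (g P) = type_of P}"

definition M3_even_group :: "(complex^2 \<Rightarrow> complex^2 \<Rightarrow> complex) \<Rightarrow> (nat \<Rightarrow> real) \<Rightarrow>
    (hexagon set \<Rightarrow> hexagon set) monoid" where
  "M3_even_group h a = (BijGroup (S_space h a)) \<lparr>carrier := M3_even h a\<rparr>"

text \<open>Hexagons of different types with the same \<open>t\<close> are identified. Since \<open>t\<close> is injective on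
  each type and has the same image on both, two hexagons get identified iff their \<open>t\<close> agree.
  An identified point is the set of the hexagons it comes from, so that the transformations
  of \<^const>\<open>M3\<close> act on identified points by taking images.\<close>

definition identified :: "(complex^2 \<Rightarrow> complex^2 \<Rightarrow> complex) \<Rightarrow> (nat \<Rightarrow> real) \<Rightarrow>
    hexagon set \<Rightarrow> hexagon set set" where
  "identified h a P = {Q \<in> S_space h a. t_of h a Q = t_of h a P}"

definition ident_topology :: "(complex^2 \<Rightarrow> complex^2 \<Rightarrow> complex) \<Rightarrow> (nat \<Rightarrow> real) \<Rightarrow>
    hexagon set set topology" where
  "ident_topology h a = quotient_topology (S_topology h a) (identified h a)"

text \<open>A set \<open>G\<close> of maps \<open>'a \<Rightarrow> 'a\<close> acting by images on a space \<open>X\<close> whose points are sets.\<close>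

definition acts_discretely :: "('a \<Rightarrow> 'a) set \<Rightarrow> 'a set topology \<Rightarrow> bool" where
  "acts_discretely G X \<longleftrightarrow>
     (\<forall>K. compactin X K \<longrightarrow> finite {g \<in> G. (\<lambda>x. g ` x) ` K \<inter> K \<noteq> {}})"

definition orbit_space :: "('a \<Rightarrow> 'a) set \<Rightarrow> 'a set topology \<Rightarrow> 'a set set topology" where
  "orbit_space G X = quotient_topology X (\<lambda>x. {g ` x | g. g \<in> G})"

definition three_holed_sphere :: "'a topology \<Rightarrow> bool" where
  "three_holed_sphere X \<longleftrightarrow>
     (\<exists>x y z :: real^3. {x, y, z} \<subseteq> sphere 0 1 \<and> x \<noteq> y \<and> x \<noteq> z \<and> y \<noteq> z \<and>
        X homeomorphic_space top_of_set (sphere 0 1 - {x, y, z}))"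

end

theory Submission
  imports Defs "HOL-Real_Asymp.Real_Asymp"
begin

text \<open>Write \<open>e = \<plusminus>1\<close> for the product of the four rotations in \<open>SU V\<close>. An affine change of the
  coordinates \<open>t\<^sub>j\<close> turns the equation of the space of hexagons into the Fricke cubic of the
  four-holed sphere with boundary traces \<open>2 e cos a\<^sub>0, 2 cos a\<^sub>1, 2 cos a\<^sub>2, 2 cos a\<^sub>3\<close>, and the modifications into
  its three Vieta involutions. Under (ii) and (iii) all coordinates exceed 2 on the component with
  \<open>e = 1\<close>; there two of the three increments of the involutions never are both nonpositive, so the involutions
  play ping-pong, and the region where no involution decreases its coordinate is a fundamental domain
  homeomorphic to a half-plane with two boundary points removed; doubling it along its three sides gives
  the sphere with three holes, with fundamental group generated by two products of two involutions.
  If a condition fails, then the component meets, or contains, level curves of a coordinate with values in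
  \<open>]-2, 2[\<close>, which are compact; the product of two involutions rotates each of them, by an angle which is not
  constant, so that infinitely many of its powers meet a compact set.\<close>

section \<open>Fricke polynomials\<close>

text \<open>Fix one coordinate x with x^2 different from 4. The increments e and f of the other two
  involutions are affine coordinates on this level, and the cubic becomes the conic e^2 + f^2 + x e
  f = kappa(x), whose right side depends on x only. For x > 2 and kappa > 0 it is a hyperbola, and
  the sign of a derivative of the form tells its branches apart; for |x| < 2 it is an ellipse, a
  point or empty. The coordinates are normalised as tau_j = 2 t_j - 1 = cosh dist(c_j, p_j), so
  hexagons are the points with all tau_j >= 1. The cubic has other real points. A curve on which one
  kappa stays nonzero cannot lead to them, because no point of the cubic has one |tau_i| > 1 and
  another |tau_j| < 1. Ping-pong and freeness need only the signs of increments. The shape of the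
  domain needs more: its third wall must be a graph over the share of the first increment in the sum
  of the first two. This is why the third increment is shown to vanish exactly once on each curve
  where that share is fixed inside ]0, 1[.\<close>

definition fricke :: "real \<Rightarrow> real \<Rightarrow> real \<Rightarrow> real \<Rightarrow> real \<Rightarrow> real \<Rightarrow> real \<Rightarrow> real" where
  "fricke A B C D x y z = x\<^sup>2 + y\<^sup>2 + z\<^sup>2 - x * y * z + 4 * (A * B + C * D) * x + 4 * (A * C + B * D) * y
     + 4 * (A * D + B * C) * z - 4 + 4 * (A\<^sup>2 + B\<^sup>2 + C\<^sup>2 + D\<^sup>2) + 16 * A * B * C * D"

text \<open>The difference between the other root of the cubic in its first variable and that
  variable; equivalently, minus the partial derivative of \<open>fricke\<close>. Permuting the
  coefficients along with the variables gives the other two increments.\<close>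

definition slope :: "real \<Rightarrow> real \<Rightarrow> real \<Rightarrow> real \<Rightarrow> real \<Rightarrow> real \<Rightarrow> real \<Rightarrow> real" where
  "slope A B C D x y z = y * z - 2 * x - 4 * (A * B + C * D)"

text \<open>Each factor is tr [g, h] - 2 for g, h in SL2 with traces 2A, 2B (respectively 2C, 2D)
  and tr (g h) = - x; it vanishes when g and h have a common eigenvector.\<close>

definition kap :: "real \<Rightarrow> real \<Rightarrow> real \<Rightarrow> real \<Rightarrow> real \<Rightarrow> real" where
  "kap A B C D x = (x\<^sup>2 + 4 * A * B * x + 4 * A\<^sup>2 + 4 * B\<^sup>2 - 4) * (x\<^sup>2 + 4 * C * D * x + 4 * C\<^sup>2 + 4 * D\<^sup>2 - 4)"

lemma abs_le_one:
  assumes "A\<^sup>2 + a\<^sup>2 = (1::real)"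
  shows "\<bar>A\<bar> \<le> 1"
proof -
  have "A\<^sup>2 \<le> 1" using assms zero_le_power2[of a] by linarith
  then show ?thesis by (simp add: abs_square_le_1)
qed

lemma abs_mult_le_one:
  assumes "A\<^sup>2 + a\<^sup>2 = (1::real)" "B\<^sup>2 + b\<^sup>2 = 1"
  shows "\<bar>A * B\<bar> \<le> 1"
  using abs_le_one[OF assms(1)] abs_le_one[OF assms(2)] by (simp add: abs_mult mult_le_one)

lemma square_gt_4:
  assumes "x > (2::real)"
  shows "x\<^sup>2 - 4 > 0"
proof -
  have "(x - 2) * (x + 2) > 0" using assms by simp
  then show ?thesis by (simp add: algebra_simps power2_eq_square)
qed

lemma fricke_swap12: "fricke A C B D y x z = fricke A B C D x y z"
  by (simp add: fricke_def algebra_simps)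

lemma fricke_swap13: "fricke A D C B z y x = fricke A B C D x y z"
  by (simp add: fricke_def algebra_simps)

lemma fricke_swap23: "fricke A B D C x z y = fricke A B C D x y z"
  by (simp add: fricke_def algebra_simps)

lemma fricke_rot: "fricke A D B C z x y = fricke A B C D x y z"
  by (simp add: fricke_def algebra_simps)

lemma fricke_rot': "fricke A C D B y z x = fricke A B C D x y z"
  by (simp add: fricke_def algebra_simps)

lemma slope_swap: "slope A B D C x z y = slope A B C D x y z"
  by (simp add: slope_def algebra_simps)

lemma level_conic_identity:
  "(slope A C B D y x z)\<^sup>2 + (slope A D B C z x y)\<^sup>2 + x * slope A C B D y x z * slope A D B C z x y
     - kap A B C D x = - (x\<^sup>2 - 4) * fricke A B C D x y z"
  unfolding slope_def kap_def fricke_def by algebra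

lemma level_conic:
  assumes "fricke A B C D x y z = 0"
  shows "(slope A C B D y x z)\<^sup>2 + (slope A D B C z x y)\<^sup>2 + x * slope A C B D y x z * slope A D B C z x y
     = kap A B C D x"
  using level_conic_identity[of A C B D y x z] assms by simp

text \<open>Apart from the multiple of \<open>fricke\<close>, the right side is the discriminant of
  the cubic in y. It is written in z + 2AD, xA + 2B and xD + 2C so that its sign can be read off on
  different ranges of x and z; later proofs by contradiction make it negative.\<close>

lemma slope_square:
  assumes "A\<^sup>2 + a\<^sup>2 = 1" "D\<^sup>2 + d\<^sup>2 = 1"
  shows "(slope A C B D y x z)\<^sup>2 = 4 * fricke A B C D x y z
     + (x\<^sup>2 - 4) * ((z + 2 * A * D)\<^sup>2 - 4 * a\<^sup>2 * d\<^sup>2) - 4 * (z + 2 * A * D) * (x * A + 2 * B) * (x * D + 2 * C)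
     - 4 * (a\<^sup>2 * (x * D + 2 * C)\<^sup>2 + d\<^sup>2 * (x * A + 2 * B)\<^sup>2)"
  using assms unfolding slope_def fricke_def by algebra

text \<open>The left side is the derivative in f of the conic form e^2 + f^2 + x e f. On the right y
  has disappeared, which makes the sign accessible from a bound on z.\<close>

lemma slope_combination:
  "x * slope A C B D y x z + 2 * slope A D B C z x y
   = (x\<^sup>2 - 4) * (z + 2 * A * D) - 2 * (x * A + 2 * B) * (x * D + 2 * C)"
  unfolding slope_def by algebra

lemma kap_factor:
  assumes "A\<^sup>2 + a\<^sup>2 = (1::real)"
  shows "x\<^sup>2 + 4 * A * B * x + 4 * A\<^sup>2 + 4 * B\<^sup>2 - 4 = (x * A + 2 * B)\<^sup>2 + (x\<^sup>2 - 4) * a\<^sup>2"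
proof -
  have a: "a\<^sup>2 = 1 - A\<^sup>2" using assms by simp
  show ?thesis unfolding a by (simp add: power2_eq_square algebra_simps)
qed

text \<open>With A, B the cosines and a, b the sines of two angles, the factor vanishes where x +
  2AB is 2ab or -2ab, that is, where the \<open>tau\<close> of this coordinate will be 1 or
  -1.\<close>

lemma kap_factor':
  assumes "A\<^sup>2 + a\<^sup>2 = 1" "B\<^sup>2 + b\<^sup>2 = (1::real)"
  shows "x\<^sup>2 + 4 * A * B * x + 4 * A\<^sup>2 + 4 * B\<^sup>2 - 4 = (x + 2 * A * B)\<^sup>2 - (2 * a * b)\<^sup>2"
proof -
  have ab: "a\<^sup>2 = 1 - A\<^sup>2" "b\<^sup>2 = 1 - B\<^sup>2" using assms by simp_all
  show ?thesis unfolding power_mult_distrib ab by (simp add: power2_eq_square algebra_simps)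
qed

text \<open>Write z + 2AD = 2 t a d. For |t| < 1 the discriminant in y is -4 times the sum of a
  square and of (1 - t^2) d^2 times the factor in \<open>pos\<close>. So it is negative, and no real
  y exists.\<close>

lemma gap:
  assumes "A\<^sup>2 + a\<^sup>2 = 1" "D\<^sup>2 + d\<^sup>2 = 1" "a \<noteq> 0" "d \<noteq> 0"
    and "fricke A B C D x y z = 0"
    and pos: "x\<^sup>2 + 4 * A * B * x + 4 * A\<^sup>2 + 4 * B\<^sup>2 - 4 > 0"
  shows "\<bar>z + 2 * A * D\<bar> \<ge> \<bar>2 * a * d\<bar>"
proof (rule ccontr)
  assume "\<not> ?thesis"
  then have lt: "\<bar>z + 2 * A * D\<bar> < \<bar>2 * a * d\<bar>" by simp
  define u v Z where "u = x * A + 2 * B" and "v = x * D + 2 * C" and "Z = z + 2 * A * D"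
  define t where "t = Z / (2 * a * d)"
  have Z: "Z = 2 * t * (a * d)" using assms by (simp add: t_def)
  have "\<bar>t\<bar> < 1" using lt assms by (simp add: t_def Z_def abs_divide)
  then have t: "t\<^sup>2 < 1" by (simp add: abs_square_less_1)
  have p: "u\<^sup>2 + (x\<^sup>2 - 4) * a\<^sup>2 > 0"
    using pos kap_factor[OF assms(1), of x B] by (simp add: u_def)
  have "0 \<le> (slope A C B D y x z)\<^sup>2" by simp
  also have "\<dots> = (x\<^sup>2 - 4) * (Z\<^sup>2 - 4 * a\<^sup>2 * d\<^sup>2) - 4 * Z * u * v - 4 * (a\<^sup>2 * v\<^sup>2 + d\<^sup>2 * u\<^sup>2)"
    using slope_square[OF assms(1,2), of C B y x z] assms(5) by (simp add: u_def v_def Z_def)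
  also have "\<dots> = - 4 * ((a * v + t * (d * u))\<^sup>2 + (1 - t\<^sup>2) * d\<^sup>2 * (u\<^sup>2 + (x\<^sup>2 - 4) * a\<^sup>2))"
    unfolding Z by algebra
  also have "\<dots> < 0"
  proof -
    have "(1 - t\<^sup>2) * d\<^sup>2 * (u\<^sup>2 + (x\<^sup>2 - 4) * a\<^sup>2) > 0"
      using t p \<open>d \<noteq> 0\<close> by simp
    moreover have "- 4 * (p + q) < 0" if "0 < q" "0 \<le> p" for p q :: real using that by simp
    ultimately show ?thesis using zero_le_power2 by blast
  qed
  finally show False by simp
qed

text \<open>For A = cos r and B = cos s the two cases are 1 + cos (r + s) >= 0 and 1 + cos (r - s)
  >= 0.\<close>

lemma one_plus_prod_ge:
  assumes "A\<^sup>2 + a\<^sup>2 = 1" "B\<^sup>2 + b\<^sup>2 = (1::real)"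
  shows "\<bar>a * b\<bar> \<le> 1 + A * B"
proof -
  have "(a * b)\<^sup>2 = (1 + A * B)\<^sup>2 - (A + B)\<^sup>2" using assms by algebra
  then have "(a * b)\<^sup>2 \<le> (1 + A * B)\<^sup>2" by simp
  moreover have "0 \<le> 1 + A * B" using abs_mult_le_one[OF assms] by linarith
  ultimately show ?thesis using abs_le_square_iff[of "a * b" "1 + A * B"] by simp
qed

lemma kap_factor_pos:
  assumes "A\<^sup>2 + a\<^sup>2 = 1" "B\<^sup>2 + b\<^sup>2 = (1::real)" "x > 2"
  shows "x\<^sup>2 + 4 * A * B * x + 4 * A\<^sup>2 + 4 * B\<^sup>2 - 4 > 0"
proof -
  have "\<bar>2 * a * b\<bar> < \<bar>x + 2 * A * B\<bar>" using one_plus_prod_ge[OF assms(1,2)] assms(3)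
    by (simp add: abs_mult)
  then have "(2 * a * b)\<^sup>2 < (x + 2 * A * B)\<^sup>2"
    using abs_less_iff power2_less_imp_less by (metis abs_ge_zero abs_le_square_iff linorder_not_le)
  then show ?thesis using kap_factor'[OF assms(1,2), of x] by simp
qed

lemma kap_pos:
  assumes "A\<^sup>2 + a\<^sup>2 = 1" "B\<^sup>2 + b\<^sup>2 = 1" "C\<^sup>2 + c\<^sup>2 = 1" "D\<^sup>2 + d\<^sup>2 = 1" "x > 2"
  shows "kap A B C D x > 0"
  unfolding kap_def using kap_factor_pos[OF assms(1,2,5)] kap_factor_pos[OF assms(3,4,5)] by simp

text \<open>This picks a branch of the hyperbola on the level x. If the combination were not
  positive, then 0 < (x^2 - 4) Z <= 2uv, and every term of the discriminant in y would be
  nonpositive, the first one strictly negative.\<close>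

lemma slope_comb_pos:
  assumes "A\<^sup>2 + a\<^sup>2 = 1" "D\<^sup>2 + d\<^sup>2 = 1" "a * d > 0"
    and "fricke A B C D x y z = 0" "x > 2" "z + 2 * A * D \<ge> 2 * a * d"
  shows "x * slope A C B D y x z + 2 * slope A D B C z x y > 0"
proof (rule ccontr)
  assume neg: "\<not> ?thesis"
  define u v Z where "u = x * A + 2 * B" and "v = x * D + 2 * C" and "Z = z + 2 * A * D"
  have Z: "Z > 0" using assms by (simp add: Z_def)
  have e: "x\<^sup>2 - 4 > 0" using square_gt_4[OF assms(5)] .
  have le: "(x\<^sup>2 - 4) * Z \<le> 2 * u * v"
    using neg slope_combination[of x A C B D y z] by (simp add: u_def v_def Z_def)
  have pz: "(x\<^sup>2 - 4) * Z > 0" using Z e by simp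
  have "0 \<le> (slope A C B D y x z)\<^sup>2" by simp
  also have "\<dots> = (x\<^sup>2 - 4) * (Z\<^sup>2 - 4 * a\<^sup>2 * d\<^sup>2) - 4 * Z * u * v - 4 * (a\<^sup>2 * v\<^sup>2 + d\<^sup>2 * u\<^sup>2)"
    using slope_square[OF assms(1,2), of C B y x z] assms(4) by (simp add: u_def v_def Z_def)
  also have "\<dots> = Z * ((x\<^sup>2 - 4) * Z - 4 * u * v) - 4 * (x\<^sup>2 - 4) * (a * d)\<^sup>2 - 4 * ((a * v)\<^sup>2 + (d * u)\<^sup>2)"
    by algebra
  also have "\<dots> < 0"
  proof -
    have "Z * ((x\<^sup>2 - 4) * Z - 4 * u * v) < 0"
      using Z le pz by (intro mult_pos_neg) auto
    moreover have "0 \<le> 4 * (x\<^sup>2 - 4) * (a * d)\<^sup>2" using e by simp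
    moreover have "p - q - 4 * (m + n) < 0" if "p < 0" "0 \<le> q" "0 \<le> m" "0 \<le> n" for p q m n :: real
      using that by simp
    ultimately show ?thesis using zero_le_power2 by blast
  qed
  finally show False by simp
qed

lemma slope_sum_pos:
  assumes "A\<^sup>2 + a\<^sup>2 = 1" "C\<^sup>2 + c\<^sup>2 = 1" "D\<^sup>2 + d\<^sup>2 = 1" "a * c > 0" "a * d > 0"
    and "fricke A B C D x y z = 0" "x > 2" "y + 2 * A * C \<ge> 2 * a * c" "z + 2 * A * D \<ge> 2 * a * d"
  shows "slope A C B D y x z + slope A D B C z x y > 0"
proof -
  have "x * slope A C B D y x z + 2 * slope A D B C z x y > 0"
    by (rule slope_comb_pos) fact+
  moreover have "x * slope A D B C z x y + 2 * slope A C B D y x z > 0"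
    by (rule slope_comb_pos[of A a C c B D x z y]) (use assms in \<open>simp_all add: fricke_swap23\<close>)
  ultimately have "(x + 2) * (slope A C B D y x z + slope A D B C z x y) > 0"
    by (simp add: algebra_simps)
  then show ?thesis using assms(7) by (simp add: zero_less_mult_iff)
qed

text \<open>If x <= 2, then |x| <= 2 and both xA + 2B and xD + 2C are nonnegative, so all terms of
  the discriminant in y are nonpositive. They must all vanish, which forces A + B = 0 and C + D =
  0.\<close>

lemma coordinate_gt_2_aux:
  assumes "A\<^sup>2 + a\<^sup>2 = 1" "B\<^sup>2 + b\<^sup>2 = 1" "D\<^sup>2 + d\<^sup>2 = 1" "a > 0" "b > 0" "d > 0"
    and F: "fricke A B C D x y z = 0"
    and AB: "A + B \<ge> 0" and CD: "C + D \<ge> 0" and ne: "\<not> (A + B = 0 \<and> C + D = 0)"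
    and x: "x + 2 * A * B \<ge> 2 * a * b" and z: "z + 2 * A * D \<ge> 2 * a * d"
    and v0: "x * D + 2 * C \<ge> 0"
  shows "x > 2"
proof (rule ccontr)
  assume "\<not> x > 2"
  then have x2: "x \<le> 2" by simp
  define u v Z where "u = x * A + 2 * B" and "v = x * D + 2 * C" and "Z = z + 2 * A * D"
  have v: "v \<ge> 0" using v0 by (simp add: v_def)
  define x0 where "x0 = 2 * a * b - 2 * A * B"
  \<comment> \<open>bA + aB is the sine of the sum of the two angles. Its sign follows from that of
    A + B through the product formula, where the sign of the second factor is known from the signs
    of A and B.\<close>
  have m: "b * A + a * B \<ge> 0 \<and> (A + B > 0 \<longrightarrow> b * A + a * B > 0)"
  proof -
    have eq: "(b * A + a * B) * (b * A - a * B) = (A + B) * (A - B)" using assms(1,2) by algebra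
    consider "A \<ge> 0" "B \<ge> 0" | "A > 0" "B < 0" | "A < 0" "B > 0" using AB by linarith
    then show ?thesis
    proof cases
      case 1
      then have "0 \<le> b * A" "0 \<le> a * B" "A > 0 \<Longrightarrow> 0 < b * A" "B > 0 \<Longrightarrow> 0 < a * B"
        using assms(4,5) by simp_all
      then show ?thesis using 1 by (cases "A > 0"; cases "B > 0") auto
    next
      case 2
      then have "b * A > 0" "a * B < 0" using assms(4,5) by (simp_all add: mult_pos_neg)
      then have *: "b * A - a * B > 0" "A - B > 0" using 2 by simp_all
      show ?thesis
      proof (intro conjI impI)
        have "0 \<le> (A + B) * (A - B)" using AB * by simp
        then have "0 \<le> (b * A + a * B) * (b * A - a * B)" using eq by simp
        then show "0 \<le> b * A + a * B" using *(1) by (meson mult_neg_pos not_le)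
        assume "0 < A + B"
        then have "0 < (b * A + a * B) * (b * A - a * B)" using * eq by simp
        then show "0 < b * A + a * B" using *(1) by (meson mult_nonpos_nonneg less_imp_le not_le)
      qed
    next
      case 3
      then have "b * A < 0" "a * B > 0" using assms(4,5) by (simp_all add: mult_pos_neg)
      then have *: "b * A - a * B < 0" "A - B < 0" using 3 by simp_all
      show ?thesis
      proof (intro conjI impI)
        have "(b * A + a * B) * (b * A - a * B) \<le> 0" using AB * eq by (simp add: mult_nonneg_nonpos)
        then show "0 \<le> b * A + a * B" using *(1) by (meson mult_neg_neg not_le)
        assume "0 < A + B"
        then have "(b * A + a * B) * (b * A - a * B) < 0" using * eq by (simp add: mult_pos_neg)
        then show "0 < b * A + a * B" using *(1) by (meson mult_nonpos_nonpos less_imp_le not_le)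
      qed
    qed
  qed
  have x0: "x0 \<le> x" using x by (simp add: x0_def)
  have "x0 > -2"
  proof -
    have "A * B - a * b < 1"
    proof (rule ccontr)
      assume "\<not> ?thesis"
      then have "A * B \<ge> 1 + a * b" by simp
      moreover have "a * b > 0" using assms(4,5) by simp
      moreover have "\<bar>A * B\<bar> \<le> 1" using abs_mult_le_one[OF assms(1,2)] .
      ultimately show False by linarith
    qed
    then show ?thesis by (simp add: x0_def)
  qed
  then have xm: "x > -2" using x0 by simp
  have u_x0: "x0 * A + 2 * B = 2 * a * (b * A + a * B)" using assms(1) unfolding x0_def by algebra
  have u: "u \<ge> 0 \<and> (A + B > 0 \<longrightarrow> u > 0)"
  proof (cases "x0 = 2")
    case True
    then have "x = 2" using x0 x2 by simp
    then show ?thesis using AB by (simp add: u_def)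
  next
    case False
    then have x02: "x0 < 2" using x0 x2 by simp
    \<comment> \<open>\<open>u\<close> is affine in x, so it interpolates between its values at x0
      and at 2, which are nonnegative.\<close>
    have "(2 - x0) * u = (2 - x) * (x0 * A + 2 * B) + (x - x0) * (2 * (A + B))"
      unfolding u_def by algebra
    moreover have "(2 - x) * (x0 * A + 2 * B) \<ge> 0" using u_x0 m x2 assms(4) by simp
    moreover have "(x - x0) * (2 * (A + B)) \<ge> 0" using x0 AB by simp
    moreover have "A + B > 0 \<Longrightarrow> (2 - x) * (x0 * A + 2 * B) > 0 \<or> (x - x0) * (2 * (A + B)) > 0"
      using u_x0 m x2 assms(4) x02 by (cases "x < 2") auto
    ultimately have "(2 - x0) * u \<ge> 0" "A + B > 0 \<Longrightarrow> (2 - x0) * u > 0" by linarith+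
    then show ?thesis using x02 by (simp add: zero_le_mult_iff zero_less_mult_iff)
  qed
  have Z: "Z \<ge> 2 * (a * d)" "a * d > 0" using z assms by (simp_all add: Z_def)
  have "\<bar>x\<bar> \<le> \<bar>2\<bar>" using xm x2 by simp
  then have e: "x\<^sup>2 - 4 \<le> 0" using abs_le_square_iff[of x 2] by simp
  have "0 \<le> (slope A C B D y x z)\<^sup>2" by simp
  also have "\<dots> = (x\<^sup>2 - 4) * (Z\<^sup>2 - 4 * a\<^sup>2 * d\<^sup>2) - 4 * Z * u * v - 4 * (a\<^sup>2 * v\<^sup>2 + d\<^sup>2 * u\<^sup>2)"
    using slope_square[OF assms(1,3), of C B y x z] F by (simp add: u_def v_def Z_def)
  finally have le: "4 * ((a * v)\<^sup>2 + (d * u)\<^sup>2) \<le> (x\<^sup>2 - 4) * (Z\<^sup>2 - 4 * a\<^sup>2 * d\<^sup>2) - 4 * Z * u * v"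
    by (simp add: power_mult_distrib)
  have "(2 * (a * d))\<^sup>2 \<le> Z\<^sup>2" using Z by (intro power_mono) auto
  then have "(x\<^sup>2 - 4) * (Z\<^sup>2 - 4 * a\<^sup>2 * d\<^sup>2) \<le> 0"
    using e by (intro mult_nonpos_nonneg) (auto simp: power_mult_distrib)
  moreover have "4 * Z * u * v \<ge> 0" using Z u v by simp
  moreover have "s \<le> 0" if "p \<le> 0" "0 \<le> q" "4 * s \<le> p - q" for p q s :: real using that by simp
  ultimately have "(a * v)\<^sup>2 + (d * u)\<^sup>2 \<le> 0" using le by blast
  then have "a * v = 0" "d * u = 0" using sum_power2_le_zero_iff by blast+
  then have "v = 0" "u = 0" using assms by auto
  then have "A + B = 0" using u AB by linarith
  then have "x0 = 2"
  proof -
    have "B = - A" using \<open>A + B = 0\<close> by simp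
    then have "a\<^sup>2 = b\<^sup>2" using assms(1,2) by simp
    then have "a = b" using assms(4,5) by simp
    then show ?thesis using \<open>B = - A\<close> assms(1) unfolding x0_def by (simp add: power2_eq_square algebra_simps)
  qed
  then have "x = 2" using x0 x2 by simp
  then have "C + D = 0" using \<open>v = 0\<close> by (simp add: v_def)
  with \<open>A + B = 0\<close> ne show False by simp
qed

text \<open>The sum of xD + 2C and xC + 2D is (x + 2)(C + D) >= 0, so one of them is nonnegative;
  exchanging y and z exchanges them.\<close>

lemma coordinate_gt_2:
  assumes "A\<^sup>2 + a\<^sup>2 = 1" "B\<^sup>2 + b\<^sup>2 = 1" "C\<^sup>2 + c\<^sup>2 = 1" "D\<^sup>2 + d\<^sup>2 = 1" "a > 0" "b > 0" "c > 0" "d > 0"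
    and F: "fricke A B C D x y z = 0"
    and AB: "A + B \<ge> 0" and CD: "C + D \<ge> 0" and ne: "\<not> (A + B = 0 \<and> C + D = 0)"
    and x: "x + 2 * A * B \<ge> 2 * a * b" and y: "y + 2 * A * C \<ge> 2 * a * c" and z: "z + 2 * A * D \<ge> 2 * a * d"
  shows "x > 2"
proof -
  have xm: "x + 2 > 0"
  proof -
    have "\<bar>A * B\<bar> \<le> 1" using abs_mult_le_one[OF assms(1,2)] .
    moreover have "a * b > 0" using assms by simp
    ultimately show ?thesis using x by linarith
  qed
  have "(x * D + 2 * C) + (x * C + 2 * D) = (x + 2) * (C + D)" by algebra
  then have "(x * D + 2 * C) + (x * C + 2 * D) \<ge> 0" using xm CD by simp
  then consider "x * D + 2 * C \<ge> 0" | "x * C + 2 * D \<ge> 0" by linarith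
  then show ?thesis
  proof cases
    case 1
    then show ?thesis using coordinate_gt_2_aux[of A a B b D d C x y z] assms by blast
  next
    case 2
    then show ?thesis using coordinate_gt_2_aux[of A a B b C c D x z y] assms
      by (simp add: fricke_swap23 add.commute)
  qed
qed

text \<open>A converse of \<open>slope_comb_pos\<close>: \<open>gap\<close> leaves only Z <= -2ad to
  be excluded, and there the discriminant in y is again negative.\<close>

lemma slope_comb_imp_constraint:
  assumes "A\<^sup>2 + a\<^sup>2 = 1" "B\<^sup>2 + b\<^sup>2 = 1" "D\<^sup>2 + d\<^sup>2 = 1" "a > 0" "d > 0"
    and "fricke A B C D x y z = 0" "x > 2" "x * slope A C B D y x z + 2 * slope A D B C z x y \<ge> 0"
  shows "z + 2 * A * D \<ge> 2 * a * d"
proof (rule ccontr)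
  assume neg: "\<not> ?thesis"
  define u v Z where "u = x * A + 2 * B" and "v = x * D + 2 * C" and "Z = z + 2 * A * D"
  have "\<bar>2 * a * d\<bar> \<le> \<bar>Z\<bar>"
    unfolding Z_def by (rule gap) (use assms kap_factor_pos[OF assms(1,2,7)] in auto)
  moreover have "0 < a * d" using assms by simp
  ultimately have Z: "Z \<le> - (2 * (a * d))" "Z < 0" using neg by (auto simp: Z_def)
  have e: "x\<^sup>2 - 4 > 0" using square_gt_4[OF assms(7)] .
  have le: "2 * u * v \<le> (x\<^sup>2 - 4) * Z"
    using assms(8) slope_combination[of x A C B D y z] by (simp add: u_def v_def Z_def)
  have pz: "(x\<^sup>2 - 4) * Z < 0" using Z e by (simp add: mult_pos_neg)
  have "0 \<le> (slope A C B D y x z)\<^sup>2" by simp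
  also have "\<dots> = (x\<^sup>2 - 4) * (Z\<^sup>2 - 4 * a\<^sup>2 * d\<^sup>2) - 4 * Z * u * v - 4 * (a\<^sup>2 * v\<^sup>2 + d\<^sup>2 * u\<^sup>2)"
    using slope_square[OF assms(1,3), of C B y x z] assms(6) by (simp add: u_def v_def Z_def)
  also have "\<dots> = Z * ((x\<^sup>2 - 4) * Z - 4 * u * v) - 4 * (x\<^sup>2 - 4) * (a * d)\<^sup>2 - 4 * ((a * v)\<^sup>2 + (d * u)\<^sup>2)"
    by algebra
  also have "\<dots> < 0"
  proof -
    have "Z * ((x\<^sup>2 - 4) * Z - 4 * u * v) < 0"
      using Z le pz by (intro mult_neg_pos) auto
    moreover have "0 \<le> 4 * (x\<^sup>2 - 4) * (a * d)\<^sup>2" using e by simp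
    moreover have "p - q - 4 * (m + n) < 0" if "p < 0" "0 \<le> q" "0 \<le> m" "0 \<le> n" for p q m n :: real
      using that by simp
    ultimately show ?thesis using zero_le_power2 by blast
  qed
  finally show False by simp
qed

lemma kap_nonneg_below:
  assumes "A\<^sup>2 + a\<^sup>2 = 1" "B\<^sup>2 + b\<^sup>2 = (1::real)" "x \<le> -2"
  shows "x\<^sup>2 + 4 * A * B * x + 4 * A\<^sup>2 + 4 * B\<^sup>2 - 4 \<ge> 0"
proof -
  have "\<bar>a * b\<bar> \<le> 1 - A * B" using one_plus_prod_ge[of A a "-B" b] assms by simp
  then have "\<bar>2 * a * b\<bar> \<le> \<bar>x + 2 * A * B\<bar>" using assms(3) by (simp add: abs_mult)
  then have "(2 * a * b)\<^sup>2 \<le> (x + 2 * A * B)\<^sup>2" by (simp add: abs_le_square_iff)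
  then show ?thesis using kap_factor'[OF assms(1,2), of x] by simp
qed

lemma slope_comb_neg:
  assumes "A\<^sup>2 + a\<^sup>2 = 1" "D\<^sup>2 + d\<^sup>2 = 1" "a * d < 0"
    and "fricke A B C D x y z = 0" "x < -2" "z + 2 * A * D \<le> 2 * a * d"
  shows "x * slope A C B D y x z + 2 * slope A D B C z x y < 0"
proof (rule ccontr)
  assume neg: "\<not> ?thesis"
  define u v Z where "u = x * A + 2 * B" and "v = x * D + 2 * C" and "Z = z + 2 * A * D"
  have Z: "Z < 0" using assms by (simp add: Z_def)
  have e: "x\<^sup>2 - 4 > 0" using square_gt_4[of "-x"] assms(5) by simp
  have le: "2 * u * v \<le> (x\<^sup>2 - 4) * Z"
    using neg slope_combination[of x A C B D y z] by (simp add: u_def v_def Z_def)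
  have pz: "(x\<^sup>2 - 4) * Z < 0" using Z e by (simp add: mult_pos_neg)
  have "0 \<le> (slope A C B D y x z)\<^sup>2" by simp
  also have "\<dots> = (x\<^sup>2 - 4) * (Z\<^sup>2 - 4 * a\<^sup>2 * d\<^sup>2) - 4 * Z * u * v - 4 * (a\<^sup>2 * v\<^sup>2 + d\<^sup>2 * u\<^sup>2)"
    using slope_square[OF assms(1,2), of C B y x z] assms(4) by (simp add: u_def v_def Z_def)
  also have "\<dots> = Z * ((x\<^sup>2 - 4) * Z - 4 * u * v) - 4 * (x\<^sup>2 - 4) * (a * d)\<^sup>2 - 4 * ((a * v)\<^sup>2 + (d * u)\<^sup>2)"
    by algebra
  also have "\<dots> < 0"
  proof -
    have "Z * ((x\<^sup>2 - 4) * Z - 4 * u * v) < 0"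
      using Z le pz by (intro mult_neg_pos) auto
    moreover have "0 \<le> 4 * (x\<^sup>2 - 4) * (a * d)\<^sup>2" using e by simp
    moreover have "p - q - 4 * (m + n) < 0" if "p < 0" "0 \<le> q" "0 \<le> m" "0 \<le> n" for p q m n :: real
      using that by simp
    ultimately show ?thesis using zero_le_power2 by blast
  qed
  finally show False by simp
qed

text \<open>Serves the sheet where the product of the rotations is -1, hence a < 0. For x < -2 both
  increments are positive, and Euler's identity makes the conic form negative although kappa is
  nonnegative. For x = -2 the conic degenerates and a separate argument is needed.\<close>

lemma coordinate_gt_minus_2:
  assumes "A\<^sup>2 + a\<^sup>2 = 1" "B\<^sup>2 + b\<^sup>2 = 1" "C\<^sup>2 + c\<^sup>2 = 1" "D\<^sup>2 + d\<^sup>2 = 1" "a < 0" "b > 0" "c > 0" "d > 0"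
    and F: "fricke A B C D x y z = 0"
    and y: "y + 2 * A * C \<le> 2 * a * c" and z: "z + 2 * A * D \<le> 2 * a * d"
  shows "x > -2"
proof (rule ccontr)
  assume "\<not> x > -2"
  then consider "x < -2" | "x = -2" by linarith
  then show False
  proof cases
    case 1
    define e f where "e = slope A C B D y x z" and "f = slope A D B C z x y"
    have "a * d < 0" "a * c < 0" using assms by (simp_all add: mult_neg_pos)
    have 1: "x * e + 2 * f < 0" unfolding e_def f_def
      by (rule slope_comb_neg) fact+
    have 2: "x * f + 2 * e < 0" unfolding e_def f_def
      by (rule slope_comb_neg[of A a C c B D x z y]) (use assms 1 \<open>x < -2\<close> \<open>a * c < 0\<close> in \<open>simp_all add: fricke_swap23\<close>)
    have "(x + 2) * (e + f) < 0" using 1 2 by (simp add: algebra_simps)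
    then have s: "e + f > 0" using \<open>x < -2\<close> by (simp add: mult_less_0_iff)
    have e: "e > 0"
    proof (rule ccontr)
      assume "\<not> e > 0"
      then have "x * e \<ge> 0" using \<open>x < -2\<close> by (simp add: mult_nonpos_nonpos)
      then show False using 1 s \<open>\<not> e > 0\<close> by linarith
    qed
    have f: "f > 0"
    proof (rule ccontr)
      assume "\<not> f > 0"
      then have "x * f \<ge> 0" using \<open>x < -2\<close> by (simp add: mult_nonpos_nonpos)
      then show False using 2 s \<open>\<not> f > 0\<close> by linarith
    qed
    have "(x * e + 2 * f) * f < 0" "(x * f + 2 * e) * e < 0" using 1 2 e f by (simp_all add: mult_neg_pos)
    then have "e\<^sup>2 + f\<^sup>2 + x * e * f < 0" by (simp add: algebra_simps power2_eq_square)
    moreover have "e\<^sup>2 + f\<^sup>2 + x * e * f = kap A B C D x" unfolding e_def f_def by (rule level_conic) fact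
    moreover have "kap A B C D x \<ge> 0" unfolding kap_def
      using kap_nonneg_below[OF assms(1,2), of x] kap_nonneg_below[OF assms(3,4), of x] \<open>x < -2\<close> by simp
    ultimately show False by simp
  next
    case 2
    \<comment> \<open>Here xC + 2D = -v, so the discriminants in y and in z contain uv with opposite
      signs. Both can be nonnegative only if u = v = 0.\<close>
    define u v where "u = x * A + 2 * B" and "v = x * D + 2 * C"
    define Y Z where "Y = y + 2 * A * C" and "Z = z + 2 * A * D"
    have "a * d < 0" "a * c < 0" using assms by (simp_all add: mult_neg_pos)
    then have YZ: "Y < 0" "Z < 0" using y z by (simp_all add: Y_def Z_def)
    have x0: "x\<^sup>2 - 4 = 0" using 2 by simp
    have v': "x * C + 2 * D = - v" using 2 by (simp add: v_def)
    have "(slope A C B D y x z)\<^sup>2 = - 4 * Z * u * v - 4 * (a\<^sup>2 * v\<^sup>2 + d\<^sup>2 * u\<^sup>2)"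
      unfolding slope_square[OF assms(1,4)] F x0 u_def v_def Z_def by (simp add: algebra_simps)
    then have s1: "0 \<le> - 4 * Z * u * v - 4 * (a\<^sup>2 * v\<^sup>2 + d\<^sup>2 * u\<^sup>2)"
      using zero_le_power2 by metis
    have "(slope A D B C z x y)\<^sup>2 = 4 * Y * u * v - 4 * (a\<^sup>2 * v\<^sup>2 + c\<^sup>2 * u\<^sup>2)"
      unfolding slope_square[OF assms(1,3)] fricke_swap23 F x0 v' u_def Y_def by simp
    then have s2: "0 \<le> 4 * Y * u * v - 4 * (a\<^sup>2 * v\<^sup>2 + c\<^sup>2 * u\<^sup>2)"
      using zero_le_power2 by metis
    have sq: "0 \<le> a\<^sup>2 * v\<^sup>2 + d\<^sup>2 * u\<^sup>2" "0 \<le> a\<^sup>2 * v\<^sup>2 + c\<^sup>2 * u\<^sup>2" by simp_all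
    have lin: "w \<le> 0" if "0 \<le> - 4 * w - 4 * m" "0 \<le> m" for w m :: real using that by simp
    have "Z * (u * v) \<le> 0" using lin[OF _ sq(1), of "Z * (u * v)"] s1 by (simp add: mult.assoc)
    then have "u * v \<ge> 0" using YZ by (simp add: mult_le_0_iff)
    moreover have "Y * (u * v) \<ge> 0" using lin[OF _ sq(2), of "- (Y * (u * v))"] s2 by (simp add: mult.assoc)
    then have "u * v \<le> 0" using YZ by (simp add: zero_le_mult_iff)
    ultimately have "u * v = 0" by simp
    then have "Z * u * v = 0" by simp
    moreover have "m \<le> 0" if "0 \<le> - 4 * w - 4 * m" "w = 0" for w m :: real using that by simp
    ultimately have "(a * v)\<^sup>2 + (d * u)\<^sup>2 \<le> 0" using s1 unfolding power_mult_distrib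
      by (metis mult.assoc)
    then have "a * v = 0" "d * u = 0" using sum_power2_le_zero_iff by blast+
    then have "v = 0" "u = 0" using assms by auto
    then have AB: "B = A" "D = C" using 2 by (simp_all add: u_def v_def)
    have "(slope A C B D y x z)\<^sup>2 = 0"
      using slope_square[OF assms(1,4), of C B y x z] F x0 \<open>u = 0\<close> \<open>v = 0\<close> by (simp add: u_def v_def)
    then have "Y + Z = 0" using 2 AB by (simp add: slope_def Y_def Z_def)
    then show False using YZ by simp
  qed
qed

text \<open>Used to show that the sheets of the two signs are disjoint. What is odd under the change
  of signs, such as xyz, cancels in the sum, and completing squares leaves the positive remainder 16
  a^2.\<close>

lemma fricke_sum_pos:
  assumes "A\<^sup>2 + a\<^sup>2 = 1" "B\<^sup>2 + b\<^sup>2 = 1" "C\<^sup>2 + c\<^sup>2 = 1" "D\<^sup>2 + d\<^sup>2 = 1" "a \<noteq> 0"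
    and "(2 * a * b)\<^sup>2 \<le> (x + 2 * A * B)\<^sup>2" "(2 * a * c)\<^sup>2 \<le> (y + 2 * A * C)\<^sup>2" "(2 * a * d)\<^sup>2 \<le> (z + 2 * A * D)\<^sup>2"
  shows "fricke A B C D x y z + fricke (- A) B C D (- x) (- y) (- z) > 0"
proof -
  have u: "A\<^sup>2 = 1 - a\<^sup>2" "B\<^sup>2 = 1 - b\<^sup>2" "C\<^sup>2 = 1 - c\<^sup>2" "D\<^sup>2 = 1 - d\<^sup>2" using assms by auto
  have "fricke A B C D x y z + fricke (- A) B C D (- x) (- y) (- z)
     = 2 * (((x + 2 * A * B)\<^sup>2 - (2 * a * b)\<^sup>2) + ((y + 2 * A * C)\<^sup>2 - (2 * a * c)\<^sup>2) + ((z + 2 * A * D)\<^sup>2 - (2 * a * d)\<^sup>2)) + 16 * a\<^sup>2"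
  proof -
    have "fricke A B C D x y z + fricke (- A) B C D (- x) (- y) (- z)
     = 2 * ((x + 2 * A * B)\<^sup>2 + (y + 2 * A * C)\<^sup>2 + (z + 2 * A * D)\<^sup>2) - 8 * A\<^sup>2 * (B\<^sup>2 + C\<^sup>2 + D\<^sup>2) - 8 + 8 * (A\<^sup>2 + B\<^sup>2 + C\<^sup>2 + D\<^sup>2)"
      by (simp add: fricke_def power2_eq_square algebra_simps)
    then show ?thesis unfolding u by (simp add: power_mult_distrib algebra_simps)
  qed
  moreover have "16 * a\<^sup>2 > 0" using assms by simp
  moreover have "0 < 2 * ((p' - p) + (q' - q) + (r' - r)) + s"
    if "p \<le> p'" "q \<le> q'" "r \<le> r'" "0 < s" for p p' q q' r r' s :: real
    using that by simp
  ultimately show ?thesis using assms(6-8) by presburger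
qed

section \<open>Modifications as Vieta involutions\<close>

datatype letter = L1 | L2 | L3

lemma letter_UNIV: "(UNIV :: letter set) = {L1, L2, L3}"
  using letter.exhaust by auto

instance letter :: finite
  by standard (simp add: letter_UNIV)

type_synonym triple = "real \<times> real \<times> real"

fun crd :: "letter \<Rightarrow> triple \<Rightarrow> real" where
  "crd L1 (x, y, z) = x" | "crd L2 (x, y, z) = y" | "crd L3 (x, y, z) = z"

fun third :: "letter \<Rightarrow> letter \<Rightarrow> letter" where
  "third L1 L2 = L3" | "third L2 L1 = L3" | "third L1 L3 = L2" | "third L3 L1 = L2"
| "third L2 L3 = L1" | "third L3 L2 = L1" | "third i j = i"

lemma letter_pairs:
  assumes "i \<noteq> j"
  obtains "i = L1" "j = L2" | "i = L1" "j = L3" | "i = L2" "j = L1" | "i = L2" "j = L3"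
    | "i = L3" "j = L1" | "i = L3" "j = L2"
  using assms by (cases i; cases j) auto

lemma triple_eq_iff: "P = Q \<longleftrightarrow> (\<forall>i. crd i P = crd i Q)"
proof
  assume *: "\<forall>i. crd i P = crd i Q"
  show "P = Q" using *[rule_format, of L1] *[rule_format, of L2] *[rule_format, of L3]
    by (cases P; cases Q) auto
qed auto

lemma continuous_on_crd [continuous_intros]: "continuous_on S (crd i)"
proof -
  have "crd i = (\<lambda>P. case i of L1 \<Rightarrow> fst P | L2 \<Rightarrow> fst (snd P) | L3 \<Rightarrow> snd (snd P))"
    by (cases i) (auto simp: fun_eq_iff)
  then show ?thesis by (cases i) (auto intro!: continuous_intros)
qed

text \<open>The parameters stand for \<open>cos a\<^sub>j\<close> and \<open>sin a\<^sub>j\<close>, \<open>j = 0, \<dots>, 3\<close>. The sign of \<open>A\<close> and \<open>a\<close>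
  together selects the value \<open>\<plusminus>1\<close> of the product of the four rotations in \<open>SU V\<close>.\<close>

locale signed_angles =
  fixes A B C D a b c d :: real
  assumes unit: "A\<^sup>2 + a\<^sup>2 = 1" "B\<^sup>2 + b\<^sup>2 = 1" "C\<^sup>2 + c\<^sup>2 = 1" "D\<^sup>2 + d\<^sup>2 = 1"
    and sin_nz: "a \<noteq> 0" "b > 0" "c > 0" "d > 0"
begin

fun cs :: "letter \<Rightarrow> real" where "cs L1 = B" | "cs L2 = C" | "cs L3 = D"
fun sn :: "letter \<Rightarrow> real" where "sn L1 = b" | "sn L2 = c" | "sn L3 = d"

fun F :: "triple \<Rightarrow> real" where "F (x, y, z) = fricke A B C D x y z"

fun v :: "letter \<Rightarrow> triple \<Rightarrow> real" where
  "v L1 (x, y, z) = slope A B C D x y z"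
| "v L2 (x, y, z) = slope A C B D y x z"
| "v L3 (x, y, z) = slope A D B C z x y"

fun \<kappa> :: "letter \<Rightarrow> real \<Rightarrow> real" where
  "\<kappa> L1 x = kap A B C D x" | "\<kappa> L2 x = kap A C B D x" | "\<kappa> L3 x = kap A D B C x"

fun modif :: "letter \<Rightarrow> triple \<Rightarrow> triple" where
  "modif L1 (x, y, z) = (x + slope A B C D x y z, y, z)"
| "modif L2 (x, y, z) = (x, y + slope A C B D y x z, z)"
| "modif L3 (x, y, z) = (x, y, z + slope A D B C z x y)"

text \<open>For a hexagon this is 2 t_i - 1, the hyperbolic cosine of the distance from c_i to p_i.
  It does not change when A, a and the coordinate change sign together.\<close>

definition tau :: "letter \<Rightarrow> triple \<Rightarrow> real" where
  "tau i P = (crd i P + 2 * A * cs i) / (2 * a * sn i)"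

definition Te :: "triple set" where
  "Te = {P. F P = 0 \<and> (\<forall>i. tau i P \<ge> 1)}"

lemma sn_pos: "sn i > 0" and unit_cs: "(cs i)\<^sup>2 + (sn i)\<^sup>2 = 1"
  using sin_nz unit by (cases i; simp)+

lemma crd_modif: "crd i (modif j P) = (if i = j then crd i P + v i P else crd i P)"
  by (cases P; cases i; cases j) auto

lemma v_modif_same: "v i (modif i P) = - v i P"
  by (cases P; cases i) (auto simp: slope_def)

lemma v_modif: "i \<noteq> j \<Longrightarrow> v i (modif j P) = v i P + crd (third i j) P * v j P"
  by (cases P; cases i; cases j) (auto simp: slope_def algebra_simps)

lemma modif_modif [simp]: "modif i (modif i P) = P"
  by (cases P; cases i) (auto simp: slope_def algebra_simps)

lemma F_modif [simp]: "F (modif i P) = F P"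
proof (cases P)
  case (fields x y z)
  have 1: "fricke A B C D (x + slope A B C D x y z) y z = fricke A B C D x y z" for x y z B C D
    by (simp add: fricke_def slope_def power2_eq_square algebra_simps)
  have 2: "fricke A B C D x (y + slope A C B D y x z) z = fricke A B C D x y z"
    by (metis 1 fricke_swap12)
  have 3: "fricke A B C D x y (z + slope A D B C z x y) = fricke A B C D x y z"
    by (metis 1 fricke_rot)
  show ?thesis unfolding fields by (cases i) (simp_all add: 1 2 3)
qed

lemma continuous_on_F [continuous_intros]: "continuous_on S F"
proof -
  have "F = (\<lambda>P. fricke A B C D (crd L1 P) (crd L2 P) (crd L3 P))"
    by (auto simp: fun_eq_iff)
  then show ?thesis unfolding fricke_def by (simp add: continuous_intros)
qed

lemma continuous_on_v [continuous_intros]: "continuous_on S (v i)"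
proof -
  have "v L1 = (\<lambda>P. slope A B C D (crd L1 P) (crd L2 P) (crd L3 P))"
    "v L2 = (\<lambda>P. slope A C B D (crd L2 P) (crd L1 P) (crd L3 P))"
    "v L3 = (\<lambda>P. slope A D B C (crd L3 P) (crd L1 P) (crd L2 P))"
    by (auto simp: fun_eq_iff)
  then show ?thesis by (cases i) (simp_all add: slope_def continuous_intros)
qed

lemma continuous_on_triple_fun:
  fixes f :: "'x::topological_space \<Rightarrow> triple"
  assumes "\<And>i. continuous_on S (\<lambda>x. crd i (f x))"
  shows "continuous_on S f"
proof -
  have *: "(crd L1 P, crd L2 P, crd L3 P) = P" for P by (cases P) auto
  have "continuous_on S (\<lambda>x. (crd L1 (f x), crd L2 (f x), crd L3 (f x)))"
    by (intro continuous_on_Pair assms)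
  then show ?thesis unfolding * .
qed

lemma continuous_on_modif [continuous_intros]: "continuous_on S (modif i)"
proof (rule continuous_on_triple_fun)
  show "continuous_on S (\<lambda>x. crd j (modif i x))" for j
    by (cases "j = i") (simp_all add: crd_modif continuous_intros)
qed

lemma conic:
  assumes "F P = 0" "i \<noteq> j"
  shows "(v i P)\<^sup>2 + (v j P)\<^sup>2 + crd (third i j) P * v i P * v j P = \<kappa> (third i j) (crd (third i j) P)"
proof (cases P)
  case (fields x y z)
  have F: "fricke A B C D x y z = 0" using assms fields by simp
  have 1: "(slope A C B D y x z)\<^sup>2 + (slope A D B C z x y)\<^sup>2 + x * slope A C B D y x z * slope A D B C z x y = kap A B C D x"
    by (rule level_conic) fact
  have 2: "(slope A B C D x y z)\<^sup>2 + (slope A D C B z y x)\<^sup>2 + y * slope A B C D x y z * slope A D C B z y x = kap A C B D y"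
    by (rule level_conic) (simp add: F fricke_swap12)
  have 3: "(slope A B D C x z y)\<^sup>2 + (slope A C D B y z x)\<^sup>2 + z * slope A B D C x z y * slope A C D B y z x = kap A D B C z"
    by (rule level_conic) (simp add: F fricke_rot)
  have e2: "slope A D C B z y x = slope A D B C z x y" by (rule slope_swap)
  have e3: "slope A B D C x z y = slope A B C D x y z" "slope A C D B y z x = slope A C B D y x z" by (rule slope_swap)+
  show ?thesis unfolding fields using assms(2) 1 2[unfolded e2] 3[unfolded e3]
    by (cases i; cases j) (simp_all add: algebra_simps)
qed

lemma kappa_pos: "x > 2 \<Longrightarrow> \<kappa> i x > 0"
  using unit kap_pos by (cases i) (auto intro: kap_pos)

lemma kappa_factor: "\<kappa> i x = ((x + 2 * A * cs i)\<^sup>2 - (2 * a * sn i)\<^sup>2) *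
    (x\<^sup>2 + 4 * cs (if i = L1 then L2 else L1) * cs (if i = L3 then L2 else L3) * x
      + 4 * (cs (if i = L1 then L2 else L1))\<^sup>2 + 4 * (cs (if i = L3 then L2 else L3))\<^sup>2 - 4)"
  using kap_factor'[OF unit(1,2), of x] kap_factor'[OF unit(1,3), of x] kap_factor'[OF unit(1,4), of x]
  by (cases i) (auto simp: kap_def)

lemma tau_le_1_iff: "\<bar>tau i P\<bar> \<ge> 1 \<longleftrightarrow> \<bar>2 * a * sn i\<bar> \<le> \<bar>crd i P + 2 * A * cs i\<bar>"
  using sin_nz sn_pos[of i] by (simp add: tau_def abs_divide abs_mult)

lemma tau_square: "(tau i P)\<^sup>2 = 1 \<longleftrightarrow> (crd i P + 2 * A * cs i)\<^sup>2 = (2 * a * sn i)\<^sup>2"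
  using sin_nz sn_pos[of i] by (auto simp: tau_def power_divide)

text \<open>Six instances of \<open>gap\<close> under permutations of the coordinates. Along a
  connected set where one \<open>tau\<close> exceeds 1, the other two keep their sign, and so stay
  at least 1 if they are so at one point.\<close>

lemma gap_tau:
  assumes "F P = 0" "\<bar>tau i P\<bar> > 1"
  shows "\<bar>tau j P\<bar> \<ge> 1"
proof (cases P)
  case (fields x y z)
  have F: "fricke A B C D x y z = 0" using assms fields by simp
  have "\<bar>2 * a * sn i\<bar> < \<bar>crd i P + 2 * A * cs i\<bar>"
    using assms(2) sin_nz sn_pos[of i] by (simp add: tau_def abs_divide abs_mult)
  then have "(2 * a * sn i)\<^sup>2 < (crd i P + 2 * A * cs i)\<^sup>2"
    by (metis abs_ge_zero power2_abs power_strict_mono pos2)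
  then have pos: "(crd i P)\<^sup>2 + 4 * A * cs i * crd i P + 4 * A\<^sup>2 + 4 * (cs i)\<^sup>2 - 4 > 0"
    using kap_factor'[OF unit(1) unit_cs, of "crd i P" i] by simp
  consider "i = j" | "i \<noteq> j" by blast
  then show ?thesis
  proof cases
    case 1 then show ?thesis using assms(2) by auto
  next
    case 2
    then have "\<bar>2 * a * sn j\<bar> \<le> \<bar>crd j P + 2 * A * cs j\<bar>"
    proof (cases rule: letter_pairs)
      case 1
      then show ?thesis using gap[OF unit(1,3), of B D x z y] sin_nz F pos fields by (simp add: fricke_swap23)
    next
      case 2
      then show ?thesis using gap[OF unit(1,4), of B C x y z] sin_nz F pos fields by simp
    next
      case 3
      then show ?thesis using gap[OF unit(1,2), of C D y z x] sin_nz F pos fields by (simp add: fricke_rot')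
    next
      case 4
      then show ?thesis using gap[OF unit(1,4), of C B y x z] sin_nz F pos fields by (simp add: fricke_swap12)
    next
      case 5
      then show ?thesis using gap[OF unit(1,2), of D C z y x] sin_nz F pos fields by (simp add: fricke_swap13)
    next
      case 6
      then show ?thesis using gap[OF unit(1,3), of D B z x y] sin_nz F pos fields by (simp add: fricke_rot)
    qed
    then show ?thesis by (simp add: tau_le_1_iff)
  qed
qed

end

locale angles = signed_angles +
  assumes a_pos: "a > 0"
begin

lemma sin_pos: "a > 0" "b > 0" "c > 0" "d > 0"
  using a_pos sin_nz by auto

definition Tp :: "triple set" where
  "Tp = {P. F P = 0 \<and> (\<forall>i. crd i P + 2 * A * cs i \<ge> 2 * a * sn i)}"

lemma Tp_eq_Te: "Tp = Te"
  using sin_pos sn_pos by (auto simp: Tp_def Te_def tau_def pos_le_divide_eq)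

lemma closed_Tp: "closed Tp"
proof -
  have "Tp = {P. F P = 0} \<inter> (\<Inter>i. {P. 2 * a * sn i \<le> crd i P + 2 * A * cs i})"
    by (auto simp: Tp_def)
  moreover have "closed {P. F P = 0}"
    by (intro closed_Collect_eq continuous_intros)
  moreover have "closed {P. 2 * a * sn i \<le> crd i P + 2 * A * cs i}" for i
    by (intro closed_Collect_le continuous_intros)
  ultimately show ?thesis by (simp add: closed_Int closed_INT)
qed

text \<open>After a move, membership in \<open>Tp\<close> is easier to check through the increments,
  by finding the branch of a level hyperbola, than through the coordinate itself. All six cases are
  \<open>slope_comb_imp_constraint\<close> after a permutation.\<close>

lemma constraint_of_branch:
  assumes "F P = 0" "i \<noteq> j" "crd j P > 2" "crd j P * v (third i j) P + 2 * v i P \<ge> 0"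
  shows "crd i P + 2 * A * cs i \<ge> 2 * a * sn i"
proof (cases P)
  case (fields x y z)
  have F: "fricke A B C D x y z = 0" using assms fields by simp
  show ?thesis
    using assms(2)
  proof (cases rule: letter_pairs)
    case 1
    then show ?thesis using slope_comb_imp_constraint[OF unit(1,3,2), of D y z x] sin_pos F assms fields
      by (simp add: fricke_rot' slope_swap[of A C D B y z x] slope_swap[of A D C B z y x] slope_swap[of A B D C x z y])
  next
    case 2
    then show ?thesis using slope_comb_imp_constraint[OF unit(1,4,2), of C z y x] sin_pos F assms fields
      by (simp add: fricke_swap13 slope_swap[of A C D B y z x] slope_swap[of A D C B z y x] slope_swap[of A B D C x z y])
  next
    case 3
    then show ?thesis using slope_comb_imp_constraint[OF unit(1,2,3), of D x z y] sin_pos F assms fields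
      by (simp add: fricke_swap23 slope_swap[of A C D B y z x] slope_swap[of A D C B z y x] slope_swap[of A B D C x z y])
  next
    case 4
    then show ?thesis using slope_comb_imp_constraint[OF unit(1,4,3), of B z x y] sin_pos F assms fields
      by (simp add: fricke_rot slope_swap[of A C D B y z x] slope_swap[of A D C B z y x] slope_swap[of A B D C x z y])
  next
    case 5
    then show ?thesis using slope_comb_imp_constraint[OF unit(1,2,4), of C x y z] sin_pos F assms fields
      by simp
  next
    case 6
    then show ?thesis using slope_comb_imp_constraint[OF unit(1,3,4), of B y x z] sin_pos F assms fields
      by (simp add: fricke_swap12 slope_swap[of A C D B y z x] slope_swap[of A D C B z y x] slope_swap[of A B D C x z y])
  qed
qed

lemma v_sum_pos_aux:
  assumes "P \<in> Tp" "i \<noteq> j" "crd (third i j) P > 2"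
  shows "v i P + v j P > 0"
proof (cases P)
  case (fields x y z)
  have F: "fricke A B C D x y z = 0" and
    c: "x + 2 * A * B \<ge> 2 * a * b" "y + 2 * A * C \<ge> 2 * a * c" "z + 2 * A * D \<ge> 2 * a * d"
    using assms(1) fields by (auto simp: Tp_def dest: spec[of _ L1] spec[of _ L2] spec[of _ L3])
  have p: "a * b > 0" "a * c > 0" "a * d > 0" using sin_pos by simp_all
  have 1: "x > 2 \<Longrightarrow> slope A C B D y x z + slope A D B C z x y > 0"
    using slope_sum_pos[OF unit(1,3,4) p(2,3) F] c by simp
  have 2: "y > 2 \<Longrightarrow> slope A B C D x y z + slope A D B C z x y > 0"
    using slope_sum_pos[OF unit(1,2,4) p(1,3), of C y x z] c F by (simp add: fricke_swap12 slope_swap[of A D C B z y x])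
  have 3: "z > 2 \<Longrightarrow> slope A B C D x y z + slope A C B D y x z > 0"
    using slope_sum_pos[OF unit(1,2,3) p(1,2), of D z x y] c F
    by (simp add: fricke_rot slope_swap[of A B D C x z y] slope_swap[of A C D B y z x])
  show ?thesis using assms(2) 1 2 3 assms(3) fields
    by (cases rule: letter_pairs) (auto simp: add.commute)
qed

end

text \<open>Condition (ii), in the case where all sums \<open>a\<^sub>j + a\<^sub>k\<close> are at most \<open>\<pi>\<close>, together with (iii).\<close>

locale small_angles = angles +
  assumes pair_sums: "A + B \<ge> 0" "A + C \<ge> 0" "A + D \<ge> 0" "B + C \<ge> 0" "B + D \<ge> 0" "C + D \<ge> 0"
    and not_right: "\<not> (A = 0 \<and> B = 0 \<and> C = 0 \<and> D = 0)"
begin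

lemma gt_2:
  assumes "P \<in> Tp"
  shows "crd i P > 2"
proof (cases P)
  case (fields x y z)
  have F: "fricke A B C D x y z = 0" and
    c: "x + 2 * A * B \<ge> 2 * a * b" "y + 2 * A * C \<ge> 2 * a * c" "z + 2 * A * D \<ge> 2 * a * d"
    using assms(1) fields by (auto simp: Tp_def dest: spec[of _ L1] spec[of _ L2] spec[of _ L3])
  have ne: "\<not> (A + B = 0 \<and> C + D = 0)" "\<not> (A + C = 0 \<and> B + D = 0)" "\<not> (A + D = 0 \<and> B + C = 0)"
    using pair_sums not_right by linarith+
  have "x > 2"
    by (rule coordinate_gt_2[OF unit sin_pos F]) (use c ne pair_sums in simp_all)
  moreover have "y > 2"
    by (rule coordinate_gt_2[of A a C c B b D d y x z]) (use c ne pair_sums F unit sin_pos in \<open>simp_all add: fricke_swap12\<close>)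
  moreover have "z > 2"
    by (rule coordinate_gt_2[of A a D d B b C c z x y]) (use c ne pair_sums F unit sin_pos in \<open>simp_all add: fricke_rot\<close>)
  ultimately show ?thesis using fields by (cases i) auto
qed

text \<open>For the converse direction, the lower bound that the definition of \<open>Tp\<close>
  puts on a coordinate is at most 2, by \<open>one_plus_prod_ge\<close>.\<close>

lemma Tp_iff: "P \<in> Tp \<longleftrightarrow> F P = 0 \<and> (\<forall>i. crd i P > 2)"
proof
  assume "P \<in> Tp"
  then show "F P = 0 \<and> (\<forall>i. crd i P > 2)" using gt_2 by (auto simp: Tp_def)
next
  assume *: "F P = 0 \<and> (\<forall>i. crd i P > 2)"
  have "2 * a * sn i \<le> crd i P + 2 * A * cs i" for i
    using one_plus_prod_ge[OF unit(1) unit_cs, of i] * by (auto dest: spec[of _ i])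
  then show "P \<in> Tp" using * by (auto simp: Tp_def)
qed

lemma v_sum_pos: "P \<in> Tp \<Longrightarrow> i \<noteq> j \<Longrightarrow> v i P + v j P > 0"
  by (rule v_sum_pos_aux) (auto intro: gt_2)

text \<open>Only the constraint on coordinate i could fail. By \<open>constraint_of_branch\<close>
  it suffices that the image lies on the right branch of the hyperbola at the level y of a second
  coordinate.\<close>

lemma modif_Tp:
  assumes P: "P \<in> Tp"
  shows "modif i P \<in> Tp"
proof -
  define j where "j = (if i = L1 then L2 else L1)"
  define l where "l = third i j"
  have ij: "i \<noteq> j" "third i l = j" "i \<noteq> l" "j \<noteq> l" "third l j = i" by (cases i; simp add: j_def l_def)+
  define y p q where "y = crd j P" and "p = - v i P" and "q = v l P"
  have y: "y > 2" using gt_2[OF P] by (simp add: y_def)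
  have F0: "F P = 0" using P by (simp add: Tp_def)
  have "p\<^sup>2 + q\<^sup>2 - y * p * q > 0"
  proof -
    have "(v i P)\<^sup>2 + (v l P)\<^sup>2 + y * v i P * v l P = \<kappa> j y"
      using conic[OF F0 ij(3)] ij by (simp add: y_def)
    then show ?thesis using kappa_pos[OF y, of j] by (simp add: p_def q_def)
  qed
  note k = this
  have qp: "q > p" using v_sum_pos[OF P ij(3)] by (simp add: p_def q_def)
  \<comment> \<open>At the image the increments are p for i and q - yp for l, so this is the
    derivative of the conic form that tells the branches apart, evaluated at the image.\<close>
  have W: "y * q - (y\<^sup>2 - 2) * p \<ge> 0"
  proof (cases "p > 0")
    case False
    have "y * q - (y\<^sup>2 - 2) * p = y * (q - p) + (y - 2) * (y + 1) * (- p)"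
      by (simp add: power2_eq_square algebra_simps)
    moreover have "y * (q - p) \<ge> 0" using y qp by simp
    moreover have "(y - 2) * (y + 1) \<ge> 0" "- p \<ge> 0" using y False by simp_all
    then have "(y - 2) * (y + 1) * (- p) \<ge> 0" by (rule mult_nonneg_nonneg)
    ultimately show ?thesis by linarith
  next
    case True
    show ?thesis
    proof (rule ccontr)
      assume "\<not> ?thesis"
      then have le: "(y\<^sup>2 - 2) * p - y * q \<ge> 0" by simp
      have "q > 0" using qp True by simp
      have "(q - p) * ((y\<^sup>2 - 2) * p - y * q) \<ge> 0" using qp le by simp
      moreover have "y * (p\<^sup>2 + q\<^sup>2 - y * p * q) > 0" using y k by simp
      moreover have "y * (p\<^sup>2 + q\<^sup>2 - y * p * q) + (q - p) * ((y\<^sup>2 - 2) * p - y * q)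
          = (y - 2) * p * (q - (y + 1) * p)"
        by (simp add: power2_eq_square algebra_simps)
      ultimately have "(y - 2) * p * (q - (y + 1) * p) > 0" by linarith
      moreover have "(y - 2) * p > 0" using y True by simp
      ultimately have "q > (y + 1) * p" by (simp add: zero_less_mult_iff)
      then have "y * q \<ge> y * ((y + 1) * p)" using y by simp
      moreover have "y * ((y + 1) * p) = (y\<^sup>2 - 2) * p + (y + 2) * p" by (simp add: power2_eq_square algebra_simps)
      moreover have "(y + 2) * p > 0" using y True by simp
      ultimately show False using le by linarith
    qed
  qed
  have c: "crd i (modif i P) + 2 * A * cs i \<ge> 2 * a * sn i"
  proof (rule constraint_of_branch[of _ i j])
    show "F (modif i P) = 0" using F0 by simp
    show "i \<noteq> j" by (rule ij)
    show "2 < crd j (modif i P)" using ij y by (simp add: crd_modif y_def)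
    have "crd j (modif i P) = y" using ij by (simp add: crd_modif y_def)
    moreover have "v (third i j) (modif i P) = q - y * p"
      using ij v_modif[of l i P] by (simp add: l_def[symmetric] y_def p_def q_def) (metis third.simps(1-9) letter.exhaust)
    moreover have "v i (modif i P) = p" by (simp add: v_modif_same p_def)
    ultimately have "crd j (modif i P) * v (third i j) (modif i P) + 2 * v i (modif i P) = y * (q - y * p) + 2 * p"
      by simp
    then show "0 \<le> crd j (modif i P) * v (third i j) (modif i P) + 2 * v i (modif i P)"
      using W by (simp add: power2_eq_square algebra_simps)
  qed
  show ?thesis
    using P c by (auto simp: Tp_def crd_modif)
qed

end

section \<open>Ping-pong and the fundamental domain\<close>

text \<open>Every letter is its own inverse, so the reduced words of the free product of groups of
  order 2, one for each letter, are those with \<open>distinct_adj\<close>.\<close>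

definition cancel_Cons :: "'l \<Rightarrow> 'l list \<Rightarrow> 'l list" where
  "cancel_Cons i w = (if w \<noteq> [] \<and> hd w = i then tl w else i # w)"

definition reduce :: "'l list \<Rightarrow> 'l list" where
  "reduce w = foldr cancel_Cons w []"

lemma reduce_Nil [simp]: "reduce [] = []"
  and reduce_Cons: "reduce (i # w) = cancel_Cons i (reduce w)"
  by (simp_all add: reduce_def)

lemma distinct_adj_reduce: "distinct_adj (reduce w)"
proof (induction w)
  case (Cons i w)
  then show ?case by (cases "reduce w") (auto simp: reduce_Cons cancel_Cons_def distinct_adj_Cons)
qed simp

lemma even_length_reduce: "even (length (reduce w)) \<longleftrightarrow> even (length w)"
proof (induction w)
  case (Cons i w)
  then show ?case by (cases "reduce w") (auto simp: reduce_Cons cancel_Cons_def)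
qed simp

lemma foldr_reduce:
  assumes "\<And>i x. x \<in> S \<Longrightarrow> f i x \<in> S" "\<And>i x. x \<in> S \<Longrightarrow> f i (f i x) = x" "x \<in> S"
  shows "foldr f (reduce w) x = foldr f w x"
proof (induction w)
  case (Cons i w)
  have S: "foldr f u x \<in> S" for u using assms by (induction u) auto
  show ?case
  proof (cases "reduce w \<noteq> [] \<and> hd (reduce w) = i")
    case True
    then obtain u where u: "reduce w = i # u" by (cases "reduce w") auto
    then have "foldr f w x = f i (foldr f u x)" using Cons by simp
    then show ?thesis using u assms(2)[OF S] by (simp add: reduce_Cons cancel_Cons_def)
  next
    case False
    then show ?thesis using Cons by (auto simp: reduce_Cons cancel_Cons_def)
  qed
qed simp

context signed_angles
begin

abbreviation act :: "letter list \<Rightarrow> triple \<Rightarrow> triple" where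
  "act w \<equiv> foldr modif w"

lemma act_reduce: "act (reduce w) P = act w P"
  by (rule foldr_reduce[of UNIV]) auto

lemma act_rev [simp]: "act (rev w) (act w P) = P"
  by (induction w arbitrary: P) auto

lemma act_rev' [simp]: "act w (act (rev w) P) = P"
  using act_rev[of "rev w"] by simp

lemma continuous_on_act: "continuous_on S (act w)"
proof (induction w)
  case (Cons i w)
  have "continuous_on S (modif i \<circ> act w)"
    by (intro continuous_on_compose Cons.IH continuous_on_modif)
  then show ?case by (simp add: o_def)
qed simp

definition height :: "triple \<Rightarrow> real" where
  "height P = crd L1 P + crd L2 P + crd L3 P"

lemma height_modif: "height (modif i P) = height P + v i P"
  by (cases i) (simp_all add: height_def crd_modif)

lemma continuous_on_height [continuous_intros]: "continuous_on S height"
  unfolding height_def by (intro continuous_intros)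

end

context small_angles
begin

lemma act_Tp: "P \<in> Tp \<Longrightarrow> act w P \<in> Tp"
  by (induction w) (auto intro: modif_Tp)

definition dom :: "triple set" where
  "dom = {P \<in> Tp. \<forall>i. v i P \<ge> 0}"

lemma closed_dom: "closed dom"
proof -
  have "dom = Tp \<inter> (\<Inter>i. {P. 0 \<le> v i P})" by (auto simp: dom_def)
  moreover have "closed {P. 0 \<le> v i P}" for i
    by (intro closed_Collect_le continuous_intros)
  ultimately show ?thesis using closed_Tp by (simp add: closed_Int closed_INT)
qed

lemma modif_fixed: "v i P = 0 \<Longrightarrow> modif i P = P"
  by (auto simp: triple_eq_iff crd_modif)

text \<open>After a reduced word whose last applied letter is j, the increment of j is nonpositive.
  By \<open>v_sum_pos\<close> the increment of any other letter i is then positive, and applying i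
  reverses its sign.\<close>

lemma ping_pong:
  assumes "p \<in> dom" "distinct_adj (i # u)"
  shows "v i (act (i # u) p) \<le> 0 \<and> (u \<noteq> [] \<or> v i p > 0 \<longrightarrow> v i (act (i # u) p) < 0)"
  using assms(2)
proof (induction u arbitrary: i)
  case Nil
  then show ?case using assms(1) by (auto simp: v_modif_same dom_def)
next
  case (Cons j u)
  have "v j (act (j # u) p) \<le> 0" "i \<noteq> j" using Cons by (auto simp: distinct_adj_Cons)
  moreover have "act (j # u) p \<in> Tp" using assms(1) act_Tp[of p "j # u"] by (simp add: dom_def)
  ultimately have "v i (act (j # u) p) > 0" using v_sum_pos[of "act (j # u) p" i j] by simp
  then show ?case by (simp add: v_modif_same)
qed

lemma dom_unique:
  assumes "p \<in> dom" "distinct_adj w" "act w p \<in> dom"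
  shows "w = [] \<or> (\<exists>i. w = [i] \<and> v i p = 0)"
proof (cases w)
  case (Cons i u)
  have "v i (act w p) \<ge> 0" using assms(3) by (simp add: dom_def)
  then have "u = []" "\<not> v i p > 0" using ping_pong[OF assms(1), of i u] assms(2) Cons by auto
  moreover have "v i p \<ge> 0" using assms(1) by (simp add: dom_def)
  ultimately show ?thesis using Cons by auto
qed simp

text \<open>The claim on odd words makes \<open>Lam\<close> well defined: two words of different
  parity that lead into \<open>dom\<close> end on a wall.\<close>

lemma dom_unique':
  assumes "p \<in> dom" "act w p \<in> dom"
  shows "act w p = p \<and> (odd (length w) \<longrightarrow> (\<exists>i. v i p = 0))"
proof -
  have "act (reduce w) p \<in> dom" using assms by (simp add: act_reduce)
  from dom_unique[OF assms(1) distinct_adj_reduce this] show ?thesis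
  proof
    assume "reduce w = []"
    then show ?thesis using act_reduce[of w p] even_length_reduce[of w] by simp
  next
    assume "\<exists>i. reduce w = [i] \<and> v i p = 0"
    then obtain i where i: "reduce w = [i]" "v i p = 0" by blast
    then show ?thesis using act_reduce[of w p] modif_fixed by auto
  qed
qed

lemma bounded_Tp:
  assumes "P \<in> Tp" "height P \<le> M"
  shows "\<bar>crd i P\<bar> \<le> M"
  using gt_2[OF assms(1), of L1] gt_2[OF assms(1), of L2] gt_2[OF assms(1), of L3] assms(2)
  by (cases i) (auto simp: height_def)

lemma compact_Tp_height: "compact {P \<in> Tp. height P \<le> M}"
proof -
  have "{P \<in> Tp. height P \<le> M} = Tp \<inter> {P. height P \<le> M}" by auto
  moreover have "closed {P. height P \<le> M}" by (intro closed_Collect_le continuous_intros)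
  ultimately have "closed {P \<in> Tp. height P \<le> M}" using closed_Tp by auto
  moreover have "{P \<in> Tp. height P \<le> M} \<subseteq> {-M..M} \<times> {-M..M} \<times> {-M..M}"
  proof
    fix P assume P: "P \<in> {P \<in> Tp. height P \<le> M}"
    then show "P \<in> {-M..M} \<times> {-M..M} \<times> {-M..M}"
      using bounded_Tp[of P M L1] bounded_Tp[of P M L2] bounded_Tp[of P M L3]
      by (cases P) (auto simp: abs_le_iff)
  qed
  moreover have "compact ({-M..M} \<times> {-M..M} \<times> {-M..M})" by (intro compact_Times) auto
  ultimately show ?thesis by (meson bounded_subset compact_eq_bounded_closed compact_imp_bounded)
qed

lemma continuous_on_kappa [continuous_intros]:
  "continuous_on S f \<Longrightarrow> continuous_on S (\<lambda>x. \<kappa> i (f x))"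
  by (cases i) (auto simp: kap_def intro!: continuous_intros)

lemma kappa_lower_bound:
  obtains e where "e > 0" "\<And>P i. P \<in> Tp \<Longrightarrow> height P \<le> M \<Longrightarrow> \<kappa> i (crd i P) \<ge> e"
proof -
  let ?K = "{P \<in> Tp. height P \<le> M}"
  have "\<exists>e>0. \<forall>P\<in>?K. \<kappa> i (crd i P) \<ge> e" for i
  proof (cases "?K = {}")
    case True
    then show ?thesis by (intro exI[of _ 1]) auto
  next
    case False
    have "continuous_on ?K (\<lambda>P. \<kappa> i (crd i P))" by (intro continuous_intros)
    from continuous_attains_inf[OF compact_Tp_height False this]
    obtain P where "P \<in> ?K" "\<And>Q. Q \<in> ?K \<Longrightarrow> \<kappa> i (crd i P) \<le> \<kappa> i (crd i Q)" by blast
    then show ?thesis using kappa_pos gt_2 by (intro exI[of _ "\<kappa> i (crd i P)"]) auto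
  qed
  then obtain e where e: "\<And>i. e i > 0" "\<And>i P. P \<in> ?K \<Longrightarrow> \<kappa> i (crd i P) \<ge> e i" by metis
  have "Min (range e) > 0" using e(1) by auto
  moreover have "\<kappa> i (crd i P) \<ge> Min (range e)" if "P \<in> ?K" for P i
  proof -
    have "Min (range e) \<le> e i" by (intro Min_le) auto
    then show ?thesis using e(2)[OF that, of i] by linarith
  qed
  ultimately show ?thesis using that by blast
qed

text \<open>Descent along \<open>height\<close>. If another step is needed after a step to Q, then
  the decrease p of the step to Q exceeds the next decrease q, and p^2 + q^2 > e by the conic and
  the lower bound e of kappa. So every step but the last lowers the height by more than a
  constant.\<close>

lemma reach_dom:
  obtains N where "\<And>P. P \<in> Tp \<Longrightarrow> height P \<le> M \<Longrightarrow> \<exists>w. length w \<le> N \<and> act w P \<in> dom"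
proof -
  obtain e where e: "e > 0" "\<And>P i. P \<in> Tp \<Longrightarrow> height P \<le> M \<Longrightarrow> \<kappa> i (crd i P) \<ge> e"
    by (rule kappa_lower_bound[where M = M]) blast
  define \<delta> where "\<delta> = sqrt (e / 2)"
  have \<delta>: "\<delta> > 0" "\<delta>\<^sup>2 = e / 2" using e by (simp_all add: \<delta>_def)
  \<comment> \<open>All coordinates exceed 2, so the height exceeds 6, which starts the
    induction.\<close>
  have step: "\<exists>w. length w \<le> Suc n \<and> act w P \<in> dom"
    if "P \<in> Tp" "height P \<le> M" "height P < 6 + of_nat n * \<delta>" for P n
    using that
  proof (induction n arbitrary: P)
    case 0
    then show ?case using gt_2[of P L1] gt_2[of P L2] gt_2[of P L3] by (simp add: height_def)
  next
    case (Suc n)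
    show ?case
    proof (cases "P \<in> dom")
      case True
      then show ?thesis by (intro exI[of _ "[]"]) auto
    next
      case False
      then obtain i where i: "v i P < 0" using Suc.prems by (auto simp: dom_def not_le)
      define Q where "Q = modif i P"
      have Q: "Q \<in> Tp" "height Q < height P" "v i Q = - v i P"
        using Suc.prems i by (auto simp: Q_def modif_Tp height_modif v_modif_same)
      show ?thesis
      proof (cases "Q \<in> dom")
        case True
        then show ?thesis by (intro exI[of _ "[i]"]) (auto simp: Q_def)
      next
        case False
        then obtain j where j: "v j Q < 0" using Q by (auto simp: dom_def not_le)
        then have ij: "i \<noteq> j" using Q i by auto
        define p q x where "p = v i Q" and "q = - v j Q" and "x = crd (third i j) Q"
        have pq: "p > q" "q > 0" using v_sum_pos[OF Q(1) ij] j by (auto simp: p_def q_def)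
        have x: "x > 2" using gt_2[OF Q(1)] by (simp add: x_def)
        have "p\<^sup>2 + q\<^sup>2 - x * p * q = \<kappa> (third i j) x"
          using conic[of Q i j] Q(1) ij by (simp add: p_def q_def x_def Tp_def)
        moreover have "\<kappa> (third i j) x \<ge> e" using e(2)[OF Q(1)] Q(2) Suc.prems by (simp add: x_def)
        moreover have "x * p * q > 0" using x pq by simp
        ultimately have "p\<^sup>2 + q\<^sup>2 > e" by linarith
        moreover have "q\<^sup>2 < p\<^sup>2" using pq by (intro power_strict_mono) auto
        ultimately have "p\<^sup>2 > \<delta>\<^sup>2" using \<delta> by simp
        then have "p > \<delta>" using pq power2_less_imp_less[of \<delta> p] by simp
        then have "height Q < 6 + of_nat n * \<delta>"
          using Suc.prems Q(3) by (simp add: Q_def height_modif p_def algebra_simps v_modif_same)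
        then obtain w where "length w \<le> Suc n" "act w Q \<in> dom"
          using Suc.IH[of Q] Q Suc.prems by auto
        then show ?thesis by (intro exI[of _ "w @ [i]"]) (auto simp: Q_def)
      qed
    qed
  qed
  obtain n where n: "real n * \<delta> > M - 6" using \<delta>(1) ex_less_of_nat_mult by blast
  have "\<exists>w. length w \<le> Suc n \<and> act w P \<in> dom" if "P \<in> Tp" "height P \<le> M" for P
    by (rule step) (use that n in linarith)+
  then show ?thesis using that by blast
qed

lemma reach_dom': "P \<in> Tp \<Longrightarrow> \<exists>w. act w P \<in> dom"
  by (rule reach_dom[where M = "height P"]) blast

text \<open>Up to bounded words on both sides such a word maps a point of \<open>dom\<close> into
  \<open>dom\<close>, hence reduces to at most one letter. This leaves finitely many group
  elements.\<close>

lemma act_meets_compact: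
  assumes "compact K" "K \<subseteq> Tp"
  obtains N where "\<And>w. act w ` K \<inter> K \<noteq> {} \<Longrightarrow>
    \<exists>u u'. length u \<le> N \<and> length u' \<le> N \<and> length (reduce (u' @ w @ rev u)) \<le> 1"
proof -
  have "bounded (height ` K)"
    by (intro compact_imp_bounded compact_continuous_image continuous_intros assms)
  then obtain M where M: "\<And>P. P \<in> K \<Longrightarrow> height P \<le> M"
    by (auto simp: bounded_iff) (metis abs_le_D1)
  obtain N where N: "\<And>P. P \<in> Tp \<Longrightarrow> height P \<le> M \<Longrightarrow> \<exists>w. length w \<le> N \<and> act w P \<in> dom"
    by (rule reach_dom[where M = M]) blast
  have "\<exists>u u'. length u \<le> N \<and> length u' \<le> N \<and> length (reduce (u' @ w @ rev u)) \<le> 1"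
    if "act w ` K \<inter> K \<noteq> {}" for w
  proof -
    from that obtain P where P: "P \<in> K" "act w P \<in> K" by auto
    obtain u u' where u: "length u \<le> N" "act u P \<in> dom" "length u' \<le> N" "act u' (act w P) \<in> dom"
      using N M P assms by (meson subsetD)
    have "act (reduce (u' @ w @ rev u)) (act u P) \<in> dom" using u by (simp add: act_reduce)
    then have "length (reduce (u' @ w @ rev u)) \<le> 1"
      using dom_unique[OF u(2) distinct_adj_reduce] by fastforce
    then show ?thesis using u by blast
  qed
  then show ?thesis using that by blast
qed

end

section \<open>Coordinates on the fundamental domain\<close>

context small_angles
begin

text \<open>On the part of \<open>Tp\<close> where \<open>v L1\<close> and \<open>v L2\<close> are nonnegative, the coordinates are
  \<open>\<theta> = v L1 / (v L1 + v L2)\<close> and \<open>z\<close>.\<close>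

definition quad :: "real \<Rightarrow> real \<Rightarrow> real" where
  "quad \<theta> z = \<theta>\<^sup>2 + (1 - \<theta>)\<^sup>2 + z * \<theta> * (1 - \<theta>)"

text \<open>The positive value of \<open>v L1 + v L2\<close> that the conic forces on the level
  z.\<close>

definition radius :: "real \<Rightarrow> real \<Rightarrow> real" where
  "radius \<theta> z = sqrt (\<kappa> L3 z / quad \<theta> z)"

text \<open>When the first two increments are given, x and y solve a linear system with determinant
  4 - z^2, here by Cramer's rule.\<close>

definition par :: "real \<Rightarrow> real \<Rightarrow> triple" where
  "par \<theta> z = (let e = 4 * (A * B + C * D) + \<theta> * radius \<theta> z; f = 4 * (A * C + B * D) + (1 - \<theta>) * radius \<theta> z
     in ((z * f + 2 * e) / (z\<^sup>2 - 4), (z * e + 2 * f) / (z\<^sup>2 - 4), z))"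

lemma quad_pos:
  assumes "0 \<le> \<theta>" "\<theta> \<le> 1" "z > 2"
  shows "quad \<theta> z > 0"
proof -
  have "0 \<le> z * \<theta> * (1 - \<theta>)" using assms by simp
  moreover have "0 < \<theta>\<^sup>2 + (1 - \<theta>)\<^sup>2" by (simp add: sum_power2_gt_zero_iff)
  ultimately show ?thesis by (simp add: quad_def)
qed

lemma radius_pos: "0 \<le> \<theta> \<Longrightarrow> \<theta> \<le> 1 \<Longrightarrow> z > 2 \<Longrightarrow> radius \<theta> z > 0"
  using quad_pos[of \<theta> z] kappa_pos[of z L3] by (simp add: radius_def)

lemma crd_par [simp]: "crd L3 (par \<theta> z) = z"
  by (simp add: par_def Let_def)

lemma v_par:
  assumes "z > 2"
  shows "v L1 (par \<theta> z) = \<theta> * radius \<theta> z" "v L2 (par \<theta> z) = (1 - \<theta>) * radius \<theta> z"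
proof -
  define e f where "e = 4 * (A * B + C * D) + \<theta> * radius \<theta> z" and "f = 4 * (A * C + B * D) + (1 - \<theta>) * radius \<theta> z"
  have nz: "z\<^sup>2 - 4 \<noteq> 0" using square_gt_4[OF assms] by simp
  have p: "par \<theta> z = ((z * f + 2 * e) / (z\<^sup>2 - 4), (z * e + 2 * f) / (z\<^sup>2 - 4), z)"
    by (simp add: par_def e_def f_def)
  have *: "(z * g + 2 * h) / (z\<^sup>2 - 4) * z - 2 * ((z * h + 2 * g) / (z\<^sup>2 - 4)) = g" for g h
  proof -
    have "(z * g + 2 * h) / (z\<^sup>2 - 4) * z - 2 * ((z * h + 2 * g) / (z\<^sup>2 - 4))
      = ((z * g + 2 * h) * z - 2 * (z * h + 2 * g)) / (z\<^sup>2 - 4)"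
      by (simp add: diff_divide_distrib)
    also have "(z * g + 2 * h) * z - 2 * (z * h + 2 * g) = g * (z\<^sup>2 - 4)"
      by (simp add: power2_eq_square algebra_simps)
    finally show ?thesis using nz by simp
  qed
  show "v L1 (par \<theta> z) = \<theta> * radius \<theta> z" using *[of e f] unfolding p by (simp add: slope_def e_def)
  show "v L2 (par \<theta> z) = (1 - \<theta>) * radius \<theta> z" using *[of f e] unfolding p by (simp add: slope_def f_def)
qed

lemma F_par:
  assumes "0 \<le> \<theta>" "\<theta> \<le> 1" "z > 2"
  shows "F (par \<theta> z) = 0"
proof -
  obtain x y where xy: "par \<theta> z = (x, y, z)" by (metis crd_par crd.simps(3) prod_cases3)
  have "slope A B D C x z y = \<theta> * radius \<theta> z" "slope A C D B y z x = (1 - \<theta>) * radius \<theta> z"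
    using v_par[OF assms(3), of \<theta>] xy slope_swap[of A B D C x z y] slope_swap[of A C D B y z x] by simp_all
  moreover have "\<theta> * radius \<theta> z * (\<theta> * radius \<theta> z) + (1 - \<theta>) * radius \<theta> z * ((1 - \<theta>) * radius \<theta> z)
      + z * (\<theta> * radius \<theta> z) * ((1 - \<theta>) * radius \<theta> z) = kap A D B C z"
  proof -
    have "(radius \<theta> z)\<^sup>2 * quad \<theta> z = kap A D B C z"
      using quad_pos[OF assms] kappa_pos[OF assms(3), of L3] by (simp add: radius_def)
    then show ?thesis by (simp add: quad_def power2_eq_square algebra_simps)
  qed
  ultimately have "(z\<^sup>2 - 4) * fricke A D B C z x y = 0"
    using level_conic_identity[of A B D C x z y] by (simp add: power2_eq_square)
  then show ?thesis using square_gt_4[OF assms(3)] xy by (simp add: fricke_rot)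
qed

lemma par_Tp:
  assumes "0 \<le> \<theta>" "\<theta> \<le> 1" "z > 2"
  shows "par \<theta> z \<in> Tp"
proof -
  note F = F_par[OF assms] and r = radius_pos[OF assms]
  have "2 * a * sn L1 \<le> crd L1 (par \<theta> z) + 2 * A * cs L1"
    by (rule constraint_of_branch[OF F, of _ L3]) (use assms r v_par in auto)
  moreover have "2 * a * sn L2 \<le> crd L2 (par \<theta> z) + 2 * A * cs L2"
    by (rule constraint_of_branch[OF F, of _ L3]) (use assms r v_par in auto)
  moreover have "2 * a * sn L3 \<le> crd L3 (par \<theta> z) + 2 * A * cs L3"
    using one_plus_prod_ge[OF unit(1,4)] assms by simp
  ultimately have "2 * a * sn i \<le> crd i (par \<theta> z) + 2 * A * cs i" for i by (cases i) auto
  then show ?thesis using F by (simp add: Tp_def)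
qed

lemma par_inverse:
  assumes P: "P \<in> Tp" "v L1 P \<ge> 0" "v L2 P \<ge> 0"
  shows "par (v L1 P / (v L1 P + v L2 P)) (crd L3 P) = P"
    and "0 \<le> v L1 P / (v L1 P + v L2 P)" "v L1 P / (v L1 P + v L2 P) \<le> 1"
proof -
  define s \<theta> where "s = v L1 P + v L2 P" and "\<theta> = v L1 P / s"
  obtain x y z where xyz: "P = (x, y, z)" by (cases P)
  have z: "z > 2" using gt_2[OF P(1), of L3] xyz by simp
  have s: "s > 0" using v_sum_pos[OF P(1), of L1 L2] by (simp add: s_def)
  have th: "0 \<le> \<theta>" "\<theta> \<le> 1" using P s by (simp_all add: \<theta>_def s_def)
  then show "0 \<le> v L1 P / (v L1 P + v L2 P)" "v L1 P / (v L1 P + v L2 P) \<le> 1"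
    by (simp_all add: \<theta>_def s_def)
  have v: "v L1 P = \<theta> * s" "v L2 P = (1 - \<theta>) * s" using s by (simp_all add: \<theta>_def s_def field_simps)
  have "(v L1 P)\<^sup>2 + (v L2 P)\<^sup>2 + z * v L1 P * v L2 P = \<kappa> L3 z"
    using conic[of P L1 L2] P(1) xyz by (simp add: Tp_def)
  then have "s\<^sup>2 * quad \<theta> z = \<kappa> L3 z"
    unfolding v by (simp add: quad_def power2_eq_square algebra_simps)
  then have "\<kappa> L3 z / quad \<theta> z = s\<^sup>2" using quad_pos[OF th z] by (simp add: field_simps)
  then have r: "radius \<theta> z = s" using s by (simp add: radius_def)
  have e: "4 * (A * B + C * D) + \<theta> * s = y * z - 2 * x" "4 * (A * C + B * D) + (1 - \<theta>) * s = x * z - 2 * y"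
    unfolding v[symmetric] by (simp_all add: xyz slope_def)
  have nz: "z\<^sup>2 - 4 \<noteq> 0" using square_gt_4[OF z] by simp
  have "(z * (x * z - 2 * y) + 2 * (y * z - 2 * x)) = x * (z\<^sup>2 - 4)"
    "(z * (y * z - 2 * x) + 2 * (x * z - 2 * y)) = y * (z\<^sup>2 - 4)"
    by (simp_all add: power2_eq_square algebra_simps)
  then have "par \<theta> z = P" unfolding par_def Let_def r e using nz by (simp add: xyz)
  then show "par (v L1 P / (v L1 P + v L2 P)) (crd L3 P) = P" by (simp add: \<theta>_def s_def xyz)
qed

lemma continuous_on_par:
  assumes "continuous_on S f" "continuous_on S g" "\<And>x. x \<in> S \<Longrightarrow> 0 \<le> f x \<and> f x \<le> 1 \<and> g x > 2"
  shows "continuous_on S (\<lambda>x. par (f x) (g x))"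
proof -
  have 1: "quad (f x) (g x) \<noteq> 0" "(g x)\<^sup>2 - 4 \<noteq> 0" if "x \<in> S" for x
    using quad_pos[of "f x" "g x"] square_gt_4[of "g x"] assms(3)[OF that] by auto
  have q: "continuous_on S (\<lambda>x. quad (f x) (g x))"
    unfolding quad_def by (intro continuous_intros assms)
  have r: "continuous_on S (\<lambda>x. radius (f x) (g x))"
    unfolding radius_def by (intro continuous_intros q assms) (use 1 in auto)
  show ?thesis unfolding par_def Let_def
    by (intro continuous_intros assms r) (use 1 in auto)
qed

text \<open>In the coordinates \<theta> and z, \<open>dom\<close> is the region where this function
  is nonnegative; the lemmas that follow determine its sign.\<close>

definition zeta :: "real \<Rightarrow> real \<Rightarrow> real" where
  "zeta \<theta> z = v L3 (par \<theta> z)"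

lemma continuous_on_zeta:
  assumes "continuous_on S f" "continuous_on S g" "\<And>x. x \<in> S \<Longrightarrow> 0 \<le> f x \<and> f x \<le> 1 \<and> g x > 2"
  shows "continuous_on S (\<lambda>x. zeta (f x) (g x))"
proof -
  have "continuous_on S (v L3 \<circ> (\<lambda>x. par (f x) (g x)))"
    by (intro continuous_on_compose continuous_on_par assms continuous_on_v)
  then show ?thesis by (simp add: zeta_def o_def)
qed

lemma zeta_pos_ends:
  assumes "z > 2" "\<theta> = 0 \<or> \<theta> = 1"
  shows "zeta \<theta> z > 0"
proof -
  have th: "0 \<le> \<theta>" "\<theta> \<le> 1" using assms by auto
  have "v L1 (par \<theta> z) = 0 \<or> v L2 (par \<theta> z) = 0" using v_par[OF assms(1)] assms(2) by auto
  then show ?thesis using v_sum_pos[OF par_Tp[OF th assms(1)], of L1 L3] v_sum_pos[OF par_Tp[OF th assms(1)], of L2 L3]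
    by (auto simp: zeta_def)
qed

text \<open>If the third increment is nonpositive and z is near 2, then xy is bounded and so is the
  height. On a compact part of \<open>Tp\<close> the coordinate z stays away from 2.\<close>

lemma zeta_pos_near_2:
  obtains \<delta> where "\<delta> > 0" "\<And>\<theta> z. 0 \<le> \<theta> \<Longrightarrow> \<theta> \<le> 1 \<Longrightarrow> 2 < z \<Longrightarrow> z \<le> 2 + \<delta> \<Longrightarrow> zeta \<theta> z > 0"
proof -
  define R where "R = \<bar>4 * (A * D + B * C)\<bar>"
  \<comment> \<open>Below, x + y <= R + 6 and z <= 3.\<close>
  define M where "M = R + 9"
  let ?K = "{P \<in> Tp. height P \<le> M}"
  have "\<exists>\<delta>>0. \<delta> \<le> 1 \<and> (\<forall>P\<in>?K. crd L3 P > 2 + \<delta>)"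
  proof (cases "?K = {}")
    case True
    then show ?thesis by (intro exI[of _ 1]) auto
  next
    case False
    have "continuous_on ?K (crd L3)" by (intro continuous_intros)
    from continuous_attains_inf[OF compact_Tp_height False this]
    obtain P where P: "P \<in> ?K" "\<And>Q. Q \<in> ?K \<Longrightarrow> crd L3 P \<le> crd L3 Q" by blast
    have "crd L3 P > 2" using P gt_2 by auto
    then show ?thesis using P(2) by (intro exI[of _ "min 1 ((crd L3 P - 2) / 2)"]) (auto simp: min_def field_simps; fastforce)
  qed
  then obtain \<delta> where \<delta>: "\<delta> > 0" "\<delta> \<le> 1" "\<And>P. P \<in> ?K \<Longrightarrow> crd L3 P > 2 + \<delta>" by blast
  have "zeta \<theta> z > 0" if "0 \<le> \<theta>" "\<theta> \<le> 1" "2 < z" "z \<le> 2 + \<delta>" for \<theta> z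
  proof (rule ccontr)
    assume neg: "\<not> zeta \<theta> z > 0"
    obtain x y where xy: "par \<theta> z = (x, y, z)" by (metis crd_par crd.simps(3) prod_cases3)
    have T: "(x, y, z) \<in> Tp" using par_Tp[OF that(1-3)] xy by simp
    have "x > 2" "y > 2" using gt_2[OF T, of L1] gt_2[OF T, of L2] by simp_all
    have "x * y \<le> 2 * z + 4 * (A * D + B * C)" using neg by (simp add: zeta_def xy slope_def)
    also have "\<dots> \<le> R + 6" using that \<delta> by (simp add: R_def)
    finally have "x * y \<le> R + 6" .
    moreover have "(x - 2) * (y - 2) > 0" using \<open>x > 2\<close> \<open>y > 2\<close> by simp
    then have "x * y > 2 * x + 2 * y - 4" by (simp add: algebra_simps)
    ultimately have "2 * x + 2 * y < R + 10" by linarith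
    moreover have "R \<ge> 0" by (simp add: R_def)
    ultimately have "x + y \<le> R + 6" using \<open>x > 2\<close> \<open>y > 2\<close> by linarith
    then have "(x, y, z) \<in> ?K" using T that \<delta> by (simp add: height_def M_def)
    then show False using \<delta>(3) that by fastforce
  qed
  then show ?thesis using that \<delta>(1) by blast
qed

lemma slope_value: "(v i P)\<^sup>2 = \<kappa> j (crd j P)" if "F P = 0" "i \<noteq> j" "v (third i j) P = 0"
  using conic[OF that(1), of i "third i j"] that by (cases i; cases j) auto

text \<open>The curve \<open>v L3 = 0\<close> in \<open>Tp\<close> is an antichain in the \<open>(x, y)\<close>-plane, because the discriminant of \<open>F\<close>
  in \<open>z\<close> increases in \<open>x\<close> and \<open>y\<close>.\<close>

lemma antichain:
  assumes P: "(x, y, z) \<in> Tp" "(x', y', z') \<in> Tp" "v L3 (x, y, z) = 0" "v L3 (x', y', z') = 0"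
    and le: "x \<le> x'" "y \<le> y'"
  shows "x = x' \<and> y = y' \<and> z = z'"
proof -
  define R where "R = 4 * (A * D + B * C)"
  define G where "G = (\<lambda>x y. (x * y - R)\<^sup>2 - 4 * (x\<^sup>2 + y\<^sup>2 + 4 * (A * B + C * D) * x + 4 * (A * C + B * D) * y
     - 4 + 4 * (A\<^sup>2 + B\<^sup>2 + C\<^sup>2 + D\<^sup>2) + 16 * A * B * C * D))"
  have disc: "(v L3 (x, y, z))\<^sup>2 = G x y + 4 * F (x, y, z)" for x y z
    by (simp add: G_def R_def slope_def fricke_def power2_eq_square algebra_simps)
  have F0: "F (x, y, z) = 0" "F (x', y', z') = 0" using P by (simp_all add: Tp_def)
  have G0: "G x y = 0" "G x' y' = 0" using disc[of x y z] disc[of x' y' z'] F0 P by simp_all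
  have gt: "x > 2" "y > 2" "z > 2" "x' > 2" "y' > 2" "z' > 2"
    using gt_2[OF P(1), of L1] gt_2[OF P(1), of L2] gt_2[OF P(1), of L3]
      gt_2[OF P(2), of L1] gt_2[OF P(2), of L2] gt_2[OF P(2), of L3] by simp_all
  have z2: "2 * z = x * y - R" "2 * z' = x' * y' - R" using P by (simp_all add: slope_def R_def)
  have v1: "v L1 (x, y, z) > 0" using v_sum_pos[OF P(1), of L1 L3] P by simp
  have v2: "v L2 (x', y', z') > 0" using v_sum_pos[OF P(2), of L2 L3] P by simp
  have dx: "G x' y = (x' - x)\<^sup>2 * (y\<^sup>2 - 4) + 4 * (x' - x) * v L1 (x, y, z)"
  proof -
    have "G x' y = G x y + (x' - x)\<^sup>2 * (y\<^sup>2 - 4) + 2 * (x' - x) * (y * (x * y - R) - 4 * x - 8 * (A * B + C * D))"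
      by (simp add: G_def power2_eq_square algebra_simps)
    then show ?thesis unfolding z2(1)[symmetric] G0 by (simp add: slope_def algebra_simps)
  qed
  have y2: "y\<^sup>2 - 4 > 0" "x'\<^sup>2 - 4 > 0" using square_gt_4 gt by simp_all
  have Gx: "G x' y \<ge> 0" unfolding dx using le v1 y2 by simp
  \<comment> \<open>The path goes from (x, y) to (x', y) and then to (x', y'). Above the corner the
    larger root is taken, so that (x', y, w) has all coordinates above 2 and lies in
    \<open>Tp\<close>; this controls the growth of \<open>G\<close> on the second leg.\<close>
  define w where "w = (x' * y - R + sqrt (G x' y)) / 2"
  have "v L3 (x', y, w) = x' * y - 2 * w - R" by (simp add: slope_def R_def)
  moreover have w2: "2 * w = x' * y - R + sqrt (G x' y)" by (simp add: w_def)
  ultimately have w: "v L3 (x', y, w) = - sqrt (G x' y)" by linarith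
  then have Fw: "F (x', y, w) = 0" using disc[of x' y w] Gx by simp
  have "x * y \<le> x' * y" using le gt by simp
  moreover have "sqrt (G x' y) \<ge> 0" using Gx by simp
  ultimately have "w \<ge> z" using z2(1) w2 by linarith
  then have Tw: "(x', y, w) \<in> Tp"
  proof -
    have "crd i (x', y, w) > 2" for i using gt \<open>w \<ge> z\<close> by (cases i) auto
    then show ?thesis using Fw by (simp add: Tp_iff)
  qed
  have vw: "v L2 (x', y, w) \<ge> sqrt (G x' y)" using v_sum_pos[OF Tw, of L2 L3] w by simp
  have dy: "G x' y' = G x' y + (y' - y)\<^sup>2 * (x'\<^sup>2 - 4) + 4 * (y' - y) * (v L2 (x', y, w) - x' * sqrt (G x' y) / 2)"
  proof -
    have "G x' y' = G x' y + (y' - y)\<^sup>2 * (x'\<^sup>2 - 4) + 2 * (y' - y) * (x' * (x' * y - R) - 4 * y - 8 * (A * C + B * D))"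
      by (simp add: G_def power2_eq_square algebra_simps)
    moreover have "x' * (x' * y - R) - 4 * y - 8 * (A * C + B * D) = 2 * (v L2 (x', y, w) - x' * sqrt (G x' y) / 2)"
    proof -
      have "2 * w - sqrt (G x' y) = x' * y - R" using w2 by linarith
      then have e: "x' * (x' * y - R) = x' * (2 * w - sqrt (G x' y))" by simp
      show ?thesis unfolding e by (simp add: slope_def algebra_simps)
    qed
    ultimately have "G x' y' = G x' y + (y' - y)\<^sup>2 * (x'\<^sup>2 - 4)
        + 2 * (y' - y) * (2 * (v L2 (x', y, w) - x' * sqrt (G x' y) / 2))"
      by (simp only:)
    moreover have "2 * p * (2 * q) = 4 * p * q" for p q :: real by simp
    ultimately show ?thesis by (simp only:)
  qed
  have pos: "2 * v L2 (x', y, w) - x' * sqrt (G x' y) > 0"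
    using slope_comb_pos[OF unit(1,3), of B D x' w y] Tw sin_pos gt w
    by (auto simp: Tp_def fricke_swap23 dest: spec[of _ L2])
  have "G x' y' \<ge> G x' y"
    unfolding dy using le pos y2 by simp
  then have "G x' y = 0" using G0 Gx by simp
  then have "(x' - x)\<^sup>2 * (y\<^sup>2 - 4) + 4 * (x' - x) * v L1 (x, y, z) = 0" using dx by simp
  moreover have "(x' - x)\<^sup>2 * (y\<^sup>2 - 4) \<ge> 0" "4 * (x' - x) * v L1 (x, y, z) \<ge> 0" using le v1 y2 by simp_all
  ultimately have "4 * (x' - x) * v L1 (x, y, z) = 0" by linarith
  then have x: "x' = x" using v1 by simp
  have "(y' - y)\<^sup>2 * (x'\<^sup>2 - 4) + 4 * (y' - y) * v L2 (x', y, w) = 0"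
    using dy G0 \<open>G x' y = 0\<close> by simp
  moreover have "(y' - y)\<^sup>2 * (x'\<^sup>2 - 4) \<ge> 0" "4 * (y' - y) * v L2 (x', y, w) \<ge> 0"
    using le pos y2 \<open>G x' y = 0\<close> by simp_all
  ultimately have "4 * (y' - y) * v L2 (x', y, w) = 0" by linarith
  then have "y' = y" using pos \<open>G x' y = 0\<close> by simp
  then show ?thesis using x z2 by simp
qed

end

context small_angles
begin

lemma kappa_strict_mono:
  assumes "2 < x" "x < y"
  shows "\<kappa> i x < \<kappa> i y"
proof -
  have 1: "x\<^sup>2 + 4 * p * q * x + 4 * p\<^sup>2 + 4 * q\<^sup>2 - 4 < y\<^sup>2 + 4 * p * q * y + 4 * p\<^sup>2 + 4 * q\<^sup>2 - 4"
    if "p\<^sup>2 + r\<^sup>2 = 1" "q\<^sup>2 + s\<^sup>2 = 1" for p q r s :: real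
  proof -
    have "\<bar>p * q\<bar> \<le> 1" by (rule abs_mult_le_one) fact+
    then have "4 * (p * q) \<ge> -4" by linarith
    then have "x + y + 4 * (p * q) > 0" using assms by linarith
    then have "(y - x) * (x + y + 4 * (p * q)) > 0" using assms by simp
    then show ?thesis by (simp add: power2_eq_square algebra_simps)
  qed
  have y: "2 < y" using assms by simp
  have 2: "kap p q r s x < kap p q r s y"
    if "p\<^sup>2 + p'\<^sup>2 = 1" "q\<^sup>2 + q'\<^sup>2 = 1" "r\<^sup>2 + r'\<^sup>2 = 1" "s\<^sup>2 + s'\<^sup>2 = 1" for p q r s p' q' r' s' :: real
    unfolding kap_def
    by (intro mult_strict_mono 1[OF that(1,2)] 1[OF that(3,4)] kap_factor_pos[OF that(1,2)] less_imp_le[OF kap_factor_pos[OF that(3,4)]] assms y)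
  show ?thesis by (cases i) (auto intro!: 2 unit)
qed

text \<open>If y <= y', \<open>antichain\<close> applies. Otherwise the monotonicity of kappa
  compares the first increments through y and the second ones through x. As \<theta> is the same,
  one comparison makes the radius at z' smaller and the other does not allow it.\<close>

lemma zeta_zero_unique_aux:
  assumes th: "0 < \<theta>" "\<theta> < 1" and z: "z > 2" "z' > 2" and 0: "zeta \<theta> z = 0" "zeta \<theta> z' = 0"
    and P: "par \<theta> z = (x, y, z)" "par \<theta> z' = (x', y', z')" and le: "x \<le> x'"
  shows "z = z'"
proof (cases "y \<le> y'")
  case True
  then show ?thesis
    using antichain[of x y z x' y' z'] par_Tp[of \<theta> z] par_Tp[of \<theta> z'] assms by (simp add: zeta_def)
next
  case False
  have T: "(x, y, z) \<in> Tp" "(x', y', z') \<in> Tp" using par_Tp[of \<theta> z] par_Tp[of \<theta> z'] assms by simp_all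
  have gt: "x > 2" "x' > 2" "y' > 2"
    using gt_2[OF T(1), of L1] gt_2[OF T(2), of L1] gt_2[OF T(2), of L2] by simp_all
  have "(v L1 (x, y, z))\<^sup>2 = \<kappa> L2 y" "(v L1 (x', y', z'))\<^sup>2 = \<kappa> L2 y'"
    "(v L2 (x, y, z))\<^sup>2 = \<kappa> L1 x" "(v L2 (x', y', z'))\<^sup>2 = \<kappa> L1 x'"
    using slope_value[of _ L1 L2] slope_value[of _ L2 L1] T 0 P by (auto simp: Tp_def zeta_def simp del: \<kappa>.simps v.simps)
  then have "(\<theta> * radius \<theta> z)\<^sup>2 = \<kappa> L2 y" "(\<theta> * radius \<theta> z')\<^sup>2 = \<kappa> L2 y'"
    "((1 - \<theta>) * radius \<theta> z)\<^sup>2 = \<kappa> L1 x" "((1 - \<theta>) * radius \<theta> z')\<^sup>2 = \<kappa> L1 x'"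
    using v_par[OF z(1), of \<theta>] v_par[OF z(2), of \<theta>] P by (simp_all del: \<kappa>.simps v.simps)
  moreover have "\<kappa> L2 y' < \<kappa> L2 y" using kappa_strict_mono[of y' y L2] gt False by simp
  moreover have "\<kappa> L1 x \<le> \<kappa> L1 x'" using kappa_strict_mono[of x x' L1] gt le by (cases "x = x'") (simp_all del: \<kappa>.simps)
  ultimately have "(\<theta> * radius \<theta> z')\<^sup>2 < (\<theta> * radius \<theta> z)\<^sup>2" "((1 - \<theta>) * radius \<theta> z)\<^sup>2 \<le> ((1 - \<theta>) * radius \<theta> z')\<^sup>2" by simp_all
  then have "(radius \<theta> z')\<^sup>2 < (radius \<theta> z)\<^sup>2" "(radius \<theta> z)\<^sup>2 \<le> (radius \<theta> z')\<^sup>2"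
    using th by (simp_all add: power_mult_distrib)
  then show ?thesis by simp
qed

lemma zeta_zero_unique:
  assumes "0 \<le> \<theta>" "\<theta> \<le> 1" and z: "z > 2" "z' > 2" and 0: "zeta \<theta> z = 0" "zeta \<theta> z' = 0"
  shows "z = z'"
proof -
  have th: "0 < \<theta>" "\<theta> < 1" using zeta_pos_ends[OF z(1), of \<theta>] 0 assms by (auto simp: order_less_le)
  obtain x y x' y' where P: "par \<theta> z = (x, y, z)" "par \<theta> z' = (x', y', z')"
    by (metis crd_par crd.simps(3) prod_cases3)
  show ?thesis
    using zeta_zero_unique_aux[OF th z 0 P] zeta_zero_unique_aux[OF th z(2,1) 0(2,1) P(2,1)] by linarith
qed

text \<open>As z grows, kappa is asymptotic to z^4 and \<open>quad\<close> to \<theta>(1 - \<theta>)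
  z, so the squared radius is asymptotic to z^3 / (\<theta>(1 - \<theta>)). Then xy is asymptotic to
  z, and the third increment xy - 2z - R to -z.\<close>

lemma zeta_neg_far:
  assumes th: "0 < \<theta>" "\<theta> < 1"
  obtains z where "z > 2" "zeta \<theta> z < 0"
proof -
  define t u q where "t = \<theta>" and "u = 1 - \<theta>" and "q = t * u"
  define P Q R where "P = 4 * (A * B + C * D)" and "Q = 4 * (A * C + B * D)" and "R = 4 * (A * D + B * C)"
  have tu: "t > 0" "u > 0" "q > 0" using th by (simp_all add: t_def u_def q_def)
  define r where "r = radius \<theta>"
  have r2: "(r z)\<^sup>2 = kap A D B C z / (t\<^sup>2 + u\<^sup>2 + z * q)" if "z > 2" for z
    using that quad_pos[of \<theta> z] kappa_pos[OF that, of L3] th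
    by (simp add: r_def radius_def quad_def t_def u_def q_def mult.assoc)
  have ev: "eventually (\<lambda>z::real. z > 2) at_top" by (rule eventually_gt_at_top)
  have 1: "((\<lambda>z. (r z)\<^sup>2 / z ^ 3) \<longlongrightarrow> 1 / q) at_top"
  proof (rule Lim_transform_eventually)
    have "((\<lambda>z. kap A D B C z / (t\<^sup>2 + u\<^sup>2 + z * q) / z ^ 3) \<longlongrightarrow> inverse q) at_top"
      unfolding kap_def using tu(3) by real_asymp
    then show "((\<lambda>z. kap A D B C z / (t\<^sup>2 + u\<^sup>2 + z * q) / z ^ 3) \<longlongrightarrow> 1 / q) at_top"
      by (simp add: inverse_eq_divide)
    show "\<forall>\<^sub>F z in at_top. kap A D B C z / (t\<^sup>2 + u\<^sup>2 + z * q) / z ^ 3 = (r z)\<^sup>2 / z ^ 3"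
      using ev by eventually_elim (simp add: r2)
  qed
  have 2: "((\<lambda>z. r z / z\<^sup>2) \<longlongrightarrow> 0) at_top"
  proof (rule Lim_transform_eventually)
    have "((\<lambda>z::real. 1 / z) \<longlongrightarrow> 0) at_top" by real_asymp
    then have "((\<lambda>z. sqrt ((r z)\<^sup>2 / z ^ 3 * (1 / z))) \<longlongrightarrow> sqrt (1 / q * 0)) at_top"
      by (intro tendsto_real_sqrt tendsto_mult 1)
    then show "((\<lambda>z. sqrt ((r z)\<^sup>2 / z ^ 3 * (1 / z))) \<longlongrightarrow> 0) at_top" by simp
    show "\<forall>\<^sub>F z in at_top. sqrt ((r z)\<^sup>2 / z ^ 3 * (1 / z)) = r z / z\<^sup>2"
      using ev
    proof eventually_elim
      case (elim z)
      then have "r z > 0" using radius_pos[of \<theta> z] th by (simp add: r_def)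
      have "(r z)\<^sup>2 / z ^ 3 * (1 / z) = (r z / z\<^sup>2)\<^sup>2"
        by (simp add: power_divide power2_eq_square power3_eq_cube)
      then show ?case using elim \<open>r z > 0\<close> by (simp only: real_sqrt_abs) simp
    qed
  qed
  \<comment> \<open>The coefficients of zeta / z as a quadratic polynomial in the radius, scaled so
    that the square of the radius appears divided by z^3 and the radius by z^2.\<close>
  define c1 c2 c3 :: "real \<Rightarrow> real" where "c1 = (\<lambda>z. (2 * z * (t\<^sup>2 + u\<^sup>2) + (z\<^sup>2 + 4) * q) * z ^ 3 / (z * (z\<^sup>2 - 4)\<^sup>2))"
    and "c2 = (\<lambda>z. (2 * z * (2 * P * t + 2 * Q * u) + (z\<^sup>2 + 4) * (P * u + Q * t)) * z\<^sup>2 / (z * (z\<^sup>2 - 4)\<^sup>2))"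
    and "c3 = (\<lambda>z. (2 * z * (P\<^sup>2 + Q\<^sup>2) + (z\<^sup>2 + 4) * P * Q) / (z * (z\<^sup>2 - 4)\<^sup>2) - 2 - R / z)"
  have c: "(c1 \<longlongrightarrow> q) at_top" "(c2 \<longlongrightarrow> 0) at_top" "(c3 \<longlongrightarrow> - 2) at_top"
    unfolding c1_def c2_def c3_def by real_asymp+
  have eq: "zeta \<theta> z / z = (r z)\<^sup>2 / z ^ 3 * c1 z + r z / z\<^sup>2 * c2 z + c3 z" if "z > 2" for z
  proof -
    define N where "N = z\<^sup>2 - 4"
    define e f where "e = P + t * r z" and "f = Q + u * r z"
    have nz: "N \<noteq> 0" "z \<noteq> 0" using square_gt_4[OF that] that by (auto simp: N_def)
    have "par \<theta> z = ((z * f + 2 * e) / N, (z * e + 2 * f) / N, z)"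
      by (simp add: par_def Let_def P_def Q_def e_def f_def N_def t_def u_def r_def)
    then have "zeta \<theta> z = (z * f + 2 * e) / N * ((z * e + 2 * f) / N) - 2 * z - R"
      by (simp add: zeta_def slope_def R_def)
    also have "(z * f + 2 * e) / N * ((z * e + 2 * f) / N) = (2 * z * (e\<^sup>2 + f\<^sup>2) + (z\<^sup>2 + 4) * (e * f)) / N\<^sup>2"
      by (simp add: power2_eq_square algebra_simps)
    also have "2 * z * (e\<^sup>2 + f\<^sup>2) + (z\<^sup>2 + 4) * (e * f) = (2 * z * (t\<^sup>2 + u\<^sup>2) + (z\<^sup>2 + 4) * q) * (r z)\<^sup>2
      + (2 * z * (2 * P * t + 2 * Q * u) + (z\<^sup>2 + 4) * (P * u + Q * t)) * r z + (2 * z * (P\<^sup>2 + Q\<^sup>2) + (z\<^sup>2 + 4) * P * Q)"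
      by (simp add: e_def f_def q_def power2_eq_square algebra_simps)
    finally show ?thesis
      using nz by (simp add: c1_def c2_def c3_def N_def[symmetric] add_divide_distrib diff_divide_distrib)
        (simp add: mult_ac)
  qed
  have "((\<lambda>z. (r z)\<^sup>2 / z ^ 3 * c1 z + r z / z\<^sup>2 * c2 z + c3 z) \<longlongrightarrow> 1 / q * q + 0 * 0 + (- 2)) at_top"
    by (intro tendsto_intros 1 2 c)
  then have "((\<lambda>z. (r z)\<^sup>2 / z ^ 3 * c1 z + r z / z\<^sup>2 * c2 z + c3 z) \<longlongrightarrow> - 1) at_top" using tu by simp
  then have "\<forall>\<^sub>F z in at_top. (r z)\<^sup>2 / z ^ 3 * c1 z + r z / z\<^sup>2 * c2 z + c3 z < 0"
    by (rule order_tendstoD) simp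
  with ev have "\<forall>\<^sub>F z in at_top. z > 2 \<and> zeta \<theta> z < 0"
  proof eventually_elim
    case (elim z)
    then have "zeta \<theta> z / z < 0" by (simp add: eq)
    then show ?case using elim by (simp add: divide_less_0_iff)
  qed
  then obtain z where "z > 2 \<and> zeta \<theta> z < 0" by (auto dest: eventually_happens)
  then show ?thesis using that by blast
qed

lemma ivt_zeta:
  assumes "0 \<le> \<theta>" "\<theta> \<le> 1" "2 < z" "2 < z'" "zeta \<theta> z \<le> 0" "zeta \<theta> z' \<ge> 0"
  obtains w where "min z z' \<le> w" "w \<le> max z z'" "zeta \<theta> w = 0"
proof -
  have c: "continuous_on {min z z'..max z z'} (zeta \<theta>)"
    by (rule continuous_on_zeta[of _ "\<lambda>_. \<theta>" "\<lambda>z. z"])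
      (use assms in \<open>auto simp: min_def split: if_splits intro!: continuous_intros\<close>)
  have "\<exists>w\<ge>min z z'. w \<le> max z z' \<and> zeta \<theta> w = 0"
  proof (cases "z \<le> z'")
    case True
    then show ?thesis using IVT'[of "zeta \<theta>" z 0 z'] c assms by (auto simp: min_def max_def)
  next
    case False
    then show ?thesis using IVT2'[of "zeta \<theta>" z 0 z'] c assms by (auto simp: min_def max_def)
  qed
  then show ?thesis using that by blast
qed

text \<open>The parameter s = 1/(z - 2) maps ]2, oo[ onto ]0, oo[ and reverses it. In s the boundary
  value is finite for every \<theta>, and it is 0 at the ends, where the third increment never
  vanishes.\<close>

lemma zeta_sign:
  assumes th: "0 \<le> \<theta>" "\<theta> \<le> 1"
  shows "\<exists>w\<ge>0. (w = 0 \<longleftrightarrow> \<theta> = 0 \<or> \<theta> = 1) \<and>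
    (\<forall>s>0. (zeta \<theta> (2 + 1 / s) > 0 \<longleftrightarrow> s > w) \<and> (zeta \<theta> (2 + 1 / s) < 0 \<longleftrightarrow> s < w))"
proof (cases "\<theta> = 0 \<or> \<theta> = 1")
  case True
  then show ?thesis using zeta_pos_ends[OF _ True] by (intro exI[of _ 0]) (auto simp: not_less less_imp_le)
next
  case False
  then obtain z1 where z1: "z1 > 2" "zeta \<theta> z1 < 0" using zeta_neg_far[of \<theta>] th by (auto simp: order_less_le)
  obtain \<delta> where \<delta>: "\<delta> > 0" "\<And>z. 2 < z \<Longrightarrow> z \<le> 2 + \<delta> \<Longrightarrow> zeta \<theta> z > 0"
    using zeta_pos_near_2 th by metis
  obtain z0 where z0: "min z1 (2 + \<delta>) \<le> z0" "zeta \<theta> z0 = 0"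
  proof -
    have "zeta \<theta> (2 + \<delta>) \<ge> 0" using \<delta>(2)[of "2 + \<delta>"] \<delta>(1) by simp
    then show thesis using ivt_zeta[OF th z1(1), of "2 + \<delta>"] z1 \<delta> that by (metis less_add_same_cancel1 less_imp_le)
  qed
  then have z02: "z0 > 2" using z1 \<delta> by auto
  have below: "zeta \<theta> z > 0" if zz: "2 < z" "z < z0" for z
  proof (rule ccontr)
    assume "\<not> zeta \<theta> z > 0"
    then have "zeta \<theta> z \<le> 0" by simp
    moreover define z2 where "z2 = min z (2 + \<delta>)"
    then have "2 < z2" "zeta \<theta> z2 \<ge> 0" "z2 \<le> z" using that \<delta> by (auto simp: min_def less_imp_le)
    ultimately obtain w where "min z z2 \<le> w" "w \<le> max z z2" "zeta \<theta> w = 0"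
      using ivt_zeta[OF th zz(1)] by metis
    then show False using zeta_zero_unique[OF th, of w z0] \<open>2 < z2\<close> \<open>z2 \<le> z\<close> z0 z02 zz by auto
  qed
  have z01: "z0 < z1"
  proof (rule ccontr)
    assume "\<not> z0 < z1"
    then show False using below[of z1] z1 z0 by (cases "z0 = z1") auto
  qed
  have above: "zeta \<theta> z < 0" if zz: "z0 < z" for z
  proof (rule ccontr)
    assume "\<not> zeta \<theta> z < 0"
    then have "zeta \<theta> z \<ge> 0" by simp
    then obtain w where "min z1 z \<le> w" "zeta \<theta> w = 0"
      using ivt_zeta[OF th z1(1), of z] zz z1 z02 by force
    then show False using zeta_zero_unique[OF th, of w z0] zz z01 z0 z02 by (auto simp: min_def split: if_splits)
  qed
  define w where "w = 1 / (z0 - 2)"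
  have w: "w > 0" using z02 by (simp add: w_def)
  have cmp: "s > w \<longleftrightarrow> 2 + 1 / s < z0" "s < w \<longleftrightarrow> z0 < 2 + 1 / s" if "s > 0" for s
    using that z02 by (auto simp: w_def field_simps)
  have "(zeta \<theta> (2 + 1 / s) > 0 \<longleftrightarrow> s > w) \<and> (zeta \<theta> (2 + 1 / s) < 0 \<longleftrightarrow> s < w)" if s: "s > 0" for s
  proof -
    have "2 < 2 + 1 / s" using s by simp
    then consider "2 + 1 / s < z0" | "2 + 1 / s = z0" | "z0 < 2 + 1 / s" by linarith
    then show ?thesis
      by cases (use below[OF \<open>2 < 2 + 1 / s\<close>] above[of "2 + 1 / s"] z0 in \<open>auto simp: cmp[OF s]\<close>)
  qed
  then show ?thesis using w False by (intro exI[of _ w]) auto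
qed

definition omega :: "real \<Rightarrow> real" where
  "omega \<theta> = (SOME w. 0 \<le> w \<and> (w = 0 \<longleftrightarrow> \<theta> = 0 \<or> \<theta> = 1) \<and>
    (\<forall>s>0. (zeta \<theta> (2 + 1 / s) > 0 \<longleftrightarrow> s > w) \<and> (zeta \<theta> (2 + 1 / s) < 0 \<longleftrightarrow> s < w)))"

lemma omega:
  assumes "0 \<le> \<theta>" "\<theta> \<le> 1"
  shows "0 \<le> omega \<theta>" "omega \<theta> = 0 \<longleftrightarrow> \<theta> = 0 \<or> \<theta> = 1"
    "s > 0 \<Longrightarrow> zeta \<theta> (2 + 1 / s) > 0 \<longleftrightarrow> s > omega \<theta>" "s > 0 \<Longrightarrow> zeta \<theta> (2 + 1 / s) < 0 \<longleftrightarrow> s < omega \<theta>"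
  using someI_ex[OF zeta_sign[OF assms]] unfolding omega_def[symmetric] by blast+

text \<open>For fixed s > 0 the sign of \<open>zeta\<close> at 2 + 1/s decides whether s is above or
  below \<open>omega\<close>, and either sign is an open condition on \<theta>.\<close>

lemma continuous_on_omega: "continuous_on {0..1} omega"
proof -
  have cz: "continuous_on {0..1} (\<lambda>\<theta>. zeta \<theta> (2 + 1 / s))" if "s > 0" for s
    using continuous_on_zeta[of "{0..1}" "\<lambda>\<theta>. \<theta>" "\<lambda>_. 2 + 1 / s"] that by auto
  have "(omega \<longlongrightarrow> omega \<theta>) (at \<theta> within {0..1})" if th: "\<theta> \<in> {0..1}" for \<theta>
  proof (rule order_tendstoI)
    fix s assume s: "s < omega \<theta>"
    have w: "eventually (\<lambda>x. x \<in> {0..1}) (at \<theta> within {0..1})" by (simp add: eventually_at_filter)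
    show "eventually (\<lambda>x. s < omega x) (at \<theta> within {0..1})"
    proof (cases "s > 0")
      case True
      have "((\<lambda>x. zeta x (2 + 1 / s)) \<longlongrightarrow> zeta \<theta> (2 + 1 / s)) (at \<theta> within {0..1})"
        using cz[OF True] th by (auto simp: continuous_on_def)
      then have "eventually (\<lambda>x. zeta x (2 + 1 / s) < 0) (at \<theta> within {0..1})"
        using omega(4)[of \<theta> s] True s th by (intro order_tendstoD(2)) auto
      with w show ?thesis by eventually_elim (use omega(4)[OF _ _ True] in auto)
    next
      case False
      show ?thesis
      proof (cases "s < 0")
        case True
        from w show ?thesis by eventually_elim (use True omega(1) in force)
      next
        case False
        with \<open>\<not> s > 0\<close> have "s = 0" by simp
        \<comment> \<open>For s = 0 there is no level 2 + 1/s to test; a positive value below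
          \<open>omega \<theta>\<close> serves instead.\<close>
        define s' where "s' = omega \<theta> / 2"
        have s': "s' > 0" "s' < omega \<theta>" using s \<open>s = 0\<close> by (simp_all add: s'_def)
        have "((\<lambda>x. zeta x (2 + 1 / s')) \<longlongrightarrow> zeta \<theta> (2 + 1 / s')) (at \<theta> within {0..1})"
          using cz[OF s'(1)] th by (auto simp: continuous_on_def)
        then have "eventually (\<lambda>x. zeta x (2 + 1 / s') < 0) (at \<theta> within {0..1})"
          using omega(4)[of \<theta> s'] s' th by (intro order_tendstoD(2)) auto
        with w show ?thesis
        proof eventually_elim
          case (elim x)
          then have "s' < omega x" using omega(4)[of x s'] s' by auto
          then show ?case using s' \<open>s = 0\<close> by simp
        qed
      qed
    qed
  next
    fix s assume s: "s > omega \<theta>"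
    then have s0: "s > 0" using omega(1)[of \<theta>] th by auto
    have w: "eventually (\<lambda>x. x \<in> {0..1}) (at \<theta> within {0..1})" by (simp add: eventually_at_filter)
    have "((\<lambda>x. zeta x (2 + 1 / s)) \<longlongrightarrow> zeta \<theta> (2 + 1 / s)) (at \<theta> within {0..1})"
      using cz[OF s0] th by (auto simp: continuous_on_def)
    then have "eventually (\<lambda>x. zeta x (2 + 1 / s) > 0) (at \<theta> within {0..1})"
      using omega(3)[of \<theta> s] s0 s th by (intro order_tendstoD(1)) auto
    with w show "eventually (\<lambda>x. s > omega x) (at \<theta> within {0..1})"
      by eventually_elim (use omega(3)[OF _ _ s0] in auto)
  qed
  then show ?thesis by (simp add: continuous_on_def)
qed

end

text \<open>Confocal elliptic coordinates with foci \<open>1\<close> and \<open>-1\<close> on the closed upper half-plane.\<close>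

definition ell :: "real \<Rightarrow> real \<Rightarrow> complex" where
  "ell u y = Complex (u * sqrt (1 + y\<^sup>2)) (y * sqrt (1 - u\<^sup>2))"

definition ell_fst :: "complex \<Rightarrow> real" where
  "ell_fst w = (cmod (w + 1) - cmod (w - 1)) / 2"

definition ell_snd :: "complex \<Rightarrow> real" where
  "ell_snd w = sqrt (((cmod (w + 1) + cmod (w - 1)) / 2)\<^sup>2 - 1)"

text \<open>With r = sqrt (1 + y^2), the distances from \<open>ell u y\<close> to the foci -1 and 1
  are r + u and r - u.\<close>

lemma ell_coords:
  assumes "\<bar>u\<bar> \<le> 1" "0 \<le> y"
  shows "ell_fst (ell u y) = u" "ell_snd (ell u y) = y"
proof -
  define r where "r = sqrt (1 + y\<^sup>2)"
  have r: "r\<^sup>2 = 1 + y\<^sup>2" "r \<ge> 1" by (simp_all add: r_def)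
  have u2: "u\<^sup>2 \<le> 1" using assms(1) by (simp add: abs_square_le_1)
  have e: "(u * r + e)\<^sup>2 + (y * sqrt (1 - u\<^sup>2))\<^sup>2 = (r + e * u)\<^sup>2" if "e = 1 \<or> e = -1" for e
  proof -
    have "(y * sqrt (1 - u\<^sup>2))\<^sup>2 = (r\<^sup>2 - 1) * (1 - u\<^sup>2)" using u2 r by (simp add: power_mult_distrib)
    then show ?thesis using that by (auto simp: power2_eq_square algebra_simps)
  qed
  have 1: "cmod (ell u y + 1) = r + u" "cmod (ell u y - 1) = r - u"
    using e[of 1] e[of "-1"] r assms(1) by (auto simp: cmod_def ell_def r_def[symmetric])
  show "ell_fst (ell u y) = u" by (simp add: ell_fst_def 1)
  show "ell_snd (ell u y) = y" using assms(2) by (simp add: ell_snd_def 1 r)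
qed

lemma ell_of_coords:
  shows "\<bar>ell_fst w\<bar> \<le> 1" "0 \<le> ell_snd w" "Im w \<ge> 0 \<Longrightarrow> ell (ell_fst w) (ell_snd w) = w"
proof -
  define p q where "p = cmod (w + 1)" and "q = cmod (w - 1)"
  have "\<bar>p - q\<bar> \<le> cmod ((w + 1) - (w - 1))" unfolding p_def q_def by (rule norm_triangle_ineq3)
  then show 1: "\<bar>ell_fst w\<bar> \<le> 1" by (simp add: ell_fst_def p_def q_def)
  have "cmod ((w + 1) - (w - 1)) \<le> p + q" unfolding p_def q_def by (rule norm_triangle_ineq4)
  then have "(p + q) / 2 \<ge> 1" by simp
  then have A: "((p + q) / 2)\<^sup>2 \<ge> 1" by simp
  then show "0 \<le> ell_snd w" by (simp add: ell_snd_def p_def q_def)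
  assume Im: "Im w \<ge> 0"
  have y2: "(ell_snd w)\<^sup>2 = ((p + q) / 2)\<^sup>2 - 1" using A by (simp add: ell_snd_def p_def q_def)
  have "p\<^sup>2 = (Re w + 1)\<^sup>2 + (Im w)\<^sup>2" "q\<^sup>2 = (Re w - 1)\<^sup>2 + (Im w)\<^sup>2"
    by (simp_all add: p_def q_def cmod_power2)
  then have pq: "p\<^sup>2 - q\<^sup>2 = 4 * Re w" "p\<^sup>2 + q\<^sup>2 = 2 * ((Re w)\<^sup>2 + (Im w)\<^sup>2) + 2"
    by (simp_all add: power2_eq_square algebra_simps)
  have ef: "ell_fst w = (p - q) / 2" by (simp add: ell_fst_def p_def q_def)
  have r: "sqrt (1 + (ell_snd w)\<^sup>2) = (p + q) / 2" unfolding y2 using \<open>(p + q) / 2 \<ge> 1\<close> by simp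
  have "(p - q) / 2 * ((p + q) / 2) = (p\<^sup>2 - q\<^sup>2) / 4" by (simp add: power2_eq_square algebra_simps)
  then have re: "ell_fst w * sqrt (1 + (ell_snd w)\<^sup>2) = Re w"
    unfolding r pq(1) ef by simp
  have "(ell_snd w * sqrt (1 - (ell_fst w)\<^sup>2))\<^sup>2 = (((p + q) / 2)\<^sup>2 - 1) * (1 - (ell_fst w)\<^sup>2)"
    using 1 by (simp add: power_mult_distrib y2 abs_square_le_1)
  also have "\<dots> = (p\<^sup>2 + q\<^sup>2) / 2 - ((p\<^sup>2 - q\<^sup>2) / 4)\<^sup>2 - 1"
    unfolding ef by (simp add: power2_eq_square field_simps)
  also have "\<dots> = (Im w)\<^sup>2" unfolding pq by (simp add: field_simps)
  finally have sq: "(ell_snd w * sqrt (1 - (ell_fst w)\<^sup>2))\<^sup>2 = (Im w)\<^sup>2" .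
  have "(ell_fst w)\<^sup>2 \<le> 1" using 1 by (simp add: abs_square_le_1)
  then have "0 \<le> ell_snd w * sqrt (1 - (ell_fst w)\<^sup>2)" using \<open>0 \<le> ell_snd w\<close> by simp
  then have "ell_snd w * sqrt (1 - (ell_fst w)\<^sup>2) = Im w" using power2_eq_imp_eq[OF sq] Im by blast
  then show "ell (ell_fst w) (ell_snd w) = w" using re by (simp add: ell_def complex_eq_iff)
qed

lemma continuous_on_ell_coords [continuous_intros]: "continuous_on S ell_fst" "continuous_on S ell_snd"
  unfolding ell_fst_def ell_snd_def by (intro continuous_intros; simp)+

lemma ell_coords_focus: "ell_fst 1 = 1" "ell_fst (-1) = -1" "ell_snd 1 = 0" "ell_snd (-1) = 0"
  by (simp_all add: ell_fst_def ell_snd_def)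

definition half_plane :: "complex set" where
  "half_plane = {w. Im w \<ge> 0} - {1, -1}"

context small_angles
begin

definition theta :: "triple \<Rightarrow> real" where
  "theta P = v L1 P / (v L1 P + v L2 P)"

text \<open>In the coordinates \<theta> and s = 1/(z - 2), \<open>dom\<close> is the region s >=
  \<open>omega \<theta>\<close>, s > 0. Subtracting \<open>omega\<close> makes it a half-strip
  without its two corners, and elliptic coordinates open the half-strip to a half-plane, with the
  corners at 1 and -1.\<close>

definition lam :: "triple \<Rightarrow> complex" where
  "lam P = ell (2 * theta P - 1) (1 / (crd L3 P - 2) - omega (theta P))"

definition mu :: "complex \<Rightarrow> triple" where
  "mu w = (let \<theta> = (1 + ell_fst w) / 2 in par \<theta> (2 + 1 / (ell_snd w + omega \<theta>)))"

lemma theta_bounds: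
  assumes "P \<in> dom"
  shows "0 \<le> theta P" "theta P \<le> 1" "par (theta P) (crd L3 P) = P"
  using par_inverse[of P] assms by (auto simp: dom_def theta_def)

lemma lam_snd_nonneg:
  assumes "P \<in> dom"
  shows "0 \<le> 1 / (crd L3 P - 2) - omega (theta P)"
    and "1 / (crd L3 P - 2) = omega (theta P) \<longleftrightarrow> v L3 P = 0"
proof -
  define s where "s = 1 / (crd L3 P - 2)"
  have z: "crd L3 P > 2" using assms gt_2 by (simp add: dom_def)
  then have s: "s > 0" "2 + 1 / s = crd L3 P" by (simp_all add: s_def)
  have "zeta (theta P) (2 + 1 / s) = v L3 P" unfolding zeta_def s theta_bounds(3)[OF assms] ..
  moreover have "v L3 P \<ge> 0" using assms by (simp add: dom_def)
  ultimately have "\<not> s < omega (theta P)" "s = omega (theta P) \<longleftrightarrow> v L3 P = 0"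
    using omega(3,4)[OF theta_bounds(1,2)[OF assms] s(1)] by (auto simp: not_less order_less_le)
  then show "0 \<le> 1 / (crd L3 P - 2) - omega (theta P)" "1 / (crd L3 P - 2) = omega (theta P) \<longleftrightarrow> v L3 P = 0"
    by (auto simp: s_def)
qed

lemma lam_coords:
  assumes "P \<in> dom"
  shows "ell_fst (lam P) = 2 * theta P - 1" "ell_snd (lam P) = 1 / (crd L3 P - 2) - omega (theta P)"
  unfolding lam_def by (rule ell_coords; use theta_bounds[OF assms] lam_snd_nonneg[OF assms] in simp)+

lemma lam_half_plane:
  assumes "P \<in> dom"
  shows "lam P \<in> half_plane"
proof -
  note th = theta_bounds[OF assms] and y = lam_snd_nonneg[OF assms]
  have "\<bar>2 * theta P - 1\<bar> \<le> 1" using th by simp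
  then have "(2 * theta P - 1)\<^sup>2 \<le> 1" by (simp add: abs_square_le_1)
  then have "Im (lam P) \<ge> 0" using y by (simp add: lam_def ell_def)
  moreover have "lam P \<noteq> w" if "w = 1 \<or> w = -1" for w
  proof
    assume "lam P = w"
    then have "\<bar>2 * theta P - 1\<bar> = 1" "1 / (crd L3 P - 2) = omega (theta P)"
      using lam_coords[OF assms] that by (auto simp: ell_coords_focus)
    then have "theta P = 0 \<or> theta P = 1" by auto
    then have "omega (theta P) = 0" using omega(2)[OF th(1,2)] by simp
    moreover have "1 / (crd L3 P - 2) > 0" using assms gt_2[of P L3] by (simp add: dom_def)
    ultimately show False using \<open>1 / (crd L3 P - 2) = omega (theta P)\<close> by simp
  qed
  ultimately show ?thesis by (auto simp: half_plane_def)
qed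

lemma mu_lam:
  assumes "P \<in> dom"
  shows "mu (lam P) = P"
proof -
  have "(1 + ell_fst (lam P)) / 2 = theta P" by (simp add: lam_coords[OF assms])
  moreover have "ell_snd (lam P) + omega (theta P) = 1 / (crd L3 P - 2)" by (simp add: lam_coords[OF assms])
  ultimately show ?thesis using theta_bounds(3)[OF assms] by (simp add: mu_def Let_def)
qed

lemma half_plane_coords:
  assumes "w \<in> half_plane"
  defines "\<theta> \<equiv> (1 + ell_fst w) / 2"
  shows "0 \<le> \<theta>" "\<theta> \<le> 1" "ell_snd w + omega \<theta> > 0"
proof -
  show th: "0 \<le> \<theta>" "\<theta> \<le> 1" using ell_of_coords(1)[of w] by (auto simp: \<theta>_def)
  show "ell_snd w + omega \<theta> > 0"
  proof (rule ccontr)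
    assume "\<not> ?thesis"
    then have 0: "ell_snd w = 0" "omega \<theta> = 0" using ell_of_coords(2)[of w] omega(1)[OF th] by linarith+
    then have "\<theta> = 0 \<or> \<theta> = 1" using omega(2)[OF th] by simp
    then have "ell_fst w = 1 \<or> ell_fst w = -1" by (auto simp: \<theta>_def)
    moreover have "ell (ell_fst w) (ell_snd w) = w" using assms ell_of_coords(3) by (simp add: half_plane_def)
    ultimately have "w = 1 \<or> w = -1" using 0 by (auto simp: ell_def complex_eq_iff)
    then show False using assms by (auto simp: half_plane_def)
  qed
qed

lemma mu_dom:
  assumes "w \<in> half_plane"
  shows "mu w \<in> dom"
proof -
  define \<theta> s where "\<theta> = (1 + ell_fst w) / 2" and "s = ell_snd w + omega \<theta>"
  have th: "0 \<le> \<theta>" "\<theta> \<le> 1" and s: "s > 0" using half_plane_coords[OF assms] by (simp_all add: \<theta>_def s_def)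
  have m: "mu w = par \<theta> (2 + 1 / s)" by (simp add: mu_def Let_def \<theta>_def s_def)
  have z: "2 + 1 / s > 2" using s by simp
  have "s \<ge> omega \<theta>" using ell_of_coords(2)[of w] by (simp add: s_def)
  then have "zeta \<theta> (2 + 1 / s) \<ge> 0" using omega(4)[OF th s] by (simp add: not_less[symmetric])
  then have "v i (mu w) \<ge> 0" for i
    using v_par[OF z, of \<theta>] th radius_pos[OF th z] by (cases i) (simp_all add: m zeta_def)
  moreover have "mu w \<in> Tp" unfolding m by (rule par_Tp[OF th z])
  ultimately show ?thesis by (simp add: dom_def)
qed

lemma lam_mu:
  assumes "w \<in> half_plane"
  shows "lam (mu w) = w"
proof -
  define \<theta> s where "\<theta> = (1 + ell_fst w) / 2" and "s = ell_snd w + omega \<theta>"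
  have th: "0 \<le> \<theta>" "\<theta> \<le> 1" and s: "s > 0" using half_plane_coords[OF assms] by (simp_all add: \<theta>_def s_def)
  have m: "mu w = par \<theta> (2 + 1 / s)" by (simp add: mu_def Let_def \<theta>_def s_def)
  have z: "2 + 1 / s > 2" using s by simp
  have "theta (mu w) = \<theta>" using radius_pos[OF th z] unfolding m theta_def v_par[OF z]
    by (simp add: algebra_simps)
  moreover have "crd L3 (mu w) = 2 + 1 / s" by (simp add: m)
  ultimately have "lam (mu w) = ell (2 * \<theta> - 1) (s - omega \<theta>)" by (simp add: lam_def)
  also have "\<dots> = ell (ell_fst w) (ell_snd w)" by (simp add: \<theta>_def s_def field_simps)
  also have "\<dots> = w" using assms ell_of_coords(3) by (simp add: half_plane_def)
  finally show ?thesis .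
qed

lemma continuous_on_lam: "continuous_on dom lam"
proof -
  have nz: "v L1 P + v L2 P \<noteq> 0" "crd L3 P - 2 \<noteq> 0" if "P \<in> dom" for P
    using v_sum_pos[of P L1 L2] gt_2[of P L3] that by (auto simp: dom_def)
  have th: "continuous_on dom theta"
    unfolding theta_def by (intro continuous_intros) (use nz in auto)
  have "continuous_on dom (\<lambda>P. omega (theta P))"
    by (rule continuous_on_compose2[OF continuous_on_omega th]) (use theta_bounds in auto)
  moreover have "continuous_on dom (\<lambda>P. 1 / (crd L3 P - 2))"
    by (intro continuous_intros) (use nz in auto)
  moreover define y where "y = (\<lambda>P. 1 / (crd L3 P - 2) - omega (theta P))"
  ultimately have y: "continuous_on dom y" by (simp add: continuous_on_diff)
  have "continuous_on dom (\<lambda>P. Complex ((2 * theta P - 1) * sqrt (1 + (y P)\<^sup>2)) (y P * sqrt (1 - (2 * theta P - 1)\<^sup>2)))"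
    by (intro continuous_intros th y)
  then show ?thesis unfolding lam_def ell_def y_def .
qed

lemma continuous_on_mu: "continuous_on half_plane mu"
  unfolding mu_def Let_def
proof (rule continuous_on_par)
  show th: "continuous_on half_plane (\<lambda>w. (1 + ell_fst w) / 2)" by (intro continuous_intros) auto
  have "continuous_on half_plane (\<lambda>w. omega ((1 + ell_fst w) / 2))"
    by (rule continuous_on_compose2[OF continuous_on_omega th]) (use half_plane_coords in auto)
  then show "continuous_on half_plane (\<lambda>w. 2 + 1 / (ell_snd w + omega ((1 + ell_fst w) / 2)))"
    by (intro continuous_intros) (use half_plane_coords in force)+
qed (use half_plane_coords in auto)

text \<open>The walls of L1, L2 and L3 become the intervals ]-oo, -1[, ]1, oo[ and ]-1, 1[ of the
  real axis.\<close>

lemma Im_lam_zero: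
  assumes "P \<in> dom"
  shows "Im (lam P) = 0 \<longleftrightarrow> (\<exists>i. v i P = 0)"
proof -
  have s: "v L1 P + v L2 P > 0" using v_sum_pos[of P L1 L2] assms by (auto simp: dom_def)
  have "Im (lam P) = 0 \<longleftrightarrow> 1 / (crd L3 P - 2) = omega (theta P) \<or> (2 * theta P - 1)\<^sup>2 = 1"
    by (simp add: lam_def ell_def)
  also have "(2 * theta P - 1)\<^sup>2 = 1 \<longleftrightarrow> theta P = 0 \<or> theta P = 1"
    by (auto simp: power2_eq_1_iff)
  also have "theta P = 0 \<or> theta P = 1 \<longleftrightarrow> v L1 P = 0 \<or> v L2 P = 0"
    using s by (auto simp: theta_def divide_eq_1_iff)
  finally show ?thesis unfolding lam_snd_nonneg(2)[OF assms]
    by (metis letter.exhaust)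
qed

section \<open>The quotient by the even words as a doubled half-plane\<close>

definition Lam :: "triple \<Rightarrow> complex" where
  "Lam P = (let w = SOME w. act w P \<in> dom in if even (length w) then lam (act w P) else cnj (lam (act w P)))"

text \<open>Two words that lead from P into \<open>dom\<close> end at the same point. If their
  parities differ, this point is on a wall, where \<open>lam\<close> is real and conjugation has no
  effect.\<close>

lemma Lam_eq:
  assumes "act w P \<in> dom"
  shows "Lam P = (if even (length w) then lam (act w P) else cnj (lam (act w P)))"
proof -
  define u where "u = (SOME w. act w P \<in> dom)"
  have u: "act u P \<in> dom" unfolding u_def using assms by (rule someI)
  have e: "act (w @ rev u) (act u P) = act w P" by simp
  have *: "act w P = act u P" "odd (length (w @ rev u)) \<longrightarrow> (\<exists>i. v i (act u P) = 0)"
    using dom_unique'[OF u, of "w @ rev u"] assms unfolding e by auto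
  have "cnj (lam (act u P)) = lam (act u P)" if "odd (length (w @ rev u))"
    using * that Im_lam_zero[OF u] by (simp add: complex_eq_iff)
  then show ?thesis using * by (auto simp: Lam_def Let_def u_def[symmetric])
qed

lemma Lam_fibres:
  assumes "P \<in> Tp" "Q \<in> Tp"
  shows "Lam P = Lam Q \<longleftrightarrow> (\<exists>w. even (length w) \<and> act w P = Q)"
proof
  obtain u where u: "act u P \<in> dom" using reach_dom' assms by blast
  {
    assume "\<exists>w. even (length w) \<and> act w P = Q"
    then obtain w where w: "even (length w)" "act w P = Q" by blast
    have "act (u @ rev w) Q = act u P" by (simp flip: w(2))
    then show "Lam P = Lam Q" using Lam_eq[of u P] Lam_eq[of "u @ rev w" Q] u w by simp
  }
  obtain u' where u': "act u' Q \<in> dom" using reach_dom' assms by blast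
  assume "Lam P = Lam Q"
  then have L: "(if even (length u) then lam (act u P) else cnj (lam (act u P)))
    = (if even (length u') then lam (act u' Q) else cnj (lam (act u' Q)))"
    using Lam_eq[OF u] Lam_eq[OF u'] by simp
  have Im: "Im (lam (act u P)) \<ge> 0" "Im (lam (act u' Q)) \<ge> 0"
    using lam_half_plane u u' by (auto simp: half_plane_def)
  have lam: "lam (act u P) = lam (act u' Q)"
    using L Im by (auto simp: complex_eq_iff split: if_splits)
  then have eq: "act u P = act u' Q" using mu_lam u u' by metis
  show "\<exists>w. even (length w) \<and> act w P = Q"
  proof (cases "even (length u) = even (length u')")
    case True
    then show ?thesis using eq by (intro exI[of _ "rev u' @ u"]) auto
  next
    case False
    \<comment> \<open>With different parities the common point is on a wall, and inserting the
      involution that fixes it corrects the parity of the word.\<close>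
    then have "Im (lam (act u P)) = 0" using L lam by (auto simp: complex_eq_iff split: if_splits)
    then obtain i where "v i (act u P) = 0" using Im_lam_zero[OF u] by blast
    then have "act (rev u' @ [i] @ u) P = Q" using modif_fixed eq by simp
    then show ?thesis using False by (intro exI[of _ "rev u' @ [i] @ u"]) auto
  qed
qed

lemma Lam_dom: "P \<in> dom \<Longrightarrow> Lam P = lam P"
  using Lam_eq[of "[]" P] by simp

lemma Lam_modif_dom: "P \<in> dom \<Longrightarrow> Lam (modif i P) = cnj (lam P)"
  using Lam_eq[of "[i]" "modif i P"] by simp

text \<open>Up to a given height, finitely many closed pieces cover \<open>Tp\<close>, one for each
  short word into \<open>dom\<close>, and \<open>Lam\<close> is continuous on each of them. Every
  point has a neighbourhood of bounded height.\<close>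

lemma continuous_on_Lam: "continuous_on Tp Lam"
proof -
  have 1: "continuous_on {P \<in> Tp. height P \<le> M} Lam" for M
  proof -
    obtain N where N: "\<And>P. P \<in> Tp \<Longrightarrow> height P \<le> M \<Longrightarrow> \<exists>w. length w \<le> N \<and> act w P \<in> dom"
      by (rule reach_dom[where M = M]) blast
    define W where "W = {w :: letter list. length w \<le> N}"
    have "finite W" using finite_lists_length_le[of "UNIV :: letter set" N] by (simp add: W_def)
    define T where "T = (\<lambda>w. {P \<in> Tp. height P \<le> M} \<inter> (act w -` dom))"
    have "closed {P \<in> Tp. height P \<le> M}" by (rule compact_imp_closed[OF compact_Tp_height])
    moreover have "closed (act w -` dom)" for w
      by (rule closed_vimage[OF closed_dom continuous_on_act])
    ultimately have "closed (T w)" for w unfolding T_def by (rule closed_Int)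
    moreover have "continuous_on (T w) Lam" for w
    proof -
      have c: "continuous_on (T w) (\<lambda>P. lam (act w P))"
        by (rule continuous_on_compose2[OF continuous_on_lam continuous_on_act]) (auto simp: T_def)
      have "continuous_on (T w) (\<lambda>P. if even (length w) then lam (act w P) else cnj (lam (act w P)))"
        using c by (cases "even (length w)") (simp_all add: continuous_on_cnj)
      then show ?thesis
        by (rule continuous_on_eq) (use Lam_eq in \<open>auto simp: T_def\<close>)
    qed
    ultimately have "continuous_on (\<Union>w\<in>W. T w) Lam"
      using \<open>finite W\<close> by (intro continuous_on_closed_Union) auto
    moreover have "(\<Union>w\<in>W. T w) = {P \<in> Tp. height P \<le> M}" using N by (fastforce simp: T_def W_def)
    ultimately show ?thesis by simp
  qed
  show ?thesis
    unfolding continuous_on_eq_continuous_within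
  proof
    fix P assume P: "P \<in> Tp"
    define U where "U = {Q. height Q < height P + 1}"
    have "open U" unfolding U_def by (intro open_Collect_less continuous_intros)
    have "continuous_on (Tp \<inter> U) Lam"
      by (rule continuous_on_subset[OF 1[of "height P + 1"]]) (auto simp: U_def)
    then have "continuous (at P within (Tp \<inter> U)) Lam"
      using P by (auto simp: continuous_on_eq_continuous_within U_def)
    moreover have "at P within (Tp \<inter> U) = at P within Tp"
      by (rule at_within_nhd[of _ U]) (use \<open>open U\<close> in \<open>auto simp: U_def\<close>)
    ultimately show "continuous (at P within Tp) Lam" by simp
  qed
qed

text \<open>\<open>mu\<close> and its mirror image through \<open>modif L1\<close> are continuous
  sections of \<open>Lam\<close> over the two closed half-planes, so the part of V in each
  half-plane is the preimage of T under a section.\<close>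

lemma closedin_Lam_aux:
  assumes "closedin (top_of_set Tp) T" "T = {P \<in> Tp. Lam P \<in> V}" "V \<subseteq> - {1, -1}"
  shows "closedin (top_of_set (- {1, -1})) V"
proof -
  have H: "closedin (top_of_set (- {1, -1})) half_plane" "closedin (top_of_set (- {1, -1})) (cnj ` half_plane)"
  proof -
    have "closed {w. 0 \<le> Im w}" "closed {w. Im w \<le> 0}"
      by (rule closed_halfspace_Im_ge closed_halfspace_Im_le)+
    moreover have "half_plane = - {1, -1} \<inter> {w. 0 \<le> Im w}" by (auto simp: half_plane_def)
    moreover have "cnj ` half_plane = - {1, -1} \<inter> {w. Im w \<le> 0}"
    proof
      show "cnj ` half_plane \<subseteq> - {1, -1} \<inter> {w. Im w \<le> 0}" by (auto simp: half_plane_def complex_eq_iff)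
      show "- {1, -1} \<inter> {w. Im w \<le> 0} \<subseteq> cnj ` half_plane"
      proof
        fix w assume "w \<in> - {1, -1} \<inter> {w. Im w \<le> 0}"
        then show "w \<in> cnj ` half_plane"
          by (intro image_eqI[of _ _ "cnj w"]) (auto simp: half_plane_def complex_eq_iff)
      qed
    qed
    ultimately show "closedin (top_of_set (- {1, -1})) half_plane" "closedin (top_of_set (- {1, -1})) (cnj ` half_plane)"
      by (metis closedin_closed)+
  qed
  have m: "mu w \<in> Tp" if "w \<in> half_plane" for w using mu_dom[OF that] by (simp add: dom_def)
  have 1: "closedin (top_of_set half_plane) (half_plane \<inter> mu -` T)"
    by (rule continuous_closedin_preimage_gen[OF continuous_on_mu _ assms(1)]) (use m in auto)
  have "continuous_on (cnj ` half_plane) (\<lambda>w. modif L1 (mu (cnj w)))"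
    by (rule continuous_on_compose2[OF continuous_on_modif continuous_on_compose2[OF continuous_on_mu]])
      (auto intro!: continuous_intros)
  then have 2: "closedin (top_of_set (cnj ` half_plane)) (cnj ` half_plane \<inter> (\<lambda>w. modif L1 (mu (cnj w))) -` T)"
    by (rule continuous_closedin_preimage_gen[OF _ _ assms(1)]) (auto intro!: modif_Tp m simp del: split_paired_All)
  have Lm: "Lam (mu w) = w" "Lam (modif L1 (mu w)) = cnj w" if "w \<in> half_plane" for w
    using mu_dom[OF that] by (simp_all add: Lam_dom Lam_modif_dom lam_mu that)
  have e1: "half_plane \<inter> mu -` T = half_plane \<inter> V"
    using m Lm by (auto simp: assms(2))
  have e2: "cnj ` half_plane \<inter> (\<lambda>w. modif L1 (mu (cnj w))) -` T = cnj ` half_plane \<inter> V"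
    unfolding assms(2) by (auto simp: Lm intro!: modif_Tp m)
  have "w \<in> half_plane \<or> w \<in> cnj ` half_plane" if "w \<in> V" for w
  proof (cases "Im w \<ge> 0")
    case True
    then show ?thesis using that assms(3) by (auto simp: half_plane_def)
  next
    case False
    then have "cnj w \<in> half_plane" using that assms(3) by (auto simp: half_plane_def complex_eq_iff)
    then show ?thesis by (metis complex_cnj_cnj image_eqI)
  qed
  then have "V = (half_plane \<inter> V) \<union> (cnj ` half_plane \<inter> V)" by auto
  moreover have "closedin (top_of_set (- {1, -1})) ((half_plane \<inter> V) \<union> (cnj ` half_plane \<inter> V))"
    using closedin_trans[OF 1[unfolded e1] H(1)] closedin_trans[OF 2[unfolded e2] H(2)] by (rule closedin_Un)
  ultimately show ?thesis by simp
qed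

lemma Lam_range: "Lam ` Tp = - {1, -1}"
proof
  show "Lam ` Tp \<subseteq> - {1, -1}"
  proof
    fix w assume "w \<in> Lam ` Tp"
    then obtain P u where "w = Lam P" "act u P \<in> dom" using reach_dom' by blast
    then show "w \<in> - {1, -1}" using lam_half_plane[of "act u P"] Lam_eq[of u P]
      by (auto simp: half_plane_def complex_eq_iff split: if_splits)
  qed
  show "- {1, -1} \<subseteq> Lam ` Tp"
  proof
    fix w :: complex assume w: "w \<in> - {1, -1}"
    show "w \<in> Lam ` Tp"
    proof (cases "Im w \<ge> 0")
      case True
      then have "w \<in> half_plane" using w by (auto simp: half_plane_def)
      then show ?thesis using lam_mu Lam_dom mu_dom by (intro image_eqI[of _ _ "mu w"]) (auto simp: dom_def)
    next
      case False
      then have "cnj w \<in> half_plane" using w by (auto simp: half_plane_def complex_eq_iff)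
      then show ?thesis using lam_mu Lam_modif_dom mu_dom modif_Tp
        by (intro image_eqI[of _ _ "modif L1 (mu (cnj w))"]) (auto simp: dom_def)
    qed
  qed
qed

lemma quotient_map_Lam: "quotient_map (top_of_set Tp) (top_of_set (- {1, -1})) Lam"
  unfolding quotient_map_closedin topspace_euclidean_subtopology
proof (intro conjI allI impI)
  show "Lam ` Tp = - {1, -1}" by (rule Lam_range)
  fix V assume V: "V \<subseteq> - {1, -1 :: complex}"
  show "closedin (top_of_set Tp) {x \<in> Tp. Lam x \<in> V} = closedin (top_of_set (- {1, -1})) V"
  proof
    assume "closedin (top_of_set Tp) {x \<in> Tp. Lam x \<in> V}"
    then show "closedin (top_of_set (- {1, -1})) V" using closedin_Lam_aux V by blast
  next
    assume "closedin (top_of_set (- {1, -1})) V"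
    then have "closedin (top_of_set Tp) (Tp \<inter> Lam -` V)"
      using continuous_closedin_preimage_gen[OF continuous_on_Lam] Lam_range by blast
    moreover have "Tp \<inter> Lam -` V = {x \<in> Tp. Lam x \<in> V}" by auto
    ultimately show "closedin (top_of_set Tp) {x \<in> Tp. Lam x \<in> V}" by simp
  qed
qed

section \<open>Connectedness of the fundamental domain and of \<open>Tp\<close>\<close>

lemma connected_dom: "connected dom"
proof -
  have "connected {w. Im w > 0}" by (intro convex_connected convex_halfspace_Im_gt)
  moreover have "{w. Im w > 0} \<subseteq> half_plane" by (auto simp: half_plane_def)
  moreover have "half_plane \<subseteq> closure {w. Im w > 0}"
  proof
    fix w assume w: "w \<in> half_plane"
    show "w \<in> closure {w. Im w > 0}"
      unfolding closure_approachable
    proof (intro allI impI)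
      fix e :: real assume "e > 0"
      then show "\<exists>y\<in>{w. 0 < Im w}. dist y w < e" using w
        by (intro bexI[of _ "w + Complex 0 (e / 2)"]) (auto simp: half_plane_def dist_norm cmod_def)
    qed
  qed
  ultimately have "connected half_plane" by (rule connected_intermediate_closure)
  then have "connected (mu ` half_plane)" by (intro connected_continuous_image continuous_on_mu)
  moreover have "mu ` half_plane = dom"
    using mu_dom mu_lam lam_half_plane by (metis (no_types, lifting) image_eqI subsetI subset_antisym image_subsetI)
  ultimately show ?thesis by simp
qed

lemma wall_point: "\<exists>P\<in>dom. v i P = 0"
proof -
  define s where "s = omega (1/2)"
  have s: "s > 0" using omega(1,2)[of "1/2"] by (simp add: s_def order_less_le)
  have 3: "v L3 (par (1/2) (2 + 1 / s)) = 0"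
    using omega(3,4)[of "1/2" s] s by (simp add: zeta_def s_def[symmetric])
  have "par (1/2) (2 + 1 / s) \<in> dom"
  proof -
    have "v i (par (1/2) (2 + 1 / s)) \<ge> 0" for i
      using v_par[of "2 + 1 / s" "1/2"] radius_pos[of "1/2" "2 + 1 / s"] s 3 by (cases i) auto
    then show ?thesis using par_Tp[of "1/2" "2 + 1 / s"] s by (simp add: dom_def)
  qed
  moreover have "par \<theta> 3 \<in> dom \<and> v (if \<theta> = 0 then L1 else L2) (par \<theta> 3) = 0" if "\<theta> = 0 \<or> \<theta> = 1" for \<theta>
  proof -
    have "v i (par \<theta> 3) \<ge> 0" for i
      using v_par[of 3 \<theta>] radius_pos[of \<theta> 3] zeta_pos_ends[of 3 \<theta>] that by (cases i) (auto simp: zeta_def)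
    then show ?thesis using par_Tp[of \<theta> 3] that v_par[of 3 \<theta>] by (auto simp: dom_def)
  qed
  from this[of 0] this[of 1] have "par 0 3 \<in> dom" "v L1 (par 0 3) = 0" "par 1 3 \<in> dom" "v L2 (par 1 3) = 0" by auto
  ultimately show ?thesis using 3 by (cases i) auto
qed

lemma interior_point: "\<exists>P\<in>dom. \<forall>i. v i P > 0"
proof -
  have h: "\<i> \<in> half_plane" by (auto simp: half_plane_def complex_eq_iff)
  have "\<nexists>i. v i (mu \<i>) = 0" using Im_lam_zero[OF mu_dom[OF h]] lam_mu[OF h] by simp
  then show ?thesis using mu_dom[OF h] by (intro bexI[of _ "mu \<i>"]) (auto simp: dom_def order_less_le)
qed

text \<open>The images of \<open>dom\<close> under w and under \<open>w @ [i]\<close> share the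
  image of a point on the wall of i, so by induction on words all of them lie in one
  component.\<close>

lemma connected_Tp: "connected Tp"
proof -
  obtain P0 where P0: "P0 \<in> dom" using interior_point by blast
  have 1: "connected (act w ` dom)" for w
    by (intro connected_continuous_image continuous_on_act connected_dom)
  have sub: "act w ` dom \<subseteq> Tp" for w using act_Tp by (auto simp: dom_def)
  have 2: "act w ` dom \<subseteq> connected_component_set Tp P0" for w
  proof (induction w rule: rev_induct)
    case Nil
    show ?case using connected_component_maximal[of P0 dom Tp] P0 connected_dom by (auto simp: dom_def)
  next
    case (snoc i w)
    obtain P where P: "P \<in> dom" "v i P = 0" using wall_point by blast
    have "act w P = act (w @ [i]) P" using modif_fixed[OF P(2)] by simp
    then have "act w P \<in> act (w @ [i]) ` dom" using P(1) by (rule image_eqI)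
    moreover have "act w P \<in> act w ` dom" using P(1) by (rule imageI)
    ultimately have "connected_component Tp P0 (act w P)" using snoc by auto
    then have "connected_component_set Tp (act w P) = connected_component_set Tp P0"
      by (intro connected_component_eq) simp
    moreover have "act (w @ [i]) ` dom \<subseteq> connected_component_set Tp (act w P)"
      by (rule connected_component_maximal[OF \<open>act w P \<in> act (w @ [i]) ` dom\<close> 1 sub])
    ultimately show ?case by simp
  qed
  have "Tp \<subseteq> connected_component_set Tp P0"
  proof
    fix P assume "P \<in> Tp"
    then obtain w where "act w P \<in> dom" using reach_dom' by blast
    then have "P \<in> act (rev w) ` dom" using act_rev by (metis image_eqI)
    then show "P \<in> connected_component_set Tp P0" using 2 by blast
  qed
  then show ?thesis using connected_connected_component[of Tp P0] connected_component_subset[of Tp P0]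
    by (metis subset_antisym)
qed

end

section \<open>Free products and their even subgroups\<close>

lemma quotient_maps_homeomorphic:
  assumes f: "quotient_map X Y f" and g: "quotient_map X Z g"
    and fib: "\<And>x y. x \<in> topspace X \<Longrightarrow> y \<in> topspace X \<Longrightarrow> f x = f y \<longleftrightarrow> g x = g y"
  obtains \<phi> where "homeomorphic_map Y Z \<phi>" "\<And>x. x \<in> topspace X \<Longrightarrow> \<phi> (f x) = g x"
proof -
  obtain \<phi> where \<phi>: "continuous_map Y Z \<phi>" "\<And>x. x \<in> topspace X \<Longrightarrow> \<phi> (f x) = g x"
    using quotient_map_lift_exists[OF f quotient_imp_continuous_map[OF g]] fib by metis
  obtain \<psi> where \<psi>: "continuous_map Z Y \<psi>" "\<And>x. x \<in> topspace X \<Longrightarrow> \<psi> (g x) = f x"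
    using quotient_map_lift_exists[OF g quotient_imp_continuous_map[OF f]] fib by metis
  have "\<psi> (\<phi> y) = y" if "y \<in> topspace Y" for y
    using that \<phi>(2) \<psi>(2) quotient_imp_surjective_map[OF f] by force
  moreover have "\<phi> (\<psi> z) = z" if "z \<in> topspace Z" for z
    using that \<phi>(2) \<psi>(2) quotient_imp_surjective_map[OF g] by force
  ultimately have "homeomorphic_maps Y Z \<phi> \<psi>" using \<phi>(1) \<psi>(1) by (simp add: homeomorphic_maps_def)
  then show ?thesis using that \<phi>(2) homeomorphic_maps_map by blast
qed

lemma connected_components_of_top_of_set: "connected_components_of (top_of_set S) = components S"
proof -
  have "connected_component_of_set (top_of_set S) x = connected_component_set S x" for x
    unfolding connected_component_of_def connected_component_def
    by (auto simp: connectedin_subtopology)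
  then show ?thesis by (simp add: connected_components_of_def components_def)
qed

lemma homeomorphic_map_components:
  assumes "homeomorphic_map X (top_of_set S) f" "C \<in> connected_components_of X"
  shows "f ` C \<in> components S"
proof -
  obtain x where x: "x \<in> topspace X" "C = connected_component_of_set X x"
    using assms(2) by (auto simp: connected_components_of_def)
  have "f ` C = connected_component_of_set (top_of_set S) (f x)"
    using homeomorphic_map_connected_component_of[OF assms(1) x(1)] x(2) by simp
  moreover have "f x \<in> topspace (top_of_set S)"
    using homeomorphic_imp_surjective_map[OF assms(1)] x(1) by blast
  ultimately show ?thesis
    unfolding connected_components_of_top_of_set[symmetric] connected_components_of_def by blast
qed

lemma homeomorphism_imp_homeomorphic_maps:
  "homeomorphism S T f g \<Longrightarrow> homeomorphic_maps (top_of_set S) (top_of_set T) f g"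
  by (auto simp: homeomorphism_def homeomorphic_maps_def continuous_map_in_subtopology)

text \<open>The plane is a sphere without the point b, and b becomes the third hole.\<close>

lemma three_holed_sphere_plane:
  assumes X: "X homeomorphic_space top_of_set (- {p, q :: complex})" and "p \<noteq> q"
  shows "three_holed_sphere X"
proof -
  define b :: "real^3" where "b = axis 1 1"
  have b: "b \<in> sphere 0 1" "b \<noteq> 0" by (auto simp: b_def norm_axis_1 axis_eq_0_iff)
  have "(sphere 0 1 - {b}) homeomorphic {x. b \<bullet> x = 0}"
    by (rule homeomorphic_punctured_sphere_hyperplane) (use b in auto)
  also have "{x. b \<bullet> x = 0} homeomorphic (UNIV :: complex set)"
    by (rule homeomorphic_affine_sets) (use b in \<open>auto simp: affine_hyperplane aff_dim_hyperplane\<close>)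
  finally have "(UNIV :: complex set) homeomorphic (sphere 0 1 - {b})" by (rule homeomorphic_sym[THEN iffD1])
  then obtain f g where fg: "homeomorphism (UNIV :: complex set) (sphere 0 1 - {b}) f g"
    by (auto simp: homeomorphic_def)
  have inj: "inj f" using homeomorphism_apply1[OF fg] by (metis UNIV_I injI)
  have im: "f ` UNIV = sphere 0 1 - {b}" by (rule homeomorphism_image1[OF fg])
  have imeq: "f ` (- {p, q}) = sphere 0 1 - {b, f p, f q}"
    unfolding Compl_eq_Diff_UNIV image_set_diff[OF inj] im by auto
  have hom: "homeomorphism (- {p, q}) (sphere 0 1 - {b, f p, f q}) f g"
    by (rule homeomorphism_of_subsets[OF fg subset_UNIV _ imeq]) blast
  have "homeomorphic_maps (top_of_set (- {p, q})) (top_of_set (sphere 0 1 - {b, f p, f q})) f g"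
    by (rule homeomorphism_imp_homeomorphic_maps[OF hom])
  then have "top_of_set (- {p, q}) homeomorphic_space top_of_set (sphere 0 1 - {b, f p, f q})"
    unfolding homeomorphic_space_def by blast
  then have "X homeomorphic_space top_of_set (sphere 0 1 - {b, f p, f q})"
    using X homeomorphic_space_trans by blast
  moreover have "f p \<in> sphere 0 1 - {b}" "f q \<in> sphere 0 1 - {b}" using im by blast+
  moreover have "f p \<noteq> f q" using inj \<open>p \<noteq> q\<close> by (auto dest: injD)
  ultimately show ?thesis unfolding three_holed_sphere_def
    by (intro exI[of _ b] exI[of _ "f p"] exI[of _ "f q"]) (use b in auto)
qed

context small_angles
begin

text \<open>The outermost letter of a nonempty reduced word can be read off from the image of p: it
  is the only letter with a negative increment there.\<close>

lemma act_inj: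
  assumes p: "p \<in> dom" "\<And>i. v i p > 0" and "distinct_adj u" "distinct_adj w" "act u p = act w p"
  shows "u = w"
  using assms(3-5)
proof (induction u arbitrary: w)
  case Nil
  show ?case
  proof (cases w)
    case (Cons j w')
    then have "v j (act w p) < 0" using ping_pong[OF p(1), of j w'] p(2)[of j] Nil by blast
    then show ?thesis using p(2)[of j] Nil by simp
  qed simp
next
  case (Cons i u)
  have i: "v i (act (i # u) p) < 0" using ping_pong[OF p(1), of i u] p(2)[of i] Cons.prems by blast
  show ?case
  proof (cases w)
    case Nil
    then show ?thesis using i p(2)[of i] Cons.prems by simp
  next
    case (Cons j w')
    have j: "v j (act w p) < 0" using ping_pong[OF p(1), of j w'] p(2)[of j] Cons.prems(2) Cons by blast
    have "act w p \<in> Tp" using act_Tp p(1) by (simp add: dom_def)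
    then have "i = j" using v_sum_pos[of "act w p" i j] i j Cons.prems(3) by force
    then have "modif i (modif i (act u p)) = modif i (modif i (act w' p))" using Cons.prems(3) Cons by simp
    then have "act u p = act w' p" by simp
    moreover have "distinct_adj u" "distinct_adj w'"
      using Cons.prems(1,2) Cons by (auto simp: distinct_adj_Cons)
    ultimately show ?thesis using Cons.IH Cons \<open>i = j\<close> by blast
  qed
qed

end

section \<open>Groups generated by three involutions\<close>

locale involutions = group G for G (structure) +
  fixes md :: "letter \<Rightarrow> 'a"
  assumes md_closed [simp]: "md i \<in> carrier G" and md_md: "md i \<otimes> md i = \<one>"
begin

definition wv :: "letter list \<Rightarrow> 'a" where "wv w = foldr (\<lambda>i g. md i \<otimes> g) w \<one>"

lemma wv_Nil [simp]: "wv [] = \<one>" and wv_Cons: "wv (i # w) = md i \<otimes> wv w"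
  by (simp_all add: wv_def)

lemma wv_closed [simp]: "wv w \<in> carrier G"
  by (induction w) (simp_all add: wv_Cons)

lemma wv_append: "wv (u @ w) = wv u \<otimes> wv w"
  by (induction u) (simp_all add: wv_Cons m_assoc)

lemma md_md': "x \<in> carrier G \<Longrightarrow> md i \<otimes> (md i \<otimes> x) = x"
  using m_assoc[of "md i" "md i" x] md_md[of i] by simp

lemma wv_rev: "wv (rev w) \<otimes> wv w = \<one>"
  by (induction w) (simp_all add: wv_Cons wv_append m_assoc md_md')

lemma inv_wv: "inv (wv w) = wv (rev w)"
  by (rule inv_equality) (simp_all add: wv_rev)

lemma wv_reduce: "wv (reduce w) = wv w"
  unfolding wv_def by (rule foldr_reduce[where S = "carrier G"]) (simp_all add: md_md')

lemma generate_md: "generate G (range md) = range wv"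
proof
  show "generate G (range md) \<subseteq> range wv"
  proof
    fix g assume "g \<in> generate G (range md)"
    then show "g \<in> range wv"
    proof induction
      case one show ?case by (rule range_eqI[of _ _ "[]"]) simp
    next
      case (incl x)
      then obtain i where "x = wv [i]" by (auto simp: wv_Cons)
      then show ?case by blast
    next
      case (inv x)
      then obtain i where "x = wv [i]" by (auto simp: wv_Cons)
      then show ?case by (metis inv_wv rangeI)
    next
      case (eng x y)
      then obtain u w where "x = wv u" "y = wv w" by blast
      then show ?case by (metis wv_append rangeI)
    qed
  qed
  have "wv w \<in> generate G (range md)" for w
    by (induction w) (auto simp: wv_Cons generate.one intro: generate.eng generate.incl)
  then show "range wv \<subseteq> generate G (range md)" by blast
qed

definition even_words :: "'a set" where "even_words = wv ` {w. even (length w)}"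

lemma subgroup_even: "subgroup even_words G"
proof (rule subgroupI)
  show "even_words \<subseteq> carrier G" by (auto simp: even_words_def)
  show "even_words \<noteq> {}" by (auto simp: even_words_def intro: exI[of _ "[]"])
  show "inv x \<in> even_words" if "x \<in> even_words" for x
    using that by (auto simp: even_words_def inv_wv)
  show "x \<otimes> y \<in> even_words" if xy: "x \<in> even_words" "y \<in> even_words" for x y
  proof -
    obtain u w where "x = wv u" "y = wv w" "even (length u)" "even (length w)"
      using xy by (auto simp: even_words_def)
    then show ?thesis unfolding even_words_def by (intro image_eqI[of _ _ "u @ w"]) (simp_all add: wv_append)
  qed
qed

text \<open>The free generators are g L1 for g = L2 and g = L3, with inverses L1 g.\<close>

fun gl :: "letter \<times> bool \<Rightarrow> letter list" where
  "gl (g, b) = (if b then [g, L1] else [L1, g])"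

definition fv :: "(letter \<times> bool) list \<Rightarrow> 'a" where "fv w = wv (concat (map gl w))"

lemma fv_Cons: "fv (x # w) = wv (gl x) \<otimes> fv w" and fv_Nil [simp]: "fv [] = \<one>" and fv_closed [simp]: "fv w \<in> carrier G"
  by (simp_all add: fv_def wv_append)

text \<open>The reduced word in the involutions that represents a reduced word in the generators
  \<open>md L2 \<otimes> md L1\<close> and \<open>md L3 \<otimes> md L1\<close>; the beginning of the former determines that of the latter.\<close>

fun nf :: "(letter \<times> bool) list \<Rightarrow> letter list" where
  "nf [] = []"
| "nf ((g, b) # w) = (if b then (if nf w \<noteq> [] \<and> hd (nf w) = L1 then g # tl (nf w) else g # L1 # nf w)
    else L1 # g # nf w)"

fun begins :: "letter \<times> bool \<Rightarrow> letter list \<Rightarrow> bool" where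
  "begins (g, b) u \<longleftrightarrow> (if b then \<exists>r. u = g # r else \<exists>r. u = L1 # g # r)"

abbreviation fwords :: "(letter \<times> bool) list set" where
  "fwords \<equiv> {w. set w \<subseteq> {L2, L3} \<times> UNIV \<and> reduced_word w}"

lemma reduced_word_Cons:
  "reduced_word ((g, b) # w) \<longleftrightarrow> reduced_word w \<and> (\<forall>g' b' w'. w = (g', b') # w' \<longrightarrow> \<not> (g = g' \<and> b \<noteq> b'))"
  by (cases w) (auto simp: reduced_word_def)

lemma wv_L1_L1: "wv (g # u) = wv (g # L1 # L1 # u)"
  by (simp add: wv_Cons md_md')

lemma nf_props:
  assumes "w \<in> fwords"
  shows "distinct_adj (nf w) \<and> wv (nf w) = fv w \<and> (\<forall>x w'. w = x # w' \<longrightarrow> begins x (nf w))"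
  using assms
proof (induction w)
  case (Cons x w)
  obtain g b where x: "x = (g, b)" by (cases x)
  have g: "g \<noteq> L1" using Cons.prems x by auto
  have w: "w \<in> fwords" using Cons.prems x by (auto simp: reduced_word_Cons)
  note IH = Cons.IH[OF w]
  define u where "u = nf w"
  have val: "wv (nf (x # w)) = fv (x # w)"
  proof (cases "b \<and> u \<noteq> [] \<and> hd u = L1")
    case True
    then have u: "u = L1 # tl u" by (cases u) auto
    have "wv (g # tl u) = wv (g # L1 # u)" by (subst u) (rule wv_L1_L1)
    then have "wv (nf (x # w)) = wv (g # L1 # u)" using True by (simp add: x u_def[symmetric])
    also have "\<dots> = wv (gl x) \<otimes> wv u" using True by (simp add: x flip: wv_append)
    finally show ?thesis using IH by (simp add: fv_Cons u_def)
  next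
    case False
    then have "nf (x # w) = gl x @ u" by (auto simp: x u_def[symmetric])
    then show ?thesis using IH by (simp add: wv_append fv_Cons u_def)
  qed
  have "distinct_adj (nf (x # w)) \<and> begins x (nf (x # w))"
  proof (cases w)
    case Nil
    then show ?thesis using g by (auto simp: x distinct_adj_Cons)
  next
    case (Cons y w')
    obtain g' b' where y: "y = (g', b')" by (cases y)
    have g': "g' \<noteq> L1" and ne: "\<not> (g = g' \<and> b \<noteq> b')"
      using Cons.prems Cons y x by (auto simp: reduced_word_Cons)
    have d: "distinct_adj u" and be: "begins (g', b') u" using IH Cons y u_def by blast+
    consider r where "b'" "u = g' # r" | r where "\<not> b'" "u = L1 # g' # r"
      using be by (auto split: if_splits)
    then show ?thesis
      using g g' ne d by cases (auto simp: x u_def[symmetric] distinct_adj_Cons)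
  qed
  then show ?case using val by blast
qed simp

text \<open>\<open>nf\<close> turns reduced words in the generators into reduced words in the
  involutions, and \<open>begins\<close> recovers their first letter, so injectivity is inherited
  from \<open>wv\<close>. Surjectivity comes from i j = (i L1)(L1 j).\<close>

theorem free_even_words:
  assumes inj: "inj_on wv {w. distinct_adj w}"
  shows "free_group_of_rank (G\<lparr>carrier := even_words\<rparr>) 2"
proof -
  let ?H = "G\<lparr>carrier := even_words\<rparr>"
  have H: "group ?H" by (rule subgroup.subgroup_is_group[OF subgroup_even is_group])
  have gl_even: "wv (gl x) \<in> even_words" for x by (cases x) (auto simp: even_words_def)
  have beg: "x = y" if "begins x u" "begins y u" "fst x \<noteq> L1" "fst y \<noteq> L1" for x y u
    using that by (cases x; cases y) (auto split: if_splits)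
  have fv_inj: "w = w'" if "w \<in> fwords" "w' \<in> fwords" "fv w = fv w'" for w w'
    using that
  proof (induction w arbitrary: w')
    case Nil
    show ?case
    proof (cases w')
      case (Cons y r)
      have "wv (nf w') = wv []" using nf_props[OF Nil.prems(2)] Nil.prems(3) by simp
      then have "nf w' = []" using inj_onD[OF inj, of "nf w'" "[]"] nf_props[OF Nil.prems(2)] by simp
      then show ?thesis using nf_props[OF Nil.prems(2)] Cons by (cases y) (auto split: if_splits)
    qed simp
  next
    case (Cons x w)
    have eq: "nf (x # w) = nf w'"
      by (rule inj_onD[OF inj]) (use nf_props[OF Cons.prems(1)] nf_props[OF Cons.prems(2)] Cons.prems(3) in simp_all)
    show ?case
    proof (cases w')
      case Nil
      then show ?thesis using nf_props[OF Cons.prems(1)] eq by (cases x) (auto split: if_splits)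
    next
      case (Cons y r)
      have bx: "begins x (nf w')" "begins y (nf w')"
        using nf_props[OF Cons.prems(1)] nf_props[OF Cons.prems(2)] eq Cons by auto
      have "fst x \<noteq> L1" "fst y \<noteq> L1" using Cons.prems Cons by auto
      then have xy: "x = y" using beg[OF bx] by blast
      then have "fv w = fv r" using Cons.prems(3) Cons by (simp add: fv_Cons)
      moreover have "w \<in> fwords" "r \<in> fwords"
        using Cons.prems Cons by (cases x; cases y; auto simp: reduced_word_Cons)+
      ultimately show ?thesis using Cons.IH xy Cons by blast
    qed
  qed
  have prep: "wv (gl (g, b)) \<otimes> fv w \<in> fv ` fwords" if w: "w \<in> fwords" and g: "g \<in> {L2, L3}" for g b w
  proof (cases "reduced_word ((g, b) # w)")
    case True
    then show ?thesis using w g by (intro image_eqI[of _ _ "(g, b) # w"]) (auto simp: fv_Cons)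
  next
    case False
    then obtain b' w' where w': "w = (g, b') # w'" "b \<noteq> b'" using w by (auto simp: reduced_word_Cons)
    have "wv (gl (g, b)) \<otimes> wv (gl (g, b')) = \<one>"
      using w'(2) by (cases b) (simp_all add: wv_Cons m_assoc md_md' md_md)
    then have "wv (gl (g, b)) \<otimes> fv w = fv w'" by (simp add: w' fv_Cons flip: m_assoc)
    moreover have "w' \<in> fwords" using w w' by (auto simp: reduced_word_Cons)
    ultimately show ?thesis by simp
  qed
  have prep1: "wv [i, L1] \<otimes> y \<in> fv ` fwords" "wv [L1, i] \<otimes> y \<in> fv ` fwords" if y: "y \<in> fv ` fwords" for i y
  proof -
    obtain w where w: "w \<in> fwords" "y = fv w" using y by blast
    have "wv [L1, L1] = \<one>" by (simp add: wv_Cons md_md)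
    then show "wv [i, L1] \<otimes> y \<in> fv ` fwords" "wv [L1, i] \<otimes> y \<in> fv ` fwords"
      using prep[OF w(1), of i True] prep[OF w(1), of i False] w by (cases i; simp)+
  qed
  have surj: "wv u \<in> fv ` fwords" if "even (length u)" for u
    using that
  proof (induction u rule: length_induct)
    case (1 u)
    consider "u = []" | i j r where "u = i # j # r" using 1(2) by (cases u; cases "tl u") auto
    then show ?case
    proof cases
      case 1
      then show ?thesis by (intro image_eqI[of _ _ "[]"]) (auto simp: reduced_word_def)
    next
      case (2 i j r)
      have "wv u = wv [i, L1] \<otimes> (wv [L1, j] \<otimes> wv r)"
        by (simp add: 2 wv_Cons m_assoc md_md')
      moreover have "wv r \<in> fv ` fwords" using 1 2 by simp
      ultimately show ?thesis using prep1 by simp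
    qed
  qed
  define xg where "xg = (\<lambda>g. wv [g, L1])"
  let ?X = "xg ` {L2, L3}"
  have xg: "inj_on xg {L2, L3}"
  proof (rule inj_onI)
    fix g g' assume g: "g \<in> {L2, L3}" "g' \<in> {L2, L3}" "xg g = xg g'"
    have "[g, L1] = [g', L1]" by (rule inj_onD[OF inj]) (use g in \<open>auto simp: xg_def\<close>)
    then show "g = g'" by simp
  qed
  \<comment> \<open>\<open>free_group_of_rank\<close> speaks of words in group elements, so words in
    letters have to be translated.\<close>
  define tr where "tr = map (map_prod xg (id :: bool \<Rightarrow> bool))"
  have tr_val: "word_value ?H (tr w) = fv w" if "set w \<subseteq> {L2, L3} \<times> UNIV" for w
    using that
  proof (induction w)
    case (Cons x w)
    obtain g b where x: "x = (g, b)" by (cases x)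
    have "xg g \<in> even_words" using gl_even[of "(g, True)"] by (simp add: xg_def)
    then have "inv\<^bsub>?H\<^esub> xg g = inv (xg g)" by (rule m_inv_consistent[OF subgroup_even])
    moreover have "inv (xg g) = wv [L1, g]" by (simp add: xg_def inv_wv)
    ultimately show ?case using Cons by (auto simp: word_value_def tr_def x fv_Cons xg_def)
  qed (simp add: word_value_def tr_def)
  have tr_red: "reduced_word (tr w) \<longleftrightarrow> reduced_word w" if "set w \<subseteq> {L2, L3} \<times> UNIV" for w
    using that
  proof (induction w)
    case (Cons x w)
    then show ?case
    proof (cases w)
      case (Cons y r)
      obtain g b g' b' where "x = (g, b)" "y = (g', b')" by (cases x; cases y)
      then show ?thesis using Cons Cons.IH Cons.prems xg
        by (auto simp: reduced_word_def tr_def inj_on_def)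
    qed (simp add: reduced_word_def tr_def)
  qed (simp add: reduced_word_def tr_def)
  have words: "{w. set w \<subseteq> ?X \<times> UNIV \<and> reduced_word w} = tr ` fwords"
  proof
    show "tr ` fwords \<subseteq> {w. set w \<subseteq> ?X \<times> UNIV \<and> reduced_word w}"
    proof
      fix W assume "W \<in> tr ` fwords"
      then obtain w where w: "W = tr w" "set w \<subseteq> {L2, L3} \<times> UNIV" "reduced_word w" by blast
      have "set W \<subseteq> ?X \<times> UNIV" using w(2) unfolding w(1) tr_def by (fastforce simp: image_iff)
      then show "W \<in> {w. set w \<subseteq> ?X \<times> UNIV \<and> reduced_word w}" using tr_red w by simp
    qed
    show "{w. set w \<subseteq> ?X \<times> UNIV \<and> reduced_word w} \<subseteq> tr ` fwords"
    proof
      fix W assume W: "W \<in> {w. set w \<subseteq> ?X \<times> UNIV \<and> reduced_word w}"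
      have "\<exists>w. set w \<subseteq> {L2, L3} \<times> UNIV \<and> W = tr w" if "set W \<subseteq> ?X \<times> UNIV" for W
        using that
      proof (induction W)
        case (Cons Y W)
        then obtain w where w: "set w \<subseteq> {L2, L3} \<times> UNIV" "W = tr w" by auto
        obtain g b where "g \<in> {L2, L3}" "Y = (xg g, b)" using Cons.prems by (cases Y) auto
        then show ?case using w by (intro exI[of _ "(g, b) # w"]) (auto simp: tr_def)
      qed (simp add: tr_def)
      then obtain w where "set w \<subseteq> {L2, L3} \<times> UNIV" "W = tr w" using W by blast
      then show "W \<in> tr ` fwords" using W tr_red by blast
    qed
  qed
  have "bij_betw (word_value ?H) {w. set w \<subseteq> ?X \<times> UNIV \<and> reduced_word w} even_words"
  proof (rule bij_betw_imageI)
    show "inj_on (word_value ?H) {w. set w \<subseteq> ?X \<times> UNIV \<and> reduced_word w}"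
      unfolding words
    proof (rule inj_onI)
      fix W W' assume "W \<in> tr ` fwords" "W' \<in> tr ` fwords" and eq: "word_value ?H W = word_value ?H W'"
      then obtain w w' where w: "W = tr w" "W' = tr w'" "w \<in> fwords" "w' \<in> fwords" by blast
      then have "fv w = fv w'" using eq tr_val by simp
      then show "W = W'" using fv_inj w by blast
    qed
    have "word_value ?H ` (tr ` fwords) = fv ` fwords"
      unfolding image_image by (rule image_cong[OF refl]) (use tr_val in blast)
    also have "\<dots> = even_words"
    proof
      have "even (length (concat (map gl w)))" for w by (induction w) auto
      then show "fv ` fwords \<subseteq> even_words" unfolding fv_def even_words_def by blast
      show "even_words \<subseteq> fv ` fwords" using surj by (auto simp: even_words_def)
    qed
    finally show "word_value ?H ` {w. set w \<subseteq> ?X \<times> UNIV \<and> reduced_word w} = even_words"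
      unfolding words .
  qed
  moreover have "card ?X = 2" using card_image[OF xg] by simp
  moreover have "?X \<subseteq> even_words" unfolding xg_def even_words_def by auto
  ultimately show ?thesis unfolding free_group_of_rank_def using H
    by (intro conjI exI[of _ ?X]) auto
qed

end

section \<open>Elliptic levels\<close>

lemma third_simps:
  assumes "i \<noteq> j"
  shows "third i j \<noteq> i" "third i j \<noteq> j" "third i (third i j) = j" "third j (third i j) = i" "third (third i j) j = i"
    "third j i = third i j" "third (third i j) i = j" "j \<noteq> i"
  using assms by (cases i; cases j; simp)+

lemma third_cases:
  assumes "i \<noteq> j"
  obtains "l = i" | "l = j" | "l = third i j"
  using assms by (cases i; cases j; cases l) auto

definition tri :: "letter \<Rightarrow> letter \<Rightarrow> real \<Rightarrow> real \<Rightarrow> real \<Rightarrow> triple" where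
  "tri i j x y z = (let f = (\<lambda>l. if l = i then x else if l = j then y else z) in (f L1, f L2, f L3))"

lemma crd_tri: "crd l (tri i j x y z) = (if l = i then x else if l = j then y else z)"
  by (cases l) (simp_all add: tri_def Let_def)

lemma continuous_on_tri [continuous_intros]:
  assumes "continuous_on S f" "continuous_on S g" "continuous_on S h"
  shows "continuous_on S (\<lambda>s. tri i j (f s) (g s) (h s))"
  unfolding tri_def Let_def by (intro continuous_on_Pair; cases i; cases j; simp add: assms)

lemma connected_real_ivt:
  fixes f :: "'x :: topological_space \<Rightarrow> real"
  assumes "connected S" "continuous_on S f" "x \<in> S" "y \<in> S" "f x \<le> c" "c \<le> f y"
  obtains z where "z \<in> S" "f z = c"
proof -
  have "connected (f ` S)" by (intro connected_continuous_image assms)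
  then have "c \<in> f ` S" using assms by (meson connectedD_interval imageI)
  then show ?thesis using that by auto
qed

context signed_angles
begin

fun pc :: "letter \<Rightarrow> real" where
  "pc L1 = 4 * (A * B + C * D)" | "pc L2 = 4 * (A * C + B * D)" | "pc L3 = 4 * (A * D + B * C)"

definition S0 :: real where
  "S0 = 4 * (A\<^sup>2 + B\<^sup>2 + C\<^sup>2 + D\<^sup>2) + 16 * A * B * C * D - 4"

lemma F_generic:
  assumes "i \<noteq> j"
  shows "F P = (crd i P)\<^sup>2 + (crd j P)\<^sup>2 + (crd (third i j) P)\<^sup>2 - crd i P * crd j P * crd (third i j) P
    + pc i * crd i P + pc j * crd j P + pc (third i j) * crd (third i j) P + S0"
  using assms by (cases P; cases rule: letter_pairs) (simp_all add: fricke_def S0_def algebra_simps)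

lemma v_generic:
  assumes "i \<noteq> j"
  shows "v j P = crd i P * crd (third i j) P - 2 * crd j P - pc j"
  using assms by (cases P; cases rule: letter_pairs) (simp_all add: slope_def algebra_simps)

lemma v_generic':
  assumes "i \<noteq> j"
  shows "v (third i j) P = crd i P * crd j P - 2 * crd (third i j) P - pc (third i j)"
  using v_generic[of i "third i j" P] third_simps[OF assms] by simp

lemma conic_identity:
  assumes "i \<noteq> j"
  shows "(v j P)\<^sup>2 + (v (third i j) P)\<^sup>2 + crd i P * v j P * v (third i j) P - \<kappa> i (crd i P) = - ((crd i P)\<^sup>2 - 4) * F P"
proof (cases P)
  case (fields x y z)
  have 1: "(slope A C B D y x z)\<^sup>2 + (slope A D B C z x y)\<^sup>2 + x * slope A C B D y x z * slope A D B C z x y - kap A B C D x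
    = - (x\<^sup>2 - 4) * fricke A B C D x y z"
    by (rule level_conic_identity)
  have 2: "(slope A B C D x y z)\<^sup>2 + (slope A D B C z x y)\<^sup>2 + y * slope A B C D x y z * slope A D B C z x y - kap A C B D y
    = - (y\<^sup>2 - 4) * fricke A B C D x y z"
    using level_conic_identity[of A B C D x y z] fricke_swap12[of A C B D y x z] slope_swap[of A D C B z y x] by simp
  have 3: "(slope A B C D x y z)\<^sup>2 + (slope A C B D y x z)\<^sup>2 + z * slope A B C D x y z * slope A C B D y x z - kap A D B C z
    = - (z\<^sup>2 - 4) * fricke A B C D x y z"
    using level_conic_identity[of A B D C x z y] fricke_rot[of A D B C z x y] slope_swap[of A B D C x z y] slope_swap[of A C D B y z x]
    by simp
  show ?thesis unfolding fields using assms 1 2 3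
    by (cases rule: letter_pairs) (simp_all add: algebra_simps)
qed

text \<open>The inverse of the passage from a point on the level x to the increments e and f of its
  other two coordinates; compare \<open>par\<close>.\<close>

definition lev :: "letter \<Rightarrow> letter \<Rightarrow> real \<Rightarrow> real \<Rightarrow> real \<Rightarrow> triple" where
  "lev i j x e f = (let p = pc j + e; q = pc (third i j) + f
     in tri i j x ((x * q + 2 * p) / (x\<^sup>2 - 4)) ((x * p + 2 * q) / (x\<^sup>2 - 4)))"

lemma crd_lev [simp]: "crd i (lev i j x e f) = x"
  by (simp add: lev_def Let_def crd_tri)

lemma v_lev:
  assumes "i \<noteq> j" "x\<^sup>2 \<noteq> 4"
  shows "v j (lev i j x e f) = e" "v (third i j) (lev i j x e f) = f"
proof -
  have *: "x * ((x * g + 2 * h) / (x\<^sup>2 - 4)) - 2 * ((x * h + 2 * g) / (x\<^sup>2 - 4)) = g" for g h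
  proof -
    have "x * ((x * g + 2 * h) / (x\<^sup>2 - 4)) - 2 * ((x * h + 2 * g) / (x\<^sup>2 - 4))
      = (x * (x * g + 2 * h) - 2 * (x * h + 2 * g)) / (x\<^sup>2 - 4)"
      by (simp add: diff_divide_distrib)
    also have "x * (x * g + 2 * h) - 2 * (x * h + 2 * g) = g * (x\<^sup>2 - 4)"
      by (simp add: power2_eq_square algebra_simps)
    finally show ?thesis using assms(2) by simp
  qed
  have y: "crd j (lev i j x e f) = (x * (pc (third i j) + f) + 2 * (pc j + e)) / (x\<^sup>2 - 4)"
    and z: "crd (third i j) (lev i j x e f) = (x * (pc j + e) + 2 * (pc (third i j) + f)) / (x\<^sup>2 - 4)"
    using assms(1) third_simps[OF assms(1)] by (simp_all add: lev_def Let_def crd_tri)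
  show "v j (lev i j x e f) = e" unfolding v_generic[OF assms(1)] crd_lev y z * by simp
  show "v (third i j) (lev i j x e f) = f" unfolding v_generic'[OF assms(1)] crd_lev y z * by simp
qed

lemma lev_v:
  assumes "i \<noteq> j" "(crd i P)\<^sup>2 \<noteq> 4"
  shows "lev i j (crd i P) (v j P) (v (third i j) P) = P"
proof -
  define x y z where "x = crd i P" and "y = crd j P" and "z = crd (third i j) P"
  have "(x * (x * y - 2 * z) + 2 * (x * z - 2 * y)) = y * (x\<^sup>2 - 4)" "(x * (x * z - 2 * y) + 2 * (x * y - 2 * z)) = z * (x\<^sup>2 - 4)"
    by (simp_all add: power2_eq_square algebra_simps)
  then have e: "(x * (x * y - 2 * z) + 2 * (x * z - 2 * y)) / (x\<^sup>2 - 4) = y" "(x * (x * z - 2 * y) + 2 * (x * y - 2 * z)) / (x\<^sup>2 - 4) = z"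
    using assms(2) by (simp_all add: x_def)
  have "pc j + v j P = x * z - 2 * y" "pc (third i j) + v (third i j) P = x * y - 2 * z"
    using v_generic[OF assms(1), of P] v_generic'[OF assms(1), of P] by (simp_all add: x_def y_def z_def)
  then have "lev i j (crd i P) (v j P) (v (third i j) P) = tri i j x y z"
    unfolding lev_def Let_def x_def[symmetric] by (simp only: e)
  moreover have "crd l (tri i j x y z) = crd l P" for l
    by (rule third_cases[OF assms(1), of l]) (use third_simps[OF assms(1)] assms(1) in \<open>auto simp: crd_tri x_def y_def z_def\<close>)
  ultimately show ?thesis by (simp add: triple_eq_iff)
qed

lemma F_lev:
  assumes "i \<noteq> j" "x\<^sup>2 \<noteq> 4"
  shows "F (lev i j x e f) = 0 \<longleftrightarrow> e\<^sup>2 + f\<^sup>2 + x * e * f = \<kappa> i x"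
  using conic_identity[OF assms(1), of "lev i j x e f"] assms(2) by (auto simp: v_lev[OF assms])

lemma continuous_on_lev:
  assumes "continuous_on S x" "continuous_on S e" "continuous_on S f" "\<And>s. s \<in> S \<Longrightarrow> (x s)\<^sup>2 \<noteq> 4"
  shows "continuous_on S (\<lambda>s. lev i j (x s) (e s) (f s))"
  unfolding lev_def Let_def by (intro continuous_intros assms) (use assms(4) in auto)

lemma continuous_on_tau [continuous_intros]: "continuous_on S (tau i)"
proof -
  have "2 * a * sn i \<noteq> 0" using sin_nz sn_pos[of i] by simp
  then show ?thesis unfolding tau_def by (intro continuous_intros) auto
qed

lemma closed_Te: "closed Te"
proof -
  have "Te = {P. F P = 0} \<inter> (\<Inter>i. {P. 1 \<le> tau i P})" by (auto simp: Te_def)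
  moreover have "closed {P. F P = 0}" by (intro closed_Collect_eq continuous_intros)
  moreover have "closed {P. 1 \<le> tau i P}" for i by (intro closed_Collect_le continuous_intros)
  ultimately show ?thesis by (simp add: closed_Int closed_INT)
qed

lemma kappa_nz_tau:
  assumes "\<kappa> i (crd i P) \<noteq> 0"
  shows "(tau i P)\<^sup>2 \<noteq> 1"
  using assms kappa_factor[of i "crd i P"] by (auto simp: tau_square)

text \<open>Where kappa is nonzero, \<open>tau i\<close> is not 1, so it stays above 1 on S. By
  \<open>gap_tau\<close> the other \<open>tau j\<close> then avoid ]-1, 1[ and cannot change
  sign.\<close>

lemma connected_subset_Te:
  assumes "connected S" "\<And>P. P \<in> S \<Longrightarrow> F P = 0 \<and> \<kappa> i (crd i P) \<noteq> 0" "P0 \<in> S" "P0 \<in> Te"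
  shows "S \<subseteq> Te"
proof
  have 1: "tau i Q > 1" if Q: "Q \<in> S" for Q
  proof (rule ccontr)
    assume "\<not> tau i Q > 1"
    then obtain R where "R \<in> S" "tau i R = 1"
      using connected_real_ivt[OF assms(1) continuous_on_tau Q assms(3), of i 1] assms(4) by (auto simp: Te_def)
    then show False using kappa_nz_tau[of i R] assms(2) by auto
  qed
  fix Q assume Q: "Q \<in> S"
  have "tau j Q \<ge> 1" for j
  proof (rule ccontr)
    assume n: "\<not> tau j Q \<ge> 1"
    have g: "\<bar>tau j R\<bar> \<ge> 1" if "R \<in> S" for R
      using gap_tau[of R i j] assms(2) 1 that by fastforce
    then have "tau j Q \<le> 0" using g[OF Q] n by linarith
    moreover have "0 \<le> tau j P0" using assms(4) by (auto simp: Te_def dest: spec[of _ j])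
    ultimately obtain R where "R \<in> S" "tau j R = 0"
      using connected_real_ivt[OF assms(1) continuous_on_tau Q assms(3), of j 0] by auto
    then show False using g[of R] by simp
  qed
  then show "Q \<in> Te" using assms(2)[OF Q] by (simp add: Te_def)
qed

text \<open>A complex coordinate on the level w + 1/w in which the twist is multiplication by w^2.
  On an elliptic level w lies on the unit circle.\<close>

definition eig :: "letter \<Rightarrow> letter \<Rightarrow> complex \<Rightarrow> triple \<Rightarrow> complex" where
  "eig i j w P = of_real (v j P) + w * of_real (v (third i j) P)"

definition twist :: "letter \<Rightarrow> letter \<Rightarrow> triple \<Rightarrow> triple" where
  "twist i j = modif j \<circ> modif (third i j)"

lemma twist_apply: "twist i j P = modif j (modif (third i j) P)"
  by (simp add: twist_def)

lemma crd_twist: "i \<noteq> j \<Longrightarrow> crd i (twist i j P) = crd i P"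
  using third_simps[of i j] by (simp add: twist_apply crd_modif)

lemma eig_twist:
  assumes "i \<noteq> j" "w \<noteq> 0" "of_real (crd i P) = w + inverse w"
  shows "eig i j w (twist i j P) = w\<^sup>2 * eig i j w P"
proof -
  define x e f where "x = complex_of_real (crd i P)" and "e = complex_of_real (v j P)" and "f = complex_of_real (v (third i j) P)"
  note t = third_simps[OF assms(1)]
  have 1: "v j (modif (third i j) P) = v j P + crd i P * v (third i j) P"
    using v_modif[of j "third i j" P] t by simp
  have 2: "v (third i j) (twist i j P) = v (third i j) (modif (third i j) P) + crd i P * v j (modif (third i j) P)"
    using v_modif[of "third i j" j "modif (third i j) P"] t by (simp add: twist_apply crd_modif)
  have "eig i j w (twist i j P) = - (e + x * f) + w * (- f + x * (e + x * f))"
    unfolding eig_def 2 by (simp add: twist_apply v_modif_same 1 x_def e_def f_def)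
  also have "\<dots> = w\<^sup>2 * (e + w * f)"
  proof -
    have x: "w * x = w\<^sup>2 + 1" using assms(2,3) by (simp add: x_def power2_eq_square algebra_simps)
    have "- (e + x * f) + w * (- f + x * (e + x * f)) = (w * x - 1) * e + (x * (w * x) - x - w) * f"
      by (simp add: algebra_simps)
    also have "x * (w * x) - x - w = w * (w * x) - w" 
    proof -
      have "x * (w\<^sup>2 + 1) - x = w * (w * x)" by (simp add: power2_eq_square algebra_simps)
      then show ?thesis unfolding x by simp
    qed
    also have "(w * x - 1) * e + (w * (w * x) - w) * f = w\<^sup>2 * (e + w * f)"
      unfolding x by (simp add: power2_eq_square algebra_simps)
    finally show ?thesis .
  qed
  finally show ?thesis by (simp add: eig_def e_def f_def)
qed

lemma eig_twist_pow:
  assumes "i \<noteq> j" "w \<noteq> 0" "of_real (crd i P) = w + inverse w"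
  shows "eig i j w ((twist i j ^^ n) P) = w ^ (2 * n) * eig i j w P \<and> crd i ((twist i j ^^ n) P) = crd i P"
proof (induction n)
  case (Suc n)
  then show ?case
    using eig_twist[OF assms(1,2), of "(twist i j ^^ n) P"] assms(3) crd_twist[OF assms(1), of "(twist i j ^^ n) P"]
    by (simp add: power2_eq_square mult.assoc mult.left_commute)
qed simp

lemma eig_nz:
  assumes "i \<noteq> j" "w \<noteq> 0" "of_real (crd i P) = w + inverse w" "F P = 0" "\<kappa> i (crd i P) \<noteq> 0"
  shows "eig i j w P \<noteq> 0"
proof
  assume 0: "eig i j w P = 0"
  define e f where "e = complex_of_real (v j P)" and "f = complex_of_real (v (third i j) P)"
  have "of_real (\<kappa> i (crd i P)) = e\<^sup>2 + f\<^sup>2 + of_real (crd i P) * e * f"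
  proof -
    have "\<kappa> i (crd i P) = (v j P)\<^sup>2 + (v (third i j) P)\<^sup>2 + crd i P * v j P * v (third i j) P"
      using conic_identity[OF assms(1), of P] assms(4) by simp
    then show ?thesis by (simp add: e_def f_def)
  qed
  also have "\<dots> = (e + w * f) * (e + inverse w * f)"
    unfolding assms(3) using assms(2) by (simp add: power2_eq_square algebra_simps)
  also have "\<dots> = 0" using 0 by (simp add: eig_def e_def f_def)
  finally show False using assms(5) by simp
qed

lemma twist_finite_order:
  fixes w :: complex
  assumes "i \<noteq> j" "w \<noteq> 0" "of_real (crd i P) = w + inverse w" "F P = 0" "\<kappa> i (crd i P) \<noteq> 0"
    and "(twist i j ^^ n) P = P"
  shows "w ^ (2 * n) = 1"
  using eig_twist_pow[OF assms(1-3), of n] eig_nz[OF assms(1-5)] assms(6) by simp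

lemma exists_other: "\<exists>j. j \<noteq> (i :: letter)"
  by (cases i) auto

text \<open>For |x| < 2 the conic form is positive definite.\<close>

lemma kappa_elliptic:
  assumes "F P = 0" "\<bar>crd i P\<bar> < 2" "i \<noteq> j"
  shows "\<kappa> i (crd i P) \<ge> 0" "\<kappa> i (crd i P) = 0 \<Longrightarrow> v j P = 0 \<and> v (third i j) P = 0"
proof -
  define x e f where "x = crd i P" and "e = v j P" and "f = v (third i j) P"
  have x: "1 - (x / 2)\<^sup>2 > 0" using assms(2) by (simp add: x_def abs_square_less_1)
  have k: "\<kappa> i x = (e + x / 2 * f)\<^sup>2 + (1 - (x / 2)\<^sup>2) * f\<^sup>2"
    using conic_identity[OF assms(3), of P] assms(1) by (simp add: x_def e_def f_def power2_eq_square algebra_simps)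
  then show "\<kappa> i (crd i P) \<ge> 0" using x by (simp add: x_def)
  have 1: "(1 - (x / 2)\<^sup>2) * f\<^sup>2 \<ge> 0" "(e + x / 2 * f)\<^sup>2 \<ge> 0" using x by simp_all
  assume "\<kappa> i (crd i P) = 0"
  then have "(1 - (x / 2)\<^sup>2) * f\<^sup>2 = 0" "(e + x / 2 * f)\<^sup>2 = 0" using k 1 unfolding x_def[symmetric] by linarith+
  then show "v j P = 0 \<and> v (third i j) P = 0" using x by (auto simp: e_def f_def)
qed

lemma finite_kappa_zeros: "finite {x. \<kappa> i x = 0}"
proof -
  have q: "finite {x :: real. x\<^sup>2 + 4 * p * q * x + 4 * p\<^sup>2 + 4 * q\<^sup>2 - 4 = 0}"
    if "p\<^sup>2 + p'\<^sup>2 = 1" "q\<^sup>2 + q'\<^sup>2 = 1" for p q p' q' :: real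
  proof (rule finite_subset)
    show "{x :: real. x\<^sup>2 + 4 * p * q * x + 4 * p\<^sup>2 + 4 * q\<^sup>2 - 4 = 0} \<subseteq> {2 * p' * q' - 2 * p * q, - 2 * p' * q' - 2 * p * q}"
    proof
      fix x assume "x \<in> {x :: real. x\<^sup>2 + 4 * p * q * x + 4 * p\<^sup>2 + 4 * q\<^sup>2 - 4 = 0}"
      then have "(x + 2 * p * q)\<^sup>2 = (2 * p' * q')\<^sup>2" using kap_factor'[OF that, of x] by simp
      then have "x + 2 * p * q = 2 * p' * q' \<or> x + 2 * p * q = - (2 * p' * q')" by (rule power2_eq_iff[THEN iffD1])
      then show "x \<in> {2 * p' * q' - 2 * p * q, - 2 * p' * q' - 2 * p * q}" by auto
    qed
  qed simp
  have k: "finite {x. kap p q r s x = 0}"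
    if "p\<^sup>2 + p'\<^sup>2 = 1" "q\<^sup>2 + q'\<^sup>2 = 1" "r\<^sup>2 + r'\<^sup>2 = 1" "s\<^sup>2 + s'\<^sup>2 = 1" for p q r s p' q' r' s'
    using finite_UnI[OF q[OF that(1,2)] q[OF that(3,4)]] by (rule finite_subset[rotated]) (auto simp: kap_def)
  show ?thesis using unit k by (cases i) auto
qed

lemma continuous_on_kappa0: "continuous_on S (\<kappa> i)"
  by (cases i) (auto simp: kap_def[abs_def] intro!: continuous_intros)

lemma open_good_levels: "open {x. \<bar>x\<bar> < 2 \<and> \<kappa> i x > 0}"
proof -
  have "{x. \<bar>x\<bar> < 2 \<and> \<kappa> i x > 0} = {x. \<bar>x\<bar> < 2} \<inter> {x. 0 < \<kappa> i x}" by auto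
  moreover have "open {x::real. \<bar>x\<bar> < 2}" by (intro open_Collect_less continuous_intros)
  moreover have "open {x. 0 < \<kappa> i x}" by (intro open_Collect_less continuous_intros continuous_on_kappa0)
  ultimately show ?thesis by (simp add: open_Int)
qed

text \<open>The point is carried to nearby levels by keeping the direction of its pair of increments
  and rescaling the pair by \<open>r\<close> so that the conic equation holds. The resulting curve
  does not leave \<open>Te\<close>.\<close>

lemma nearby_levels:
  assumes P: "P \<in> Te" "\<bar>crd i P\<bar> < 2" "\<kappa> i (crd i P) > 0"
  obtains \<delta> where "\<delta> > 0" "\<And>x. \<bar>x - crd i P\<bar> < \<delta> \<Longrightarrow> \<bar>x\<bar> < 2 \<and> \<kappa> i x > 0 \<and> (\<exists>Q\<in>Te. crd i Q = x)"
proof -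
  obtain j where ij: "i \<noteq> j" using exists_other[of i] by metis
  define x0 e f where "x0 = crd i P" and "e = v j P" and "f = v (third i j) P"
  have F: "F P = 0" using P by (simp add: Te_def)
  have k: "e\<^sup>2 + f\<^sup>2 + x0 * e * f = \<kappa> i x0"
    using conic_identity[OF ij, of P] F by (simp add: x0_def e_def f_def)
  obtain \<delta> where \<delta>: "\<delta> > 0" "\<And>x. \<bar>x - x0\<bar> < \<delta> \<Longrightarrow> \<bar>x\<bar> < 2 \<and> \<kappa> i x > 0"
    using open_good_levels[of i] P unfolding open_dist x0_def dist_real_def by blast
  define J where "J = {x0 - \<delta> <..< x0 + \<delta>}"
  have J: "\<bar>x\<bar> < 2" "\<kappa> i x > 0" "x\<^sup>2 \<noteq> 4" if "x \<in> J" for x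
  proof -
    show 1: "\<bar>x\<bar> < 2" "\<kappa> i x > 0" using \<delta>(2)[of x] that by (auto simp: J_def)
    then have "x\<^sup>2 < 2\<^sup>2" by (metis abs_numeral abs_le_square_iff not_le)
    then show "x\<^sup>2 \<noteq> 4" by simp
  qed
  define Q where "Q = (\<lambda>x. e\<^sup>2 + f\<^sup>2 + x * e * f)"
  have Qpos: "Q x > 0" if "x \<in> J" for x
  proof -
    have "e \<noteq> 0 \<or> f \<noteq> 0" using k P(3) by (auto simp: x0_def)
    have x: "1 - (x / 2)\<^sup>2 > 0" using J(1)[OF that] by (simp add: abs_square_less_1)
    have eq: "Q x = (e + x / 2 * f)\<^sup>2 + (1 - (x / 2)\<^sup>2) * f\<^sup>2"
      by (simp add: Q_def power2_eq_square algebra_simps)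
    show ?thesis
    proof (cases "f = 0")
      case True then show ?thesis using \<open>e \<noteq> 0 \<or> f \<noteq> 0\<close> by (simp add: eq)
    next
      case False
      then have "(1 - (x / 2)\<^sup>2) * f\<^sup>2 > 0" using x by simp
      then show ?thesis unfolding eq by (simp add: add_nonneg_pos)
    qed
  qed
  define r where "r = (\<lambda>x. sqrt (\<kappa> i x / Q x))"
  define L where "L = (\<lambda>x. lev i j x (r x * e) (r x * f))"
  have cr: "continuous_on J r"
  proof -
    have "continuous_on J Q" unfolding Q_def by (intro continuous_intros)
    moreover have "\<forall>x\<in>J. Q x \<noteq> 0" using Qpos by fastforce
    ultimately show ?thesis unfolding r_def
      by (intro continuous_on_real_sqrt continuous_on_divide continuous_on_kappa0)
  qed
  have cL: "continuous_on J L"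
    unfolding L_def by (intro continuous_on_lev continuous_intros cr) (use J in auto)
  have FL: "F (L x) = 0" if "x \<in> J" for x
  proof -
    have "(r x)\<^sup>2 * Q x = \<kappa> i x" using Qpos[OF that] J(2)[OF that] by (simp add: r_def)
    then show ?thesis unfolding L_def F_lev[OF ij J(3)[OF that]]
      by (simp add: Q_def power2_eq_square algebra_simps)
  qed
  have x0: "x0 \<in> J" using \<delta> by (simp add: J_def)
  have "r x0 = 1" using k Qpos[OF x0] by (simp add: r_def Q_def)
  then have LP: "L x0 = P" using lev_v[OF ij, of P] J(3)[OF x0] by (simp add: L_def x0_def e_def f_def)
  have "L ` J \<subseteq> Te"
  proof (rule connected_subset_Te[of _ i])
    show "connected (L ` J)" by (intro connected_continuous_image cL) (simp add: J_def)
    show "P \<in> L ` J" using LP x0 by blast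
    show "P \<in> Te" by fact
    fix R assume "R \<in> L ` J"
    then show "F R = 0 \<and> \<kappa> i (crd i R) \<noteq> 0" using FL J(2) by (fastforce simp: L_def)
  qed
  then have "\<exists>R\<in>Te. crd i R = x" if "\<bar>x - x0\<bar> < \<delta>" for x
  proof -
    have "x \<in> J" using that by (auto simp: J_def)
    then show ?thesis using \<open>L ` J \<subseteq> Te\<close> by (intro bexI[of _ "L x"]) (auto simp: L_def)
  qed
  then show ?thesis using that[of \<delta>] \<delta> by (simp add: x0_def)
qed

text \<open>Near a nondegenerate elliptic level the rotation angle of the twist takes infinitely many values.\<close>

lemma twist_infinite_order:
  assumes P: "P \<in> Te" "\<bar>crd i P\<bar> < 2" "\<kappa> i (crd i P) > 0" and ij: "i \<noteq> j" and N: "N > 0"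
  shows "\<exists>Q\<in>Te. (twist i j ^^ N) Q \<noteq> Q"
proof (rule ccontr)
  assume "\<not> ?thesis"
  then have per: "(twist i j ^^ N) Q = Q" if "Q \<in> Te" for Q using that by blast
  obtain \<delta> where \<delta>: "\<delta> > 0" "\<And>x. \<bar>x - crd i P\<bar> < \<delta> \<Longrightarrow> \<bar>x\<bar> < 2 \<and> \<kappa> i x > 0 \<and> (\<exists>Q\<in>Te. crd i Q = x)"
    using nearby_levels[OF P] by blast
  let ?J = "{crd i P - \<delta> <..< crd i P + \<delta>}"
  \<comment> \<open>w is the complex number of modulus 1 with real part x/2. A twist of order
    dividing N forces it to be a root of unity, and only finitely many are available.\<close>
  have "?J \<subseteq> (\<lambda>w. 2 * Re w) ` {w. w ^ (2 * N) = 1}"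
  proof
    fix x assume "x \<in> ?J"
    then have "\<bar>x - crd i P\<bar> < \<delta>" by auto
    then obtain Q where Q: "\<bar>x\<bar> < 2" "\<kappa> i x > 0" "Q \<in> Te" "crd i Q = x" using \<delta>(2) by blast
    define w where "w = Complex (x / 2) (sqrt (1 - (x / 2)\<^sup>2))"
    have "1 - (x / 2)\<^sup>2 > 0" using Q(1) by (simp add: abs_square_less_1)
    then have "(cmod w)\<^sup>2 = 1" by (simp add: w_def cmod_power2)
    then have "w * cnj w = 1" using complex_norm_square[of w] by simp
    then have "inverse w = cnj w" "w \<noteq> 0" by (auto intro: inverse_unique)
    then have "of_real (crd i Q) = w + inverse w" by (simp add: Q(4) complex_add_cnj) (simp add: w_def)
    then have "w ^ (2 * N) = 1"
      using twist_finite_order[OF ij \<open>w \<noteq> 0\<close>, of Q N] per[OF Q(3)] Q by (auto simp: Te_def)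
    moreover have "x = 2 * Re w" by (simp add: w_def)
    ultimately show "x \<in> (\<lambda>w. 2 * Re w) ` {w. w ^ (2 * N) = 1}" by blast
  qed
  moreover have "finite {w :: complex. w ^ (2 * N) = 1}"
    using finite_roots_unity[of "2 * N", where 'a = complex] N by simp
  ultimately have "finite ?J" by (meson finite_imageI finite_subset)
  then show False using \<delta>(1) infinite_Ioo[of "crd i P - \<delta>" "crd i P + \<delta>"] by simp
qed

lemma elliptic_level:
  assumes x: "\<bar>x\<bar> < 2" "\<kappa> i x > 0"
  defines "E \<equiv> {Q. F Q = 0 \<and> crd i Q = x}"
  shows "compact E" "connected E"
proof -
  obtain j where ij: "i \<noteq> j" using exists_other[of i] by metis
  define s r where "s = sqrt (1 - (x / 2)\<^sup>2)" and "r = sqrt (\<kappa> i x)"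
  have "1 - (x / 2)\<^sup>2 > 0" using x(1) by (simp add: abs_square_less_1)
  then have s: "s > 0" "s\<^sup>2 = 1 - (x / 2)\<^sup>2" by (simp_all add: s_def)
  have r: "r > 0" "r\<^sup>2 = \<kappa> i x" using x by (simp_all add: r_def)
  have "x\<^sup>2 < 2\<^sup>2" using x(1) by (metis abs_numeral abs_le_square_iff not_le)
  then have x2: "x\<^sup>2 \<noteq> 4" by simp
  \<comment> \<open>Completing the square turns the conic into (e + x f / 2)^2 + (s f)^2 = r^2, a
    circle parametrised by t.\<close>
  define g where "g = (\<lambda>t. lev i j x (r * cos t - x / 2 * (r * sin t / s)) (r * sin t / s))"
  have "continuous_on {0..2 * pi} g"
    unfolding g_def by (intro continuous_on_lev continuous_intros) (use s x2 in auto)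
  moreover have "E = g ` {0..2 * pi}"
  proof
    show "g ` {0..2 * pi} \<subseteq> E"
    proof
      fix Q assume "Q \<in> g ` {0..2 * pi}"
      then obtain t where t: "Q = g t" by blast
      define f where "f = r * sin t / s"
      have f: "s * f = r * sin t" using s by (simp add: f_def)
      have "(r * cos t - x / 2 * f)\<^sup>2 + f\<^sup>2 + x * (r * cos t - x / 2 * f) * f = (r * cos t)\<^sup>2 + (1 - (x / 2)\<^sup>2) * f\<^sup>2"
        by (simp add: power2_eq_square algebra_simps)
      also have "\<dots> = (r * cos t)\<^sup>2 + (s * f)\<^sup>2" using s(2) by (simp add: power_mult_distrib)
      also have "\<dots> = r\<^sup>2 * ((cos t)\<^sup>2 + (sin t)\<^sup>2)" unfolding f by (simp only: power_mult_distrib distrib_left)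
      also have "\<dots> = \<kappa> i x" by (simp add: r)
      finally show "Q \<in> E" unfolding E_def t g_def f_def[symmetric] using F_lev[OF ij x2] by simp
    qed
    show "E \<subseteq> g ` {0..2 * pi}"
    proof
      fix Q assume Q: "Q \<in> E"
      define e f where "e = v j Q" and "f = v (third i j) Q"
      have "e\<^sup>2 + f\<^sup>2 + x * e * f = \<kappa> i x" using conic_identity[OF ij, of Q] Q by (simp add: E_def e_def f_def)
      then have "(e + x / 2 * f)\<^sup>2 + (s * f)\<^sup>2 = r\<^sup>2"
        unfolding r power_mult_distrib s by (simp add: power2_eq_square algebra_simps)
      then have "((e + x / 2 * f) / r)\<^sup>2 + (s * f / r)\<^sup>2 = 1" using r x(2) by (simp add: power_divide add_divide_distrib[symmetric])
      then obtain t where t: "0 \<le> t" "t < 2 * pi" "(e + x / 2 * f) / r = cos t" "s * f / r = sin t"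
        using sincos_total_2pi by metis
      then have 2: "r * cos t = e + x / 2 * f" "r * sin t = s * f" using r by (simp_all add: field_simps)
      have "g t = lev i j x e f" unfolding g_def 2 using s by simp
      also have "\<dots> = Q" using lev_v[OF ij, of Q] Q x2 by (simp add: E_def e_def f_def)
      finally show "Q \<in> g ` {0..2 * pi}" using t by (intro image_eqI[of _ _ t]) auto
    qed
  qed
  ultimately show "compact E" "connected E"
    by (auto intro: compact_continuous_image connected_continuous_image)
qed

text \<open>\<open>max\<close> stands for the maximality of a component, and \<open>disc\<close> for
  what discreteness says about a compact set preserved by two involutions. Both are applied to the
  whole level ellipse through P.\<close>

lemma elliptic_contradiction_aux:
  assumes max: "\<And>E. connected E \<Longrightarrow> E \<subseteq> Te \<Longrightarrow> E \<inter> K \<noteq> {} \<Longrightarrow> E \<subseteq> K"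
    and disc: "\<And>E j l. compact E \<Longrightarrow> E \<subseteq> K \<Longrightarrow> E \<noteq> {} \<Longrightarrow> modif j ` E \<subseteq> E \<Longrightarrow> modif l ` E \<subseteq> E \<Longrightarrow>
      \<exists>N>0. \<forall>Q\<in>Te. ((modif j \<circ> modif l) ^^ N) Q = Q"
    and P: "P \<in> K" "K \<subseteq> Te" "\<bar>crd i P\<bar> < 2" "\<kappa> i (crd i P) > 0"
  shows False
proof -
  obtain j where ij: "i \<noteq> j" using exists_other[of i] by metis
  define E where "E = {Q. F Q = 0 \<and> crd i Q = crd i P}"
  have E: "compact E" "connected E" using elliptic_level[OF P(3,4)] by (simp_all add: E_def)
  have PE: "P \<in> E" using P by (auto simp: E_def Te_def)
  have "E \<subseteq> Te"
    by (rule connected_subset_Te[OF E(2), of i P]) (use P PE in \<open>auto simp: E_def\<close>)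
  then have "E \<subseteq> K" using max[OF E(2)] PE P by blast
  moreover have "modif l ` E \<subseteq> E" if "l \<noteq> i" for l using that by (auto simp: E_def crd_modif)
  ultimately obtain N where "N > 0" "\<And>Q. Q \<in> Te \<Longrightarrow> (twist i j ^^ N) Q = Q"
    using disc[OF E(1), of j "third i j"] PE ij third_simps[OF ij] unfolding twist_def by blast
  then show False using twist_infinite_order[OF _ P(3,4) ij] P by blast
qed

text \<open>By the previous lemma kappa vanishes on all elliptic levels that meet K, so such a level
  meets K in a single point. Hence coordinate i is not constant on K, and by connectedness it takes
  infinitely many values in ]-2, 2[, all of them zeros of the polynomial kappa.\<close>

lemma elliptic_contradiction:
  assumes max: "\<And>E. connected E \<Longrightarrow> E \<subseteq> Te \<Longrightarrow> E \<inter> K \<noteq> {} \<Longrightarrow> E \<subseteq> K"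
    and disc: "\<And>E j l. compact E \<Longrightarrow> E \<subseteq> K \<Longrightarrow> E \<noteq> {} \<Longrightarrow> modif j ` E \<subseteq> E \<Longrightarrow> modif l ` E \<subseteq> E \<Longrightarrow>
      \<exists>N>0. \<forall>Q\<in>Te. ((modif j \<circ> modif l) ^^ N) Q = Q"
    and K: "connected K" "\<not> is_singleton K"
    and P: "P \<in> K" "K \<subseteq> Te" "\<bar>crd i P\<bar> < 2"
  shows False
proof -
  obtain j where ij: "i \<noteq> j" using exists_other[of i] by metis
  have F: "F Q = 0" if "Q \<in> K" for Q using that P by (auto simp: Te_def)
  have k0: "\<kappa> i (crd i Q) = 0" if "Q \<in> K" "\<bar>crd i Q\<bar> < 2" for Q
    using elliptic_contradiction_aux[OF max disc that(1) P(2) that(2)] kappa_elliptic(1)[OF F[OF that(1)] that(2) ij] by fastforce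
  define x where "x = crd i P"
  have "\<exists>Q\<in>K. crd i Q \<noteq> x"
  proof (rule ccontr)
    assume n: "\<not> ?thesis"
    have "Q = P" if Q: "Q \<in> K" for Q
    proof -
      have x: "crd i Q = x" using n Q by blast
      then have "v j Q = v j P" "v (third i j) Q = v (third i j) P"
        using kappa_elliptic(2)[OF F[OF Q] _ ij] k0[OF Q] kappa_elliptic(2)[OF F[OF P(1)] P(3) ij] k0[OF P(1,3)] P(3)
        by (auto simp: x_def)
      moreover have "x\<^sup>2 < 2\<^sup>2" using P(3) unfolding x_def by (metis abs_numeral abs_le_square_iff not_le)
      then have "(crd i Q)\<^sup>2 \<noteq> 4" "(crd i P)\<^sup>2 \<noteq> 4" using x by (auto simp: x_def)
      note lev_v[OF ij this(1)] lev_v[OF ij this(2)]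
      ultimately show ?thesis using x unfolding x_def by metis
    qed
    then have "K = {P}" using P(1) by blast
    then show False using K(2) unfolding is_singleton_def by blast
  qed
  then obtain Q where Q: "Q \<in> K" "crd i Q \<noteq> x" by blast
  have sub: "{min x (crd i Q)..max x (crd i Q)} \<inter> {-2<..<2} \<subseteq> {x. \<kappa> i x = 0}"
  proof
    fix y assume y: "y \<in> {min x (crd i Q)..max x (crd i Q)} \<inter> {-2<..<2}"
    obtain R where "R \<in> K" "crd i R = y"
    proof (cases "x \<le> crd i Q")
      case True
      then show ?thesis using connected_real_ivt[OF K(1) continuous_on_crd P(1) Q(1), of i y] y that by (auto simp: x_def)
    next
      case False
      then show ?thesis using connected_real_ivt[OF K(1) continuous_on_crd Q(1) P(1), of i y] y that by (auto simp: x_def)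
    qed
    then show "y \<in> {x. \<kappa> i x = 0}" using k0[of R] y by auto
  qed
  have "infinite ({min x (crd i Q)..max x (crd i Q)} \<inter> {-2<..<2})"
  proof (cases "x < crd i Q")
    case True
    have "{x<..<min (crd i Q) 2} \<subseteq> {min x (crd i Q)..max x (crd i Q)} \<inter> {-2<..<2}"
      using True P(3) by (auto simp: x_def)
    moreover have "infinite {x<..<min (crd i Q) 2}" using True P(3) by (simp add: x_def)
    ultimately show ?thesis using finite_subset by blast
  next
    case False
    then have lt: "crd i Q < x" using Q by simp
    have "{max (crd i Q) (-2)<..<x} \<subseteq> {min x (crd i Q)..max x (crd i Q)} \<inter> {-2<..<2}"
      using lt P(3) by (auto simp: x_def)
    moreover have "infinite {max (crd i Q) (-2)<..<x}" using lt P(3) by (simp add: x_def)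
    ultimately show ?thesis using finite_subset by blast
  qed
  then show False using finite_subset[OF sub finite_kappa_zeros] by blast
qed

end

section \<open>Necessity of the conditions\<close>

lemma crd_uminus [simp]: "crd i (- P) = - crd i P"
  by (cases P; cases i) auto

lemma real_hyperbolic_root:
  assumes "x > (2::real)"
  obtains w where "w > 1" "x = w + inverse w"
proof -
  define r where "r = sqrt ((x / 2)\<^sup>2 - 1)"
  have "(x / 2)\<^sup>2 - 1 > 0" using square_gt_4[OF assms] by (simp add: power_divide)
  then have r: "r > 0" "r\<^sup>2 = (x / 2)\<^sup>2 - 1" by (simp_all add: r_def)
  have "(x / 2 + r) * (x / 2 - r) = 1" using r(2) by (simp add: power2_eq_square algebra_simps)
  then have "inverse (x / 2 + r) = x / 2 - r" by (rule inverse_unique)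
  then show ?thesis using that[of "x / 2 + r"] r(1) assms by simp
qed

context signed_angles
begin

text \<open>For x = w + 1/w with w > 1 the conic form factors as (e + w f)(e + f/w), so a branch of
  the hyperbola is traced by multiplying one factor by s and dividing the other by s.\<close>

lemma branch_unbounded:
  assumes P: "P \<in> Te" "crd i P > 2" "\<kappa> i (crd i P) \<noteq> 0" and ij: "i \<noteq> j"
  obtains S where "connected S" "S \<subseteq> Te" "P \<in> S" "\<And>M. \<exists>Q\<in>S. v (third i j) Q > M \<or> v (third i j) Q < - M"
proof -
  define x e f where "x = crd i P" and "e = v j P" and "f = v (third i j) P"
  have F0: "F P = 0" using P by (simp add: Te_def)
  obtain w where w: "w > 1" "x = w + inverse w" using real_hyperbolic_root P(2) unfolding x_def by blast
  have x4: "x\<^sup>2 \<noteq> 4" using square_gt_4[of x] P(2) by (simp add: x_def)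
  define h where "h = w - inverse w"
  have h: "h > 0" using w by (simp add: h_def field_simps) (simp add: less_1_mult)
  define f0 f1 where "f0 = e + w * f" and "f1 = e + inverse w * f"
  have prod: "(p + w * q) * (p + inverse w * q) = p\<^sup>2 + q\<^sup>2 + x * p * q" for p q
    using w by (simp add: power2_eq_square algebra_simps)
  have k: "f0 * f1 = \<kappa> i x"
    using conic_identity[OF ij, of P] F0 by (simp add: f0_def f1_def prod) (simp add: x_def e_def f_def)
  then have nz: "f0 \<noteq> 0" using P(3) by (auto simp: x_def)
  define b where "b = (\<lambda>s. (s * f0 - f1 / s) / h)"
  define g where "g = (\<lambda>s. lev i j x (s * f0 - w * b s) (b s))"
  have Fg: "F (g s) = 0" if "s \<ge> 1" for s
  proof -
    have "h * b s = s * f0 - f1 / s" using h by (simp add: b_def)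
    then have "(s * f0 - w * b s) + inverse w * b s = f1 / s" by (simp add: h_def algebra_simps)
    then have "(s * f0 - w * b s)\<^sup>2 + (b s)\<^sup>2 + x * (s * f0 - w * b s) * b s = s * f0 * (f1 / s)"
      unfolding prod[symmetric] by simp
    also have "\<dots> = \<kappa> i x" using k that by simp
    finally show ?thesis unfolding g_def F_lev[OF ij x4] .
  qed
  have g1: "g 1 = P"
  proof -
    have "f0 - f1 = h * f" by (simp add: f0_def f1_def h_def algebra_simps)
    then have "b 1 = f" using h by (simp add: b_def)
    then have "g 1 = lev i j x e f" by (simp add: g_def f0_def)
    then show ?thesis using lev_v[OF ij, of P] x4 by (simp add: x_def e_def f_def)
  qed
  have cg: "continuous_on {1..} g"
    unfolding g_def b_def using h by (intro continuous_on_lev continuous_intros) (use x4 in auto)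
  have con: "connected (g ` {1..})" by (intro connected_continuous_image cg) simp
  have sub: "g ` {1..} \<subseteq> Te"
  proof (rule connected_subset_Te[OF con, of i P])
    fix Q assume "Q \<in> g ` {1..}"
    then show "F Q = 0 \<and> \<kappa> i (crd i Q) \<noteq> 0" using Fg P(3) by (auto simp: g_def x_def)
  next
    show "P \<in> g ` {1..}" using g1 by (intro image_eqI[of _ _ 1]) auto
  qed (fact P)
  have "\<exists>Q\<in>g ` {1..}. v (third i j) Q > M \<or> v (third i j) Q < - M" for M
  proof -
    \<comment> \<open>Large enough for |s f0| to exceed |f1 / s| by more than |M| h.\<close>
    define s where "s = max 1 ((\<bar>M\<bar> * h + \<bar>f1\<bar> + 1) / \<bar>f0\<bar>)"
    have s: "s \<ge> 1" "s * \<bar>f0\<bar> \<ge> \<bar>M\<bar> * h + \<bar>f1\<bar> + 1"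
      using nz by (auto simp: s_def max_def field_simps)
    have "\<bar>f1 / s\<bar> \<le> \<bar>f1\<bar>" using s(1) by (simp add: abs_divide divide_le_eq mult_le_cancel_left1)
    moreover have "\<bar>s * f0\<bar> = s * \<bar>f0\<bar>" using s(1) by (simp add: abs_mult)
    ultimately have "\<bar>s * f0 - f1 / s\<bar> > \<bar>M\<bar> * h" using s(2) by linarith
    then have "\<bar>b s\<bar> > \<bar>M\<bar>" using h by (simp add: b_def abs_divide less_divide_eq)
    moreover have "v (third i j) (g s) = b s" unfolding g_def by (rule v_lev[OF ij x4])
    ultimately show ?thesis using s(1) by (intro bexI[of _ "g s"]) auto
  qed
  then show ?thesis using that[OF con sub] g1 by (metis atLeast_iff image_eqI order_refl)
qed

lemma pc_sum:
  assumes "i \<noteq> j"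
  shows "pc j + pc (third i j) = 4 * (A + cs i) * (cs j + cs (third i j))"
  using assms by (cases rule: letter_pairs) (simp_all add: algebra_simps)

lemma S0_conic:
  assumes "i \<noteq> j"
  shows "(pc j)\<^sup>2 + (pc (third i j))\<^sup>2 + x * pc j * pc (third i j) - \<kappa> i x = - (x\<^sup>2 - 4) * (x\<^sup>2 + pc i * x + S0)"
  using conic_identity[OF assms, of "tri i j x 0 0"] third_simps[OF assms]
  by (simp add: v_generic[OF assms] v_generic'[OF assms] F_generic[OF assms] crd_tri)

text \<open>If \<open>(A + cs i) (cs j + cs k) < 0\<close>, the level \<open>crd i = 2\<close> is not at infinity: the path below crosses it.
  Along the path, \<open>p\<close> and \<open>q\<close> are the sum and the difference of the other two coordinates, and \<open>m\<close> is constant.\<close>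

lemma crossing_path:
  assumes P: "P \<in> Te" "crd i P \<ge> 2" and ij: "i \<noteq> j" and neg: "(A + cs i) * (cs j + cs (third i j)) < 0"
    and vs: "crd i P > 2 \<Longrightarrow> v j P + v (third i j) P > 0"
  obtains S Q where "connected S" "S \<subseteq> Te" "P \<in> S" "Q \<in> S" "crd i Q < 2"
proof -
  note t = third_simps[OF ij]
  define x0 y0 z0 k where "x0 = crd i P" and "y0 = crd j P" and "z0 = crd (third i j) P" and "k = third i j"
  define N d where "N = - (pc j + pc k)" and "d = pc j - pc k"
  have "4 * ((A + cs i) * (cs j + cs (third i j))) < 0" by (rule mult_pos_neg[OF _ neg]) simp
  then have "pc j + pc k < 0" using pc_sum[OF ij] by (simp only: k_def mult.assoc)
  then have N: "N > 0" by (simp add: N_def)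
  \<comment> \<open>This is the difference \<open>v (third i j) P - v j P\<close> of the two
    increments.\<close>
  define m where "m = (x0 + 2) * (y0 - z0) + d"
  define H where "H = (\<lambda>x. x\<^sup>2 + pc i * x + S0)"
  define G where "G = (\<lambda>x. (m\<^sup>2 - d\<^sup>2) / (x + 2) + 4 * H x)"
  define W where "W = (\<lambda>x. N\<^sup>2 + (x - 2) * G x)"
  define V where "V = (\<lambda>x. 4 * \<kappa> i x + (x - 2) * m\<^sup>2)"
  \<comment> \<open>On the path the sum of the increments is sqrt (W x), that is, (x - 2) p = sqrt
    (W x) - N. The rationalised form avoids the division by x - 2; its denominator is positive at x
    = 2 too, as N > 0.\<close>
  define p q where "p = (\<lambda>x. G x / (sqrt (W x) + N))" and "q = (\<lambda>x. (m - d) / (x + 2))"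
  define L where "L = (\<lambda>x. tri i j x ((p x + q x) / 2) ((p x - q x) / 2))"
  have kap: "\<kappa> i x = (pc j)\<^sup>2 + (pc k)\<^sup>2 + x * pc j * pc k + (x\<^sup>2 - 4) * H x" for x
    using S0_conic[OF ij, of x] by (simp add: H_def k_def algebra_simps)
  have VW: "(x + 2) * W x = V x" if "x > -2" for x
  proof -
    have "(x + 2) * G x = m\<^sup>2 - d\<^sup>2 + 4 * (x + 2) * H x"
      using that by (simp add: G_def distrib_left)
    moreover have "(x + 2) * W x = (x + 2) * N\<^sup>2 + (x - 2) * ((x + 2) * G x)"
      by (simp add: W_def algebra_simps)
    ultimately have "(x + 2) * W x = (x + 2) * N\<^sup>2 + (x - 2) * (m\<^sup>2 - d\<^sup>2 + 4 * (x + 2) * H x)"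
      by (simp only:)
    also have "\<dots> = V x" unfolding V_def kap N_def d_def by (simp add: power2_eq_square algebra_simps)
    finally show ?thesis .
  qed
  define O' where "O' = {x. \<kappa> i x > 0} \<inter> {x. V x > 0} \<inter> {x. x > -2}"
  have "continuous_on UNIV V" unfolding V_def by (intro continuous_intros continuous_on_kappa0)
  then have opO: "open O'" unfolding O'_def
    by (intro open_Int open_Collect_less continuous_intros continuous_on_kappa0) auto
  have "\<kappa> i 2 = N\<^sup>2" unfolding kap N_def by (simp add: power2_eq_square algebra_simps)
  then have k2: "\<kappa> i 2 > 0" using N by simp
  have ge2: "x \<in> O'" if "x \<ge> 2" for x
  proof -
    have "\<kappa> i x > 0" using that k2 kappa_pos[of x i] by (cases "x = 2") auto
    moreover have "(x - 2) * m\<^sup>2 \<ge> 0" using that by simp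
    ultimately show ?thesis using that by (simp add: O'_def V_def add_pos_nonneg)
  qed
  obtain \<delta> where \<delta>: "\<delta> > 0" "\<And>x. dist x 2 < \<delta> \<Longrightarrow> x \<in> O'"
    using opO ge2[of 2] unfolding open_dist by auto
  define x1 where "x1 = 2 - \<delta> / 2"
  have J: "x \<in> O'" if "x \<ge> x1" for x
    using ge2[of x] \<delta>(2)[of x] \<delta>(1) that by (cases "x \<ge> 2") (auto simp: x1_def dist_real_def)
  have Wpos: "x > -2" "W x > 0" if "x \<ge> x1" for x
  proof -
    have x: "x > -2" "V x > 0" using J[OF that] by (auto simp: O'_def)
    then show "x > -2" by simp
    have "(x + 2) * W x > 0" using VW[OF x(1)] x(2) by (simp only:)
    then show "W x > 0" using x(1) by (simp add: zero_less_mult_iff)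
  qed
  have FL: "F (L x) = 0" if "x \<ge> x1" for x
  proof -
    define s where "s = sqrt (W x)"
    have s: "s > 0" "s\<^sup>2 = W x" using Wpos[OF that] by (simp_all add: s_def)
    have sN: "s + N \<noteq> 0" using s N by linarith
    have "p x = G x / (s + N)" by (simp add: p_def s_def)
    then have p: "p x * (s + N) = G x" using sN by simp
    have "(x - 2) * p x * (s + N) = (x - 2) * G x" by (simp only: mult.assoc p)
    also have "\<dots> = W x - N\<^sup>2" by (simp add: W_def)
    also have "\<dots> = (s - N) * (s + N)" unfolding s(2)[symmetric] by (simp add: power2_eq_square algebra_simps)
    finally have p2: "(x - 2) * p x = s - N" using sN by simp
    have q: "(x + 2) * q x = m - d" using Wpos[OF that] by (simp add: q_def)
    have "(x + 2) * (q x)\<^sup>2 + 2 * d * q x = q x * ((x + 2) * q x + 2 * d)" by (simp add: power2_eq_square algebra_simps)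
    also have "\<dots> = (m - d) / (x + 2) * (m + d)" unfolding q by (simp add: q_def)
    also have "\<dots> = (m\<^sup>2 - d\<^sup>2) / (x + 2)" by (simp add: power2_eq_square algebra_simps)
    finally have q2: "(x + 2) * (q x)\<^sup>2 + 2 * d * q x = (m\<^sup>2 - d\<^sup>2) / (x + 2)" .
    have "4 * F (L x) = 4 * H x - p x * ((x - 2) * p x + 2 * N) + ((x + 2) * (q x)\<^sup>2 + 2 * d * q x)"
      unfolding F_generic[OF ij, folded k_def] L_def crd_tri using t[folded k_def] ij
      by (simp add: H_def N_def d_def power2_eq_square field_simps)
    also have "\<dots> = 4 * H x - p x * (s + N) + (m\<^sup>2 - d\<^sup>2) / (x + 2)" unfolding q2 p2 by simp
    also have "\<dots> = 0" unfolding p by (simp add: G_def)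
    finally show ?thesis by simp
  qed
  have cV: "continuous_on {x1..x0} G"
    unfolding G_def H_def by (intro continuous_intros) (use Wpos in force)
  then have cW: "continuous_on {x1..x0} W" unfolding W_def by (intro continuous_intros)
  have "sqrt (W x) + N \<noteq> 0" "x + 2 \<noteq> 0" if "x \<in> {x1..x0}" for x
    using Wpos[of x] that N by (auto simp: add_nonneg_eq_0_iff)
  then have cL: "continuous_on {x1..x0} L"
    unfolding L_def p_def q_def by (intro continuous_intros cV cW) auto
  have x10: "x1 \<le> x0" "x1 < 2" using P(2) \<delta>(1) by (simp_all add: x1_def x0_def)
  have LP: "L x0 = P"
  proof -
    \<comment> \<open>The sum of the two increments at P. Its positivity shows that the path with
      the positive square root passes through P.\<close>
    define s where "s = (x0 - 2) * (y0 + z0) + N"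
    have s: "s > 0"
    proof (cases "crd i P > 2")
      case True
      have "v j P + v k P = s" unfolding v_generic[OF ij] v_generic'[OF ij, folded k_def]
        by (simp add: s_def N_def x0_def y0_def z0_def k_def algebra_simps)
      then show ?thesis using vs[OF True] by (simp add: k_def)
    next
      case False
      then show ?thesis using P(2) N by (simp add: s_def x0_def)
    qed
    have q: "q x0 = y0 - z0" using Wpos(1)[OF x10(1)] by (simp add: q_def m_def)
    have "(x0 + 2) * (y0 - z0)\<^sup>2 + 2 * d * (y0 - z0) = (m\<^sup>2 - d\<^sup>2) / (x0 + 2)"
      using Wpos(1)[OF x10(1)] by (simp add: m_def power2_eq_square field_simps)
    moreover have "4 * F P = 4 * H x0 - (y0 + z0) * ((x0 - 2) * (y0 + z0) + 2 * N) + ((x0 + 2) * (y0 - z0)\<^sup>2 + 2 * d * (y0 - z0))"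
      unfolding F_generic[OF ij]
      by (simp add: x0_def y0_def z0_def k_def H_def N_def d_def power2_eq_square field_simps)
    ultimately have G: "G x0 = (y0 + z0) * (s + N)" using P(1) by (simp add: Te_def G_def s_def algebra_simps)
    have "(x0 - 2) * (y0 + z0) = s - N" by (simp add: s_def)
    then have "(x0 - 2) * G x0 = (s - N) * (s + N)" by (simp add: G mult.assoc[symmetric])
    then have "W x0 = s\<^sup>2" by (simp add: W_def power2_eq_square algebra_simps)
    then have "p x0 = y0 + z0" using s N by (simp add: p_def G)
    then have "L x0 = tri i j x0 y0 z0" using q by (simp add: L_def)
    moreover have "crd l (tri i j x0 y0 z0) = crd l P" for l
      by (rule third_cases[OF ij, of l]) (use t ij in \<open>auto simp: crd_tri x0_def y0_def z0_def\<close>)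
    ultimately show ?thesis by (simp add: triple_eq_iff)
  qed
  have con: "connected (L ` {x1..x0})" by (intro connected_continuous_image cL) simp
  have mem: "P \<in> L ` {x1..x0}" "L x1 \<in> L ` {x1..x0}" using LP x10 by (force, force)
  have cr: "crd i (L x) = x" for x by (simp add: L_def crd_tri)
  have "L ` {x1..x0} \<subseteq> Te"
  proof (rule connected_subset_Te[OF con _ mem(1) P(1), of i])
    fix Q assume "Q \<in> L ` {x1..x0}"
    then show "F Q = 0 \<and> \<kappa> i (crd i Q) \<noteq> 0" using FL J by (fastforce simp: cr O'_def)
  qed
  then show ?thesis using that[OF con _ mem] x10 by (simp add: cr)
qed

end

context angles
begin

sublocale neg: signed_angles "- A" B C D "- a" b c d
  by standard (use unit sin_nz in auto)

text \<open>The sheet where the product of the rotations is -1. Changing the signs of A, a and all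
  coordinates together makes the results of \<open>signed_angles\<close> apply to it and keeps
  \<open>tau\<close>.\<close>

definition Tm :: "triple set" where
  "Tm = {P. - P \<in> neg.Te}"

abbreviation TT :: "triple set" where
  "TT \<equiv> Tp \<union> Tm"

definition nmod :: "letter \<Rightarrow> triple \<Rightarrow> triple" where
  "nmod j P = (if P \<in> Tp then modif j P else - neg.modif j (- P))"

lemma neg_tau: "neg.tau i (- P) = tau i P"
proof -
  have "neg.tau i (- P) = (- (crd i P + 2 * A * cs i)) / (- (2 * a * sn i))"
    by (simp add: neg.tau_def)
  then show ?thesis unfolding minus_divide_divide tau_def .
qed

lemma Tp_tau: "P \<in> Tp \<longleftrightarrow> F P = 0 \<and> (\<forall>i. tau i P \<ge> 1)"
  unfolding Tp_eq_Te by (simp add: Te_def)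

lemma Tm_tau: "P \<in> Tm \<longleftrightarrow> neg.F (- P) = 0 \<and> (\<forall>i. tau i P \<ge> 1)"
  unfolding Tm_def neg.Te_def by (simp add: neg_tau)

lemma disjoint: "Tp \<inter> Tm = {}"
proof (rule ccontr)
  assume "Tp \<inter> Tm \<noteq> {}"
  then obtain P where P: "P \<in> Tp" "P \<in> Tm" by blast
  obtain x y z where xyz: "P = (x, y, z)" by (cases P)
  have sq: "(2 * a * sn i)\<^sup>2 \<le> (crd i P + 2 * A * cs i)\<^sup>2" for i
    using P(1) sn_pos[of i] a_pos by (intro power_mono) (auto simp: Tp_def)
  have "fricke A B C D x y z + fricke (- A) B C D (- x) (- y) (- z) > 0"
    by (rule fricke_sum_pos[OF unit sin_nz(1)]) (use sq[of L1] sq[of L2] sq[of L3] xyz in auto)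
  moreover have "F P = 0" "neg.F (- P) = 0" using P unfolding Tp_tau Tm_tau by auto
  ultimately show False using xyz by simp
qed

lemma closed_Tm: "closed Tm"
proof -
  have "Tm = uminus -` neg.Te" by (auto simp: Tm_def)
  then show ?thesis using neg.closed_Te by (auto intro!: closed_vimage continuous_intros)
qed

lemma abs_A_cs: "\<bar>A * cs i\<bar> \<le> 1"
  by (rule abs_mult_le_one[OF unit(1) unit_cs])

lemma tau_ge_1_iff: "tau i P \<ge> 1 \<longleftrightarrow> crd i P + 2 * A * cs i \<ge> 2 * a * sn i"
proof -
  have "2 * a * sn i > 0" using a_pos sn_pos by simp
  then show ?thesis by (simp add: tau_def pos_le_divide_eq)
qed

lemma crd_gt_minus_2:
  assumes "tau i P \<ge> 1"
  shows "crd i P > -2"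
proof -
  have "a * sn i > 0" using a_pos sn_pos by simp
  then have "crd i P + 2 * A * cs i \<ge> 2 * a * sn i"
    using assms by (simp add: tau_def pos_le_divide_eq mult.assoc)
  then show ?thesis using abs_A_cs[of i] \<open>a * sn i > 0\<close> by (simp add: mult.assoc)
qed

lemma Tm_bounds:
  assumes "P \<in> Tm"
  shows "\<bar>crd i P\<bar> < 2"
proof -
  obtain x y z where xyz: "P = (x, y, z)" by (cases P)
  have F: "fricke (- A) B C D (- x) (- y) (- z) = 0" using assms xyz by (simp add: Tm_tau)
  have t: "crd i P + 2 * A * cs i \<ge> 2 * a * sn i" for i
    using assms unfolding Tm_tau tau_ge_1_iff by blast
  have "- x > -2"
    by (rule coordinate_gt_minus_2[of "-A" "-a" B b C c D d "-x" "-y" "-z"])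
      (use unit sin_pos F t[of L1] t[of L2] t[of L3] xyz in auto)
  moreover have "- y > -2"
    by (rule coordinate_gt_minus_2[of "-A" "-a" C c B b D d "-y" "-x" "-z"])
      (use unit sin_pos F t[of L1] t[of L2] t[of L3] xyz in \<open>auto simp: fricke_swap12\<close>)
  moreover have "- z > -2"
    by (rule coordinate_gt_minus_2[of "-A" "-a" D d B b C c "-z" "-x" "-y"])
      (use unit sin_pos F t[of L1] t[of L2] t[of L3] xyz in \<open>auto simp: fricke_rot\<close>)
  moreover have "tau i P \<ge> 1" using assms by (simp add: Tm_tau)
  ultimately show ?thesis using crd_gt_minus_2[of i P] xyz by (cases i) auto
qed

lemma component_cases:
  assumes "K \<in> components TT"
  shows "K \<subseteq> Tp \<or> K \<subseteq> Tm"
proof -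
  have "connected K" "K \<subseteq> TT" using assms in_components_connected in_components_subset by blast+
  then show ?thesis using disjoint closed_Tp closed_Tm unfolding connected_closed by blast
qed

lemma nmod_pow_Tp:
  assumes inv: "\<And>j P. P \<in> TT \<Longrightarrow> nmod j P \<in> TT" and "P \<in> Tp"
  shows "((nmod j \<circ> nmod l) ^^ n) P = ((modif j \<circ> modif l) ^^ n) P \<and> ((modif j \<circ> modif l) ^^ n) P \<in> Tp"
proof (induction n)
  case (Suc n)
  have 1: "modif i Q \<in> Tp" if "Q \<in> Tp" for i Q
  proof -
    have "modif i Q \<in> TT" using inv[of Q i] that by (simp add: nmod_def)
    then have "\<forall>l. tau l (modif i Q) \<ge> 1" unfolding Un_iff Tp_tau Tm_tau by blast
    then show ?thesis using that by (simp add: Tp_tau)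
  qed
  show ?case using Suc 1 by (simp add: nmod_def)
qed (use assms in simp)

lemma nmod_pow_Tm:
  assumes inv: "\<And>j P. P \<in> TT \<Longrightarrow> nmod j P \<in> TT" and "P \<in> Tm"
  shows "((nmod j \<circ> nmod l) ^^ n) P = - ((neg.modif j \<circ> neg.modif l) ^^ n) (- P) \<and> ((nmod j \<circ> nmod l) ^^ n) P \<in> Tm"
proof (induction n)
  case (Suc n)
  have 1: "nmod i Q = - neg.modif i (- Q)" "nmod i Q \<in> Tm" if "Q \<in> Tm" for i Q
  proof -
    have "Q \<notin> Tp" using that disjoint by auto
    then show "nmod i Q = - neg.modif i (- Q)" by (simp add: nmod_def)
    then have F: "neg.F (- nmod i Q) = 0" using that by (simp add: Tm_tau)
    have "nmod i Q \<in> TT" using inv that by blast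
    then have "tau l (nmod i Q) \<ge> 1" for l by (auto simp: Tp_tau Tm_tau)
    then show "nmod i Q \<in> Tm" using F by (simp add: Tm_tau)
  qed
  define R where "R = ((nmod j \<circ> nmod l) ^^ n) P"
  have R: "R \<in> Tm" "R = - ((neg.modif j \<circ> neg.modif l) ^^ n) (- P)" using Suc unfolding R_def by blast+
  have e: "((nmod j \<circ> nmod l) ^^ Suc n) P = nmod j (nmod l R)" unfolding R_def funpow.simps o_apply ..
  have e': "((neg.modif j \<circ> neg.modif l) ^^ Suc n) (- P) = neg.modif j (neg.modif l (- R))"
    unfolding R(2) funpow.simps o_apply by (simp only: minus_minus)
  show ?case unfolding e e' using 1 R(1) by (metis minus_minus)
qed (use assms in simp)

text \<open>Discreteness enters only through \<open>disc\<close>: two involutions that preserve a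
  nonempty compact subset of K have a product of finite order. It excludes coordinates in ]-2, 2[
  from K, hence the sheet \<open>Tm\<close>; the claims are then proved for a component of
  \<open>Tp\<close> with all coordinates at least 2.\<close>

theorem discrete_conditions:
  assumes K: "K \<in> components TT" "\<not> is_singleton K"
    and inv: "\<And>j P. P \<in> TT \<Longrightarrow> nmod j P \<in> TT"
    and disc: "\<And>E j l. compact E \<Longrightarrow> E \<subseteq> K \<Longrightarrow> E \<noteq> {} \<Longrightarrow> nmod j ` E \<subseteq> E \<Longrightarrow> nmod l ` E \<subseteq> E \<Longrightarrow>
      \<exists>N>0. \<forall>Q\<in>TT. ((nmod j \<circ> nmod l) ^^ N) Q = Q"
  shows "\<not> compact K" "\<not> (A = 0 \<and> B = 0 \<and> C = 0 \<and> D = 0)"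
    and "(A + B \<ge> 0 \<and> A + C \<ge> 0 \<and> A + D \<ge> 0 \<and> B + C \<ge> 0 \<and> B + D \<ge> 0 \<and> C + D \<ge> 0) \<or>
      (A + B \<le> 0 \<and> A + C \<le> 0 \<and> A + D \<le> 0 \<and> B + C \<le> 0 \<and> B + D \<le> 0 \<and> C + D \<le> 0)"
proof -
  have con: "connected K" and sub: "K \<subseteq> TT" and ne: "K \<noteq> {}"
    using K in_components_connected in_components_subset in_components_nonempty by blast+
  have max: "E \<subseteq> K" if "connected E" "E \<subseteq> TT" "E \<inter> K \<noteq> {}" for E
    using components_maximal[OF K(1) that(1,2)] that(3) by blast
  have KTp: "K \<subseteq> Tp"
  proof (rule ccontr)
    assume "\<not> K \<subseteq> Tp"
    then have Km: "K \<subseteq> Tm" using component_cases[OF K(1)] by blast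
    obtain P where P: "P \<in> K" using ne by blast
    have cu: "continuous_on X (uminus :: triple \<Rightarrow> triple)" for X by (intro continuous_intros)
    show False
    proof (rule neg.elliptic_contradiction[of "uminus ` K" "- P" L1])
      fix E assume E: "connected E" "E \<subseteq> neg.Te" "E \<inter> uminus ` K \<noteq> {}"
      have "uminus ` E \<subseteq> K"
        
      proof (rule max)
        show "connected (uminus ` E)" by (rule connected_continuous_image[OF cu E(1)])
        show "uminus ` E \<subseteq> TT" using E(2) by (auto simp: Tm_def)
        obtain Q where "Q \<in> K" "- Q \<in> E" using E(3) by blast
        then have "- (- Q) \<in> uminus ` E" by blast
        then show "uminus ` E \<inter> K \<noteq> {}" using \<open>Q \<in> K\<close> by auto
      qed
      show "E \<subseteq> uminus ` K"
      proof
        fix Q assume "Q \<in> E"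
        then have "- Q \<in> K" using \<open>uminus ` E \<subseteq> K\<close> by blast
        then have "- (- Q) \<in> uminus ` K" by (rule imageI)
        then show "Q \<in> uminus ` K" by simp
      qed
    next
      fix E j l assume E: "compact E" "E \<subseteq> uminus ` K" "E \<noteq> {}" "neg.modif j ` E \<subseteq> E" "neg.modif l ` E \<subseteq> E"
      have EK: "uminus ` E \<subseteq> K"
      proof
        fix Q assume "Q \<in> uminus ` E"
        then obtain R where "R \<in> K" "Q = - (- R)" using E(2) by blast
        then show "Q \<in> K" by simp
      qed
      have n: "nmod i ` uminus ` E = uminus ` neg.modif i ` E" for i
      proof -
        have "nmod i (- Q) = - neg.modif i Q" if "Q \<in> E" for Q
        proof -
          have "- Q \<in> Tm" using that EK Km by blast
          then have "- Q \<notin> Tp" using disjoint by blast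
          then show ?thesis by (simp add: nmod_def)
        qed
        then show ?thesis by (simp add: image_image)
      qed
      have "\<exists>N>0. \<forall>Q\<in>TT. ((nmod j \<circ> nmod l) ^^ N) Q = Q"
      proof (rule disc[of "uminus ` E"])
        show "compact (uminus ` E)" by (rule compact_continuous_image[OF cu E(1)])
        show "uminus ` E \<subseteq> K" by (rule EK)
        show "uminus ` E \<noteq> {}" using E(3) by blast
        show "nmod j ` uminus ` E \<subseteq> uminus ` E" "nmod l ` uminus ` E \<subseteq> uminus ` E"
          unfolding n using E(4,5) by blast+
      qed
      then obtain N where N: "N > 0" "\<And>Q. Q \<in> TT \<Longrightarrow> ((nmod j \<circ> nmod l) ^^ N) Q = Q" by blast
      have "((neg.modif j \<circ> neg.modif l) ^^ N) Q = Q" if "Q \<in> neg.Te" for Q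
      proof -
        have "- Q \<in> Tm" using that by (simp add: Tm_def)
        then have "- ((neg.modif j \<circ> neg.modif l) ^^ N) (- (- Q)) = - Q"
          using nmod_pow_Tm[OF inv, of "- Q" N j l] N(2)[of "- Q"] by simp
        then show ?thesis by simp
      qed
      then show "\<exists>N>0. \<forall>Q\<in>neg.Te. ((neg.modif j \<circ> neg.modif l) ^^ N) Q = Q" using N(1) by blast
    next
      show "connected (uminus ` K)" by (rule connected_continuous_image[OF cu con])
      show "\<not> is_singleton (uminus ` K)"
      proof
        assume "is_singleton (uminus ` K)"
        then obtain R where "uminus ` K = {R}" by (rule is_singletonE)
        then have "Q = - R" if "Q \<in> K" for Q using that by (metis imageI minus_minus singletonD)
        then have "K = {- R}" using P by blast
        then show False using K(2) unfolding is_singleton_def by blast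
      qed
      show "- P \<in> uminus ` K" using P by blast
      show "uminus ` K \<subseteq> neg.Te" using Km by (auto simp: Tm_def simp del: split_paired_All)
      show "\<bar>crd L1 (- P)\<bar> < 2" using Tm_bounds[of P L1] P Km by auto
    qed
  qed
  have disc': "\<exists>N>0. \<forall>Q\<in>Te. ((modif j \<circ> modif l) ^^ N) Q = Q"
    if E: "compact E" "E \<subseteq> K" "E \<noteq> {}" "modif j ` E \<subseteq> E" "modif l ` E \<subseteq> E" for E j l
  proof -
    have n: "nmod i ` E = modif i ` E" for i
      by (rule image_cong[OF refl]) (use E(2) KTp in \<open>auto simp: nmod_def\<close>)
    obtain N where N: "N > 0" "\<And>Q. Q \<in> TT \<Longrightarrow> ((nmod j \<circ> nmod l) ^^ N) Q = Q"
      using disc[OF E(1-3), of j l] E(4,5) unfolding n by blast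
    have "((modif j \<circ> modif l) ^^ N) Q = Q" if "Q \<in> Te" for Q
      using nmod_pow_Tp[OF inv, of Q N j l] N(2)[of Q] that by (simp add: Tp_eq_Te)
    then show ?thesis using N(1) by blast
  qed
  have max': "E \<subseteq> K" if "connected E" "E \<subseteq> Te" "E \<inter> K \<noteq> {}" for E
    using max[OF that(1) _ that(3)] that(2) by (auto simp: Tp_eq_Te)
  have KTe: "K \<subseteq> Te" using KTp by (simp add: Tp_eq_Te)
  have ge2: "crd i P \<ge> 2" if P: "P \<in> K" for P i
  proof (rule ccontr)
    assume n: "\<not> crd i P \<ge> 2"
    have "tau i P \<ge> 1" using P KTp by (auto simp: Tp_tau)
    then have "\<bar>crd i P\<bar> < 2" using crd_gt_minus_2[of i P] n by linarith
    show False
    proof (rule elliptic_contradiction[of K P i])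
      show "E \<subseteq> K" if "connected E" "E \<subseteq> Te" "E \<inter> K \<noteq> {}" for E by (rule max'[OF that])
      show "\<exists>N>0. \<forall>Q\<in>Te. ((modif j \<circ> modif l) ^^ N) Q = Q"
        if "compact E" "E \<subseteq> K" "E \<noteq> {}" "modif j ` E \<subseteq> E" "modif l ` E \<subseteq> E" for E j l
        by (rule disc'[OF that])
    qed fact+
  qed
  have "\<exists>P\<in>K. \<exists>i. crd i P > 2"
  proof (rule ccontr)
    assume n: "\<not> ?thesis"
    have "P = (2, 2, 2)" if "P \<in> K" for P
    proof -
      have nn: "\<not> crd i P > 2" for i using n that by blast
      have "crd i P = 2" for i using nn[of i] ge2[OF that, of i] by linarith
      moreover have "crd i (2, 2, 2) = 2" for i by (cases i) auto
      ultimately have "crd i P = crd i (2, 2, 2)" for i by simp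
      then show ?thesis by (simp add: triple_eq_iff)
    qed
    then have "K = {(2, 2, 2)}" using ne by blast
    then show False using K(2) unfolding is_singleton_def by blast
  qed
  then obtain P i where P: "P \<in> K" "crd i P > 2" by blast
  have kP: "\<kappa> i (crd i P) > 0" by (rule kappa_pos[OF P(2)])
  obtain j where ij: "i \<noteq> j" using exists_other[of i] by metis
  show "\<not> compact K"
  proof
    assume "compact K"
    obtain S where S: "connected S" "S \<subseteq> Te" "P \<in> S" "\<And>M. \<exists>Q\<in>S. v (third i j) Q > M \<or> v (third i j) Q < - M"
      using branch_unbounded[of P i j] P kP ij KTe by auto
    have "S \<subseteq> K" using max'[OF S(1,2)] S(3) P(1) by blast
    have "bounded (v (third i j) ` K)"
      by (intro compact_imp_bounded compact_continuous_image \<open>compact K\<close> continuous_on_v)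
    then obtain M where M: "\<And>Q. Q \<in> K \<Longrightarrow> \<bar>v (third i j) Q\<bar> \<le> M" by (auto simp: bounded_iff)
    obtain Q where Q: "Q \<in> S" "v (third i j) Q > M \<or> v (third i j) Q < - M" using S(4)[of M] by blast
    then have "\<bar>v (third i j) Q\<bar> \<le> M" using M \<open>S \<subseteq> K\<close> by blast
    then show False using Q(2) by linarith
  qed
  show "\<not> (A = 0 \<and> B = 0 \<and> C = 0 \<and> D = 0)"
  proof
    \<comment> \<open>The cubic is now the Cayley cubic x^2 + y^2 + z^2 - xyz = 4, and all
      involutions fix (2, 2, 2). A path in \<open>Te\<close> joins this point to P, so discreteness
      at the point gives the twist finite order, although it is hyperbolic at P.\<close>
    assume z: "A = 0 \<and> B = 0 \<and> C = 0 \<and> D = 0"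
    then have sq: "a\<^sup>2 = 1" "b\<^sup>2 = 1" "c\<^sup>2 = 1" "d\<^sup>2 = 1" using unit by simp_all
    have one: "a = 1" "b = 1" "c = 1" "d = 1"
      using sq sin_pos by (auto simp: power2_eq_1_iff)
    obtain x y w where xyz: "P = (x, y, w)" by (cases P)
    have FZ: "F (x, y, w) = x\<^sup>2 + y\<^sup>2 + w\<^sup>2 - x * y * w - 4" for x y w
      unfolding F.simps fricke_def using z by simp
    have cs0: "cs l = 0" for l
      using z cs.simps by (cases l) metis+
    have sn1: "sn l = 1" for l
      using one sn.simps by (cases l) metis+
    have FP: "F P = 0" using P(1) KTp unfolding Tp_def by blast
    then have F0: "x\<^sup>2 + y\<^sup>2 + w\<^sup>2 - x * y * w - 4 = 0" unfolding xyz FZ .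
    have gt: "x \<ge> 2" "y \<ge> 2" using ge2[OF P(1), of L1] ge2[OF P(1), of L2] xyz by simp_all
    \<comment> \<open>Selects the root that the path follows in the third coordinate, so that it
      ends at P.\<close>
    define e where "e = (if x * y - 2 * w \<ge> 0 then 1 else - 1 :: real)"
    have e2: "e\<^sup>2 = 1" by (simp add: e_def)
    define p q where "p = (\<lambda>s. 2 + s * (x - 2))" and "q = (\<lambda>s. 2 + s * (y - 2))"
    define r where "r = (\<lambda>s. sqrt (((p s)\<^sup>2 - 4) * ((q s)\<^sup>2 - 4)))"
    define L where "L = (\<lambda>s. (p s, q s, (p s * q s - e * r s) / 2))"
    have pq: "p s \<ge> 2" "q s \<ge> 2" "(p s)\<^sup>2 - 4 \<ge> 0" "(q s)\<^sup>2 - 4 \<ge> 0" if "s \<in> {0..1}" for s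
    proof -
      show 1: "p s \<ge> 2" "q s \<ge> 2" using that gt by (simp_all add: p_def q_def)
      have "(2::real)\<^sup>2 \<le> (p s)\<^sup>2" "(2::real)\<^sup>2 \<le> (q s)\<^sup>2" using 1 by (intro power_mono; simp)+
      then show "(p s)\<^sup>2 - 4 \<ge> 0" "(q s)\<^sup>2 - 4 \<ge> 0" by simp_all
    qed
    have r2: "(r s)\<^sup>2 = ((p s)\<^sup>2 - 4) * ((q s)\<^sup>2 - 4)" if "s \<in> {0..1}" for s
      using pq[OF that] by (simp add: r_def)
    have LTp: "L s \<in> Te" if s: "s \<in> {0..1}" for s
    proof -
      have "4 * F (L s) = (e * r s)\<^sup>2 - ((p s)\<^sup>2 - 4) * ((q s)\<^sup>2 - 4)"
        unfolding L_def FZ by (simp add: power2_eq_square field_simps)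
      then have F: "F (L s) = 0" using e2 r2[OF s] by (simp add: power_mult_distrib)
      have "2 * 2 \<le> p s * q s" using pq[OF s] by (intro mult_mono) auto
      then have nn: "0 \<le> p s * q s - 4" by simp
      have "(p s * q s - 4)\<^sup>2 - ((p s)\<^sup>2 - 4) * ((q s)\<^sup>2 - 4) = 4 * (p s - q s)\<^sup>2"
        by (simp add: power2_eq_square algebra_simps)
      also have "\<dots> \<ge> 0" by simp
      finally have "(r s)\<^sup>2 \<le> (p s * q s - 4)\<^sup>2" unfolding r2[OF s] by (simp only: diff_ge_0_iff_ge)
      then have "r s \<le> p s * q s - 4" using nn by (rule power2_le_imp_le)
      moreover have "r s \<ge> 0" using pq[OF s] by (simp add: r_def)
      ultimately have "e * r s \<le> p s * q s - 4" by (auto simp: e_def)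
      then have ge: "crd l (L s) \<ge> 2" for l using pq[OF s] by (cases l) (auto simp: L_def)
      have "2 * a * sn l \<le> crd l (L s) + 2 * A * cs l" for l
        using ge[of l] cs0[of l] sn1[of l] one(1) by simp
      then have "L s \<in> Tp" unfolding Tp_def using F by blast
      then show ?thesis by (simp add: Tp_eq_Te)
    qed
    have L0: "L 0 = (2, 2, 2)" by (simp add: L_def p_def q_def r_def)
    have L1: "L 1 = P"
    proof -
      have sq: "(x\<^sup>2 - 4) * (y\<^sup>2 - 4) = (x * y - 2 * w)\<^sup>2" using F0 by algebra
      have 1: "p 1 = x" "q 1 = y" by (simp_all add: p_def q_def)
      have "r 1 = \<bar>x * y - 2 * w\<bar>" unfolding r_def 1 by (simp only: sq real_sqrt_abs)
      then have "e * r 1 = x * y - 2 * w" by (auto simp: e_def)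
      then show ?thesis by (simp add: L_def 1 xyz)
    qed
    have "continuous_on {0..1} L" unfolding L_def r_def p_def q_def by (intro continuous_intros) auto
    then have "connected (L ` {0..1})" by (intro connected_continuous_image) auto
    moreover have "L ` {0..1} \<subseteq> Te" using LTp by blast
    moreover have "P \<in> L ` {0..1}" using L1 by (metis atLeastAtMost_iff image_eqI order_refl zero_le_one)
    ultimately have "L ` {0..1} \<subseteq> K" using max' P(1) by blast
    then have K2: "(2, 2, 2) \<in> K" using L0 by (metis atLeastAtMost_iff imageI order_refl subsetD zero_le_one)
    have fx: "modif l ` {(2, 2, 2)} \<subseteq> {(2, 2, 2)}" for l
    proof -
      have "slope A B C D 2 2 2 = 0" "slope A C B D 2 2 2 = 0" "slope A D B C 2 2 2 = 0"
        by (simp_all add: slope_def z)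
      then show ?thesis by (cases l) simp_all
    qed
    have "\<exists>N>0. \<forall>Q\<in>Te. ((modif j \<circ> modif (third i j)) ^^ N) Q = Q"
      by (rule disc'[OF _ _ _ fx fx]) (use K2 in simp_all)
    then obtain N where N: "N > 0" "\<And>Q. Q \<in> Te \<Longrightarrow> ((modif j \<circ> modif (third i j)) ^^ N) Q = Q" by blast
    obtain w where w: "w > 1" "crd i P = w + inverse w" using real_hyperbolic_root P(2) by blast
    have tw: "(twist i j ^^ N) P = P" unfolding twist_def using N(2) P(1) KTe by blast
    have e: "complex_of_real (crd i P) = complex_of_real w + inverse (complex_of_real w)" unfolding w(2) by simp
    have "complex_of_real w ^ (2 * N) = 1"
      by (rule twist_finite_order[OF ij _ e _ _ tw]) (use w(1) kP FP in auto)
    then have "w ^ (2 * N) = 1" by (metis of_real_eq_1_iff of_real_power)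
    moreover have "w ^ (2 * N) > 1" using w(1) N(1) by (intro one_less_power) auto
    ultimately show False by simp
  qed
  show "(A + B \<ge> 0 \<and> A + C \<ge> 0 \<and> A + D \<ge> 0 \<and> B + C \<ge> 0 \<and> B + D \<ge> 0 \<and> C + D \<ge> 0) \<or>
      (A + B \<le> 0 \<and> A + C \<le> 0 \<and> A + D \<le> 0 \<and> B + C \<le> 0 \<and> B + D \<le> 0 \<and> C + D \<le> 0)"
  proof (rule ccontr)
    assume n: "\<not> ?thesis"
    have cross: False if ij: "i \<noteq> j" and neg: "(A + cs i) * (cs j + cs (third i j)) < 0" for i j
    proof -
      obtain S Q where S: "connected S" "S \<subseteq> Te" "P \<in> S" "Q \<in> S" "crd i Q < 2"
      proof (rule crossing_path[of P i j])
        show "P \<in> Te" "2 \<le> crd i P" using P KTe ge2 by auto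
        show "0 < v j P + v (third i j) P" if "2 < crd i P"
          by (rule v_sum_pos_aux) (use P KTp that third_simps[OF ij] in auto)
      qed (use ij neg in auto)
      then have "Q \<in> K" using max'[OF S(1,2)] P(1) by blast
      then show False using ge2[of Q i] S(5) by simp
    qed
    \<comment> \<open>The three complementary pairs of sums have the same total A + B + C + D. If no
      pair had strictly opposite signs, the sign of this total would be a weak sign of all six
      sums.\<close>
    have "(A + B < 0 \<and> C + D > 0) \<or> (A + B > 0 \<and> C + D < 0) \<or> (A + C < 0 \<and> B + D > 0) \<or> (A + C > 0 \<and> B + D < 0)
      \<or> (A + D < 0 \<and> B + C > 0) \<or> (A + D > 0 \<and> B + C < 0)"
      using n by linarith
    then have "(A + B) * (C + D) < 0 \<or> (A + C) * (B + D) < 0 \<or> (A + D) * (B + C) < 0"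
      by (auto simp: mult_less_0_iff)
    then show False using cross[of L1 L2] cross[of L2 L1] cross[of L3 L1] by auto
  qed
qed

end

section \<open>The hermitian triple product\<close>

text \<open>Here \<open>e = \<plusminus>1\<close> is the product of the four rotations in \<open>SU V\<close>, and \<open>vre\<close>, \<open>vim\<close> are the parts of
  \<open>-2 e i r1 r3 g\<close>, where \<open>g\<close> is the triple product of \<open>c0\<close>, \<open>c3\<close>, \<open>c1\<close>.\<close>

locale trig =
  fixes C0 C1 C2 C3 r0 r1 r2 r3 e :: real
  assumes trig: "C0\<^sup>2 + r0\<^sup>2 = 1" "C1\<^sup>2 + r1\<^sup>2 = 1" "C2\<^sup>2 + r2\<^sup>2 = 1" "C3\<^sup>2 + r3\<^sup>2 = 1" "e\<^sup>2 = 1"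
    and r_nz: "r0 \<noteq> 0" "r1 \<noteq> 0" "r2 \<noteq> 0" "r3 \<noteq> 0"
begin

definition vre :: "real \<Rightarrow> real \<Rightarrow> real \<Rightarrow> real" where
  "vre t1 t2 t3 = r2 * t2 * C0 + e * r3 * C1 * t3 + e * r1 * C3 * t1 - (C0 * r2 - r0 * C2 + e * (C1 * r3 + r1 * C3)) / 2"

definition vim :: "real \<Rightarrow> real \<Rightarrow> real \<Rightarrow> real" where
  "vim t1 t2 t3 = - r2 * t2 * r0 - e * r3 * r1 * t3 - e * r1 * r3 * t1 + (C0 * C2 + r0 * r2 - e * (C1 * C3 - r1 * r3)) / 2"

definition X1 :: "real \<Rightarrow> real" where "X1 t = e * (2 * r0 * r1 * (2 * t - 1) - 2 * C0 * C1)"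
definition X2 :: "real \<Rightarrow> real" where "X2 t = e * (2 * r0 * r2 * (2 * t - 1) - 2 * C0 * C2)"
definition X3 :: "real \<Rightarrow> real" where "X3 t = e * (2 * r0 * r3 * (2 * t - 1) - 2 * C0 * C3)"

text \<open>Rewrite rules that reduce polynomials modulo the relations of \<open>trig\<close>, so
  that the identities below can be checked by normalisation.\<close>

lemma red:
  "r0 * r0 = 1 - C0 * C0" "r1 * r1 = 1 - C1 * C1" "r2 * r2 = 1 - C2 * C2" "r3 * r3 = 1 - C3 * C3" "e * e = 1"
  "r0 * (r0 * x) = x - C0 * (C0 * x)" "r1 * (r1 * x) = x - C1 * (C1 * x)" "r2 * (r2 * x) = x - C2 * (C2 * x)"
  "r3 * (r3 * x) = x - C3 * (C3 * x)" "e * (e * x) = x"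
proof -
  show 1: "r0 * r0 = 1 - C0 * C0" "r1 * r1 = 1 - C1 * C1" "r2 * r2 = 1 - C2 * C2" "r3 * r3 = 1 - C3 * C3" "e * e = 1"
    using trig by (simp_all add: power2_eq_square)
  show "r0 * (r0 * x) = x - C0 * (C0 * x)" "r1 * (r1 * x) = x - C1 * (C1 * x)" "r2 * (r2 * x) = x - C2 * (C2 * x)"
    "r3 * (r3 * x) = x - C3 * (C3 * x)" "e * (e * x) = x"
    by (simp_all only: mult.assoc[symmetric] 1 left_diff_distrib mult_1_left)
qed

lemma gram_fricke:
  "16 * r0\<^sup>2 * ((vre t1 t2 t3)\<^sup>2 + (vim t1 t2 t3)\<^sup>2) - 64 * r0\<^sup>2 * r1\<^sup>2 * r3\<^sup>2 * t1 * t3 * (1 - t1 - t3)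
    + 64 * r0\<^sup>2 * r1 * r3 * t1 * t3 * e * vim t1 t2 t3 = fricke (e * C0) C1 C2 C3 (X1 t1) (X2 t2) (X3 t3)"
  unfolding vre_def vim_def X1_def X2_def X3_def fricke_def power2_eq_square
  by (simp add: field_simps red)

lemma slope1:
  "4 * r0 * e * (2 * e * (r3 * vim t1 t2 t3 - C3 * vre t1 t2 t3) - 4 * e * r3 * t3 * vim t1 t2 t3 + 4 * r1 * r3\<^sup>2 * t3 * (1 - t1 - t3))
    = slope (e * C0) C1 C2 C3 (X1 t1) (X2 t2) (X3 t3)"
  unfolding vre_def vim_def X1_def X2_def X3_def slope_def power2_eq_square
  by (simp add: field_simps red)

lemma slope3:
  "4 * r0 * e * (2 * e * (r1 * vim t1 t2 t3 - C1 * vre t1 t2 t3) - 4 * e * r1 * t1 * vim t1 t2 t3 + 4 * r3 * r1\<^sup>2 * t1 * (1 - t1 - t3))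
    = slope (e * C0) C3 C1 C2 (X3 t3) (X1 t1) (X2 t2)"
  unfolding vre_def vim_def X1_def X2_def X3_def slope_def power2_eq_square
  by (simp add: field_simps red)

text \<open>In \<open>hexagon_equations\<close> the sum of the two squares is 4 r2^2 t2 t2', so on
  the cubic t2' belongs to the other root in the second coordinate.\<close>

lemma vieta2:
  "4 * r0\<^sup>2 * ((C1 * C2 - r1 * r2 - e * (C0 * C3 + r0 * r3) + 2 * r1 * r2 * t1 + 2 * e * r3 * r0 * t3)\<^sup>2
      + (C1 * r2 + r1 * C2 - e * (r0 * C3 - C0 * r3) - 2 * r1 * C2 * t1 - 2 * e * r3 * C0 * t3)\<^sup>2)
    = 16 * r0\<^sup>2 * r2\<^sup>2 * t2\<^sup>2 + 4 * r0 * r2 * e * t2 * slope (e * C0) C2 C1 C3 (X2 t2) (X1 t1) (X3 t3)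
      + fricke (e * C0) C1 C2 C3 (X1 t1) (X2 t2) (X3 t3)"
  unfolding X1_def X2_def X3_def slope_def fricke_def power2_eq_square
  by (simp add: field_simps red)

definition gg :: "real \<Rightarrow> real \<Rightarrow> real \<Rightarrow> complex" where
  "gg t1 t2 t3 = Complex (- e * vim t1 t2 t3 / (2 * r1 * r3)) (e * vre t1 t2 t3 / (2 * r1 * r3))"

text \<open>Up to sign the bracket is t1 t3 times the Gram determinant of c0, c1, c3 if
  \<open>gg\<close> is their triple product. The determinant vanishes for vectors of a plane, which
  is the origin of the cubic equation.\<close>

lemma gram_gg:
  "64 * r0\<^sup>2 * r1\<^sup>2 * r3\<^sup>2 * ((cmod (gg t1 t2 t3))\<^sup>2 - t1 * t3 * (2 * Re (gg t1 t2 t3) - t1 - t3 + 1))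
    = fricke (e * C0) C1 C2 C3 (X1 t1) (X2 t2) (X3 t3)"
proof -
  have 1: "4 * r1\<^sup>2 * r3\<^sup>2 * (cmod (gg t1 t2 t3))\<^sup>2 = (vre t1 t2 t3)\<^sup>2 + (vim t1 t2 t3)\<^sup>2"
    using r_nz trig(5) by (simp add: gg_def cmod_power2 power_divide power_mult_distrib field_simps)
  have 2: "2 * r1 * r3 * Re (gg t1 t2 t3) = - e * vim t1 t2 t3"
    using r_nz by (simp add: gg_def)
  have "64 * r0\<^sup>2 * r1\<^sup>2 * r3\<^sup>2 * ((cmod (gg t1 t2 t3))\<^sup>2 - t1 * t3 * (2 * Re (gg t1 t2 t3) - t1 - t3 + 1))
    = 16 * r0\<^sup>2 * (4 * r1\<^sup>2 * r3\<^sup>2 * (cmod (gg t1 t2 t3))\<^sup>2) - 64 * r0\<^sup>2 * r1\<^sup>2 * r3\<^sup>2 * t1 * t3 * (1 - t1 - t3)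
      - 64 * r0\<^sup>2 * r1 * r3 * t1 * t3 * (2 * r1 * r3 * Re (gg t1 t2 t3))"
    by (simp add: power2_eq_square algebra_simps)
  also have "\<dots> = fricke (e * C0) C1 C2 C3 (X1 t1) (X2 t2) (X3 t3)"
    unfolding 1 2 gram_fricke[symmetric] by simp
  finally show ?thesis .
qed

text \<open>The other root of \<open>F\<close> in \<open>t1\<close> and in \<open>t3\<close>, in terms of \<open>g\<close>.\<close>

lemma other_root_1:
  assumes "(cmod (gg t1 t2 t3))\<^sup>2 = t1 * t3 * (2 * Re (gg t1 t2 t3) - t1 - t3 + 1)"
  shows "4 * e * r0 * r1 * (cmod (Complex C3 (- r3) * t1 + 2 * \<i> * r3 * gg t1 t2 t3))\<^sup>2
    = t1 * (4 * e * r0 * r1 * t1 + slope (e * C0) C1 C2 C3 (X1 t1) (X2 t2) (X3 t3))"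
proof -
  define g where "g = gg t1 t2 t3"
  have 2: "2 * r1 * r3 * Re g = - e * vim t1 t2 t3" "2 * r1 * r3 * Im g = e * vre t1 t2 t3"
    using r_nz by (simp_all add: g_def gg_def)
  have "(cmod (Complex C3 (- r3) * t1 + 2 * \<i> * r3 * g))\<^sup>2
    = (C3\<^sup>2 + r3\<^sup>2) * t1\<^sup>2 - 4 * r3 * t1 * (C3 * Im g + r3 * Re g) + 4 * r3\<^sup>2 * ((Re g)\<^sup>2 + (Im g)\<^sup>2)"
    unfolding cmod_power2 by (simp add: power2_eq_square algebra_simps)
  also have "\<dots> = t1\<^sup>2 - 4 * r3 * t1 * (C3 * Im g + r3 * Re g) + 4 * r3\<^sup>2 * (t1 * t3 * (2 * Re g - t1 - t3 + 1))"
    using assms trig(4) by (simp add: cmod_power2 g_def)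
  finally have n: "(cmod (Complex C3 (- r3) * t1 + 2 * \<i> * r3 * g))\<^sup>2
    = t1\<^sup>2 - 4 * r3 * t1 * (C3 * Im g + r3 * Re g) + 4 * r3\<^sup>2 * (t1 * t3 * (2 * Re g - t1 - t3 + 1))" .
  have "4 * e * r0 * r1 * (cmod (Complex C3 (- r3) * t1 + 2 * \<i> * r3 * g))\<^sup>2
    = t1 * (4 * e * r0 * r1 * t1 + 4 * r0 * e * (- 2 * (C3 * (2 * r1 * r3 * Im g) + r3 * (2 * r1 * r3 * Re g))
       + 4 * r3 * t3 * (2 * r1 * r3 * Re g) + 4 * r1 * r3\<^sup>2 * t3 * (1 - t1 - t3)))"
    unfolding n by (simp add: power2_eq_square algebra_simps)
  also have "\<dots> = t1 * (4 * e * r0 * r1 * t1 + slope (e * C0) C1 C2 C3 (X1 t1) (X2 t2) (X3 t3))"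
    unfolding 2 slope1[symmetric] by (simp add: algebra_simps)
  finally show ?thesis by (simp add: g_def)
qed

lemma other_root_3:
  assumes "(cmod (gg t1 t2 t3))\<^sup>2 = t1 * t3 * (2 * Re (gg t1 t2 t3) - t1 - t3 + 1)"
  shows "4 * e * r0 * r3 * (cmod (Complex C1 r1 * t3 - 2 * \<i> * r1 * cnj (gg t1 t2 t3)))\<^sup>2
    = t3 * (4 * e * r0 * r3 * t3 + slope (e * C0) C3 C1 C2 (X3 t3) (X1 t1) (X2 t2))"
proof -
  define g where "g = gg t1 t2 t3"
  have 2: "2 * r1 * r3 * Re g = - e * vim t1 t2 t3" "2 * r1 * r3 * Im g = e * vre t1 t2 t3"
    using r_nz by (simp_all add: g_def gg_def)
  have "(cmod (Complex C1 r1 * t3 - 2 * \<i> * r1 * cnj g))\<^sup>2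
    = (C1\<^sup>2 + r1\<^sup>2) * t3\<^sup>2 - 4 * r1 * t3 * (C1 * Im g + r1 * Re g) + 4 * r1\<^sup>2 * ((Re g)\<^sup>2 + (Im g)\<^sup>2)"
    unfolding cmod_power2 by (simp add: power2_eq_square algebra_simps)
  also have "\<dots> = t3\<^sup>2 - 4 * r1 * t3 * (C1 * Im g + r1 * Re g) + 4 * r1\<^sup>2 * (t1 * t3 * (2 * Re g - t1 - t3 + 1))"
    using assms trig(2) by (simp add: cmod_power2 g_def)
  finally have n: "(cmod (Complex C1 r1 * t3 - 2 * \<i> * r1 * cnj g))\<^sup>2
    = t3\<^sup>2 - 4 * r1 * t3 * (C1 * Im g + r1 * Re g) + 4 * r1\<^sup>2 * (t1 * t3 * (2 * Re g - t1 - t3 + 1))" .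
  have "4 * e * r0 * r3 * (cmod (Complex C1 r1 * t3 - 2 * \<i> * r1 * cnj g))\<^sup>2
    = t3 * (4 * e * r0 * r3 * t3 + 4 * r0 * e * (- 2 * (C1 * (2 * r1 * r3 * Im g) + r1 * (2 * r1 * r3 * Re g))
       + 4 * r1 * t1 * (2 * r1 * r3 * Re g) + 4 * r3 * r1\<^sup>2 * t1 * (1 - t1 - t3)))"
    unfolding n by (simp add: power2_eq_square algebra_simps)
  also have "\<dots> = t3 * (4 * e * r0 * r3 * t3 + slope (e * C0) C3 C1 C2 (X3 t3) (X1 t1) (X2 t2))"
    unfolding 2 slope3[symmetric] by (simp add: algebra_simps)
  finally show ?thesis by (simp add: g_def)
qed

lemma gg_linear:
  "- 2 * \<i> * e * r1 * r3 * Complex C0 r0 * gg t1 t2 t3 = r2 * t2 + e * r3 * (Complex C0 r0 * Complex C1 (- r1)) * t3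
     + e * r1 * (Complex C0 r0 * Complex C3 (- r3)) * t1
     + \<i> / 2 * (Complex C2 r2 - e * (Complex C0 r0 * Complex C1 (- r1) * Complex C3 (- r3)))"
proof -
  define g where "g = gg t1 t2 t3"
  have 2: "2 * r1 * r3 * Re g = - e * vim t1 t2 t3" "2 * r1 * r3 * Im g = e * vre t1 t2 t3"
    using r_nz by (simp_all add: g_def gg_def)
  have "Re (- 2 * \<i> * e * r1 * r3 * Complex C0 r0 * g) = e * (C0 * (2 * r1 * r3 * Im g) + r0 * (2 * r1 * r3 * Re g))"
    "Im (- 2 * \<i> * e * r1 * r3 * Complex C0 r0 * g) = e * (r0 * (2 * r1 * r3 * Im g) - C0 * (2 * r1 * r3 * Re g))"
    by (simp_all add: algebra_simps)
  then show ?thesis unfolding 2 g_def[symmetric] complex_eq_iff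
    by (simp add: vre_def vim_def field_simps red)
qed

end

section \<open>Rotations in the hyperbolic plane\<close>

locale hermitian_basis =
  fixes h :: "complex^2 \<Rightarrow> complex^2 \<Rightarrow> complex" and e0 e1 :: "complex^2"
  assumes h_add: "h (u + v) w = h u w + h v w"
    and h_scale: "h (z *s u) v = z * h u v"
    and h_cnj: "h v u = cnj (h u v)"
    and basis: "h e0 e0 = 1" "h e1 e1 = -1" "h e0 e1 = 0"
begin

lemma h_add2: "h u (v + w) = h u v + h u w"
  by (metis h_add h_cnj complex_cnj_add)

lemma h_scale2: "h u (z *s v) = cnj z * h u v"
  by (metis h_scale h_cnj complex_cnj_mult)

lemma h_minus: "h (- u) w = - h u w" "h u (- w) = - h u w"
  using h_scale[of "-1" u w] h_scale2[of u "-1" w] by (simp_all flip: vector_sneg_minus1)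

lemma h_diff: "h (u - v) w = h u w - h v w" "h u (v - w) = h u v - h u w"
  using h_add[of u "- v" w] h_add2[of u v "- w"] by (simp_all add: h_minus)

lemmas h_simps = h_add h_scale h_add2 h_scale2 h_minus h_diff

lemma basis': "h e1 e0 = 0"
  using h_cnj[of e1 e0] basis by simp

lemma h_self_real: "Im (h v v) = 0"
  using h_cnj[of v v] by (simp add: complex_eq_iff)

lemma zero_scale: "0 *s (v :: complex^2) = 0"
  by simp

lemma h_zero [simp]: "h 0 v = 0" "h v 0 = 0"
  using h_scale[of 0 v v] h_scale2[of v 0 v] by (simp_all add: zero_scale)

lemma decomp: "v = h v e0 *s e0 + (- h v e1) *s e1"
proof -
  have sp: "UNIV \<subseteq> vec.span {e0, e1}"
  proof (rule vec.card_ge_dim_independent)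
    have ne: "e0 \<noteq> e1" using basis by auto
    have "e0 \<notin> vec.span {e1}"
    proof
      assume "e0 \<in> vec.span {e1}"
      then obtain z where "e0 = z *s e1" by (auto simp: vec.span_singleton)
      then show False using basis h_scale2[of e0 z e1] by auto
    qed
    moreover have "e1 \<noteq> 0" using basis by auto
    ultimately show "vec.independent {e0, e1}" using ne by (simp add: vec.independent_insert)
    show "vec.dim (UNIV :: (complex^2) set) \<le> card {e0, e1}" using ne unfolding vec_dim_card by simp
  qed simp
  then obtain s where "v - s *s e0 \<in> vec.span {e1}" by (metis UNIV_I subsetD vec.span_breakdown_eq)
  then obtain t where "v - s *s e0 = t *s e1" by (auto simp: vec.span_singleton)
  then have v: "v = s *s e0 + t *s e1" by (metis add.commute diff_add_cancel)
  have "h v e0 = s" "h v e1 = - t" unfolding v by (simp_all add: h_simps basis basis')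
  then show ?thesis using v by simp
qed

lemma h_ext: "h v e0 = h w e0 \<Longrightarrow> h v e1 = h w e1 \<Longrightarrow> v = w"
  by (metis decomp)

lemma h_formula: "h v w = h v e0 * cnj (h w e0) - h v e1 * cnj (h w e1)"
proof -
  have "h v w = h v (h w e0 *s e0 + (- h w e1) *s e1)" using decomp[of w] by simp
  then show ?thesis by (simp add: h_simps algebra_simps)
qed

lemma gram_det:
  "h u u * (h v v * h w w - h v w * h w v) - h u v * (h v u * h w w - h v w * h w u) + h u w * (h v u * h w v - h v v * h w u) = 0"
  unfolding h_formula[of u u] h_formula[of v v] h_formula[of w w] h_formula[of u v] h_formula[of v u]
    h_formula[of u w] h_formula[of w u] h_formula[of v w] h_formula[of w v]
  by (simp add: algebra_simps)

abbreviation unit :: "complex^2 \<Rightarrow> bool" where "unit c \<equiv> h c c = 1"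

definition Rv :: "complex^2 \<Rightarrow> complex \<Rightarrow> complex^2 \<Rightarrow> complex^2" where
  "Rv c k v = ((cnj k - k) * (h v c / h c c)) *s c + k *s v"

lemma Rv_unit: "unit c \<Longrightarrow> Rv c k v = ((cnj k - k) * h v c) *s c + k *s v"
  by (simp add: Rv_def)

lemma Rv_scale_centre: "z \<noteq> 0 \<Longrightarrow> Rv (z *s c) k v = Rv c k v"
  by (simp add: Rv_def h_simps)

lemma h_Rv:
  assumes "unit c" "k * cnj k = 1"
  shows "h (Rv c k u) (Rv c k v) = h u v"
proof -
  have "h (Rv c k u) (Rv c k v) = k * cnj k * h u v"
    using assms(1) h_cnj[of c v] by (simp add: Rv_unit h_simps algebra_simps)
  then show ?thesis using assms(2) by simp
qed

lemma Rv_inv: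
  assumes "unit c" "k * cnj k = 1"
  shows "Rv c (cnj k) (Rv c k v) = v"
proof -
  have k: "k * (cnj k * x) = x" for x using assms(2) by (simp flip: mult.assoc)
  have "cnj k * (k * x) = x" for x using assms(2) by (simp add: mult.commute flip: mult.assoc)
  with k show ?thesis using assms by (intro h_ext) (simp_all add: Rv_unit h_simps algebra_simps)
qed

lemma Rv_inv':
  assumes "unit c" "k * cnj k = 1"
  shows "Rv c k (Rv c (cnj k) v) = v"
  using Rv_inv[of c "cnj k" v] assms by (simp add: mult.commute)

lemma Rv_add: "Rv c k (u + v) = Rv c k u + Rv c k v"
  by (rule h_ext) (simp_all add: Rv_def h_simps algebra_simps add_divide_distrib)

lemma Rv_scale: "Rv c k (z *s v) = z *s Rv c k v"
  by (rule h_ext) (simp_all add: Rv_def h_simps algebra_simps)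

lemma Rv_unitary: "unit c \<Longrightarrow> k * cnj k = 1 \<Longrightarrow> Rv c k \<in> unitary h"
  by (simp add: unitary_def h_Rv Vector_Spaces.linear_iff Rv_add Rv_scale vec.vector_space_axioms)

lemma unitary_linear:
  assumes "g \<in> unitary h"
  shows "g (u + v) = g u + g v" "g (z *s v) = z *s g v" "h (g u) (g v) = h u v"
  using assms by (auto simp: unitary_def Vector_Spaces.linear_iff)

lemma Rv_equivariant: "g \<in> unitary h \<Longrightarrow> g (Rv c k v) = Rv (g c) k (g v)"
  by (simp add: Rv_def unitary_linear)

lemma Rv_centre: "unit c \<Longrightarrow> Rv c k c = cnj k *s c"
  by (rule h_ext) (simp_all add: Rv_unit h_simps algebra_simps)

lemma Rv_conj:
  assumes "unit c" "k * cnj k = 1"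
  shows "Rv (Rv c k c') m v = Rv c k (Rv c' m (Rv c (cnj k) v))"
  using Rv_equivariant[OF Rv_unitary[OF assms], of c' m "Rv c (cnj k) v"] Rv_inv'[OF assms] by simp

text \<open>The shape of the matrices of SU(1,1) in the coordinates \<open>h v e0\<close> and
  \<open>h v e1\<close>.\<close>

definition su :: "(complex^2 \<Rightarrow> complex^2) \<Rightarrow> bool" where
  "su g \<longleftrightarrow> (\<exists>\<alpha> \<beta>. \<forall>v. h (g v) e0 = \<alpha> * h v e0 + \<beta> * h v e1 \<and> h (g v) e1 = cnj \<beta> * h v e0 + cnj \<alpha> * h v e1)"

lemma su_Rv:
  assumes "unit c"
  shows "su (Rv c k)"
proof -
  define p q m where "p = h c e0" and "q = h c e1" and "m = cnj k - k"
  have pq: "p * cnj p = 1 + q * cnj q" using h_formula[of c c] assms by (simp add: p_def q_def algebra_simps)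
  have vc: "h v c = h v e0 * cnj p - h v e1 * cnj q" for v using h_formula[of v c] by (simp add: p_def q_def)
  have cm: "cnj m = - m" by (simp add: m_def)
  have ck: "cnj (k + m * (p * cnj p)) = k - m * (q * cnj q)"
  proof -
    have "cnj (k + m * (p * cnj p)) = cnj k - m * (p * cnj p)" by (simp add: cm mult.commute)
    also have "\<dots> = k - m * (q * cnj q)" unfolding pq by (simp add: m_def algebra_simps)
    finally show ?thesis .
  qed
  have "h (Rv c k v) e0 = (k + m * (p * cnj p)) * h v e0 + (- m * p * cnj q) * h v e1
      \<and> h (Rv c k v) e1 = cnj (- m * p * cnj q) * h v e0 + cnj (k + m * (p * cnj p)) * h v e1" for v
  proof
    have "h (Rv c k v) e0 = m * h v c * p + k * h v e0" "h (Rv c k v) e1 = m * h v c * q + k * h v e1"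
      by (simp_all add: Rv_unit[OF assms] h_simps p_def q_def m_def)
    note * = this[unfolded vc]
    show "h (Rv c k v) e0 = (k + m * (p * cnj p)) * h v e0 + (- m * p * cnj q) * h v e1"
      unfolding * by (simp add: algebra_simps)
    show "h (Rv c k v) e1 = cnj (- m * p * cnj q) * h v e0 + cnj (k + m * (p * cnj p)) * h v e1"
      unfolding * ck by (simp add: cm algebra_simps)
  qed
  then show ?thesis unfolding su_def by blast
qed

lemma su_compose:
  assumes "su f" "su g"
  shows "su (\<lambda>v. f (g v))"
proof -
  obtain a b where f: "\<And>v. h (f v) e0 = a * h v e0 + b * h v e1 \<and> h (f v) e1 = cnj b * h v e0 + cnj a * h v e1"
    using assms(1) unfolding su_def by blast
  obtain c d where g: "\<And>v. h (g v) e0 = c * h v e0 + d * h v e1 \<and> h (g v) e1 = cnj d * h v e0 + cnj c * h v e1"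
    using assms(2) unfolding su_def by blast
  show ?thesis unfolding su_def
    by (rule exI[of _ "a * c + b * cnj d"], rule exI[of _ "a * d + b * cnj c"]) (simp add: f g algebra_simps)
qed

lemma su_scalar:
  assumes "su g" "\<And>v. g v = z *s v" "h (g e0) (g e0) = h e0 e0"
  shows "z = 1 \<or> z = -1"
proof -
  obtain a b where g: "\<And>v. h (g v) e0 = a * h v e0 + b * h v e1 \<and> h (g v) e1 = cnj b * h v e0 + cnj a * h v e1"
    using assms(1) unfolding su_def by blast
  have "z = a" using g[of e0] by (simp add: assms(2) h_simps basis)
  moreover have "z = cnj a" using g[of e1] by (simp add: assms(2) h_simps basis basis')
  ultimately have "cnj z = z" by simp
  moreover have "z * cnj z = 1" using assms(3) by (simp add: assms(2) h_simps basis mult.commute)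
  ultimately have "z * z = 1" by simp
  then have "(z - 1) * (z + 1) = 0" by (simp add: algebra_simps)
  then show ?thesis by (auto simp: add_eq_0_iff2)
qed

text \<open>The first equation at c and the conjugate of the second give (a - e) times
  \<open>h c c\<close> = 0, hence a = e. Then b annihilates both components of c.\<close>

lemma su_fixed_line:
  assumes "su g" "unit c" "g c = complex_of_real e *s c"
  shows "g v = complex_of_real e *s v"
proof -
  obtain a b where g: "\<And>v. h (g v) e0 = a * h v e0 + b * h v e1 \<and> h (g v) e1 = cnj b * h v e0 + cnj a * h v e1"
    using assms(1) unfolding su_def by blast
  define p q where "p = h c e0" and "q = h c e1"
  have pq: "p * cnj p - q * cnj q = 1" using h_formula[of c c] assms(2) by (simp add: p_def q_def)
  have 1: "e * p = a * p + b * q" "e * q = cnj b * p + cnj a * q"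
    using g[of c] by (simp_all add: assms(3) h_simps p_def q_def)
  then have 2: "e * cnj q = b * cnj p + a * cnj q" by (metis complex_cnj_add complex_cnj_cnj complex_cnj_complex_of_real complex_cnj_mult)
  have "(a - e) * (p * cnj p - q * cnj q) = 0" using 1(1) 2 by algebra
  then have a: "a = e" using pq by simp
  then have "b * q = 0" "b * cnj p = 0" using 1(1) 2 by simp_all
  moreover have "p \<noteq> 0 \<or> q \<noteq> 0" using pq by auto
  ultimately have "b = 0" by auto
  then show ?thesis using g[of v] a by (intro h_ext) (simp_all add: h_simps)
qed

definition triv :: "(nat \<Rightarrow> complex) \<Rightarrow> complex^2 \<Rightarrow> complex^2 \<Rightarrow> complex^2 \<Rightarrow> complex^2 \<Rightarrow> bool" where
  "triv k c0 c1 c2 c3 \<longleftrightarrow> (\<exists>z. z \<noteq> 0 \<and> (\<forall>v. Rv c3 (k 3) (Rv c2 (k 2) (Rv c1 (k 1) (Rv c0 (k 0) v))) = z *s v))"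

context
  fixes k :: "nat \<Rightarrow> complex" and c0 c1 c2 c3
  assumes units: "unit c0" "unit c1" "unit c2" "unit c3" and k: "\<And>j. k j * cnj (k j) = 1"
begin

lemma kc: "cnj (k j) * k j = 1"
  using k[of j] by (simp add: mult.commute)

text \<open>By \<open>su_fixed_line\<close> the product of the four rotations is scalar as soon as
  it multiplies c0 by a sign, and by \<open>su_scalar\<close> no other scalar occurs. So the
  relation amounts to one equation between vectors.\<close>

lemma triv_iff:
  "triv k c0 c1 c2 c3 \<longleftrightarrow> (\<exists>e::real. e\<^sup>2 = (1::real) \<and> Rv c3 (k 3) (Rv c2 (k 2) (Rv c1 (k 1) c0)) = (e * k 0) *s c0)"
proof -
  define g where "g = (\<lambda>v. Rv c3 (k 3) (Rv c2 (k 2) (Rv c1 (k 1) (Rv c0 (k 0) v))))"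
  have su: "su g" unfolding g_def
    by (rule su_compose[OF su_Rv[OF units(4)] su_compose[OF su_Rv[OF units(3)] su_compose[OF su_Rv[OF units(2)] su_Rv[OF units(1)]]]])
  have gc: "k 0 *s g c0 = Rv c3 (k 3) (Rv c2 (k 2) (Rv c1 (k 1) c0))"
    using k[of 0] units by (simp add: g_def Rv_centre Rv_scale vector_smult_assoc)
  show ?thesis
  proof
    assume "triv k c0 c1 c2 c3"
    then obtain z where z: "\<And>v. g v = z *s v" by (auto simp: triv_def g_def)
    have "h (g e0) (g e0) = h e0 e0" using units k by (simp add: g_def h_Rv)
    then have "z = 1 \<or> z = -1" using su_scalar[OF su z] by blast
    then obtain e :: real where "e\<^sup>2 = 1" "z = e"
    proof
      assume "z = 1" then show thesis using that[of 1] by simp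
    next
      assume "z = -1" then show thesis using that[of "-1"] by simp
    qed
    then show "\<exists>e::real. e\<^sup>2 = (1::real) \<and> Rv c3 (k 3) (Rv c2 (k 2) (Rv c1 (k 1) c0)) = (e * k 0) *s c0"
      using gc z by (intro exI[of _ e]) (simp add: mult.commute)
  next
    assume "\<exists>e::real. e\<^sup>2 = (1::real) \<and> Rv c3 (k 3) (Rv c2 (k 2) (Rv c1 (k 1) c0)) = (e * k 0) *s c0"
    then obtain e :: real where e: "e\<^sup>2 = 1" "k 0 *s g c0 = (e * k 0) *s c0" using gc by metis
    have "g c0 = cnj (k 0) *s (k 0 *s g c0)" by (simp add: vector_smult_assoc kc)
    also have "\<dots> = (e * (cnj (k 0) * k 0)) *s c0" unfolding e(2) vector_smult_assoc by (simp only: mult.left_commute)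
    also have "\<dots> = complex_of_real e *s c0" by (simp add: kc)
    finally have "g v = complex_of_real e *s v" for v using su_fixed_line[OF su units(1)] by blast
    moreover have "e \<noteq> 0" using e(1) by auto
    ultimately show "triv k c0 c1 c2 c3" unfolding triv_def g_def by (intro exI[of _ "complex_of_real e"]) simp
  qed
qed

text \<open>Inverting the relation inverts the scalar, and conjugating by one rotation after the
  other permutes the factors cyclically without changing the scalar.\<close>

lemma triv_cyclic:
  assumes "triv k c0 c1 c2 c3"
  obtains z where "z \<noteq> 0" "\<And>v. Rv c1 (cnj (k 1)) (Rv c2 (cnj (k 2)) (Rv c3 (cnj (k 3)) (Rv c0 (cnj (k 0)) v))) = z *s v"
    "\<And>v. Rv c2 (cnj (k 2)) (Rv c3 (cnj (k 3)) (Rv c0 (cnj (k 0)) (Rv c1 (cnj (k 1)) v))) = z *s v"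
    "\<And>v. Rv c0 (cnj (k 0)) (Rv c1 (cnj (k 1)) (Rv c2 (cnj (k 2)) (Rv c3 (cnj (k 3)) v))) = z *s v"
proof -
  obtain z where z: "z \<noteq> 0" "\<And>v. Rv c3 (k 3) (Rv c2 (k 2) (Rv c1 (k 1) (Rv c0 (k 0) v))) = z *s v"
    using assms by (auto simp: triv_def)
  note I = Rv_inv[OF units(1) k] Rv_inv[OF units(2) k] Rv_inv[OF units(3) k] Rv_inv[OF units(4) k]
    Rv_inv'[OF units(1) k] Rv_inv'[OF units(2) k] Rv_inv'[OF units(3) k] Rv_inv'[OF units(4) k]
  have z1: "(1 / z) *s (z *s v) = v" "z *s ((1 / z) *s v) = v" for v :: "complex^2" using z(1) by simp_all
  have a: "Rv c0 (cnj (k 0)) (Rv c1 (cnj (k 1)) (Rv c2 (cnj (k 2)) (Rv c3 (cnj (k 3)) v))) = (1 / z) *s v" for v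
  proof -
    define u where "u = Rv c0 (cnj (k 0)) (Rv c1 (cnj (k 1)) (Rv c2 (cnj (k 2)) (Rv c3 (cnj (k 3)) v)))"
    have "v = z *s u" using z(2)[of u] unfolding u_def by (simp only: I)
    then show ?thesis using z1 u_def by metis
  qed
  have b: "Rv c1 (cnj (k 1)) (Rv c2 (cnj (k 2)) (Rv c3 (cnj (k 3)) (Rv c0 (cnj (k 0)) v))) = (1 / z) *s v" for v
    using arg_cong[OF a[of "Rv c0 (cnj (k 0)) v"], of "Rv c0 (k 0)"] by (simp only: I Rv_scale)
  have c: "Rv c2 (cnj (k 2)) (Rv c3 (cnj (k 3)) (Rv c0 (cnj (k 0)) (Rv c1 (cnj (k 1)) v))) = (1 / z) *s v" for v
    using arg_cong[OF b[of "Rv c1 (cnj (k 1)) v"], of "Rv c1 (k 1)"] by (simp only: I Rv_scale)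
  show ?thesis by (rule that[of "1 / z"]) (use z(1) a b c in auto)
qed

end

end

section \<open>Hexagons in coordinates\<close>

text \<open>Lagrange's identity in signature (1,1): the excess over 1 is the squared modulus of p q'
  - q p'.\<close>

lemma (in hermitian_basis) unit_ge_1:
  assumes "unit u" "unit v"
  shows "(cmod (h u v))\<^sup>2 \<ge> 1"
proof -
  define p q p' q' where "p = h u e0" and "q = h u e1" and "p' = h v e0" and "q' = h v e1"
  have 1: "p * cnj p = 1 + q * cnj q" "p' * cnj p' = 1 + q' * cnj q'"
    using h_formula[of u u] h_formula[of v v] assms by (simp_all add: p_def q_def p'_def q'_def algebra_simps)
  have "of_real ((cmod (h u v))\<^sup>2) = h u v * cnj (h u v)" by (rule complex_norm_square)
  also have "\<dots> = (p * cnj p' - q * cnj q') * (cnj p * p' - cnj q * q')"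
    unfolding h_formula[of u v] by (simp add: p_def q_def p'_def q'_def)
  also have "\<dots> = (p * cnj p) * (p' * cnj p') + (q * cnj q) * (q' * cnj q') - (p * cnj q * cnj p' * q' + cnj p * q * p' * cnj q')"
    by (simp add: algebra_simps)
  also have "\<dots> = 1 + (p * q' - q * p') * cnj (p * q' - q * p')"
    unfolding 1 using 1 by (simp add: algebra_simps) algebra
  also have "\<dots> = of_real (1 + (cmod (p * q' - q * p'))\<^sup>2)"
    by (simp only: of_real_add of_real_1 complex_norm_square)
  finally have "(cmod (h u v))\<^sup>2 = 1 + (cmod (p * q' - q * p'))\<^sup>2" by (simp only: of_real_eq_iff)
  then show ?thesis by simp
qed

locale configuration = hermitian_basis +
  fixes C r :: "nat \<Rightarrow> real"
  assumes Cr: "(C j)\<^sup>2 + (r j)\<^sup>2 = 1" and r_nonzero: "j \<le> 3 \<Longrightarrow> r j \<noteq> 0"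
begin

definition K :: "nat \<Rightarrow> complex" where "K j = Complex (C j) (r j)"

lemma K_norm: "K j * cnj (K j) = 1"
  using Cr[of j] by (simp add: K_def complex_eq_iff power2_eq_square)

lemma K_diff: "cnj (K j) - K j = - 2 * \<i> * r j"
  by (simp add: K_def complex_eq_iff)

lemma trig: "e\<^sup>2 = 1 \<Longrightarrow> trig (C 0) (C 1) (C 2) (C 3) (r 0) (r 1) (r 2) (r 3) e"
  by unfold_locales (use Cr r_nonzero in auto)

abbreviation GG :: "real \<Rightarrow> real \<Rightarrow> real \<Rightarrow> real \<Rightarrow> complex" where
  "GG e \<equiv> trig.gg (C 0) (C 1) (C 2) (C 3) (r 0) (r 1) (r 2) (r 3) e"

text \<open>With p1 = R1 c0, both sides of the equation will be the product of R2 p1 with p1: on the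
  left directly, on the right through R2 p1 = e k0 R3^(-1) c0. It is linear in g, so t1, t2, t3
  determine the triple product.\<close>

lemma GG_equation:
  assumes "e\<^sup>2 = (1::real)"
  shows "g = GG e t1 t2 t3 \<longleftrightarrow> - 2 * \<i> * r 2 * t2 + K 2 = e * K 0 * (2 * \<i> * r 3 * (2 * \<i> * r 1 * g + cnj (K 1) * t3)
      + cnj (K 3) * (2 * \<i> * r 1 * t1 + cnj (K 1)))"
proof -
  interpret trig "C 0" "C 1" "C 2" "C 3" "r 0" "r 1" "r 2" "r 3" e by (rule trig[OF assms])
  define R where "R = r 2 * t2 + e * r 3 * (K 0 * cnj (K 1)) * t3 + e * r 1 * (K 0 * cnj (K 3)) * t1
     + \<i> / 2 * (K 2 - e * (K 0 * cnj (K 1) * cnj (K 3)))"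
  define Q where "Q = - 2 * \<i> * e * r 1 * r 3 * K 0"
  have lin: "Q * GG e t1 t2 t3 = R"
    using gg_linear[of t1 t2 t3] by (simp add: Q_def R_def K_def complex_cnj)
  have "K 0 \<noteq> 0" using K_norm[of 0] by auto
  moreover have "e \<noteq> 0" using assms by auto
  ultimately have Q: "Q \<noteq> 0" using r_nonzero[of 1] r_nonzero[of 3] by (simp add: Q_def)
  have aux: "L = M \<longleftrightarrow> Q * g = R" if "L - M = 2 * \<i> * (Q * g - R)" for L M
  proof -
    have "L = M \<longleftrightarrow> L - M = 0" by simp
    also have "\<dots> \<longleftrightarrow> Q * g = R" unfolding that by simp
    finally show ?thesis .
  qed
  have "(- 2 * \<i> * r 2 * t2 + K 2 = e * K 0 * (2 * \<i> * r 3 * (2 * \<i> * r 1 * g + cnj (K 1) * t3)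
      + cnj (K 3) * (2 * \<i> * r 1 * t1 + cnj (K 1)))) \<longleftrightarrow> Q * g = R"
    by (rule aux) (simp add: Q_def R_def algebra_simps)
  also have "\<dots> \<longleftrightarrow> g = GG e t1 t2 t3" unfolding lin[symmetric] using Q by simp
  finally show ?thesis by blast
qed

context
  fixes c0 c1 c3
  assumes units: "unit c0" "unit c1" "unit c3"
begin

text \<open>Unlike the single products, g does not change when the three vectors are multiplied by
  scalars of modulus 1. The first claim is the vanishing of the Gram determinant, multiplied by t1
  t3.\<close>

lemma triple_product:
  defines "g \<equiv> h c0 c3 * cnj (h c0 c1) * h c3 c1"
    and "t1 \<equiv> (cmod (h c1 c0))\<^sup>2" and "t3 \<equiv> (cmod (h c3 c0))\<^sup>2"
  shows "(cmod g)\<^sup>2 = t1 * t3 * (2 * Re g - t1 - t3 + 1)"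
    "h c0 c1 * cnj (h c0 c1) = t1" "h c0 c3 * cnj (h c0 c3) = t3"
    "h (Rv c1 (K 1) c0) c0 = - 2 * \<i> * r 1 * t1 + K 1"
    "h c0 (Rv c1 (K 1) c0) = 2 * \<i> * r 1 * t1 + cnj (K 1)"
    "h (Rv c3 (cnj (K 3)) c0) c0 = 2 * \<i> * r 3 * t3 + cnj (K 3)"
    "h c0 c3 * h c3 (Rv c1 (K 1) c0) = 2 * \<i> * r 1 * g + cnj (K 1) * t3"
    "cnj (h c0 c1) * h (Rv c3 (cnj (K 3)) c0) c1 = 2 * \<i> * r 3 * g + cnj (K 3) * t1"
    "h (Rv c3 (cnj (K 3)) c0) (Rv c1 (K 1) c0) = 2 * \<i> * r 3 * (2 * \<i> * r 1 * g + cnj (K 1) * t3)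
      + cnj (K 3) * (2 * \<i> * r 1 * t1 + cnj (K 1))"
proof -
  define x y s where "x = h c0 c1" and "y = h c0 c3" and "s = h c3 c1"
  have xy: "h c1 c0 = cnj x" "h c3 c0 = cnj y" "h c1 c3 = cnj s"
    using h_cnj[of c1 c0] h_cnj[of c3 c0] h_cnj[of c1 c3] by (simp_all add: x_def y_def s_def)
  have g: "g = y * cnj x * s" by (simp add: g_def x_def y_def s_def)
  have T: "x * cnj x = t1" "y * cnj y = t3"
    using complex_norm_square[of x] complex_norm_square[of y] by (simp_all add: t1_def t3_def xy)
  show "h c0 c1 * cnj (h c0 c1) = t1" "h c0 c3 * cnj (h c0 c3) = t3" using T by (simp_all add: x_def y_def)
  have det: "s * cnj s = 1 - x * cnj x - y * cnj y + x * cnj s * cnj y + y * cnj x * s"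
    using gram_det[of c0 c1 c3] units by (simp add: xy x_def[symmetric] y_def[symmetric] s_def[symmetric] algebra_simps)
  have "of_real ((cmod g)\<^sup>2) = g * cnj g" by (rule complex_norm_square)
  also have "\<dots> = (x * cnj x) * (y * cnj y) * (s * cnj s)" by (simp add: g algebra_simps)
  also have "\<dots> = t1 * t3 * (1 - t1 - t3 + (g + cnj g))" unfolding det T by (simp add: g algebra_simps)
  also have "g + cnj g = of_real (2 * Re g)" by (rule complex_add_cnj)
  also have "of_real (t1 * t3) * (of_real (1 - t1 - t3) + of_real (2 * Re g)) = complex_of_real (t1 * t3 * (2 * Re g - t1 - t3 + 1))"
    by (simp add: algebra_simps)
  finally show "(cmod g)\<^sup>2 = t1 * t3 * (2 * Re g - t1 - t3 + 1)" by (simp only: of_real_eq_iff)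
  have a1: "Rv c1 (K 1) c0 = (- 2 * \<i> * r 1 * x) *s c1 + K 1 *s c0"
    using Rv_unit[OF units(2), of "K 1" c0] K_diff[of 1] by (simp add: x_def)
  have "K 3 - cnj (K 3) = 2 * \<i> * r 3" using K_diff[of 3] by (simp add: algebra_simps)
  then have b3: "Rv c3 (cnj (K 3)) c0 = (2 * \<i> * r 3 * y) *s c3 + cnj (K 3) *s c0"
    using Rv_unit[OF units(3), of "cnj (K 3)" c0] by (simp add: y_def)
  show 1: "h (Rv c1 (K 1) c0) c0 = - 2 * \<i> * r 1 * t1 + K 1"
    unfolding a1 by (simp add: h_simps xy units flip: T)
  show 2: "h c0 (Rv c1 (K 1) c0) = 2 * \<i> * r 1 * t1 + cnj (K 1)"
    using h_cnj[of c0 "Rv c1 (K 1) c0"] unfolding 1 by simp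
  show "h (Rv c3 (cnj (K 3)) c0) c0 = 2 * \<i> * r 3 * t3 + cnj (K 3)"
    unfolding b3 by (simp add: h_simps xy units flip: T)
  show 3: "h c0 c3 * h c3 (Rv c1 (K 1) c0) = 2 * \<i> * r 1 * g + cnj (K 1) * t3"
    unfolding a1 by (simp add: h_simps xy units g flip: T x_def y_def s_def) (simp add: algebra_simps)
  show "cnj (h c0 c1) * h (Rv c3 (cnj (K 3)) c0) c1 = 2 * \<i> * r 3 * g + cnj (K 3) * t1"
    unfolding b3 by (simp add: h_simps xy units g flip: T x_def y_def s_def) (simp add: algebra_simps)
  have "h (Rv c3 (cnj (K 3)) c0) (Rv c1 (K 1) c0) = 2 * \<i> * r 3 * (h c0 c3 * h c3 (Rv c1 (K 1) c0)) + cnj (K 3) * h c0 (Rv c1 (K 1) c0)"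
    unfolding b3 by (simp add: h_simps y_def mult.assoc)
  then show "h (Rv c3 (cnj (K 3)) c0) (Rv c1 (K 1) c0) = 2 * \<i> * r 3 * (2 * \<i> * r 1 * g + cnj (K 1) * t3)
      + cnj (K 3) * (2 * \<i> * r 1 * t1 + cnj (K 1))" unfolding 2 3 .
qed

end

abbreviation XX :: "nat \<Rightarrow> real \<Rightarrow> real" where
  "XX j t \<equiv> 2 * r 0 * r j * (2 * t - 1) - 2 * C 0 * C j"

text \<open>t1', t2', t3' are the values after the three modifications, see \<open>vhex_tv\<close>.
  Each is identified with the other root of the cubic through a formula for the product t_j
  t_j'.\<close>

theorem hexagon_equations:
  assumes units: "unit c0" "unit c1" "unit c2" "unit c3" and e: "e\<^sup>2 = (1::real)"
    and eq: "Rv c3 (K 3) (Rv c2 (K 2) (Rv c1 (K 1) c0)) = (e * K 0) *s c0"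
  defines "t1 \<equiv> (cmod (h c1 c0))\<^sup>2" and "t2 \<equiv> (cmod (h c2 (Rv c1 (K 1) c0)))\<^sup>2" and "t3 \<equiv> (cmod (h c3 c0))\<^sup>2"
    and "t1' \<equiv> (cmod (h c1 (Rv c3 (cnj (K 3)) c0)))\<^sup>2" and "t2' \<equiv> (cmod (h c2 c0))\<^sup>2"
    and "t3' \<equiv> (cmod (h c3 (Rv c1 (K 1) c0)))\<^sup>2"
  shows "t1 \<ge> 1" "t2 \<ge> 1" "t3 \<ge> 1"
    and "fricke (e * C 0) (C 1) (C 2) (C 3) (e * XX 1 t1) (e * XX 2 t2) (e * XX 3 t3) = 0"
    and "e * XX 1 t1' = e * XX 1 t1 + slope (e * C 0) (C 1) (C 2) (C 3) (e * XX 1 t1) (e * XX 2 t2) (e * XX 3 t3)"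
    and "e * XX 2 t2' = e * XX 2 t2 + slope (e * C 0) (C 2) (C 1) (C 3) (e * XX 2 t2) (e * XX 1 t1) (e * XX 3 t3)"
    and "e * XX 3 t3' = e * XX 3 t3 + slope (e * C 0) (C 3) (C 1) (C 2) (e * XX 3 t3) (e * XX 1 t1) (e * XX 2 t2)"
proof -
  interpret trig "C 0" "C 1" "C 2" "C 3" "r 0" "r 1" "r 2" "r 3" e by (rule trig[OF e])
  have X: "X1 t = e * XX 1 t" "X2 t = e * XX 2 t" "X3 t = e * XX 3 t" for t unfolding X1_def X2_def X3_def by simp_all
  define a1 b3 where "a1 = Rv c1 (K 1) c0" and "b3 = Rv c3 (cnj (K 3)) c0"
  define x y w g where "x = h c0 c1" and "y = h c0 c3" and "w = h a1 c2" and "g = h c0 c3 * cnj (h c0 c1) * h c3 c1"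
  have ua: "unit a1" using h_Rv[OF units(2) K_norm] units(1) by (simp add: a1_def)
  show ge: "t1 \<ge> 1" "t2 \<ge> 1" "t3 \<ge> 1"
    unfolding t1_def t2_def t3_def a1_def[symmetric] by (rule unit_ge_1[OF _ _]; fact units ua)+
  note tp = triple_product[OF units(1,2,4), folded t1_def t3_def g_def a1_def b3_def x_def y_def]
  have w: "h c2 a1 = cnj w" using h_cnj[of c2 a1] by (simp add: w_def)
  have t2c: "t2 = (cmod w)\<^sup>2" unfolding t2_def a1_def[symmetric] w by simp
  have ww: "w * cnj w = t2" unfolding t2c complex_norm_square ..
  have "Rv c3 (cnj (K 3)) (Rv c3 (K 3) (Rv c2 (K 2) a1)) = (e * K 0) *s b3"
    using eq by (simp add: a1_def b3_def Rv_scale)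
  then have "Rv c2 (K 2) a1 = (e * K 0) *s b3" using Rv_inv[OF units(4) K_norm] by simp
  moreover have "Rv c2 (K 2) a1 = (- 2 * \<i> * r 2 * w) *s c2 + K 2 *s a1"
    using Rv_unit[OF units(3), of "K 2" a1] K_diff[of 2] by (simp add: w_def)
  \<comment> \<open>Pairing this equation with p1 determines the triple product g; pairing it with
    c0 yields t2'.\<close>
  ultimately have E: "(- 2 * \<i> * r 2 * w) *s c2 + K 2 *s a1 = (e * K 0) *s b3" by simp
  have "- 2 * \<i> * r 2 * t2 + K 2 = e * K 0 * h b3 a1"
    using arg_cong[OF E, of "\<lambda>v. h v a1"] by (simp add: h_simps w ua mult.assoc flip: ww)
  then have g: "g = GG e t1 t2 t3" unfolding GG_equation[OF e] tp(9) .
  note G = tp(1)[unfolded g]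
  show fr: "fricke (e * C 0) (C 1) (C 2) (C 3) (e * XX 1 t1) (e * XX 2 t2) (e * XX 3 t3) = 0"
    using gram_gg[of t1 t2 t3] G unfolding X by simp
  have n1: "t1 * t1' = (cmod (Complex (C 3) (- r 3) * t1 + 2 * \<i> * r 3 * GG e t1 t2 t3))\<^sup>2"
  proof -
    have "h c1 b3 = cnj (h b3 c1)" by (rule h_cnj)
    then have "t1' = (cmod (h b3 c1))\<^sup>2" by (simp add: t1'_def b3_def[symmetric])
    moreover have "t1 = (cmod (cnj x))\<^sup>2" using h_cnj[of c1 c0] by (simp add: t1_def x_def)
    ultimately have "t1 * t1' = (cmod (cnj x * h b3 c1))\<^sup>2" by (simp add: norm_mult power_mult_distrib)
    then show ?thesis unfolding tp(8) g[symmetric] by (simp add: K_def complex_cnj add.commute)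
  qed
  have n3: "t3 * t3' = (cmod (Complex (C 1) (r 1) * t3 - 2 * \<i> * r 1 * cnj (GG e t1 t2 t3)))\<^sup>2"
  proof -
    have "t3 = (cmod y)\<^sup>2" using h_cnj[of c3 c0] by (simp add: t3_def y_def)
    moreover have "t3' = (cmod (h c3 a1))\<^sup>2" by (simp only: t3'_def a1_def)
    ultimately have "t3 * t3' = (cmod (y * h c3 a1))\<^sup>2" by (simp add: norm_mult power_mult_distrib)
    also have "\<dots> = (cmod (cnj (2 * \<i> * r 1 * g + cnj (K 1) * t3)))\<^sup>2" unfolding tp(7) by (simp only: complex_mod_cnj)
    also have "cnj (2 * \<i> * r 1 * g + cnj (K 1) * t3) = Complex (C 1) (r 1) * t3 - 2 * \<i> * r 1 * cnj g"
      by (simp add: K_def)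
    finally show ?thesis unfolding g .
  qed
  define Y where "Y = K 2 * h a1 c0 - e * K 0 * h b3 c0"
  have n2: "4 * (r 2)\<^sup>2 * (t2 * t2') = (cmod Y)\<^sup>2"
  proof -
    have "2 * \<i> * r 2 * (w * h c2 c0) = Y"
      using arg_cong[OF E, of "\<lambda>v. h v c0"] by (simp add: h_simps Y_def algebra_simps)
    then have "(cmod Y)\<^sup>2 = (cmod (2 * \<i> * r 2 * (w * h c2 c0)))\<^sup>2" by simp
    also have "\<dots> = 4 * (r 2)\<^sup>2 * ((cmod w)\<^sup>2 * t2')"
      by (simp add: norm_mult power_mult_distrib t2'_def)
    also have "(cmod w)\<^sup>2 = t2" by (rule t2c[symmetric])
    finally show ?thesis by simp
  qed
  have Y: "(cmod Y)\<^sup>2 = (C 1 * C 2 - r 1 * r 2 - e * (C 0 * C 3 + r 0 * r 3) + 2 * r 1 * r 2 * t1 + 2 * e * r 3 * r 0 * t3)\<^sup>2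
      + (C 1 * r 2 + r 1 * C 2 - e * (r 0 * C 3 - C 0 * r 3) - 2 * r 1 * C 2 * t1 - 2 * e * r 3 * C 0 * t3)\<^sup>2"
  proof -
    have "Re Y = C 1 * C 2 - r 1 * r 2 - e * (C 0 * C 3 + r 0 * r 3) + 2 * r 1 * r 2 * t1 + 2 * e * r 3 * r 0 * t3"
      "Im Y = C 1 * r 2 + r 1 * C 2 - e * (r 0 * C 3 - C 0 * r 3) - 2 * r 1 * C 2 * t1 - 2 * e * r 3 * C 0 * t3"
      unfolding Y_def tp(4) tp(6) by (simp_all add: K_def algebra_simps)
    then show ?thesis unfolding cmod_power2 by simp
  qed
  have d: "e * XX j s' = e * XX j s + v" if "4 * e * r 0 * r j * s' = 4 * e * r 0 * r j * s + v" for j s s' v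
    using that by (simp add: algebra_simps)
  have ee: "e * (e * z) = z" for z using e by (simp add: power2_eq_square flip: mult.assoc)
  show "e * XX 1 t1' = e * XX 1 t1 + slope (e * C 0) (C 1) (C 2) (C 3) (e * XX 1 t1) (e * XX 2 t2) (e * XX 3 t3)"
  proof (rule d)
    have "t1 * (4 * e * r 0 * r 1 * t1') = 4 * e * r 0 * r 1 * (t1 * t1')" by simp
    also have "\<dots> = t1 * (4 * e * r 0 * r 1 * t1 + slope (e * C 0) (C 1) (C 2) (C 3) (e * XX 1 t1) (e * XX 2 t2) (e * XX 3 t3))"
      unfolding n1 other_root_1[OF G] X ..
    finally show "4 * e * r 0 * r 1 * t1' = 4 * e * r 0 * r 1 * t1 + slope (e * C 0) (C 1) (C 2) (C 3) (e * XX 1 t1) (e * XX 2 t2) (e * XX 3 t3)"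
      using ge by simp
  qed
  show "e * XX 3 t3' = e * XX 3 t3 + slope (e * C 0) (C 3) (C 1) (C 2) (e * XX 3 t3) (e * XX 1 t1) (e * XX 2 t2)"
  proof (rule d)
    have "t3 * (4 * e * r 0 * r 3 * t3') = 4 * e * r 0 * r 3 * (t3 * t3')" by simp
    also have "\<dots> = t3 * (4 * e * r 0 * r 3 * t3 + slope (e * C 0) (C 3) (C 1) (C 2) (e * XX 3 t3) (e * XX 1 t1) (e * XX 2 t2))"
      unfolding n3 other_root_3[OF G] X ..
    finally show "4 * e * r 0 * r 3 * t3' = 4 * e * r 0 * r 3 * t3 + slope (e * C 0) (C 3) (C 1) (C 2) (e * XX 3 t3) (e * XX 1 t1) (e * XX 2 t2)"
      using ge by simp
  qed
  show "e * XX 2 t2' = e * XX 2 t2 + slope (e * C 0) (C 2) (C 1) (C 3) (e * XX 2 t2) (e * XX 1 t1) (e * XX 3 t3)"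
  proof (rule d)
    define S where "S = slope (e * C 0) (C 2) (C 1) (C 3) (e * XX 2 t2) (e * XX 1 t1) (e * XX 3 t3)"
    have "4 * (r 0)\<^sup>2 * (4 * (r 2)\<^sup>2 * (t2 * t2')) = 16 * (r 0)\<^sup>2 * (r 2)\<^sup>2 * t2\<^sup>2 + 4 * r 0 * r 2 * e * t2 * S"
      unfolding n2 Y vieta2[of t1 t3 t2] X fr S_def by simp
    then have "(4 * r 0 * r 2 * t2) * (4 * r 0 * r 2 * t2') = (4 * r 0 * r 2 * t2) * (4 * r 0 * r 2 * t2 + e * S)"
      by (simp add: power2_eq_square algebra_simps)
    then have "4 * r 0 * r 2 * t2' = 4 * r 0 * r 2 * t2 + e * S"
      using ge r_nonzero[of 0] r_nonzero[of 2] by simp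
    then have "e * (4 * r 0 * r 2 * t2') = e * (4 * r 0 * r 2 * t2 + e * S)" by simp
    then show "4 * e * r 0 * r 2 * t2' = 4 * e * r 0 * r 2 * t2 + S" by (simp add: distrib_left ee)
  qed
qed

text \<open>With c0 = e0, the vectors c1 and c3 are chosen to have the values t1, t3 and the triple
  product that \<open>GG_equation\<close> demands; this is possible since the cubic is the vanishing
  of the Gram determinant. Then c2 is read off from the required action of R2.\<close>

theorem hexagon_exists:
  assumes e: "e\<^sup>2 = (1::real)" and t: "t1 \<ge> 1" "t2 \<ge> 1" "t3 \<ge> 1"
    and fr: "fricke (e * C 0) (C 1) (C 2) (C 3) (e * XX 1 t1) (e * XX 2 t2) (e * XX 3 t3) = 0"
  obtains c1 c2 c3 where "unit c1" "unit c2" "unit c3"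
    "Rv c3 (K 3) (Rv c2 (K 2) (Rv c1 (K 1) e0)) = (e * K 0) *s e0"
    "(cmod (h c1 e0))\<^sup>2 = t1" "(cmod (h c2 (Rv c1 (K 1) e0)))\<^sup>2 = t2" "(cmod (h c3 e0))\<^sup>2 = t3"
proof -
  interpret trig "C 0" "C 1" "C 2" "C 3" "r 0" "r 1" "r 2" "r 3" e by (rule trig[OF e])
  have X: "X1 t = e * XX 1 t" "X2 t = e * XX 2 t" "X3 t = e * XX 3 t" for t unfolding X1_def X2_def X3_def by simp_all
  define g where "g = GG e t1 t2 t3"
  have G: "(cmod g)\<^sup>2 = t1 * t3 * (2 * Re g - t1 - t3 + 1)"
    using gram_gg[of t1 t2 t3] fr r_nz unfolding X g_def by simp
  define n where "n = (cmod (of_real (t1 * t3) - g))\<^sup>2"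
  have n: "n = t1 * (t1 - 1) * (t3 * (t3 - 1))"
  proof -
    have "n = (t1 * t3)\<^sup>2 - 2 * t1 * t3 * Re g + (cmod g)\<^sup>2"
      unfolding n_def cmod_power2 by (simp add: power2_eq_square algebra_simps)
    then show ?thesis unfolding G by (simp add: power2_eq_square algebra_simps)
  qed
  define m where "m = sqrt t1 * sqrt (t1 - 1)"
  have m2: "m\<^sup>2 = t1 * (t1 - 1)" using t by (simp add: m_def power_mult_distrib)
  \<comment> \<open>z / sqrt t3 will be the second coordinate of c3. For t1 = 1 the vector c1 will
    be e0, the triple product does not involve z, and any z of the right modulus serves.\<close>
  obtain z :: complex where z: "(cmod z)\<^sup>2 = t3 * (t3 - 1)" "of_real (t1 * t3) - g = z * m"
  proof (cases "t1 = 1")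
    case True
    then have "g = of_real (t1 * t3)" using n by (simp add: n_def)
    then show ?thesis using that[of "of_real (sqrt (t3 * (t3 - 1)))"] t True by (simp add: m_def)
  next
    case False
    then have "m > 0" using t by (simp add: m_def)
    have "(cmod ((of_real (t1 * t3) - g) / m))\<^sup>2 = n / m\<^sup>2" by (simp add: n_def norm_divide power_divide)
    also have "\<dots> = t3 * (t3 - 1)" using False t unfolding n m2 by simp
    finally show ?thesis using that[of "(of_real (t1 * t3) - g) / m"] \<open>m > 0\<close> by simp
  qed
  define V where "V = (\<lambda>p q :: complex. p *s e0 + (- q) *s e1)"
  have V: "h (V p q) e0 = p" "h (V p q) e1 = q" for p q by (simp_all add: V_def h_simps basis basis')
  define c1 c3 where "c1 = V (sqrt t1) (sqrt (t1 - 1))" and "c3 = V (sqrt t3) (z / sqrt t3)"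
  have u1: "unit c1" using t h_formula[of c1 c1] by (simp add: c1_def V flip: of_real_mult)
  have q: "h c3 e0 = sqrt t3" "h c3 e1 = z / sqrt t3" by (simp_all add: c3_def V)
  have st3: "complex_of_real (sqrt t3) * complex_of_real (sqrt t3) = t3" using t by (simp flip: of_real_mult)
  have zz: "z * cnj z = of_real (t3 * (t3 - 1))" using complex_norm_square[of z] unfolding z(1) by simp
  have "h c3 c3 = complex_of_real (sqrt t3) * complex_of_real (sqrt t3)
      - (z * cnj z) / (complex_of_real (sqrt t3) * complex_of_real (sqrt t3))"
    unfolding h_formula[of c3 c3] q by simp
  also have "\<dots> = 1" unfolding st3 zz using t by simp
  finally have u3: "unit c3" .
  have u0: "unit e0" by (rule basis)
  have hc: "h e0 c1 = sqrt t1" "h e0 c3 = sqrt t3" "h c1 e0 = sqrt t1" "h c3 e0 = sqrt t3"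
    using h_cnj[of e0 c1] h_cnj[of e0 c3] by (simp_all add: c1_def c3_def V)
  have t13: "(cmod (h c1 e0))\<^sup>2 = t1" "(cmod (h c3 e0))\<^sup>2 = t3" using t by (simp_all add: hc)
  have hcc: "h c3 c1 = of_real (sqrt t3) * of_real (sqrt t1) - z / of_real (sqrt t3) * of_real (sqrt (t1 - 1))"
    unfolding h_formula[of c3 c1] q by (simp add: c1_def V)
  have st1: "complex_of_real (sqrt t1) * complex_of_real (sqrt t1) = t1" using t by (simp flip: of_real_mult)
  have "complex_of_real (sqrt t3) \<noteq> 0" using t by simp
  then have "h e0 c3 * cnj (h e0 c1) * h c3 c1 = (complex_of_real (sqrt t3) * complex_of_real (sqrt t3)) *
      (complex_of_real (sqrt t1) * complex_of_real (sqrt t1)) - z * (complex_of_real (sqrt t1) * complex_of_real (sqrt (t1 - 1)))"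
    unfolding hcc hc by (simp add: field_simps)
  then have "h e0 c3 * cnj (h e0 c1) * h c3 c1 = of_real (t1 * t3) - z * m"
    unfolding st3 st1 m_def by simp
  then have g: "h e0 c3 * cnj (h e0 c1) * h c3 c1 = g" using z(2) by (simp add: algebra_simps)
  note tp = triple_product[OF u0 u1 u3, unfolded t13 g]
  define a1 b3 where "a1 = Rv c1 (K 1) e0" and "b3 = Rv c3 (cnj (K 3)) e0"
  have ua: "unit a1" using h_Rv[OF u1 K_norm] u0 by (simp add: a1_def)
  have ub: "unit b3" using h_Rv[OF u3, of "cnj (K 3)"] K_norm[of 3] u0 by (simp add: b3_def mult.commute)
  have ba: "- 2 * \<i> * r 2 * t2 + K 2 = e * K 0 * h b3 a1"
    unfolding a1_def b3_def tp(9) by (rule iffD1[OF GG_equation[OF e]]) (rule g_def)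
  define mm where "mm = cnj (K 2) - K 2"
  have mm: "mm = - 2 * \<i> * r 2" "mm \<noteq> 0" using K_diff[of 2] r_nonzero[of 2] by (simp_all add: mm_def)
  \<comment> \<open>R2 p1 - k2 p1 must be a multiple of c2, so \<open>dd\<close> has the direction
    of c2. Its square turns out to be t2, which fixes the scaling.\<close>
  define dd where "dd = (1 / mm) *s ((e * K 0) *s b3 - K 2 *s a1)"
  have D: "mm *s dd = (e * K 0) *s b3 - K 2 *s a1" using mm(2) by (simp add: dd_def)
  have "mm * h dd a1 = e * K 0 * h b3 a1 - K 2" using arg_cong[OF D, of "\<lambda>v. h v a1"] ua by (simp add: h_simps)
  also have "\<dots> = mm * t2" unfolding ba[symmetric] mm(1) by simp
  finally have da: "h dd a1 = t2" using mm(2) by simp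
  have ad: "h a1 dd = t2" using h_cnj[of a1 dd] da by simp
  have dd: "h dd dd = t2"
  proof -
    have S: "(e * K 0) *s b3 = mm *s dd + K 2 *s a1" using D by simp
    have "h ((e * K 0) *s b3) ((e * K 0) *s b3) = (e * e) * (K 0 * cnj (K 0)) * h b3 b3" by (simp add: h_simps)
    also have "\<dots> = 1" using e ub K_norm[of 0] by (simp add: power2_eq_square flip: of_real_mult)
    finally have "h (mm *s dd + K 2 *s a1) (mm *s dd + K 2 *s a1) = 1" unfolding S .
    then have "mm * cnj mm * h dd dd + (mm * cnj (K 2) + cnj mm * K 2) * t2 + K 2 * cnj (K 2) = 1"
      by (simp add: h_simps da ad ua algebra_simps)
    moreover have "mm * cnj (K 2) + cnj mm * K 2 = - (mm * cnj mm)" by (simp add: mm_def algebra_simps)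
    ultimately have "mm * cnj mm * (h dd dd - t2) = 0" using K_norm[of 2] by (simp add: algebra_simps)
    then show ?thesis using mm(2) by simp
  qed
  define c2 where "c2 = complex_of_real (1 / sqrt t2) *s dd"
  have st: "complex_of_real (sqrt t2) * complex_of_real (sqrt t2) = t2" "sqrt t2 \<noteq> 0"
    using t by (simp_all flip: of_real_mult)
  have u2: "unit c2" using st by (simp add: c2_def h_simps dd)
  have w: "h a1 c2 = sqrt t2" using st by (simp add: c2_def h_simps ad field_simps)
  have "(mm * h a1 c2) *s c2 = mm *s dd"
    unfolding w unfolding c2_def vector_smult_assoc using st(2) by simp
  then have "Rv c2 (K 2) a1 = mm *s dd + K 2 *s a1"
    unfolding Rv_unit[OF u2] mm_def[symmetric] by metis
  also have "\<dots> = (e * K 0) *s b3" using D by simp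
  finally have "Rv c3 (K 3) (Rv c2 (K 2) a1) = (e * K 0) *s Rv c3 (K 3) b3" by (simp add: Rv_scale)
  then have eq: "Rv c3 (K 3) (Rv c2 (K 2) (Rv c1 (K 1) e0)) = (e * K 0) *s e0"
    unfolding b3_def a1_def by (simp add: Rv_inv'[OF u3 K_norm])
  have "(cmod (h c2 a1))\<^sup>2 = t2" using h_cnj[of c2 a1] w t by simp
  then show ?thesis using that[OF u1 u2 u3 eq] t13 by (simp add: a1_def)
qed

end

section \<open>Points of the projective line and unit vectors\<close>

abbreviation pt_of :: "complex^2 \<Rightarrow> pt" where "pt_of c \<equiv> vec.span {c}"

lemma rep_pt_of:
  assumes "c \<noteq> 0"
  obtains z where "z \<noteq> 0" "rep (pt_of c) = z *s c"
proof -
  have "c \<noteq> 0 \<and> c \<in> pt_of c" using assms vec.span_base[of c "{c}"] by auto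
  then have r: "rep (pt_of c) \<noteq> 0 \<and> rep (pt_of c) \<in> pt_of c" unfolding rep_def by (rule someI)
  then obtain z where "rep (pt_of c) = z *s c" by (auto simp: vec.span_singleton)
  then show ?thesis using that r by (cases "z = 0") auto
qed

lemma pt_of_scale: "z \<noteq> 0 \<Longrightarrow> pt_of (z *s c) = pt_of c"
proof -
  assume z: "z \<noteq> 0"
  have "k *s c = (k / z) *s (z *s c)" for k using z by (simp add: vector_smult_assoc)
  moreover have "k *s (z *s c) = (k * z) *s c" for k by (simp add: vector_smult_assoc)
  ultimately show ?thesis unfolding vec.span_singleton by (metis (no_types, lifting) image_subset_iff rangeI subset_antisym)
qed

lemma image_pt_of: "(\<And>z. g (z *s c) = z *s g c) \<Longrightarrow> g ` pt_of c = pt_of (g c)"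
  by (simp add: vec.span_singleton image_image)

lemma pt_of_eqD:
  assumes "pt_of c = pt_of c'" "c' \<noteq> 0"
  obtains z where "z \<noteq> 0" "c' = z *s c"
proof -
  have "c' \<in> pt_of c" using assms(1) vec.span_base[of c' "{c'}"] by auto
  then obtain z where "c' = z *s c" by (auto simp: vec.span_singleton)
  then show ?thesis using that assms(2) by (cases "z = 0") auto
qed

fun flip :: "hex_type \<Rightarrow> hex_type" where "flip First = Second" | "flip Second = First"

context hermitian_basis
begin

lemma unit_nz: "unit c \<Longrightarrow> c \<noteq> 0"
  by auto

lemma BV_iff: "p \<in> BV h \<longleftrightarrow> (\<exists>c. unit c \<and> p = pt_of c)"
proof
  assume "p \<in> BV h"
  then obtain v where v: "p = pt_of v" "Re (h v v) > 0" by (auto simp: BV_def)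
  define s where "s = complex_of_real (1 / sqrt (Re (h v v)))"
  have "h v v = of_real (Re (h v v))" using h_self_real[of v] by (simp add: complex_eq_iff)
  moreover have "s * cnj s * of_real (Re (h v v)) = 1"
    using v(2) by (simp add: s_def flip: of_real_mult)
  moreover have "h (s *s v) (s *s v) = s * cnj s * h v v" by (simp add: h_scale h_scale2)
  ultimately have "unit (s *s v)" by metis
  moreover have "s \<noteq> 0" using v(2) by (simp add: s_def)
  ultimately show "\<exists>c. unit c \<and> p = pt_of c" using v(1) pt_of_scale by metis
next
  assume "\<exists>c. unit c \<and> p = pt_of c"
  then obtain c where "unit c" "p = pt_of c" by blast
  then show "p \<in> BV h" unfolding BV_def by (intro CollectI exI[of _ c]) simp
qed

lemma rot_pt_of: "unit c \<Longrightarrow> rot h (pt_of c) k = Rv c k"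
proof -
  assume c: "unit c"
  then obtain z where z: "z \<noteq> 0" "rep (pt_of c) = z *s c" using rep_pt_of[OF unit_nz] by blast
  have "rot h (pt_of c) k v = Rv (z *s c) k v" for v by (simp add: rot_def z(2) Rv_def Let_def)
  then show ?thesis using Rv_scale_centre[OF z(1)] by (simp add: fun_eq_iff)
qed

lemma ta_pt_of:
  assumes "unit c" "unit c'"
  shows "ta h (pt_of c) (pt_of c') = (cmod (h c c'))\<^sup>2"
proof -
  obtain z where z: "z \<noteq> 0" "rep (pt_of c) = z *s c" using rep_pt_of[OF unit_nz[OF assms(1)]] by blast
  obtain w where w: "w \<noteq> 0" "rep (pt_of c') = w *s c'" using rep_pt_of[OF unit_nz[OF assms(2)]] by blast
  have "h c' c = cnj (h c c')" by (rule h_cnj)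
  then have "ta h (pt_of c) (pt_of c') = Re (h c c' * cnj (h c c'))"
    using z(1) w(1) by (simp add: ta_def z(2) w(2) h_simps assms)
  then show ?thesis by (simp flip: complex_norm_square)
qed

lemma inv_Rv:
  assumes "unit c" "k * cnj k = 1"
  shows "inv_into UNIV (Rv c k) = Rv c (cnj k)"
  by (rule inv_equality) (simp_all add: Rv_inv[OF assms] Rv_inv'[OF assms])

lemma image_Rv: "Rv c k ` pt_of v = pt_of (Rv c k v)"
  by (rule image_pt_of) (rule Rv_scale)

lemma unit_Rv: "unit c \<Longrightarrow> k * cnj k = 1 \<Longrightarrow> unit v \<Longrightarrow> unit (Rv c k v)"
  by (simp add: h_Rv)

lemma cmod_h_Rv:
  assumes "unit c" "k * cnj k = 1"
  shows "cmod (h c (Rv c k v)) = cmod (h c v)"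
proof -
  have "(cmod k)\<^sup>2 = 1\<^sup>2" using arg_cong[OF assms(2), of cmod] by (simp add: norm_mult power2_eq_square)
  then have k: "cmod k = 1" by (rule power2_eq_imp_eq) simp_all
  have "h (cnj k *s c) (Rv c k v) = h c v" using h_Rv[OF assms, of c v] by (simp add: Rv_centre assms(1))
  then have "cmod (cnj k * h c (Rv c k v)) = cmod (h c v)" by (simp add: h_simps)
  then show ?thesis by (simp add: norm_mult k)
qed

lemma triv_inverse:
  assumes units: "unit c0" "unit c1" "unit c2" "unit c3" and k: "\<And>j. k j * cnj (k j) = 1" and "z \<noteq> 0"
    and z: "\<And>v. Rv c0 (cnj (k 0)) (Rv c1 (cnj (k 1)) (Rv c2 (cnj (k 2)) (Rv c3 (cnj (k 3)) v))) = z *s v"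
  shows "triv k c0 c1 c2 c3"
proof -
  have "Rv c3 (k 3) (Rv c2 (k 2) (Rv c1 (k 1) (Rv c0 (k 0) v))) = (1 / z) *s v" for v
  proof -
    let ?u = "Rv c3 (k 3) (Rv c2 (k 2) (Rv c1 (k 1) (Rv c0 (k 0) v)))"
    have "v = z *s ?u" using z[of ?u]
      by (simp only: Rv_inv[OF units(1) k] Rv_inv[OF units(2) k] Rv_inv[OF units(3) k] Rv_inv[OF units(4) k])
    then have "(1 / z) *s v = (1 / z) *s (z *s ?u)" by metis
    then show ?thesis using \<open>z \<noteq> 0\<close> by (simp add: vector_smult_assoc)
  qed
  then show ?thesis unfolding triv_def using \<open>z \<noteq> 0\<close> by (intro exI[of _ "1 / z"]) simp
qed

end

locale hexagons = hermitian_basis +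
  fixes al :: "nat \<Rightarrow> real"
  assumes al: "j \<le> 3 \<Longrightarrow> 0 < al j \<and> al j < pi"
begin

declare One_nat_def [simp del]

lemma sin_al: "j \<le> 3 \<Longrightarrow> sin (al j) > 0"
  using al sin_gt_zero by blast

sublocale ang: angles "cos (al 0)" "cos (al 1)" "cos (al 2)" "cos (al 3)" "sin (al 0)" "sin (al 1)" "sin (al 2)" "sin (al 3)"
  by unfold_locales (use sin_al[of 0] sin_al[of 1] sin_al[of 2] sin_al[of 3] in simp_all)

text \<open>With every \<open>k\<^sub>j\<close> replaced by its conjugate, the relation of the second type is the inverse of a relation
  of the first type. So a sign of the angles accounts for the types.\<close>

definition sg :: "hex_type \<Rightarrow> real" where "sg ty = (case ty of First \<Rightarrow> 1 | Second \<Rightarrow> -1)"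

definition kk :: "hex_type \<Rightarrow> nat \<Rightarrow> complex" where "kk ty j = cis (sg ty * al j)"

lemma sg_sq: "sg ty * sg ty = 1" by (cases ty) (simp_all add: sg_def)

lemma kk_norm: "kk ty j * cnj (kk ty j) = 1"
  by (simp add: kk_def cis_cnj cis_mult)

lemma kk_norm': "cnj (kk ty j) * kk ty j = 1"
  by (simp add: kk_norm mult.commute)

lemma kk_flip: "kk (flip ty) j = cnj (kk ty j)"
  by (cases ty) (simp_all add: kk_def sg_def cis_cnj)

lemma kk_Second: "kk Second j = cnj (kk First j)"
  using kk_flip[of First j] by simp

lemma cf: "configuration h e0 e1 (\<lambda>j. cos (al j)) (\<lambda>j. sg ty * sin (al j))"
proof
  have "sg ty = 1 \<or> sg ty = -1" by (cases ty) (simp_all add: sg_def)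
  then show "(cos (al j))\<^sup>2 + (sg ty * sin (al j))\<^sup>2 = 1" "j \<le> 3 \<Longrightarrow> sg ty * sin (al j) \<noteq> 0" for j
    using sin_al[of j] by auto
qed

lemma cf_K: "configuration.K (\<lambda>j. cos (al j)) (\<lambda>j. sg ty * sin (al j)) = kk ty"
proof -
  interpret configuration h e0 e1 "\<lambda>j. cos (al j)" "\<lambda>j. sg ty * sin (al j)" by (rule cf)
  show ?thesis unfolding K_def kk_def by (cases ty) (simp_all add: fun_eq_iff sg_def complex_eq_iff)
qed

lemma hex_rot_pt_of: "unit c \<Longrightarrow> hex_rot h al j (pt_of c) = Rv c (kk First j)"
  by (simp add: hex_rot_def rot_pt_of kk_def sg_def cis_conv_exp mult.commute)

abbreviation hx :: "hex_type \<Rightarrow> complex^2 \<Rightarrow> complex^2 \<Rightarrow> complex^2 \<Rightarrow> complex^2 \<Rightarrow> hexagon" where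
  "hx ty c0 c1 c2 c3 \<equiv> (ty, pt_of c0, pt_of c1, pt_of c2, pt_of c3)"

text \<open>As R_j fixes the line of c_j, the point p_j may be replaced by its predecessor p_(j-1)
  in t_1 and t_2, where the predecessor of p1 is c0. One formula covers both types because
  \<open>kk\<close> carries the sign.\<close>

definition tv :: "hex_type \<Rightarrow> complex^2 \<Rightarrow> complex^2 \<Rightarrow> complex^2 \<Rightarrow> complex^2 \<Rightarrow> triple" where
  "tv ty c0 c1 c2 c3 = ((cmod (h c1 c0))\<^sup>2, (cmod (h c2 (Rv c1 (kk ty 1) c0)))\<^sup>2, (cmod (h c3 c0))\<^sup>2)"

definition vhex :: "hex_type \<Rightarrow> complex^2 \<Rightarrow> complex^2 \<Rightarrow> complex^2 \<Rightarrow> complex^2 \<Rightarrow> bool" where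
  "vhex ty c0 c1 c2 c3 \<longleftrightarrow> unit c0 \<and> unit c1 \<and> unit c2 \<and> unit c3 \<and> triv (kk ty) c0 c1 c2 c3"

lemma is_hexagon_hx:
  assumes units: "unit c0" "unit c1" "unit c2" "unit c3"
  shows "is_hexagon h al (hx ty c0 c1 c2 c3) \<longleftrightarrow> triv (kk ty) c0 c1 c2 c3"
proof (cases ty)
  case First
  have "pt_of c \<in> BV h" if "unit c" for c using that BV_iff by blast
  then show ?thesis using units
    by (simp add: First hex_rot_pt_of trivial_in_PU_def triv_def)
next
  case Second
  have "pt_of c \<in> BV h" if "unit c" for c using that BV_iff by blast
  then have "is_hexagon h al (hx ty c0 c1 c2 c3) \<longleftrightarrow> (\<exists>z. z \<noteq> 0 \<and> (\<forall>v. Rv c0 (cnj (kk Second 0)) (Rv c1 (cnj (kk Second 1))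
      (Rv c2 (cnj (kk Second 2)) (Rv c3 (cnj (kk Second 3)) v))) = z *s v))"
    using units by (simp add: Second hex_rot_pt_of trivial_in_PU_def kk_Second)
  also have "\<dots> \<longleftrightarrow> triv (kk Second) c0 c1 c2 c3"
  proof
    assume "\<exists>z. z \<noteq> 0 \<and> (\<forall>v. Rv c0 (cnj (kk Second 0)) (Rv c1 (cnj (kk Second 1))
      (Rv c2 (cnj (kk Second 2)) (Rv c3 (cnj (kk Second 3)) v))) = z *s v)"
    then obtain z where "z \<noteq> 0" "\<And>v. Rv c0 (cnj (kk Second 0)) (Rv c1 (cnj (kk Second 1))
      (Rv c2 (cnj (kk Second 2)) (Rv c3 (cnj (kk Second 3)) v))) = z *s v" by blast
    then show "triv (kk Second) c0 c1 c2 c3" by (rule triv_inverse[OF units kk_norm])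
  next
    assume "triv (kk Second) c0 c1 c2 c3"
    then show "\<exists>z. z \<noteq> 0 \<and> (\<forall>v. Rv c0 (cnj (kk Second 0)) (Rv c1 (cnj (kk Second 1))
      (Rv c2 (cnj (kk Second 2)) (Rv c3 (cnj (kk Second 3)) v))) = z *s v)"
      by (rule triv_cyclic[OF units kk_norm]) blast
  qed
  finally show ?thesis by (simp add: Second)
qed

lemma is_hexagon_vhex: "vhex ty c0 c1 c2 c3 \<Longrightarrow> is_hexagon h al (hx ty c0 c1 c2 c3)"
  using is_hexagon_hx by (simp add: vhex_def)

lemma hexagon_cases:
  assumes "is_hexagon h al x"
  obtains ty c0 c1 c2 c3 where "vhex ty c0 c1 c2 c3" "x = hx ty c0 c1 c2 c3"
proof -
  obtain ty p0 p1 p2 p3 where x: "x = (ty, p0, p1, p2, p3)" by (cases x)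
  have "p0 \<in> BV h" "p1 \<in> BV h" "p2 \<in> BV h" "p3 \<in> BV h" using assms x by simp_all
  then obtain c0 c1 c2 c3 where c: "unit c0" "p0 = pt_of c0" "unit c1" "p1 = pt_of c1"
    "unit c2" "p2 = pt_of c2" "unit c3" "p3 = pt_of c3" unfolding BV_iff by blast
  then show ?thesis using that[of ty c0 c1 c2 c3] assms is_hexagon_hx[of c0 c1 c2 c3 ty] x by (simp add: vhex_def)
qed

lemma hexagon_t_hx:
  assumes units: "unit c0" "unit c1" "unit c2" "unit c3"
  shows "hexagon_t h al (hx ty c0 c1 c2 c3) = tv ty c0 c1 c2 c3"
  using units
  by (cases ty) (simp_all add: hex_rot_pt_of inv_Rv kk_norm image_Rv ta_pt_of unit_Rv cmod_h_Rv tv_def Let_def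
      kk_Second kk_norm')

text \<open>The two types have the same formulas because \<open>kk Second\<close> is the conjugate
  of \<open>kk First\<close>.\<close>

lemma n_hx:
  assumes units: "unit c0" "unit c1" "unit c2" "unit c3"
  shows "hexagon_n1 h al (hx ty c0 c1 c2 c3) = hx (flip ty) (Rv c3 (cnj (kk ty 3)) c0) c1 (Rv c1 (cnj (kk ty 1)) c2) c3"
    "hexagon_n2 h al (hx ty c0 c1 c2 c3) = hx (flip ty) (Rv c3 (cnj (kk ty 3)) c0) (Rv c2 (kk ty 2) c1) c2 c3"
    "hexagon_n3 h al (hx ty c0 c1 c2 c3) = hx (flip ty) (Rv c1 (kk ty 1) c0) c1 (Rv c3 (kk ty 3) c2) c3"
  using units by (cases ty; simp add: hex_rot_pt_of inv_Rv kk_norm image_Rv Let_def kk_Second kk_norm')+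

definition nh :: "letter \<Rightarrow> hexagon \<Rightarrow> hexagon" where
  "nh j = (case j of L1 \<Rightarrow> hexagon_n1 h al | L2 \<Rightarrow> hexagon_n2 h al | L3 \<Rightarrow> hexagon_n3 h al)"

text \<open>The affine change of coordinates for which \<open>tau i\<close> is 2 t_i - 1. The sign
  of the product of the rotations does not enter here; it is left to \<open>Tp\<close> and
  \<open>Tm\<close>.\<close>

definition Th :: "triple \<Rightarrow> triple" where
  "Th t = (2 * sin (al 0) * sin (al 1) * (2 * crd L1 t - 1) - 2 * cos (al 0) * cos (al 1),
    2 * sin (al 0) * sin (al 2) * (2 * crd L2 t - 1) - 2 * cos (al 0) * cos (al 2),
    2 * sin (al 0) * sin (al 3) * (2 * crd L3 t - 1) - 2 * cos (al 0) * cos (al 3))"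

lemma tau_Th: "ang.tau i (Th t) = 2 * crd i t - 1"
proof -
  have "crd i (Th t) + 2 * cos (al 0) * ang.cs i = (2 * sin (al 0) * ang.sn i) * (2 * crd i t - 1)"
    by (cases i) (simp_all add: Th_def)
  moreover have "2 * sin (al 0) * ang.sn i \<noteq> 0" using ang.sn_pos[of i] sin_al[of 0] by simp
  ultimately show ?thesis by (simp add: ang.tau_def)
qed

lemma Th_inj: "Th s = Th t \<longleftrightarrow> s = t"
proof
  assume "Th s = Th t"
  then have "crd i s = crd i t" for i using tau_Th[of i s] tau_Th[of i t] by simp
  then show "s = t" using triple_eq_iff by blast
qed simp

lemma Th_tau: "Th ((ang.tau L1 P + 1) / 2, (ang.tau L2 P + 1) / 2, (ang.tau L3 P + 1) / 2) = P"
proof -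
  define t where "t = ((ang.tau L1 P + 1) / 2, (ang.tau L2 P + 1) / 2, (ang.tau L3 P + 1) / 2)"
  have c: "crd i Q = 2 * sin (al 0) * ang.sn i * ang.tau i Q - 2 * cos (al 0) * ang.cs i" for i Q
    using ang.sn_pos[of i] sin_al[of 0] by (simp add: ang.tau_def)
  have ct: "crd i t = (ang.tau i P + 1) / 2" for i by (cases i) (simp_all add: t_def)
  have "ang.tau i (Th t) = ang.tau i P" for i using ct[of i] tau_Th[of i t] by simp
  then have "crd i (Th t) = crd i P" for i using c[of i P] c[of i "Th t"] by simp
  then show ?thesis unfolding t_def[symmetric] triple_eq_iff by blast
qed

lemma vhex_relation:
  assumes v: "vhex ty c0 c1 c2 c3"
  obtains e :: real where "e = 1 \<or> e = -1"
    "Rv c3 (kk ty 3) (Rv c2 (kk ty 2) (Rv c1 (kk ty 1) c0)) = (e * kk ty 0) *s c0"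
proof -
  have u: "unit c0" "unit c1" "unit c2" "unit c3" using v by (simp_all add: vhex_def)
  have "triv (kk ty) c0 c1 c2 c3" using v by (simp add: vhex_def)
  then obtain e :: real where "e\<^sup>2 = 1" "Rv c3 (kk ty 3) (Rv c2 (kk ty 2) (Rv c1 (kk ty 1) c0)) = (e * kk ty 0) *s c0"
    unfolding triv_iff[OF u kk_norm] by blast
  then show ?thesis using that unfolding power2_eq_1_iff by blast
qed

text \<open>In each claim two entries are those of the old hexagon, and the remaining one is the
  t_j' of \<open>hexagon_equations\<close>. The relation is used to move the new products back to
  the old vectors.\<close>

lemma vhex_tv:
  assumes v: "vhex ty c0 c1 c2 c3"
  shows "tv (flip ty) (Rv c3 (cnj (kk ty 3)) c0) c1 (Rv c1 (cnj (kk ty 1)) c2) c3 =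
      ((cmod (h c1 (Rv c3 (cnj (kk ty 3)) c0)))\<^sup>2, (cmod (h c2 (Rv c1 (kk ty 1) c0)))\<^sup>2, (cmod (h c3 c0))\<^sup>2)"
    "tv (flip ty) (Rv c3 (cnj (kk ty 3)) c0) (Rv c2 (kk ty 2) c1) c2 c3 =
      ((cmod (h c1 c0))\<^sup>2, (cmod (h c2 c0))\<^sup>2, (cmod (h c3 c0))\<^sup>2)"
    "tv (flip ty) (Rv c1 (kk ty 1) c0) c1 (Rv c3 (kk ty 3) c2) c3 =
      ((cmod (h c1 c0))\<^sup>2, (cmod (h c2 (Rv c1 (kk ty 1) c0)))\<^sup>2, (cmod (h c3 (Rv c1 (kk ty 1) c0)))\<^sup>2)"
proof -
  have u: "unit c0" "unit c1" "unit c2" "unit c3" using v by (simp_all add: vhex_def)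
  obtain e :: real where e: "e = 1 \<or> e = -1"
    "Rv c3 (kk ty 3) (Rv c2 (kk ty 2) (Rv c1 (kk ty 1) c0)) = (e * kk ty 0) *s c0" by (rule vhex_relation[OF v])
  define w where "w = complex_of_real e * kk ty 0"
  have cw: "cmod w = 1" using e(1) by (auto simp: w_def norm_mult kk_def)
  define A1 A2 B1 B2 B3 where "A1 = Rv c1 (kk ty 1)" and "A2 = Rv c2 (kk ty 2)" and "B1 = Rv c1 (cnj (kk ty 1))"
    and "B2 = Rv c2 (cnj (kk ty 2))" and "B3 = Rv c3 (cnj (kk ty 3))"
  note inv = Rv_inv[OF u(2) kk_norm] Rv_inv[OF u(3) kk_norm] Rv_inv[OF u(4) kk_norm]
    Rv_inv'[OF u(2) kk_norm] Rv_inv'[OF u(3) kk_norm] Rv_inv'[OF u(4) kk_norm]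
  have E: "A2 (A1 c0) = w *s B3 c0"
    using arg_cong[OF e(2), of B3] unfolding w_def[symmetric] A1_def A2_def B3_def inv Rv_scale .
  have E': "A1 c0 = w *s B2 (B3 c0)"
    using arg_cong[OF E, of B2] unfolding A1_def A2_def B3_def B2_def inv Rv_scale .
  have E'': "c0 = w *s B1 (B2 (B3 c0))"
    using arg_cong[OF E', of B1] unfolding A1_def B1_def B3_def B2_def inv Rv_scale .
  have n: "cmod (h x (w *s y)) = cmod (h x y)" for x y by (simp add: h_simps norm_mult cw)
  have hA: "h (A1 x) (A1 y) = h x y" "h (A2 x) (A2 y) = h x y" "h (B1 x) (B1 y) = h x y" "h (B3 x) (B3 y) = h x y" for x y
    unfolding A1_def A2_def B1_def B3_def by (rule h_Rv; simp add: u kk_norm kk_norm')+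
  have nA: "cmod (h c1 (A1 y)) = cmod (h c1 y)" "cmod (h c2 (A2 y)) = cmod (h c2 y)" "cmod (h c3 (B3 y)) = cmod (h c3 y)" for y
    unfolding A1_def A2_def B3_def by (rule cmod_h_Rv; simp add: u kk_norm kk_norm')+
  have t2: "cmod (h c2 (B3 c0)) = cmod (h c2 (A1 c0))"
    using nA(2)[of "A1 c0"] unfolding E n .
  show "tv (flip ty) (Rv c3 (cnj (kk ty 3)) c0) c1 (Rv c1 (cnj (kk ty 1)) c2) c3 =
      ((cmod (h c1 (Rv c3 (cnj (kk ty 3)) c0)))\<^sup>2, (cmod (h c2 (Rv c1 (kk ty 1) c0)))\<^sup>2, (cmod (h c3 c0))\<^sup>2)"
    unfolding tv_def kk_flip A1_def[symmetric] B1_def[symmetric] B3_def[symmetric] hA nA t2 ..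
  have "cmod (h (A2 c1) (B3 c0)) = cmod (h c1 c0)"
  proof -
    have "cmod (h (A2 c1) (B3 c0)) = cmod (h (A2 c1) (A2 (A1 c0)))" unfolding E n ..
    then show ?thesis unfolding hA nA .
  qed
  moreover have "cmod (h c2 (Rv (A2 c1) (cnj (kk ty 1)) (B3 c0))) = cmod (h c2 c0)"
  proof -
    have "Rv (A2 c1) (cnj (kk ty 1)) (B3 c0) = A2 (B1 (B2 (B3 c0)))"
      unfolding A2_def B1_def B2_def by (rule Rv_conj[OF u(3) kk_norm])
    then have "cmod (h c2 (Rv (A2 c1) (cnj (kk ty 1)) (B3 c0))) = cmod (h c2 (w *s B1 (B2 (B3 c0))))"
      by (simp only: nA n)
    then show ?thesis unfolding E''[symmetric] .
  qed
  ultimately show "tv (flip ty) (Rv c3 (cnj (kk ty 3)) c0) (Rv c2 (kk ty 2) c1) c2 c3 =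
      ((cmod (h c1 c0))\<^sup>2, (cmod (h c2 c0))\<^sup>2, (cmod (h c3 c0))\<^sup>2)"
    unfolding tv_def kk_flip A2_def[symmetric] B3_def[symmetric] by (simp only: nA)
  have "cmod (h (Rv c3 (kk ty 3) c2) c0) = cmod (h c2 (B3 c0))"
    using hA(4)[of "Rv c3 (kk ty 3) c2" c0] by (simp only: B3_def inv)
  then show "tv (flip ty) (Rv c1 (kk ty 1) c0) c1 (Rv c3 (kk ty 3) c2) c3 =
      ((cmod (h c1 c0))\<^sup>2, (cmod (h c2 (Rv c1 (kk ty 1) c0)))\<^sup>2, (cmod (h c3 (Rv c1 (kk ty 1) c0)))\<^sup>2)"
    unfolding tv_def kk_flip inv by (simp only: nA[unfolded A1_def] t2[unfolded A1_def])
qed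

lemma vhex_n:
  assumes v: "vhex ty c0 c1 c2 c3"
  shows "vhex (flip ty) (Rv c3 (cnj (kk ty 3)) c0) c1 (Rv c1 (cnj (kk ty 1)) c2) c3"
    "vhex (flip ty) (Rv c3 (cnj (kk ty 3)) c0) (Rv c2 (kk ty 2) c1) c2 c3"
    "vhex (flip ty) (Rv c1 (kk ty 1) c0) c1 (Rv c3 (kk ty 3) c2) c3"
proof -
  have u: "unit c0" "unit c1" "unit c2" "unit c3" and tr0: "triv (kk ty) c0 c1 c2 c3"
    using v by (simp_all add: vhex_def)
  obtain z where z: "z \<noteq> 0"
    "\<And>v. Rv c1 (cnj (kk ty 1)) (Rv c2 (cnj (kk ty 2)) (Rv c3 (cnj (kk ty 3)) (Rv c0 (cnj (kk ty 0)) v))) = z *s v"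
    "\<And>v. Rv c2 (cnj (kk ty 2)) (Rv c3 (cnj (kk ty 3)) (Rv c0 (cnj (kk ty 0)) (Rv c1 (cnj (kk ty 1)) v))) = z *s v"
    "\<And>v. Rv c0 (cnj (kk ty 0)) (Rv c1 (cnj (kk ty 1)) (Rv c2 (cnj (kk ty 2)) (Rv c3 (cnj (kk ty 3)) v))) = z *s v"
    by (rule triv_cyclic[OF u kk_norm tr0]) (rule that; assumption)
  note inv = Rv_inv[OF u(1) kk_norm] Rv_inv[OF u(2) kk_norm] Rv_inv[OF u(3) kk_norm] Rv_inv[OF u(4) kk_norm]
    Rv_inv'[OF u(1) kk_norm] Rv_inv'[OF u(2) kk_norm] Rv_inv'[OF u(3) kk_norm] Rv_inv'[OF u(4) kk_norm]
  have cc: "cnj (kk ty j) * cnj (cnj (kk ty j)) = 1" for j by (simp add: kk_norm')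
  note conj = Rv_conj[OF u(2) kk_norm] Rv_conj[OF u(3) kk_norm] Rv_conj[OF u(4) kk_norm]
    Rv_conj[OF u(2) cc] Rv_conj[OF u(4) cc]
  have un: "unit (Rv c1 (kk ty j) x)" "unit (Rv c2 (kk ty j) x)" "unit (Rv c3 (kk ty j) x)"
    "unit (Rv c1 (cnj (kk ty j)) x)" "unit (Rv c3 (cnj (kk ty j)) x)" if "unit x" for x j
    by (rule unit_Rv; simp add: u that kk_norm kk_norm')+
  note rules = kk_flip conj complex_cnj_cnj inv z(2,3) Rv_scale
  have tr: "triv (kk (flip ty)) d0 d1 d2 d3" if "\<And>v. Rv d3 (cnj (kk ty 3)) (Rv d2 (cnj (kk ty 2))
    (Rv d1 (cnj (kk ty 1)) (Rv d0 (cnj (kk ty 0)) v))) = z *s v" for d0 d1 d2 d3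
    unfolding triv_def kk_flip using that z(1) by blast
  show "vhex (flip ty) (Rv c3 (cnj (kk ty 3)) c0) c1 (Rv c1 (cnj (kk ty 1)) c2) c3"
    unfolding vhex_def by (intro conjI tr) (simp_all only: un u rules)
  show "vhex (flip ty) (Rv c3 (cnj (kk ty 3)) c0) (Rv c2 (kk ty 2) c1) c2 c3"
    unfolding vhex_def by (intro conjI tr) (simp_all only: un u rules)
  show "vhex (flip ty) (Rv c1 (kk ty 1) c0) c1 (Rv c3 (kk ty 3) c2) c3"
    unfolding vhex_def by (intro conjI tr) (simp_all only: un u rules)
qed

definition hexT :: "hexagon \<Rightarrow> triple" where "hexT x = Th (hexagon_t h al x)"

lemma hexT_hx: "vhex ty c0 c1 c2 c3 \<Longrightarrow> hexT (hx ty c0 c1 c2 c3) = Th (tv ty c0 c1 c2 c3)"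
  using hexagon_t_hx by (simp add: hexT_def vhex_def)

lemma hexagon_nh: "is_hexagon h al x \<Longrightarrow> is_hexagon h al (nh j x)"
  and nh_nh: "is_hexagon h al x \<Longrightarrow> nh j (nh j x) = x"
  and fst_nh: "is_hexagon h al x \<Longrightarrow> fst (nh j x) = flip (fst x)"
proof -
  assume "is_hexagon h al x"
  then obtain ty c0 c1 c2 c3 where v: "vhex ty c0 c1 c2 c3" and x: "x = hx ty c0 c1 c2 c3"
    using hexagon_cases by blast
  have u: "unit c0" "unit c1" "unit c2" "unit c3" using v by (simp_all add: vhex_def)
  show "is_hexagon h al (nh j x)" unfolding x nh_def
    by (cases j) (simp_all only: n_hx[OF u] letter.case vhex_n[OF v] is_hexagon_vhex)
  show "fst (nh j x) = flip (fst x)" unfolding x nh_def by (cases j) (simp_all only: n_hx[OF u] letter.case fst_conv)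
  have un: "unit (Rv c1 (kk ty j) x)" "unit (Rv c2 (kk ty j) x)" "unit (Rv c3 (kk ty j) x)"
    "unit (Rv c1 (cnj (kk ty j)) x)" "unit (Rv c3 (cnj (kk ty j)) x)" if "unit x" for x j
    by (rule unit_Rv; simp add: u that kk_norm kk_norm')+
  have ff: "flip (flip ty) = ty" by (cases ty) simp_all
  note inv = Rv_inv[OF u(2) kk_norm] Rv_inv[OF u(3) kk_norm] Rv_inv[OF u(4) kk_norm]
    Rv_inv'[OF u(2) kk_norm] Rv_inv'[OF u(4) kk_norm]
  show "nh j (nh j x) = x" unfolding x nh_def
    by (cases j) (simp_all only: letter.case n_hx u un kk_flip complex_cnj_cnj inv ff)
qed

text \<open>The sign e of the relation decides between \<open>Tp\<close> and \<open>Tm\<close>, and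
  \<open>hexagon_equations\<close> with this sign is the matching branch of
  \<open>nmod\<close>.\<close>

lemma hexT_facts:
  assumes v: "vhex ty c0 c1 c2 c3"
  shows "hexT (hx ty c0 c1 c2 c3) \<in> ang.TT \<and> hexT (nh j (hx ty c0 c1 c2 c3)) = ang.nmod j (hexT (hx ty c0 c1 c2 c3))"
proof -
  have u: "unit c0" "unit c1" "unit c2" "unit c3" using v by (simp_all add: vhex_def)
  obtain e :: real where e: "e = 1 \<or> e = -1"
    "Rv c3 (kk ty 3) (Rv c2 (kk ty 2) (Rv c1 (kk ty 1) c0)) = (e * kk ty 0) *s c0" by (rule vhex_relation[OF v])
  interpret configuration h e0 e1 "\<lambda>j. cos (al j)" "\<lambda>j. sg ty * sin (al j)" by (rule cf)
  have X: "XX j t = 2 * sin (al 0) * sin (al j) * (2 * t - 1) - 2 * cos (al 0) * cos (al j)" for j t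
    using sg_sq[of ty] by (cases ty) (simp_all add: sg_def)
  have e2: "e\<^sup>2 = 1" using e(1) by auto
  note H = hexagon_equations[OF u e2, unfolded cf_K, OF e(2), unfolded X]
  define x where "x = 2 * sin (al 0) * sin (al 1) * (2 * (cmod (h c1 c0))\<^sup>2 - 1) - 2 * cos (al 0) * cos (al 1)"
  define y where "y = 2 * sin (al 0) * sin (al 2) * (2 * (cmod (h c2 (Rv c1 (kk ty 1) c0)))\<^sup>2 - 1) - 2 * cos (al 0) * cos (al 2)"
  define z where "z = 2 * sin (al 0) * sin (al 3) * (2 * (cmod (h c3 c0))\<^sup>2 - 1) - 2 * cos (al 0) * cos (al 3)"
  note H = H[folded x_def y_def z_def]
  define x' where "x' = 2 * sin (al 0) * sin (al 1) * (2 * (cmod (h c1 (Rv c3 (cnj (kk ty 3)) c0)))\<^sup>2 - 1) - 2 * cos (al 0) * cos (al 1)"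
  define y' where "y' = 2 * sin (al 0) * sin (al 2) * (2 * (cmod (h c2 c0))\<^sup>2 - 1) - 2 * cos (al 0) * cos (al 2)"
  define z' where "z' = 2 * sin (al 0) * sin (al 3) * (2 * (cmod (h c3 (Rv c1 (kk ty 1) c0)))\<^sup>2 - 1) - 2 * cos (al 0) * cos (al 3)"
  note H = H[folded x'_def y'_def z'_def]
  define t where "t = tv ty c0 c1 c2 c3"
  have P: "hexT (hx ty c0 c1 c2 c3) = Th t" using hexT_hx[OF v] by (simp only: t_def)
  have xyz: "Th t = (x, y, z)" unfolding t_def tv_def Th_def crd.simps x_def y_def z_def ..
  have t1: "crd i t \<ge> 1" for i using H(1-3) by (cases i) (simp_all only: t_def tv_def crd.simps)
  have tau: "ang.tau i (x, y, z) \<ge> 1" for i using tau_Th[of i t, unfolded xyz] t1[of i] by linarith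
  have n: "hexT (nh j (hx ty c0 c1 c2 c3)) = (case j of L1 \<Rightarrow> (x', y, z) | L2 \<Rightarrow> (x, y', z) | L3 \<Rightarrow> (x, y, z'))"
    unfolding nh_def x_def y_def z_def x'_def y'_def z'_def
    by (cases j) (simp_all only: letter.case n_hx[OF u] hexT_hx[OF vhex_n(1)[OF v]] hexT_hx[OF vhex_n(2)[OF v]]
      hexT_hx[OF vhex_n(3)[OF v]] vhex_tv[OF v] Th_def crd.simps)
  show ?thesis
  proof (cases "e = 1")
    case True
    note H = H[unfolded True of_real_1 mult_1]
    have "(x, y, z) \<in> ang.Tp" unfolding ang.Tp_tau using H(4) tau by simp
    then show ?thesis unfolding P xyz n ang.nmod_def using H(5-7) by (cases j) simp_all
  next
    case False
    then have e': "e = -1" using e(1) by blast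
    note H = H[unfolded e' mult_minus1]
    have m: "(x, y, z) \<in> ang.Tm" unfolding ang.Tm_tau using H(4) tau by simp
    moreover have "(x, y, z) \<notin> ang.Tp" using m ang.disjoint by blast
    ultimately show ?thesis unfolding P xyz n ang.nmod_def using H(5-7) by (cases j) simp_all
  qed
qed

lemma hexT_TT: "is_hexagon h al x \<Longrightarrow> hexT x \<in> ang.TT"
  and hexT_nh: "is_hexagon h al x \<Longrightarrow> hexT (nh j x) = ang.nmod j (hexT x)"
proof -
  assume "is_hexagon h al x"
  then obtain ty c0 c1 c2 c3 where "vhex ty c0 c1 c2 c3" "x = hx ty c0 c1 c2 c3" by (rule hexagon_cases)
  then show "hexT x \<in> ang.TT" "hexT (nh j x) = ang.nmod j (hexT x)" using hexT_facts by blast+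
qed

lemma hexT_onto:
  assumes P: "P \<in> ang.TT"
  obtains c1 c2 c3 where "vhex First e0 c1 c2 c3" "Th (tv First e0 c1 c2 c3) = P"
proof -
  interpret configuration h e0 e1 "\<lambda>j. cos (al j)" "\<lambda>j. sg First * sin (al j)" by (rule cf)
  have X: "XX j t = 2 * sin (al 0) * sin (al j) * (2 * t - 1) - 2 * cos (al 0) * cos (al j)" for j t
    by (simp add: sg_def)
  define t where "t = ((ang.tau L1 P + 1) / 2, (ang.tau L2 P + 1) / 2, (ang.tau L3 P + 1) / 2)"
  obtain t1 t2 t3 where t: "t = (t1, t2, t3)" by (cases t)
  have Pt: "Th t = P" unfolding t_def by (rule Th_tau)
  have tau: "ang.tau i P \<ge> 1" for i using P unfolding Un_iff ang.Tp_tau ang.Tm_tau by blast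
  have "crd i t \<ge> 1" for i using tau_Th[of i t, unfolded Pt] tau[of i] by linarith
  from this[of L1] this[of L2] this[of L3] have t1: "t1 \<ge> 1" "t2 \<ge> 1" "t3 \<ge> 1" using t by simp_all
  obtain x y z where xyz: "P = (x, y, z)" by (cases P)
  have XX: "XX 1 t1 = x" "XX 2 t2 = y" "XX 3 t3 = z" unfolding X using Pt unfolding xyz Th_def t by simp_all
  obtain e :: real where e: "e = 1 \<or> e = -1" "fricke (e * cos (al 0)) (cos (al 1)) (cos (al 2)) (cos (al 3)) (e * x) (e * y) (e * z) = 0"
  proof (cases "P \<in> ang.Tp")
    case True
    then show ?thesis using that[of 1] by (simp add: ang.Tp_tau xyz)
  next
    case False
    then have "P \<in> ang.Tm" using P by blast
    then show ?thesis using that[of "-1"] by (simp add: ang.Tm_tau xyz)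
  qed
  have e2: "e\<^sup>2 = 1" using e(1) by auto
  obtain c1 c2 c3 where c: "unit c1" "unit c2" "unit c3"
    "Rv c3 (kk First 3) (Rv c2 (kk First 2) (Rv c1 (kk First 1) e0)) = (e * kk First 0) *s e0"
    "(cmod (h c1 e0))\<^sup>2 = t1" "(cmod (h c2 (Rv c1 (kk First 1) e0)))\<^sup>2 = t2" "(cmod (h c3 e0))\<^sup>2 = t3"
    by (rule hexagon_exists[OF e2 t1, unfolded cf_K XX, OF e(2)])
  have "triv (kk First) e0 c1 c2 c3"
    unfolding triv_iff[OF basis(1) c(1-3) kk_norm] using c(4) e2 by blast
  then have "vhex First e0 c1 c2 c3" using c basis(1) by (simp add: vhex_def)
  moreover have "Th (tv First e0 c1 c2 c3) = P" unfolding tv_def c(5-7) t[symmetric] by (rule Pt)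
  ultimately show ?thesis using that by blast
qed

lemma unitary_hx: "g \<in> unitary h \<Longrightarrow> move_hexagon g (hx ty c0 c1 c2 c3) = hx ty (g c0) (g c1) (g c2) (g c3)"
  using unitary_linear(2)[of g] by (simp add: image_pt_of)

lemma hexagon_move:
  assumes g: "g \<in> unitary h" and x: "is_hexagon h al x"
  shows "hexagon_t h al (move_hexagon g x) = hexagon_t h al x"
    "nh j (move_hexagon g x) = move_hexagon g (nh j x)"
proof -
  obtain ty c0 c1 c2 c3 where v: "vhex ty c0 c1 c2 c3" and x: "x = hx ty c0 c1 c2 c3"
    using hexagon_cases[OF x] by blast
  have u: "unit c0" "unit c1" "unit c2" "unit c3" using v by (simp_all add: vhex_def)
  have u': "unit (g c0)" "unit (g c1)" "unit (g c2)" "unit (g c3)" using u unitary_linear(3)[OF g] by simp_all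
  show "hexagon_t h al (move_hexagon g x) = hexagon_t h al x"
    unfolding x unitary_hx[OF g] hexagon_t_hx[OF u] hexagon_t_hx[OF u'] tv_def
    by (simp only: Rv_equivariant[OF g, symmetric] unitary_linear(3)[OF g])
  show "nh j (move_hexagon g x) = move_hexagon g (nh j x)"
    unfolding x nh_def by (cases j) (simp_all only: letter.case unitary_hx[OF g] n_hx[OF u] n_hx[OF u'] Rv_equivariant[OF g])
qed

lemma id_unitary: "(\<lambda>v. v) \<in> unitary h"
  by (simp add: unitary_def Vector_Spaces.linear_iff vec.vector_space_axioms)

lemma move_id: "move_hexagon (\<lambda>v. v) x = x"
  by (cases x) simp

lemma orbit_self: "x \<in> PU_orbit h x"
  unfolding PU_orbit_def using id_unitary move_id[of x] by (intro CollectI exI[of _ "\<lambda>v. v"]) simp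

lemma t_of_orbit: "is_hexagon h al x \<Longrightarrow> t_of h al (PU_orbit h x) = hexagon_t h al x"
proof -
  assume x: "is_hexagon h al x"
  have "hexagon_t h al ` PU_orbit h x \<subseteq> {hexagon_t h al x}"
    unfolding PU_orbit_def using hexagon_move(1)[OF _ x] by auto
  then have "hexagon_t h al ` PU_orbit h x = {hexagon_t h al x}" using orbit_self by blast
  then show ?thesis by (simp add: t_of_def)
qed

lemma type_of_orbit: "type_of (PU_orbit h x) = fst x"
proof -
  have "fst (move_hexagon g x) = fst x" for g by (cases x) simp
  then have "fst ` PU_orbit h x \<subseteq> {fst x}" unfolding PU_orbit_def by auto
  then have "fst ` PU_orbit h x = {fst x}" using orbit_self by blast
  then show ?thesis by (simp add: type_of_def)
qed

lemma nh_orbit: "is_hexagon h al x \<Longrightarrow> nh j ` PU_orbit h x = PU_orbit h (nh j x)"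
  unfolding PU_orbit_def setcompr_eq_image image_image Collect_mem_eq
  by (rule image_cong[OF refl]) (rule hexagon_move(2))

end

section \<open>The topology of the space of hexagons\<close>

lemma continuous_on_vector_smult [continuous_intros]:
  fixes f :: "'a::topological_space \<Rightarrow> complex" and g :: "'a \<Rightarrow> complex^2"
  assumes "continuous_on S f" "continuous_on S g"
  shows "continuous_on S (\<lambda>x. f x *s g x)"
  unfolding vector_scalar_mult_def using assms by (intro continuous_intros)

context hermitian_basis
begin

lemma continuous_on_h0: "continuous_on S (\<lambda>v. h v u)"
proof -
  have sc: "r *\<^sub>R v = complex_of_real r *s v" for r and v :: "complex^2"
    unfolding vec_eq_iff vector_scaleR_component vector_smult_component by (simp add: scaleR_conv_of_real)
  have "linear (\<lambda>v. h v u)"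
  proof (rule linearI)
    show "h (r *\<^sub>R v) u = r *\<^sub>R h v u" for r v unfolding sc h_scale scaleR_conv_of_real ..
  qed (rule h_add)
  then show ?thesis by (simp add: linear_continuous_on linear_conv_bounded_linear)
qed

lemma continuous_on_h [continuous_intros]:
  assumes f: "continuous_on S f" and g: "continuous_on S g"
  shows "continuous_on S (\<lambda>x. h (f x) (g x))"
proof -
  have eq: "(\<lambda>x. h (f x) (g x)) = (\<lambda>x. h (f x) e0 * cnj (h (g x) e0) - h (f x) e1 * cnj (h (g x) e1))"
    by (rule ext) (rule h_formula)
  have 1: "continuous_on S (\<lambda>x. h (f x) u)" "continuous_on S (\<lambda>x. h (g x) u)" for u
    using continuous_on_compose2[OF continuous_on_h0 f, of UNIV] continuous_on_compose2[OF continuous_on_h0 g, of UNIV]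
    by simp_all
  show ?thesis unfolding eq by (intro continuous_on_diff continuous_on_mult continuous_on_cnj 1)
qed

text \<open>Agrees with \<open>Rv\<close> for a unit centre, but has no denominator and is therefore
  continuous in both vectors without restriction.\<close>

definition Rp :: "complex^2 \<Rightarrow> complex \<Rightarrow> complex^2 \<Rightarrow> complex^2" where
  "Rp c k v = ((cnj k - k) * h v c) *s c + k *s v"

lemma Rp_unit: "unit c \<Longrightarrow> Rp c k v = Rv c k v"
  by (simp add: Rp_def Rv_unit)

lemma continuous_on_Rp [continuous_intros]:
  assumes "continuous_on S f" "continuous_on S g"
  shows "continuous_on S (\<lambda>x. Rp (f x) k (g x))"
  unfolding Rp_def using assms by (intro continuous_intros)

abbreviation positive :: "complex^2 \<Rightarrow> bool" where "positive v \<equiv> Re (h v v) > 0"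

lemma h_self: "h v v = of_real (Re (h v v))"
  using h_self_real[of v] by (simp add: complex_eq_iff)

lemma Re_h_self: "Re (h v v) = (cmod (h v e0))\<^sup>2 - (cmod (h v e1))\<^sup>2"
  unfolding h_formula[of v v] complex_norm_square[symmetric] by (simp flip: of_real_power)

lemma positive_nz:
  assumes "positive v"
  shows "h v e0 \<noteq> 0" "v \<noteq> 0"
proof -
  show "h v e0 \<noteq> 0"
  proof
    assume "h v e0 = 0"
    then have "Re (h v v) \<le> 0" unfolding Re_h_self by simp
    then show False using assms by simp
  qed
  then show "v \<noteq> 0" by auto
qed

lemma positive_scale: "z \<noteq> 0 \<Longrightarrow> positive (z *s v) \<longleftrightarrow> positive v"
proof -
  assume "z \<noteq> 0"
  have "h (z *s v) (z *s v) = of_real ((cmod z)\<^sup>2 * Re (h v v))"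
    unfolding of_real_mult complex_norm_square h_self[symmetric] by (simp add: h_simps)
  then have "Re (h (z *s v) (z *s v)) = (cmod z)\<^sup>2 * Re (h v v)" by simp
  then show ?thesis using \<open>z \<noteq> 0\<close> by (simp add: zero_less_mult_iff)
qed

lemma pt_of_BV: "v \<noteq> 0 \<Longrightarrow> pt_of v \<in> BV h \<longleftrightarrow> positive v"
proof
  assume v: "v \<noteq> 0"
  assume "pt_of v \<in> BV h"
  then obtain c where c: "unit c" "pt_of c = pt_of v" unfolding BV_iff by metis
  then obtain z where z: "z \<noteq> 0" "v = z *s c" using pt_of_eqD[OF c(2) v] by blast
  have "positive c" using c(1) by simp
  then show "positive v" unfolding z(2) using positive_scale[OF z(1)] by blast
next
  assume "positive v" then show "pt_of v \<in> BV h" by (auto simp: BV_def)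
qed

text \<open>The unit vector in a positive line whose product with \<open>e0\<close> is a positive real.\<close>

definition nu :: "complex^2 \<Rightarrow> complex^2" where
  "nu v = (cnj (h v e0) / of_real (cmod (h v e0) * sqrt (Re (h v v)))) *s v"

lemma nu_props:
  assumes "positive v"
  shows "unit (nu v)" "pt_of (nu v) = pt_of v"
proof -
  define z where "z = cnj (h v e0) / of_real (cmod (h v e0) * sqrt (Re (h v v)))"
  have n: "h v e0 \<noteq> 0" using positive_nz[OF assms] by simp
  have "cmod z = 1 / sqrt (Re (h v v))" using n assms by (simp add: z_def norm_divide norm_mult)
  then have "(cmod z)\<^sup>2 = 1 / Re (h v v)" using assms by (simp add: power_divide)
  then have "z * cnj z = of_real (1 / Re (h v v))" using complex_norm_square[of z] by simp
  moreover have "h (z *s v) (z *s v) = (z * cnj z) * of_real (Re (h v v))"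
    unfolding h_self[symmetric] by (simp add: h_simps)
  ultimately have "unit (z *s v)" using assms by (simp flip: of_real_mult)
  then show "unit (nu v)" by (simp add: nu_def z_def)
  have "z \<noteq> 0" using n assms by (simp add: z_def)
  then show "pt_of (nu v) = pt_of v" unfolding nu_def z_def[symmetric] by (rule pt_of_scale)
qed

lemma nu_scale:
  assumes "positive v" "z \<noteq> 0"
  shows "nu (z *s v) = nu v"
proof -
  have n: "h v e0 \<noteq> 0" using positive_nz[OF assms(1)] by simp
  have "h (z *s v) (z *s v) = of_real ((cmod z)\<^sup>2 * Re (h v v))"
    unfolding of_real_mult complex_norm_square h_self[symmetric] by (simp add: h_simps)
  then have "Re (h (z *s v) (z *s v)) = (cmod z)\<^sup>2 * Re (h v v)" by simp
  then have s: "sqrt (Re (h (z *s v) (z *s v))) = cmod z * sqrt (Re (h v v))" by (simp add: real_sqrt_mult)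
  define a m t where "a = h v e0" and "m = complex_of_real (cmod z)" and "t = complex_of_real (cmod (h v e0) * sqrt (Re (h v v)))"
  have zz: "z * cnj z = m * m" using complex_norm_square[of z] by (simp add: m_def power2_eq_square)
  have nz: "m \<noteq> 0" "t \<noteq> 0" using n assms by (simp_all add: m_def t_def)
  have 1: "complex_of_real (cmod (h (z *s v) e0) * sqrt (Re (h (z *s v) (z *s v)))) = m * m * t"
    unfolding s unfolding h_scale norm_mult m_def t_def by simp
  have "cnj (h (z *s v) e0) / of_real (cmod (h (z *s v) e0) * sqrt (Re (h (z *s v) (z *s v)))) * z = (z * cnj z) * cnj a / (m * m * t)"
    unfolding 1 unfolding h_scale a_def by simp
  also have "\<dots> = cnj a / t" unfolding zz using nz by simp
  finally have "cnj (h (z *s v) e0) / of_real (cmod (h (z *s v) e0) * sqrt (Re (h (z *s v) (z *s v)))) * z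
      = cnj (h v e0) / of_real (cmod (h v e0) * sqrt (Re (h v v)))" by (simp only: a_def t_def)
  then show ?thesis unfolding nu_def vector_smult_assoc by simp
qed

definition nr :: "pt \<Rightarrow> complex^2" where
  "nr p = nu (SOME v. p = pt_of v \<and> positive v)"

lemma nr_pt_of:
  assumes "positive v"
  shows "nr (pt_of v) = nu v"
proof -
  define w where "w = (SOME w. pt_of v = pt_of w \<and> positive w)"
  have w: "pt_of v = pt_of w" "positive w" unfolding w_def
    using someI[of "\<lambda>w. pt_of v = pt_of w \<and> positive w" v] assms by blast+
  then obtain z where "z \<noteq> 0" "w = z *s v" using pt_of_eqD positive_nz(2) by metis
  then have "nu w = nu v" using nu_scale assms by simp
  then show ?thesis by (simp add: nr_def w_def)
qed

lemma open_positive: "open {v. positive v}"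
  by (intro open_Collect_less continuous_intros)

lemma continuous_on_nu: "continuous_on {v. positive v} nu"
proof -
  have "complex_of_real (cmod (h v e0) * sqrt (Re (h v v))) \<noteq> 0" if "v \<in> {v. positive v}" for v
    using that positive_nz(1)[of v] by simp
  then show ?thesis unfolding nu_def by (intro continuous_intros) blast
qed

lemma topspace_proj_line: "topspace proj_line_topology = pt_of ` (- {0})"
  by (simp add: proj_line_topology_def topspace_quotient_topology)

lemma BV_subset: "BV h \<subseteq> pt_of ` (- {0})"
proof
  fix p assume "p \<in> BV h"
  then obtain v where v: "p = pt_of v" "positive v" unfolding BV_def by blast
  then show "p \<in> pt_of ` (- {0})" using positive_nz(2)[OF v(2)] by blast
qed

lemma topspace_BV: "topspace (BV_topology h) = BV h"
  unfolding BV_topology_def topspace_subtopology topspace_proj_line using BV_subset by blast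

text \<open>A continuous choice of unit representatives reduces continuity on the quotient topology
  to continuity of formulas in vectors.\<close>

lemma continuous_nr: "continuous_map (BV_topology h) euclidean nr"
  unfolding continuous_map_def
proof (intro conjI allI impI)
  fix U :: "(complex^2) set" assume "openin euclidean U"
  then have U: "open U" by simp
  define W where "W = {p \<in> BV h. nr p \<in> U}"
  have "{v. positive v} \<inter> nu -` U = - {0} \<inter> {v. positive v \<and> nu v \<in> U}"
    using positive_nz(2) by blast
  moreover have "{v \<in> - {0}. pt_of v \<in> W} = - {0} \<inter> {v. positive v \<and> nu v \<in> U}"
  proof (rule Set.set_eqI)
    fix v
    show "v \<in> {v \<in> - {0}. pt_of v \<in> W} \<longleftrightarrow> v \<in> - {0} \<inter> {v. positive v \<and> nu v \<in> U}"
    proof (cases "v = 0")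
      case False
      have "pt_of v \<in> W \<longleftrightarrow> positive v \<and> nr (pt_of v) \<in> U" unfolding W_def mem_Collect_eq pt_of_BV[OF False] ..
      also have "\<dots> \<longleftrightarrow> positive v \<and> nu v \<in> U" using nr_pt_of[of v] by metis
      finally show ?thesis using False by blast
    qed simp
  qed
  moreover have "open ({v. positive v} \<inter> nu -` U)"
    by (rule continuous_open_preimage[OF continuous_on_nu open_positive U])
  ultimately have "openin (top_of_set (- {0})) {v \<in> - {0}. pt_of v \<in> W}"
    by (metis (no_types, lifting) inf_le1 open_subset)
  then have "openin proj_line_topology W"
    unfolding proj_line_topology_def openin_quotient_topology topspace_euclidean_subtopology
    using BV_subset unfolding W_def by blast
  moreover have "{x \<in> topspace (BV_topology h). nr x \<in> U} = W \<inter> BV h"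
    unfolding W_def topspace_BV by blast
  ultimately show "openin (BV_topology h) {x \<in> topspace (BV_topology h). nr x \<in> U}"
    unfolding BV_topology_def openin_subtopology by blast
qed simp

lemma continuous_pt_of: "continuous_map (top_of_set {v. unit v}) (BV_topology h) pt_of"
proof -
  have "continuous_map (top_of_set (- {0})) proj_line_topology pt_of"
    unfolding proj_line_topology_def by (rule quotient_imp_continuous_map[OF quotient_map_quotient_topology])
  then have "continuous_map (top_of_set {v. unit v}) proj_line_topology pt_of"
    by (rule continuous_map_from_subtopology_mono) auto
  moreover have "pt_of v \<in> BV h" if "unit v" for v using that BV_iff by blast
  ultimately show ?thesis unfolding BV_topology_def continuous_map_in_subtopology by auto
qed

definition disk :: "real \<Rightarrow> (complex^2) set" where
  "disk T = (\<lambda>(p, q). p *s e0 + (- q) *s e1) ` (cball 0 T \<times> cball 0 T)"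

lemma compact_disk: "compact (disk T)"
  unfolding disk_def case_prod_unfold
  by (intro compact_continuous_image compact_Times compact_cball continuous_intros)

lemma in_disk:
  assumes "unit c" "(cmod (h c e0))\<^sup>2 \<le> T" "T \<ge> 1"
  shows "c \<in> disk T"
proof -
  have "T \<le> T\<^sup>2" using assms(3) by (simp add: power2_eq_square)
  moreover have "(cmod (h c e1))\<^sup>2 \<le> T" using Re_h_self[of c] assms(1,2) by simp
  ultimately have 1: "(cmod (h c e0))\<^sup>2 \<le> T\<^sup>2" "(cmod (h c e1))\<^sup>2 \<le> T\<^sup>2" using assms(2) by linarith+
  have "cmod (h c e0) \<le> T" "cmod (h c e1) \<le> T"
    using power2_le_imp_le[OF 1(1)] power2_le_imp_le[OF 1(2)] assms(3) by simp_all
  then have "(h c e0, h c e1) \<in> cball 0 T \<times> cball 0 T" by simp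
  moreover have "c = (\<lambda>(p, q). p *s e0 + (- q) *s e1) (h c e0, h c e1)" unfolding prod.case by (rule decomp)
  ultimately show ?thesis unfolding disk_def by (rule rev_image_eqI)
qed

end

context hexagons
begin

abbreviation HT :: "hexagon topology" where "HT \<equiv> hexagon_topology h al"

lemma topspace_HT: "topspace HT = {x. is_hexagon h al x}"
proof -
  have "x \<in> UNIV \<times> BV h \<times> BV h \<times> BV h \<times> BV h" if "is_hexagon h al x" for x
    using that by (cases x) (simp add: Let_def)
  moreover have "topspace HT = (UNIV \<times> BV h \<times> BV h \<times> BV h \<times> BV h) \<inter> {x. is_hexagon h al x}"
    by (simp only: hexagon_topology_def topspace_subtopology topspace_prod_topology topspace_discrete_topology topspace_BV)
  ultimately show ?thesis by blast
qed

definition NR :: "hexagon \<Rightarrow> (complex^2) \<times> (complex^2) \<times> (complex^2) \<times> (complex^2)" where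
  "NR x = (nr (fst (snd x)), nr (fst (snd (snd x))), nr (fst (snd (snd (snd x)))), nr (snd (snd (snd (snd x)))))"

definition GV :: "hex_type \<Rightarrow> (complex^2) \<times> (complex^2) \<times> (complex^2) \<times> (complex^2) \<Rightarrow> triple" where
  "GV ty m = Th ((cmod (h (fst (snd m)) (fst m)))\<^sup>2, (cmod (h (fst (snd (snd m))) (Rp (fst (snd m)) (kk ty 1) (fst m))))\<^sup>2,
     (cmod (h (snd (snd (snd m))) (fst m)))\<^sup>2)"

lemma continuous_GV: "continuous_on UNIV (GV ty)"
  unfolding GV_def Th_def crd.simps by (intro continuous_intros)

lemma hexT_GV:
  assumes "is_hexagon h al x"
  shows "hexT x = GV (fst x) (NR x)"
proof -
  obtain ty c0 c1 c2 c3 where v: "vhex ty c0 c1 c2 c3" and x: "x = hx ty c0 c1 c2 c3"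
    using hexagon_cases[OF assms] by blast
  have p: "positive c0" "positive c1" "positive c2" "positive c3" using v by (simp_all add: vhex_def)
  note u = nu_props(1)[OF p(1)] nu_props(1)[OF p(2)] nu_props(1)[OF p(3)] nu_props(1)[OF p(4)]
  have "x = hx ty (nu c0) (nu c1) (nu c2) (nu c3)"
    unfolding x nu_props(2)[OF p(1)] nu_props(2)[OF p(2)] nu_props(2)[OF p(3)] nu_props(2)[OF p(4)] ..
  then have "hexT x = Th (tv ty (nu c0) (nu c1) (nu c2) (nu c3))"
    unfolding hexT_def using hexagon_t_hx[OF u] by simp
  moreover have "NR x = (nu c0, nu c1, nu c2, nu c3)"
    unfolding NR_def x by (simp only: fst_conv snd_conv nr_pt_of[OF p(1)] nr_pt_of[OF p(2)] nr_pt_of[OF p(3)] nr_pt_of[OF p(4)])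
  ultimately show ?thesis
    unfolding GV_def tv_def x by (simp only: fst_conv snd_conv Rp_unit[OF u(2)])
qed

lemma continuous_hexT: "continuous_map HT euclidean hexT"
proof -
  let ?B = "BV_topology h"
  have s0: "continuous_map HT (prod_topology (discrete_topology UNIV)
         (prod_topology ?B (prod_topology ?B (prod_topology ?B ?B)))) (\<lambda>x. x)"
    unfolding hexagon_topology_def by (intro continuous_map_from_subtopology continuous_map_id[unfolded id_def])
  note s1 = continuous_map_snd_of[OF s0, unfolded o_def]
  note s2 = continuous_map_snd_of[OF s1, unfolded o_def]
  note s3 = continuous_map_snd_of[OF s2, unfolded o_def]
  note s4 = continuous_map_snd_of[OF s3, unfolded o_def]
  note f0 = continuous_map_fst_of[OF s0, unfolded o_def]
  note n = continuous_map_compose[OF _ continuous_nr, unfolded o_def]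
  have "continuous_map HT (prod_topology euclidean (prod_topology euclidean (prod_topology euclidean euclidean))) NR"
    unfolding NR_def
    by (intro continuous_map_pairedI n[OF s4] n[OF continuous_map_fst_of[OF s1, unfolded o_def]]
      n[OF continuous_map_fst_of[OF s2, unfolded o_def]] n[OF continuous_map_fst_of[OF s3, unfolded o_def]])
  then have NR: "continuous_map HT euclidean NR" by simp
  have G: "continuous_map HT euclidean (\<lambda>x. GV ty (NR x))" for ty
    using continuous_map_compose[OF NR, of euclidean "GV ty"] continuous_GV by (simp add: o_def)
  show ?thesis unfolding continuous_map_def
  proof (intro conjI allI impI)
    fix U :: "triple set" assume U: "openin euclidean U"
    have "openin HT ({x \<in> topspace HT. fst x \<in> {ty}} \<inter> {x \<in> topspace HT. GV ty (NR x) \<in> U})" for ty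
      by (intro openin_Int openin_continuous_map_preimage[OF f0] openin_continuous_map_preimage[OF G U]) simp
    then have "openin HT (\<Union>ty. {x \<in> topspace HT. fst x \<in> {ty}} \<inter> {x \<in> topspace HT. GV ty (NR x) \<in> U})"
      by (intro openin_Union) auto
    moreover have "{x \<in> topspace HT. hexT x \<in> U} = (\<Union>ty. {x \<in> topspace HT. fst x \<in> {ty}} \<inter> {x \<in> topspace HT. GV ty (NR x) \<in> U})"
      unfolding topspace_HT using hexT_GV by auto
    ultimately show "openin HT {x \<in> topspace HT. hexT x \<in> U}" by simp
  qed simp
qed

text \<open>Every hexagon is congruent to one with \<open>c\<^sub>0\<close> spanned by \<open>e0\<close>; on this slice \<open>hexT\<close> is proper.\<close>

definition slice :: "((complex^2) \<times> (complex^2) \<times> (complex^2)) set" where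
  "slice = {m. vhex First e0 (fst m) (fst (snd m)) (snd (snd m))}"

definition emb :: "(complex^2) \<times> (complex^2) \<times> (complex^2) \<Rightarrow> hexagon" where
  "emb m = hx First e0 (fst m) (fst (snd m)) (snd (snd m))"

lemma closed_slice: "closed slice"
proof -
  define E where "E = (\<lambda>m :: (complex^2) \<times> (complex^2) \<times> (complex^2).
    Rp (snd (snd m)) (kk First 3) (Rp (fst (snd m)) (kk First 2) (Rp (fst m) (kk First 1) e0)))"
  have "m \<in> slice \<longleftrightarrow> h (fst m) (fst m) = 1 \<and> h (fst (snd m)) (fst (snd m)) = 1 \<and> h (snd (snd m)) (snd (snd m)) = 1 \<and>
    (E m = kk First 0 *s e0 \<or> E m = (- kk First 0) *s e0)" for m
  proof -
    have "triv (kk First) e0 (fst m) (fst (snd m)) (snd (snd m)) \<longleftrightarrow> E m = kk First 0 *s e0 \<or> E m = (- kk First 0) *s e0"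
      if u: "unit (fst m)" "unit (fst (snd m))" "unit (snd (snd m))"
    proof -
      have "triv (kk First) e0 (fst m) (fst (snd m)) (snd (snd m)) \<longleftrightarrow> (\<exists>e::real. e\<^sup>2 = (1::real) \<and> E m = (e * kk First 0) *s e0)"
        unfolding triv_iff[OF basis(1) u kk_norm] E_def Rp_unit[OF u(1)] Rp_unit[OF u(2)] Rp_unit[OF u(3)] ..
      also have "\<dots> \<longleftrightarrow> (\<exists>e::real. (e = (1::real) \<or> e = -1) \<and> E m = (e * kk First 0) *s e0)" by (simp add: power2_eq_1_iff)
      also have "\<dots> \<longleftrightarrow> E m = (complex_of_real 1 * kk First 0) *s e0 \<or> E m = (complex_of_real (-1) * kk First 0) *s e0" by blast
      finally show ?thesis by simp
    qed
    then show ?thesis unfolding slice_def vhex_def using basis(1) by blast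
  qed
  then have "slice = {m. h (fst m) (fst m) = 1 \<and> h (fst (snd m)) (fst (snd m)) = 1 \<and> h (snd (snd m)) (snd (snd m)) = 1 \<and>
    (E m = kk First 0 *s e0 \<or> E m = (- kk First 0) *s e0)}" by blast
  also have "closed \<dots>"
    unfolding E_def
    by (intro closed_Collect_conj closed_Collect_disj closed_Collect_eq continuous_intros)
  finally show ?thesis .
qed

lemma emb_hexagon: "m \<in> slice \<Longrightarrow> is_hexagon h al (emb m)"
  unfolding emb_def slice_def by (intro is_hexagon_vhex) simp

lemma continuous_emb: "continuous_map (top_of_set slice) HT emb"
proof -
  have u: "unit (fst m)" "unit (fst (snd m))" "unit (snd (snd m))" if "m \<in> slice" for m
    using that by (auto simp: slice_def vhex_def)
  have p: "continuous_map (top_of_set slice) (BV_topology h) (\<lambda>m. pt_of (f m))"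
    if "continuous_on slice f" "\<And>m. m \<in> slice \<Longrightarrow> unit (f m)" for f
    using continuous_map_compose[OF _ continuous_pt_of, of "top_of_set slice" f] that
    by (auto simp: o_def continuous_map_in_subtopology)
  have "continuous_map (top_of_set slice) (prod_topology (discrete_topology UNIV)
         (prod_topology (BV_topology h) (prod_topology (BV_topology h) (prod_topology (BV_topology h) (BV_topology h))))) emb"
    unfolding emb_def
    by (intro continuous_map_pairedI p continuous_intros) (use u basis(1) in auto)
  then show ?thesis unfolding hexagon_topology_def continuous_map_in_subtopology topspace_euclidean_subtopology
    using emb_hexagon by blast
qed

lemma hexT_emb: "m \<in> slice \<Longrightarrow> hexT (emb m) = Th (tv First e0 (fst m) (fst (snd m)) (snd (snd m)))"
  unfolding emb_def slice_def by (intro hexT_hx) simp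

text \<open>Bounds on t1 and t3 bound c1 and c3, since these are measured against e0. The bound on
  t2 is relative to p1 = R1 e0, so c2 is bounded as the image under R1 of a vector that is bounded
  in this way.\<close>

lemma compact_slice_preimage:
  assumes U: "compact U"
  shows "compact {m \<in> slice. hexT (emb m) \<in> U}"
proof -
  have "continuous_map (top_of_set slice) euclidean (hexT \<circ> emb)"
    by (rule continuous_map_compose[OF continuous_emb continuous_hexT])
  then have cont: "continuous_on slice (\<lambda>m. hexT (emb m))" by (simp add: o_def)
  have cl: "closed {m \<in> slice. hexT (emb m) \<in> U}"
  proof -
    have "{m \<in> slice. hexT (emb m) \<in> U} = slice \<inter> (\<lambda>m. hexT (emb m)) -` U" by blast
    then show ?thesis using continuous_closed_preimage[OF cont closed_slice compact_imp_closed[OF U]] by simp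
  qed
  have "\<exists>T. \<forall>P\<in>U. ang.tau i P \<le> T" for i
  proof -
    have "bounded (ang.tau i ` U)"
      by (intro compact_imp_bounded compact_continuous_image ang.continuous_on_tau U)
    then obtain T where T: "\<forall>x\<in>ang.tau i ` U. norm x \<le> T" unfolding bounded_iff by blast
    have "ang.tau i P \<le> T" if "P \<in> U" for P
    proof -
      have "norm (ang.tau i P) \<le> T" using T that by blast
      then show ?thesis by simp
    qed
    then show ?thesis by blast
  qed
  then have "\<forall>i. \<exists>T. \<forall>P\<in>U. ang.tau i P \<le> T" by (rule allI)
  then have "\<exists>b. \<forall>i. \<forall>P\<in>U. ang.tau i P \<le> b i" by (rule choice)
  then obtain b where b0: "\<forall>i. \<forall>P\<in>U. ang.tau i P \<le> b i" by (rule exE)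
  have b: "ang.tau i P \<le> b i" if "P \<in> U" for i P using b0 that by (simp only: Ball_def)
  define T where "T = 1 + \<bar>b L1\<bar> + \<bar>b L2\<bar> + \<bar>b L3\<bar>"
  have N: "0 \<le> \<bar>b L1\<bar>" "0 \<le> \<bar>b L2\<bar>" "0 \<le> \<bar>b L3\<bar>" by (rule abs_ge_zero)+
  have B: "b L1 \<le> \<bar>b L1\<bar>" "b L2 \<le> \<bar>b L2\<bar>" "b L3 \<le> \<bar>b L3\<bar>" by (rule abs_ge_self)+
  have T1: "T \<ge> 1" using N unfolding T_def by linarith
  have b1: "b L1 + 1 \<le> T + T" using N B unfolding T_def by linarith
  have b2: "b L2 + 1 \<le> T + T" using N B unfolding T_def by linarith
  have b3: "b L3 + 1 \<le> T + T" using N B unfolding T_def by linarith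
  have T2: "b i + 1 \<le> T + T" for i
  proof (cases i)
    case L1 show ?thesis unfolding L1 by (rule b1)
  next
    case L2 show ?thesis unfolding L2 by (rule b2)
  next
    case L3 show ?thesis unfolding L3 by (rule b3)
  qed
  let ?f = "\<lambda>m. (fst m, Rp (fst m) (kk First 1) (fst (snd m)), snd (snd m))"
  have "{m \<in> slice. hexT (emb m) \<in> U} \<subseteq> ?f ` (disk T \<times> disk T \<times> disk T)"
  proof
    fix m assume m: "m \<in> {m \<in> slice. hexT (emb m) \<in> U}"
    obtain c1 c2 c3 where c: "m = (c1, c2, c3)" by (cases m)
    have v: "vhex First e0 c1 c2 c3" using m by (simp add: slice_def c)
    then have u: "unit c1" "unit c2" "unit c3" by (simp_all add: vhex_def)
    define t where "t = tv First e0 c1 c2 c3"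
    have "Th t \<in> U" using m hexT_emb[of m] by (simp add: c t_def)
    then have bb: "ang.tau i (Th t) \<le> b i" for i by (rule b)
    have t: "crd i t \<le> T" for i using bb[of i] tau_Th[of i t] T2[of i] by linarith
    define c2' where "c2' = Rv c1 (cnj (kk First 1)) c2"
    have c2: "c2 = Rv c1 (kk First 1) c2'" unfolding c2'_def by (simp add: Rv_inv'[OF u(1) kk_norm])
    have u2: "unit c2'" unfolding c2'_def by (rule unit_Rv) (simp_all add: u kk_norm')
    have "h c2 (Rv c1 (kk First 1) e0) = h c2' e0" unfolding c2 by (rule h_Rv[OF u(1) kk_norm])
    then have "(cmod (h c1 e0))\<^sup>2 \<le> T" "(cmod (h c2' e0))\<^sup>2 \<le> T" "(cmod (h c3 e0))\<^sup>2 \<le> T"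
      using t[of L1] t[of L2] t[of L3] by (simp_all only: t_def tv_def crd.simps)
    then have "c1 \<in> disk T" "c2' \<in> disk T" "c3 \<in> disk T" using in_disk[OF u(1) _ T1] in_disk[OF u2 _ T1] in_disk[OF u(3) _ T1] by blast+
    moreover have "m = ?f (c1, c2', c3)" unfolding c fst_conv snd_conv Rp_unit[OF u(1)] c2[symmetric] ..
    ultimately show "m \<in> ?f ` (disk T \<times> disk T \<times> disk T)" by blast
  qed
  moreover have "compact (?f ` (disk T \<times> disk T \<times> disk T))"
    by (intro compact_continuous_image compact_Times compact_disk continuous_intros)
  ultimately have "bounded {m \<in> slice. hexT (emb m) \<in> U}"
    using bounded_subset compact_imp_bounded by blast
  then show ?thesis using cl by (simp add: compact_eq_bounded_closed)
qed

text \<open>It is enough that the restriction to the slice is a quotient map. It is closed there: a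
  convergent sequence of values together with its limit is compact, so points of the slice with
  these values have a convergent subsequence.\<close>

theorem quotient_map_hexT: "quotient_map HT (top_of_set ang.TT) hexT"
proof (rule quotient_map_from_composition[OF continuous_emb])
  show "continuous_map HT (top_of_set ang.TT) hexT"
    unfolding continuous_map_in_subtopology topspace_HT using continuous_hexT hexT_TT by blast
  then have cont: "continuous_map (top_of_set slice) (top_of_set ang.TT) (hexT \<circ> emb)"
    by (rule continuous_map_compose[OF continuous_emb])
  then have co: "continuous_on slice (hexT \<circ> emb)" by (simp add: continuous_map_in_subtopology)
  show "quotient_map (top_of_set slice) (top_of_set ang.TT) (hexT \<circ> emb)"
  proof (rule continuous_closed_imp_quotient_map[OF cont])
    show "(hexT \<circ> emb) ` topspace (top_of_set slice) = topspace (top_of_set ang.TT)"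
    proof
      show "(hexT \<circ> emb) ` topspace (top_of_set slice) \<subseteq> topspace (top_of_set ang.TT)"
        unfolding topspace_euclidean_subtopology o_apply using hexT_TT emb_hexagon by blast
      show "topspace (top_of_set ang.TT) \<subseteq> (hexT \<circ> emb) ` topspace (top_of_set slice)"
      proof
        fix P assume "P \<in> topspace (top_of_set ang.TT)"
        then have "P \<in> ang.TT" by simp
        then obtain c1 c2 c3 where c: "vhex First e0 c1 c2 c3" "Th (tv First e0 c1 c2 c3) = P" by (rule hexT_onto)
        then have m: "(c1, c2, c3) \<in> slice" by (simp add: slice_def)
        then have "hexT (emb (c1, c2, c3)) = P" using hexT_emb[OF m] c(2) by simp
        then show "P \<in> (hexT \<circ> emb) ` topspace (top_of_set slice)"
          using m by (intro image_eqI[of _ _ "(c1, c2, c3)"]) simp_all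
      qed
    qed
    show "closed_map (top_of_set slice) (top_of_set ang.TT) (hexT \<circ> emb)"
      unfolding closed_map_def
    proof (intro allI impI)
      fix K assume K: "closedin (top_of_set slice) K"
      have Kc: "closed K" "K \<subseteq> slice"
        using closedin_closed_trans[OF K closed_slice] closedin_subset[OF K] by simp_all
      have "closed ((hexT \<circ> emb) ` K)"
        unfolding closed_sequential_limits
      proof (intro allI impI)
        fix y l assume y: "(\<forall>n. y n \<in> (hexT \<circ> emb) ` K) \<and> y \<longlonglongrightarrow> l"
        then have "\<forall>n. \<exists>m. m \<in> K \<and> y n = hexT (emb m)" unfolding image_iff o_apply by blast
        then have "\<exists>m. \<forall>n. m n \<in> K \<and> y n = hexT (emb (m n))" by (rule choice)
        then obtain m where m0: "\<forall>n. m n \<in> K \<and> y n = hexT (emb (m n))" by (rule exE)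
        have m: "m n \<in> K" "y n = hexT (emb (m n))" for n using m0 by simp_all
        define U where "U = insert l (range y)"
        have "compact U" unfolding U_def using y compact_sequence_with_limit by blast
        then have c: "compact ({m \<in> slice. hexT (emb m) \<in> U} \<inter> K)"
          using compact_slice_preimage Kc(1) by (intro compact_Int_closed)
        have "m n \<in> {m \<in> slice. hexT (emb m) \<in> U} \<inter> K" for n
        proof -
          have "hexT (emb (m n)) \<in> U" unfolding m(2)[symmetric] U_def by simp
          then show ?thesis using m(1)[of n] Kc(2) by blast
        qed
        then have c': "\<forall>n. m n \<in> {m \<in> slice. hexT (emb m) \<in> U} \<inter> K" by (rule allI)
        obtain p r where p: "p \<in> {m \<in> slice. hexT (emb m) \<in> U} \<inter> K" "strict_mono r" "(m \<circ> r) \<longlonglongrightarrow> p"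
          using seq_compactE[OF compact_imp_seq_compact[OF c] c'] by blast
        have "p \<in> slice" "\<forall>n. (m \<circ> r) n \<in> slice" using p(1) m(1) Kc(2) by auto
        then have "((hexT \<circ> emb) \<circ> (m \<circ> r)) \<longlonglongrightarrow> (hexT \<circ> emb) p"
          using co[unfolded continuous_on_sequentially] p(3) by blast
        moreover have "(hexT \<circ> emb) \<circ> (m \<circ> r) = y \<circ> r" using m(2) by (simp add: fun_eq_iff)
        moreover have "(y \<circ> r) \<longlonglongrightarrow> l" using y p(2) LIMSEQ_subseq_LIMSEQ by blast
        ultimately have "l = (hexT \<circ> emb) p" by (metis LIMSEQ_unique)
        then show "l \<in> (hexT \<circ> emb) ` K" using p(1) by blast
      qed
      moreover have "(hexT \<circ> emb) ` K \<subseteq> ang.TT" unfolding o_apply using Kc(2) hexT_TT emb_hexagon by blast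
      ultimately show "closedin (top_of_set ang.TT) ((hexT \<circ> emb) ` K)" by (rule closed_subset[rotated])
    qed
  qed
qed

end

section \<open>Transformations and the main theorem\<close>

lemma BijGroup_mult_apply:
  "f \<in> Bij S \<Longrightarrow> g \<in> Bij S \<Longrightarrow> x \<in> S \<Longrightarrow> (f \<otimes>\<^bsub>BijGroup S\<^esub> g) x = f (g x)"
  by (simp add: BijGroup_def compose_def)

lemma carrier_BijGroup: "carrier (BijGroup S) = Bij S"
  and one_BijGroup: "\<one>\<^bsub>BijGroup S\<^esub> = (\<lambda>x\<in>S. x)"
  by (simp_all add: BijGroup_def)

context hexagons
begin

abbreviation orb :: "hexagon \<Rightarrow> hexagon set" where "orb \<equiv> PU_orbit h"

lemma S_space_eq: "S_space h al = orb ` {x. is_hexagon h al x}"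
  by (simp only: S_topology_def topspace_quotient_topology topspace_HT)

lemma orb_S: "is_hexagon h al x \<Longrightarrow> orb x \<in> S_space h al"
  unfolding S_space_eq by blast

definition md :: "letter \<Rightarrow> hexagon set \<Rightarrow> hexagon set" where
  "md j = restrict (\<lambda>P. nh j ` P) (S_space h al)"

lemma md_orb: "is_hexagon h al x \<Longrightarrow> md j (orb x) = orb (nh j x)"
  using orb_S[of x] nh_orbit[of x j] by (simp add: md_def)

lemma md_S: "P \<in> S_space h al \<Longrightarrow> md j P \<in> S_space h al"
  and md_md_id: "P \<in> S_space h al \<Longrightarrow> md j (md j P) = P"
proof -
  assume "P \<in> S_space h al"
  then obtain x where x: "is_hexagon h al x" "P = orb x" unfolding S_space_eq by blast
  show "md j P \<in> S_space h al" unfolding x(2) md_orb[OF x(1)] by (rule orb_S[OF hexagon_nh[OF x(1)]])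
  show "md j (md j P) = P" unfolding x(2) md_orb[OF x(1)] md_orb[OF hexagon_nh[OF x(1)]] nh_nh[OF x(1)] ..
qed

lemma md_Bij: "md j \<in> Bij (S_space h al)"
proof -
  have "bij_betw (md j) (S_space h al) (S_space h al)"
  proof (rule bij_betw_byWitness[where f' = "md j"])
    show "\<forall>P\<in>S_space h al. md j (md j P) = P" by (intro ballI md_md_id)
    show "\<forall>P\<in>S_space h al. md j (md j P) = P" by (intro ballI md_md_id)
    show "md j ` S_space h al \<subseteq> S_space h al" by (intro image_subsetI md_S)
    show "md j ` S_space h al \<subseteq> S_space h al" by (intro image_subsetI md_S)
  qed
  moreover have "md j \<in> extensional (S_space h al)" unfolding md_def by (rule restrict_extensional)
  ultimately show ?thesis unfolding Bij_def by blast
qed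

sublocale grp: involutions "BijGroup (S_space h al)" md
proof (intro involutions.intro involutions_axioms.intro)
  show "group (BijGroup (S_space h al))" by (rule group_BijGroup)
  show "md j \<in> carrier (BijGroup (S_space h al))" for j unfolding carrier_BijGroup by (rule md_Bij)
  show "md j \<otimes>\<^bsub>BijGroup (S_space h al)\<^esub> md j = \<one>\<^bsub>BijGroup (S_space h al)\<^esub>" for j
  proof -
    have "md j \<otimes>\<^bsub>BijGroup (S_space h al)\<^esub> md j = compose (S_space h al) (md j) (md j)"
      using md_Bij[of j] by (simp add: BijGroup_def)
    also have "\<dots> = (\<lambda>P\<in>S_space h al. P)" unfolding compose_def by (rule restrict_ext) (rule md_md_id)
    finally show ?thesis unfolding one_BijGroup .
  qed
qed

lemma M3_eq: "M3 h al = range grp.wv"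
proof -
  have a: "range md = {md L1, md L2, md L3}" unfolding letter_UNIV image_insert image_empty ..
  have b: "modifications h al = {md L1, md L2, md L3}"
    unfolding modifications_def md_def nh_def letter.case image_insert image_empty ..
  show ?thesis unfolding M3_def b a[symmetric] by (rule grp.generate_md)
qed

lemma wv_Bij: "grp.wv w \<in> Bij (S_space h al)"
  using grp.wv_closed[of w] unfolding carrier_BijGroup .

lemma hact_hexagon: "is_hexagon h al x \<Longrightarrow> is_hexagon h al (foldr nh w x)"
  by (induction w) (simp_all add: hexagon_nh del: is_hexagon.simps)

lemma hact_rev: "is_hexagon h al x \<Longrightarrow> foldr nh (rev w) (foldr nh w x) = x"
  by (induction w arbitrary: x) (simp_all add: nh_nh hact_hexagon del: is_hexagon.simps)

lemma hexT_hact: "is_hexagon h al x \<Longrightarrow> hexT (foldr nh w x) = foldr ang.nmod w (hexT x)"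
  by (induction w) (simp_all add: hexT_nh hact_hexagon del: is_hexagon.simps)

lemma flip_neq: "flip t \<noteq> t" "flip (flip t) = t"
  by (cases t; simp)+

lemma fst_hact: "is_hexagon h al x \<Longrightarrow> fst (foldr nh w x) = (if even (length w) then fst x else flip (fst x))"
  by (induction w) (simp_all add: fst_nh hact_hexagon flip_neq del: is_hexagon.simps)

lemma wv_orb:
  assumes x: "is_hexagon h al x"
  shows "grp.wv w (orb x) = orb (foldr nh w x)"
proof (induction w)
  case Nil
  show ?case unfolding grp.wv_Nil one_BijGroup using orb_S[OF x] by (simp only: restrict_apply' foldr_Nil id_apply)
next
  case (Cons i w)
  have "grp.wv (i # w) (orb x) = md i (grp.wv w (orb x))"
    unfolding grp.wv_Cons by (rule BijGroup_mult_apply[OF md_Bij wv_Bij orb_S[OF x]])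
  then show ?case unfolding Cons using md_orb[OF hact_hexagon[OF x]] by simp
qed

abbreviation IT :: "hexagon set set topology" where "IT \<equiv> ident_topology h al"

definition ix :: "hexagon \<Rightarrow> hexagon set set" where "ix x = identified h al (orb x)"

lemma ix_eq:
  assumes x: "is_hexagon h al x"
  shows "ix x = orb ` {y. is_hexagon h al y \<and> hexT y = hexT x}"
proof -
  have "t_of h al (orb y) = t_of h al (orb x) \<longleftrightarrow> hexT y = hexT x" if "is_hexagon h al y" for y
    unfolding t_of_orbit[OF that] t_of_orbit[OF x] hexT_def Th_inj ..
  then show ?thesis unfolding ix_def identified_def S_space_eq by blast
qed

lemma orb_eq_hexT: "is_hexagon h al x \<Longrightarrow> is_hexagon h al y \<Longrightarrow> orb x = orb y \<Longrightarrow> hexT x = hexT y"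
  using t_of_orbit[of x] t_of_orbit[of y] by (simp add: hexT_def)

lemma ix_eq_iff:
  assumes x: "is_hexagon h al x" and y: "is_hexagon h al y"
  shows "ix x = ix y \<longleftrightarrow> hexT x = hexT y"
proof
  assume "ix x = ix y"
  moreover have "orb x \<in> ix x" unfolding ix_eq[OF x] using x by blast
  ultimately obtain z where z: "is_hexagon h al z" "hexT z = hexT y" "orb x = orb z" unfolding ix_eq[OF y] by blast
  then show "hexT x = hexT y" using orb_eq_hexT[OF x z(1)] by simp
qed (simp add: ix_eq[OF x] ix_eq[OF y])

lemma wv_ix:
  assumes x: "is_hexagon h al x"
  shows "grp.wv w ` ix x = ix (foldr nh w x)"
proof -
  have "grp.wv w ` ix x = (\<lambda>y. orb (foldr nh w y)) ` {y. is_hexagon h al y \<and> hexT y = hexT x}"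
    unfolding ix_eq[OF x] image_image by (rule image_cong[OF refl]) (use wv_orb in blast)
  also have "\<dots> = orb ` {z. is_hexagon h al z \<and> hexT z = hexT (foldr nh w x)}"
  proof
    show "(\<lambda>y. orb (foldr nh w y)) ` {y. is_hexagon h al y \<and> hexT y = hexT x} \<subseteq>
        orb ` {z. is_hexagon h al z \<and> hexT z = hexT (foldr nh w x)}"
    proof
      fix P assume "P \<in> (\<lambda>y. orb (foldr nh w y)) ` {y. is_hexagon h al y \<and> hexT y = hexT x}"
      then obtain y where y: "is_hexagon h al y" "hexT y = hexT x" "P = orb (foldr nh w y)" by blast
      have "hexT (foldr nh w y) = hexT (foldr nh w x)" unfolding hexT_hact[OF y(1)] hexT_hact[OF x] y(2) ..
      then show "P \<in> orb ` {z. is_hexagon h al z \<and> hexT z = hexT (foldr nh w x)}"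
        unfolding y(3) using hact_hexagon[OF y(1)] by blast
    qed
    show "orb ` {z. is_hexagon h al z \<and> hexT z = hexT (foldr nh w x)} \<subseteq>
        (\<lambda>y. orb (foldr nh w y)) ` {y. is_hexagon h al y \<and> hexT y = hexT x}"
    proof
      fix P assume "P \<in> orb ` {z. is_hexagon h al z \<and> hexT z = hexT (foldr nh w x)}"
      then obtain z where z: "is_hexagon h al z" "hexT z = hexT (foldr nh w x)" "P = orb z" by blast
      define y where "y = foldr nh (rev w) z"
      have y: "is_hexagon h al y" unfolding y_def by (rule hact_hexagon[OF z(1)])
      have "hexT y = foldr ang.nmod (rev w) (hexT (foldr nh w x))" unfolding y_def hexT_hact[OF z(1)] z(2) ..
      also have "\<dots> = hexT x" unfolding hexT_hact[OF hact_hexagon[OF x], symmetric] hact_rev[OF x] ..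
      finally have "hexT y = hexT x" .
      moreover have "foldr nh w y = z" using hact_rev[OF z(1), of "rev w"] by (simp add: y_def)
      ultimately show "P \<in> (\<lambda>y. orb (foldr nh w y)) ` {y. is_hexagon h al y \<and> hexT y = hexT x}"
        unfolding z(3) using y by blast
    qed
  qed
  finally show ?thesis unfolding ix_eq[OF hact_hexagon[OF x]] .
qed

lemma quotient_map_ix: "quotient_map HT IT ix"
proof -
  have "quotient_map HT (S_topology h al) orb" unfolding S_topology_def by (rule quotient_map_quotient_topology)
  moreover have "quotient_map (S_topology h al) IT (identified h al)"
    unfolding ident_topology_def by (rule quotient_map_quotient_topology)
  ultimately have "quotient_map HT IT (identified h al \<circ> orb)" by (rule quotient_map_compose)
  moreover have "identified h al \<circ> orb = ix" by (simp add: fun_eq_iff ix_def)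
  ultimately show ?thesis by simp
qed

lemma topspace_IT: "topspace IT = ix ` {x. is_hexagon h al x}"
  using quotient_imp_surjective_map[OF quotient_map_ix] unfolding topspace_HT by simp

lemma hexT_range: "hexT ` {x. is_hexagon h al x} = ang.TT"
  using quotient_imp_surjective_map[OF quotient_map_hexT] unfolding topspace_HT by simp

text \<open>The space of identified hexagons and \<open>ang.TT\<close> are quotients of the same
  space of hexagons with the same fibres, by \<open>ix_eq_iff\<close>, hence homeomorphic.\<close>

definition Phi :: "hexagon set set \<Rightarrow> triple" where
  "Phi = (SOME \<phi>. homeomorphic_map IT (top_of_set ang.TT) \<phi> \<and> (\<forall>x. is_hexagon h al x \<longrightarrow> \<phi> (ix x) = hexT x))"

lemma Phi: "homeomorphic_map IT (top_of_set ang.TT) Phi" "is_hexagon h al x \<Longrightarrow> Phi (ix x) = hexT x"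
proof -
  have f: "ix x = ix y \<longleftrightarrow> hexT x = hexT y" if "x \<in> topspace HT" "y \<in> topspace HT" for x y
    using that ix_eq_iff unfolding topspace_HT by blast
  obtain \<phi> where "homeomorphic_map IT (top_of_set ang.TT) \<phi>" "\<And>x. x \<in> topspace HT \<Longrightarrow> \<phi> (ix x) = hexT x"
  proof (rule quotient_maps_homeomorphic[OF quotient_map_ix quotient_map_hexT])
    show "ix x = ix y \<longleftrightarrow> hexT x = hexT y" if "x \<in> topspace HT" "y \<in> topspace HT" for x y using that by (rule f)
  qed (rule that)
  then have "\<exists>\<phi>. homeomorphic_map IT (top_of_set ang.TT) \<phi> \<and> (\<forall>x. is_hexagon h al x \<longrightarrow> \<phi> (ix x) = hexT x)"
    unfolding topspace_HT by blast
  then have "homeomorphic_map IT (top_of_set ang.TT) Phi \<and> (\<forall>x. is_hexagon h al x \<longrightarrow> Phi (ix x) = hexT x)"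
    unfolding Phi_def by (rule someI_ex)
  then show "homeomorphic_map IT (top_of_set ang.TT) Phi" "is_hexagon h al x \<Longrightarrow> Phi (ix x) = hexT x" by blast+
qed

lemma Phi_inj: "Q \<in> topspace IT \<Longrightarrow> Q' \<in> topspace IT \<Longrightarrow> Phi Q = Phi Q' \<Longrightarrow> Q = Q'"
  using homeomorphic_imp_injective_map[OF Phi(1)] by (rule inj_onD)

lemma wv_IT: "Q \<in> topspace IT \<Longrightarrow> grp.wv w ` Q \<in> topspace IT"
  and Phi_wv: "Q \<in> topspace IT \<Longrightarrow> Phi (grp.wv w ` Q) = foldr ang.nmod w (Phi Q)"
proof -
  assume "Q \<in> topspace IT"
  then obtain x where x: "is_hexagon h al x" "Q = ix x" unfolding topspace_IT by blast
  show "grp.wv w ` Q \<in> topspace IT" unfolding x(2) wv_ix[OF x(1)] topspace_IT using hact_hexagon[OF x(1)] by blast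
  show "Phi (grp.wv w ` Q) = foldr ang.nmod w (Phi Q)"
    unfolding x(2) wv_ix[OF x(1)] Phi(2)[OF x(1)] Phi(2)[OF hact_hexagon[OF x(1)]] by (rule hexT_hact[OF x(1)])
qed

lemma wv_image_append: "Q \<in> topspace IT \<Longrightarrow> grp.wv u ` (grp.wv w ` Q) = grp.wv (u @ w) ` Q"
  by (rule Phi_inj) (simp_all only: wv_IT Phi_wv foldr_append o_apply)

lemma nmod_TT: "P \<in> ang.TT \<Longrightarrow> ang.nmod j P \<in> ang.TT"
  and nact_rev: "P \<in> ang.TT \<Longrightarrow> foldr ang.nmod (rev w) (foldr ang.nmod w P) = P"
  and wv_eq_nact: "P \<in> ang.TT \<Longrightarrow> grp.wv u = grp.wv w \<Longrightarrow> foldr ang.nmod u P = foldr ang.nmod w P"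
proof -
  assume "P \<in> ang.TT"
  then obtain x where x: "is_hexagon h al x" "P = hexT x" unfolding hexT_range[symmetric] by blast
  show "ang.nmod j P \<in> ang.TT" unfolding x(2) hexT_nh[OF x(1), symmetric] by (rule hexT_TT[OF hexagon_nh[OF x(1)]])
  show "foldr ang.nmod (rev w) (foldr ang.nmod w P) = P"
    unfolding x(2) hexT_hact[OF x(1), symmetric] hexT_hact[OF hact_hexagon[OF x(1)], symmetric] hact_rev[OF x(1)] ..
  assume "grp.wv u = grp.wv w"
  then have "orb (foldr nh u x) = orb (foldr nh w x)" using wv_orb[OF x(1)] by metis
  then have "hexT (foldr nh u x) = hexT (foldr nh w x)"
    by (rule orb_eq_hexT[OF hact_hexagon[OF x(1)] hact_hexagon[OF x(1)]])
  then show "foldr ang.nmod u P = foldr ang.nmod w P" unfolding x(2) hexT_hact[OF x(1)] .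
qed

lemma pair_sum_iff:
  assumes "j \<le> 3" "k \<le> 3"
  shows "cos (al j) + cos (al k) \<ge> 0 \<longleftrightarrow> al j + al k \<le> pi" "cos (al j) + cos (al k) \<le> 0 \<longleftrightarrow> pi \<le> al j + al k"
proof -
  have b: "0 \<le> al j" "al j \<le> pi" "0 \<le> pi - al k" "pi - al k \<le> pi" using al[OF assms(1)] al[OF assms(2)] by auto
  have c: "cos (pi - al k) = - cos (al k)" by simp
  show "cos (al j) + cos (al k) \<ge> 0 \<longleftrightarrow> al j + al k \<le> pi"
    using cos_mono_le_eq[OF b(3,4,1,2)] unfolding c by linarith
  show "cos (al j) + cos (al k) \<le> 0 \<longleftrightarrow> pi \<le> al j + al k"
    using cos_mono_le_eq[OF b] unfolding c by linarith
qed

lemma right_iff: "j \<le> 3 \<Longrightarrow> cos (al j) = 0 \<longleftrightarrow> al j = pi / 2"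
proof -
  assume "j \<le> 3"
  then have b: "0 \<le> al j" "al j \<le> pi" using al by (simp_all add: less_imp_le)
  show ?thesis
  proof
    assume "cos (al j) = 0"
    then have "cos (al j) = cos (pi / 2)" by (simp only: cos_pi_half)
    then show "al j = pi / 2" using cos_inj_pi[OF b, of "pi / 2"] by simp
  qed (simp only: cos_pi_half)
qed

lemma four: "{0..3} = {0, 1, 2, 3 :: nat}"
  by auto

section \<open>The action on one connected component\<close>

context
  fixes C
  assumes C: "C \<in> connected_components_of IT" and not_singleton: "\<not> is_singleton C"
begin

abbreviation X :: "hexagon set set topology" where "X \<equiv> subtopology IT C"

definition KC :: "triple set" where "KC = Phi ` C"

lemma C_sub: "C \<subseteq> topspace IT"
  using C by (rule connected_components_of_subset)

lemma topspace_X: "topspace X = C"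
  using C_sub by auto

lemma KC_component: "KC \<in> components ang.TT"
  unfolding KC_def by (rule homeomorphic_map_components[OF Phi(1) C])

lemma KC_sub: "KC \<subseteq> ang.TT"
  using KC_component by (rule in_components_subset)

lemma hom_X: "homeomorphic_map X (top_of_set KC) Phi"
proof -
  have "homeomorphic_map X (subtopology (top_of_set ang.TT) KC) Phi"
  proof (rule homeomorphic_map_subtopologies[OF Phi(1)])
    show "Phi ` (topspace IT \<inter> C) = topspace (top_of_set ang.TT) \<inter> KC"
      unfolding Int_absorb1[OF C_sub] topspace_euclidean_subtopology Int_absorb1[OF KC_sub] unfolding KC_def ..
  qed
  then show ?thesis unfolding subtopology_subtopology Int_absorb1[OF KC_sub] .
qed

lemma Phi_inj_C: "inj_on Phi C"
  using homeomorphic_imp_injective_map[OF hom_X] unfolding topspace_X .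

lemma KC_not_singleton: "\<not> is_singleton KC"
proof -
  have "card KC = card C" unfolding KC_def by (rule card_image[OF Phi_inj_C])
  then show ?thesis using not_singleton unfolding is_singleton_altdef by simp
qed

lemma compactin_X: "compactin X E \<longleftrightarrow> E \<subseteq> C \<and> compact (Phi ` E)"
proof -
  have "compactin X E \<longleftrightarrow> E \<subseteq> topspace X \<and> compactin (top_of_set KC) (Phi ` E)"
    by (rule homeomorphic_map_compactness_eq[OF hom_X])
  also have "\<dots> \<longleftrightarrow> E \<subseteq> C \<and> compact (Phi ` E)"
    unfolding topspace_X
  proof (rule conj_cong[OF refl])
    assume "E \<subseteq> C"
    then have "Phi ` E \<subseteq> KC" unfolding KC_def by (rule image_mono)
    then show "compactin (top_of_set KC) (Phi ` E) = compact (Phi ` E)"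
      by (simp only: compactin_subtopology compactin_euclidean_iff simp_thms)
  qed
  finally show ?thesis .
qed

lemma compact_X: "compact_space X \<longleftrightarrow> compact KC"
  unfolding compact_space_def topspace_X compactin_X KC_def by simp

lemma meets_iff:
  assumes E: "E \<subseteq> C"
  shows "(\<lambda>Q. grp.wv w ` Q) ` E \<inter> E \<noteq> {} \<longleftrightarrow> foldr ang.nmod w ` (Phi ` E) \<inter> Phi ` E \<noteq> {}"
proof
  assume "(\<lambda>Q. grp.wv w ` Q) ` E \<inter> E \<noteq> {}"
  then obtain Q where Q: "Q \<in> E" "grp.wv w ` Q \<in> E" by blast
  have "Phi (grp.wv w ` Q) = foldr ang.nmod w (Phi Q)" using Phi_wv Q(1) E C_sub by blast
  then show "foldr ang.nmod w ` (Phi ` E) \<inter> Phi ` E \<noteq> {}" using Q by blast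
next
  assume "foldr ang.nmod w ` (Phi ` E) \<inter> Phi ` E \<noteq> {}"
  then obtain Q Q' where Q: "Q \<in> E" "Q' \<in> E" "foldr ang.nmod w (Phi Q) = Phi Q'" by blast
  have T: "Q \<in> topspace IT" "Q' \<in> topspace IT" using Q E C_sub by blast+
  have "grp.wv w ` Q = Q'" by (rule Phi_inj[OF wv_IT[OF T(1)] T(2)]) (simp only: Phi_wv[OF T(1)] Q(3))
  then show "(\<lambda>Q. grp.wv w ` Q) ` E \<inter> E \<noteq> {}" using Q by blast
qed

lemma discrete_iff:
  "acts_discretely (M3 h al) X \<longleftrightarrow>
    (\<forall>E. E \<subseteq> C \<longrightarrow> compact (Phi ` E) \<longrightarrow> finite (grp.wv ` {w. foldr ang.nmod w ` (Phi ` E) \<inter> Phi ` E \<noteq> {}}))"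
proof -
  have key: "{g \<in> M3 h al. (\<lambda>Q. g ` Q) ` E \<inter> E \<noteq> {}} = grp.wv ` {w. foldr ang.nmod w ` (Phi ` E) \<inter> Phi ` E \<noteq> {}}"
    if "E \<subseteq> C" for E
  proof -
    have "{g \<in> M3 h al. (\<lambda>Q. g ` Q) ` E \<inter> E \<noteq> {}} = grp.wv ` {w. (\<lambda>Q. grp.wv w ` Q) ` E \<inter> E \<noteq> {}}"
      unfolding M3_eq by blast
    then show ?thesis unfolding meets_iff[OF that] .
  qed
  have "acts_discretely (M3 h al) X \<longleftrightarrow>
    (\<forall>E. E \<subseteq> C \<and> compact (Phi ` E) \<longrightarrow> finite {g \<in> M3 h al. (\<lambda>Q. g ` Q) ` E \<inter> E \<noteq> {}})"
    unfolding acts_discretely_def compactin_X ..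
  also have "\<dots> \<longleftrightarrow> (\<forall>E. E \<subseteq> C \<longrightarrow> compact (Phi ` E) \<longrightarrow>
      finite (grp.wv ` {w. foldr ang.nmod w ` (Phi ` E) \<inter> Phi ` E \<noteq> {}}))"
  proof (rule iff_allI)
    fix E
    show "(E \<subseteq> C \<and> compact (Phi ` E) \<longrightarrow> finite {g \<in> M3 h al. (\<lambda>Q. g ` Q) ` E \<inter> E \<noteq> {}}) =
      (E \<subseteq> C \<longrightarrow> compact (Phi ` E) \<longrightarrow> finite (grp.wv ` {w. foldr ang.nmod w ` (Phi ` E) \<inter> Phi ` E \<noteq> {}}))"
    proof (cases "E \<subseteq> C")
      case True
      show ?thesis unfolding key[OF True] by blast
    qed blast
  qed
  finally show ?thesis .
qed

text \<open>All powers of the product map E into itself, so discreteness makes two different powers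
  equal as transformations. Cancelling gives finite order on all of \<open>ang.TT\<close>, not only
  on E.\<close>

lemma finite_order:
  assumes disc: "acts_discretely (M3 h al) X"
    and E: "compact E" "E \<subseteq> KC" "E \<noteq> {}" "ang.nmod j ` E \<subseteq> E" "ang.nmod l ` E \<subseteq> E"
  shows "\<exists>N>0. \<forall>Q\<in>ang.TT. ((ang.nmod j \<circ> ang.nmod l) ^^ N) Q = Q"
proof -
  define f where "f = ang.nmod j \<circ> ang.nmod l"
  define p where "p = (\<lambda>n. concat (replicate n [j, l]))"
  have p: "foldr ang.nmod (p n) P = (f ^^ n) P" for n P
    by (induction n) (simp_all add: p_def f_def)
  have fE: "f P \<in> E" if "P \<in> E" for P unfolding f_def o_apply using E(4,5) that by blast
  have inv: "(f ^^ n) P \<in> E" if "P \<in> E" for n P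
    by (induction n) (simp_all add: that fE)
  obtain E' where E': "E' \<subseteq> C" "E = Phi ` E'" using E(2) unfolding KC_def subset_image_iff by blast
  obtain P where P: "P \<in> E" using E(3) by blast
  have mem: "grp.wv (p n) \<in> grp.wv ` {w. foldr ang.nmod w ` E \<inter> E \<noteq> {}}" for n
  proof -
    have "foldr ang.nmod (p n) P \<in> E" unfolding p by (rule inv[OF P])
    then have "foldr ang.nmod (p n) ` E \<inter> E \<noteq> {}" using P by blast
    then show ?thesis by blast
  qed
  have "finite (grp.wv ` {w. foldr ang.nmod w ` (Phi ` E') \<inter> Phi ` E' \<noteq> {}})"
    using disc[unfolded discrete_iff] E' E(1) by blast
  then have "finite (grp.wv ` {w. foldr ang.nmod w ` E \<inter> E \<noteq> {}})" unfolding E'(2) .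
  moreover have "range (\<lambda>n. grp.wv (p n)) \<subseteq> grp.wv ` {w. foldr ang.nmod w ` E \<inter> E \<noteq> {}}"
    by (rule image_subsetI) (rule mem)
  ultimately have fin: "finite (range (\<lambda>n. grp.wv (p n)))" by (rule finite_subset[rotated])
  have "\<not> inj (\<lambda>n. grp.wv (p n))"
  proof
    assume "inj (\<lambda>n. grp.wv (p n))"
    then have "finite (UNIV :: nat set)" by (rule finite_imageD[OF fin])
    then show False by simp
  qed
  then obtain n m where nm: "n \<noteq> m" "grp.wv (p n) = grp.wv (p m)" unfolding inj_on_def by blast
  have fTT: "f Q \<in> ang.TT" if "Q \<in> ang.TT" for Q unfolding f_def o_apply by (rule nmod_TT[OF nmod_TT[OF that]])
  have main: "\<exists>N>0. \<forall>Q\<in>ang.TT. (f ^^ N) Q = Q" if "n < m" "grp.wv (p n) = grp.wv (p m)" for n m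
  proof (intro exI[of _ "m - n"] conjI ballI)
    show "0 < m - n" using that(1) by simp
    fix Q assume Q: "Q \<in> ang.TT"
    define R where "R = (f ^^ (m - n)) Q"
    have "(f ^^ i) Q \<in> ang.TT" for i by (induction i) (simp_all only: funpow.simps o_apply id_apply Q fTT)
    then have R: "R \<in> ang.TT" unfolding R_def .
    have "n + (m - n) = m" using that(1) by simp
    then have "(f ^^ m) Q = (f ^^ n) R" unfolding R_def using funpow_add[of n "m - n" f] by simp
    then have e: "foldr ang.nmod (p n) R = foldr ang.nmod (p n) Q"
      using wv_eq_nact[OF Q that(2)] unfolding p by simp
    have "R = foldr ang.nmod (rev (p n)) (foldr ang.nmod (p n) R)" by (rule nact_rev[OF R, symmetric])
    also have "\<dots> = Q" unfolding e by (rule nact_rev[OF Q])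
    finally show "(f ^^ (m - n)) Q = Q" unfolding R_def .
  qed
  show ?thesis unfolding f_def[symmetric]
  proof (cases "n < m")
    case True
    then show "\<exists>N>0. \<forall>Q\<in>ang.TT. (f ^^ N) Q = Q" using nm(2) by (rule main)
  next
    case False
    then have "m < n" using nm(1) by simp
    then show "\<exists>N>0. \<forall>Q\<in>ang.TT. (f ^^ N) Q = Q" using nm(2)[symmetric] by (rule main)
  qed
qed

lemma discrete_imp:
  assumes "acts_discretely (M3 h al) X"
  shows "\<not> compact_space X"
    "(\<forall>j\<in>{0..3}. \<forall>k\<in>{0..3}. j \<noteq> k \<longrightarrow> al j + al k \<le> pi) \<or> (\<forall>j\<in>{0..3}. \<forall>k\<in>{0..3}. j \<noteq> k \<longrightarrow> pi \<le> al j + al k)"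
    "\<exists>j\<in>{0..3}. al j \<noteq> pi / 2"
proof -
  have inv: "\<And>j P. P \<in> ang.TT \<Longrightarrow> ang.nmod j P \<in> ang.TT" by (rule nmod_TT)
  have fo: "\<And>E j l. compact E \<Longrightarrow> E \<subseteq> KC \<Longrightarrow> E \<noteq> {} \<Longrightarrow> ang.nmod j ` E \<subseteq> E \<Longrightarrow> ang.nmod l ` E \<subseteq> E \<Longrightarrow>
      \<exists>N>0. \<forall>Q\<in>ang.TT. ((ang.nmod j \<circ> ang.nmod l) ^^ N) Q = Q"
    by (rule finite_order[OF assms])
  have D1: "\<not> compact KC"
    by (rule ang.discrete_conditions(1)[OF KC_component KC_not_singleton]) (erule inv, erule (4) fo)
  have D2: "\<not> (cos (al 0) = 0 \<and> cos (al 1) = 0 \<and> cos (al 2) = 0 \<and> cos (al 3) = 0)"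
    by (rule ang.discrete_conditions(2)[OF KC_component KC_not_singleton]) (erule inv, erule (4) fo)
  have D3: "(cos (al 0) + cos (al 1) \<ge> 0 \<and> cos (al 0) + cos (al 2) \<ge> 0 \<and> cos (al 0) + cos (al 3) \<ge> 0 \<and>
      cos (al 1) + cos (al 2) \<ge> 0 \<and> cos (al 1) + cos (al 3) \<ge> 0 \<and> cos (al 2) + cos (al 3) \<ge> 0) \<or>
      (cos (al 0) + cos (al 1) \<le> 0 \<and> cos (al 0) + cos (al 2) \<le> 0 \<and> cos (al 0) + cos (al 3) \<le> 0 \<and>
      cos (al 1) + cos (al 2) \<le> 0 \<and> cos (al 1) + cos (al 3) \<le> 0 \<and> cos (al 2) + cos (al 3) \<le> 0)"
    by (rule ang.discrete_conditions(3)[OF KC_component KC_not_singleton]) (erule inv, erule (4) fo)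
  have l: "(0::nat) \<le> 3" "(1::nat) \<le> 3" "(2::nat) \<le> 3" "(3::nat) \<le> 3" by simp_all
  show "\<not> compact_space X" unfolding compact_X by (rule D1)
  show "\<exists>j\<in>{0..3}. al j \<noteq> pi / 2"
    using D2 unfolding right_iff[OF l(1)] right_iff[OF l(2)] right_iff[OF l(3)] right_iff[OF l(4)] four by blast
  show "(\<forall>j\<in>{0..3}. \<forall>k\<in>{0..3}. j \<noteq> k \<longrightarrow> al j + al k \<le> pi) \<or> (\<forall>j\<in>{0..3}. \<forall>k\<in>{0..3}. j \<noteq> k \<longrightarrow> pi \<le> al j + al k)"
    using D3 unfolding pair_sum_iff[OF l(1) l(2)] pair_sum_iff[OF l(1) l(3)] pair_sum_iff[OF l(1) l(4)]
      pair_sum_iff[OF l(2) l(3)] pair_sum_iff[OF l(2) l(4)] pair_sum_iff[OF l(3) l(4)] four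
    by (auto simp: add.commute)
qed

text \<open>Every modification interchanges the types, so the parity of a word is visible at any
  single hexagon, and C provides one.\<close>

lemma M3_even_eq: "M3_even h al = grp.even_words"
proof -
  obtain Q where "Q \<in> C" using nonempty_connected_components_of[OF C] by blast
  then obtain x where x: "is_hexagon h al x" using C_sub unfolding topspace_IT by blast
  have "(\<forall>P\<in>S_space h al. type_of (grp.wv w P) = type_of P) \<longleftrightarrow> even (length w)" for w
  proof
    assume "\<forall>P\<in>S_space h al. type_of (grp.wv w P) = type_of P"
    then have "type_of (grp.wv w (orb x)) = type_of (orb x)" using orb_S[OF x] by blast
    then have "fst (foldr nh w x) = fst x" unfolding wv_orb[OF x] type_of_orbit .
    then show "even (length w)" unfolding fst_hact[OF x] using flip_neq(1)[of "fst x"] by (cases "even (length w)") simp_all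
  next
    assume w: "even (length w)"
    show "\<forall>P\<in>S_space h al. type_of (grp.wv w P) = type_of P"
    proof
      fix P assume "P \<in> S_space h al"
      then obtain y where y: "is_hexagon h al y" "P = orb y" unfolding S_space_eq by blast
      show "type_of (grp.wv w P) = type_of P"
        unfolding y(2) wv_orb[OF y(1)] type_of_orbit fst_hact[OF y(1)] using w by simp
    qed
  qed
  then show ?thesis unfolding M3_even_def M3_eq grp.even_words_def by blast
qed

text \<open>The sign s treats both alternatives of (ii) at once: the cubic and its increments do not
  change if all four cosines change sign, that is, if every a_j is replaced by pi - a_j.\<close>

lemma discrete_converse:
  assumes s: "s = 1 \<or> s = (-1::real)"
    and pairs: "\<forall>j k. j \<le> 3 \<longrightarrow> k \<le> 3 \<longrightarrow> j \<noteq> k \<longrightarrow> s * cos (al j) + s * cos (al k) \<ge> 0"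
    and not_right: "\<exists>j\<in>{0..3}. al j \<noteq> pi / 2" and noncompact: "\<not> compact_space X"
  shows "acts_discretely (M3 h al) X" "three_holed_sphere (orbit_space (M3_even h al) X)"
    "free_group_of_rank (M3_even_group h al) 2"
proof -
  have l: "(0::nat) \<le> 3" "(1::nat) \<le> 3" "(2::nat) \<le> 3" "(3::nat) \<le> 3" by simp_all
  have s2: "s * s = 1" "s\<^sup>2 = 1" using s by auto
  have nr: "\<not> (cos (al 0) = 0 \<and> cos (al 1) = 0 \<and> cos (al 2) = 0 \<and> cos (al 3) = 0)"
    using not_right unfolding right_iff[OF l(1)] right_iff[OF l(2)] right_iff[OF l(3)] right_iff[OF l(4)] four by blast
  interpret sm: small_angles "s * cos (al 0)" "s * cos (al 1)" "s * cos (al 2)" "s * cos (al 3)"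
    "sin (al 0)" "sin (al 1)" "sin (al 2)" "sin (al 3)"
  proof
    show "0 \<le> s * cos (al 0) + s * cos (al 1)" "0 \<le> s * cos (al 0) + s * cos (al 2)" "0 \<le> s * cos (al 0) + s * cos (al 3)"
      "0 \<le> s * cos (al 1) + s * cos (al 2)" "0 \<le> s * cos (al 1) + s * cos (al 3)" "0 \<le> s * cos (al 2) + s * cos (al 3)"
      by (rule pairs[rule_format]; simp)+
    show "\<not> (s * cos (al 0) = 0 \<and> s * cos (al 1) = 0 \<and> s * cos (al 2) = 0 \<and> s * cos (al 3) = 0)"
      using nr s by auto
  qed (use sin_al[of 0] sin_al[of 1] sin_al[of 2] sin_al[of 3] s2(2) in \<open>simp_all add: power_mult_distrib\<close>)
  have F: "sm.F P = ang.F P" for P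
    using s by (cases P) (auto simp: fricke_def)
  have cs: "sm.cs i = s * ang.cs i" for i by (cases i) simp_all
  have Acs: "2 * (s * cos (al 0)) * sm.cs i = 2 * cos (al 0) * ang.cs i" for i
    unfolding cs using s by auto
  have Tp: "sm.Tp = ang.Tp" unfolding sm.Tp_def ang.Tp_def F Acs ..
  have modif: "sm.modif i P = ang.modif i P" for i P
    using s by (cases P; cases i) (auto simp: slope_def)
  have act: "foldr ang.nmod w P = sm.act w P" if "P \<in> sm.Tp" for w P
  proof (induction w)
    case (Cons i w)
    have "sm.act w P \<in> ang.Tp" using sm.act_Tp[OF that] unfolding Tp .
    then have "ang.nmod i (sm.act w P) = ang.modif i (sm.act w P)" unfolding ang.nmod_def by (rule if_P)
    then show ?case unfolding foldr_Cons o_apply Cons modif .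
  qed simp
  \<comment> \<open>The component is closed and \<open>ang.Tm\<close> is bounded, so inside
    \<open>ang.Tm\<close> it would be compact. This leaves \<open>ang.Tp\<close>, which is
    connected.\<close>
  have KC_Tp: "KC = sm.Tp"
  proof -
    have "\<not> KC \<subseteq> ang.Tm"
    proof
      assume "KC \<subseteq> ang.Tm"
      have "KC \<subseteq> {-2..2} \<times> {-2..2} \<times> {-2..2}"
      proof
        fix P assume "P \<in> KC"
        then have "P \<in> ang.Tm" using \<open>KC \<subseteq> ang.Tm\<close> by blast
        then have b: "\<bar>crd i P\<bar> < 2" for i by (rule ang.Tm_bounds)
        obtain x y z where "P = (x, y, z)" by (cases P)
        then show "P \<in> {-2..2} \<times> {-2..2} \<times> {-2..2}" using b[of L1] b[of L2] b[of L3] by auto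
      qed
      moreover have "bounded ({-2..2} \<times> {-2..2} \<times> {-2..2} :: triple set)"
        by (intro bounded_Times bounded_closed_interval)
      ultimately have "bounded KC" by (rule bounded_subset[rotated])
      moreover have "closed KC"
        by (rule closed_components[OF closed_Un[OF ang.closed_Tp ang.closed_Tm] KC_component])
      ultimately show False using noncompact compact_eq_bounded_closed unfolding compact_X by blast
    qed
    then have sub: "KC \<subseteq> ang.Tp" using ang.component_cases[OF KC_component] by blast
    have "KC \<noteq> {}" by (rule in_components_nonempty[OF KC_component])
    then have ne: "KC \<inter> ang.Tp \<noteq> {}" using sub by blast
    have "ang.Tp \<subseteq> KC"
      by (rule components_maximal[OF KC_component sm.connected_Tp[unfolded Tp] Un_upper1 ne])
    with sub show ?thesis unfolding Tp by (rule equalityI)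
  qed
  note wv_simps = grp.wv_append grp.m_assoc
  have cancel: "grp.wv (rev u' @ (u' @ w @ rev u) @ u) = grp.wv w" for u u' w
  proof -
    have "grp.wv (rev u' @ (u' @ w @ rev u) @ u) = (grp.wv (rev u') \<otimes>\<^bsub>BijGroup (S_space h al)\<^esub> grp.wv u')
        \<otimes>\<^bsub>BijGroup (S_space h al)\<^esub> (grp.wv w \<otimes>\<^bsub>BijGroup (S_space h al)\<^esub> (grp.wv (rev u) \<otimes>\<^bsub>BijGroup (S_space h al)\<^esub> grp.wv u))"
      by (simp add: wv_simps)
    then show ?thesis unfolding grp.wv_rev by simp
  qed
  show "acts_discretely (M3 h al) X"
    unfolding discrete_iff
  proof (intro allI impI)
    fix E assume E: "E \<subseteq> C" "compact (Phi ` E)"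
    have sub: "Phi ` E \<subseteq> sm.Tp" using E(1) unfolding KC_Tp[symmetric] KC_def by blast
    obtain N where N: "\<And>w. sm.act w ` (Phi ` E) \<inter> Phi ` E \<noteq> {} \<Longrightarrow>
      \<exists>u u'. length u \<le> N \<and> length u' \<le> N \<and> length (reduce (u' @ w @ rev u)) \<le> 1"
    proof (rule sm.act_meets_compact[OF E(2) sub])
    qed (rule that)
    define L where "L = (\<lambda>n. {u :: letter list. set u \<subseteq> UNIV \<and> length u \<le> n})"
    have fin: "finite (L n)" for n unfolding L_def by (rule finite_lists_length_le) simp
    \<comment> \<open>Up to words of length at most N on both sides, the remaining middle word has
      at most one letter, so there are finitely many choices.\<close>
    have "grp.wv ` {w. foldr ang.nmod w ` (Phi ` E) \<inter> Phi ` E \<noteq> {}} \<subseteq>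
      (\<lambda>(u', s, u). grp.wv (rev u' @ s @ u)) ` (L N \<times> L 1 \<times> L N)"
    proof
      fix g assume "g \<in> grp.wv ` {w. foldr ang.nmod w ` (Phi ` E) \<inter> Phi ` E \<noteq> {}}"
      then obtain w where w: "g = grp.wv w" "foldr ang.nmod w ` (Phi ` E) \<inter> Phi ` E \<noteq> {}" by blast
      have eq: "foldr ang.nmod w ` (Phi ` E) = sm.act w ` (Phi ` E)"
        by (rule image_cong[OF refl]) (use act sub in blast)
      have "sm.act w ` (Phi ` E) \<inter> Phi ` E \<noteq> {}" using w(2) unfolding eq .
      then obtain u u' where u: "length u \<le> N" "length u' \<le> N" "length (reduce (u' @ w @ rev u)) \<le> 1"
        using N by blast
      have "grp.wv (rev u' @ reduce (u' @ w @ rev u) @ u) = grp.wv (rev u' @ (u' @ w @ rev u) @ u)"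
        by (simp only: grp.wv_append[of "rev u'"] grp.wv_append[of _ u] grp.wv_reduce)
      then have "g = grp.wv (rev u' @ reduce (u' @ w @ rev u) @ u)" unfolding cancel w(1) by simp
      then show "g \<in> (\<lambda>(u', s, u). grp.wv (rev u' @ s @ u)) ` (L N \<times> L 1 \<times> L N)"
        using u unfolding L_def by (intro image_eqI[of _ _ "(u', reduce (u' @ w @ rev u), u)"]) auto
    qed
    then show "finite (grp.wv ` {w. foldr ang.nmod w ` (Phi ` E) \<inter> Phi ` E \<noteq> {}})"
      by (rule finite_subset) (intro finite_imageI finite_cartesian_product fin)
  qed
  \<comment> \<open>Equal transformations move an interior point of the domain to the same place,
    and \<open>act_inj\<close> recovers the reduced word from this place.\<close>
  have inj: "inj_on grp.wv {w. distinct_adj w}"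
  proof (rule inj_onI)
    fix u w assume uw: "u \<in> {w. distinct_adj w}" "w \<in> {w. distinct_adj w}" "grp.wv u = grp.wv w"
    obtain p where p: "p \<in> sm.dom" "\<And>i. sm.v i p > 0" using sm.interior_point by blast
    have pT: "p \<in> sm.Tp" using p(1) by (simp add: sm.dom_def)
    then have "p \<in> ang.TT" using Tp by blast
    then have "foldr ang.nmod u p = foldr ang.nmod w p" using uw(3) by (rule wv_eq_nact)
    then have "sm.act u p = sm.act w p" unfolding act[OF pT] .
    then show "u = w" using sm.act_inj[OF p] uw(1,2) by blast
  qed
  then show "free_group_of_rank (M3_even_group h al) 2"
    unfolding M3_even_group_def M3_even_eq by (rule grp.free_even_words)
  define f where "f = (\<lambda>Q. {g ` Q | g. g \<in> M3_even h al})"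
  have f: "quotient_map X (orbit_space (M3_even h al) X) f"
    unfolding orbit_space_def f_def by (rule quotient_map_quotient_topology)
  have g: "quotient_map X (top_of_set (- {1, -1})) (sm.Lam \<circ> Phi)"
  proof (rule quotient_map_compose[OF _ sm.quotient_map_Lam])
    show "quotient_map X (top_of_set sm.Tp) Phi" using hom_X unfolding homeomorphic_map_def KC_Tp by blast
  qed
  have f_eq: "f Q = {grp.wv u ` Q | u. even (length u)}" for Q
    unfolding f_def M3_even_eq grp.even_words_def by blast
  have f_sub: "f Q' \<subseteq> f Q" if "Q \<in> topspace IT" "even (length w)" "grp.wv w ` Q = Q'" for Q Q' w
  proof
    fix R assume "R \<in> f Q'"
    then obtain u where u: "even (length u)" "R = grp.wv u ` Q'" unfolding f_eq by blast
    have "R = grp.wv (u @ w) ` Q" using wv_image_append[OF that(1), of u w] u(2) that(3) by simp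
    moreover have "even (length (u @ w))" using u(1) that(2) by simp
    ultimately show "R \<in> f Q" unfolding f_eq by blast
  qed
  have wv_Nil: "grp.wv [] ` Q = Q" if "Q \<in> topspace IT" for Q
    by (rule Phi_inj[OF wv_IT[OF that] that]) (simp only: Phi_wv[OF that] foldr_Nil id_apply)
  have fib: "f Q = f Q' \<longleftrightarrow> (sm.Lam \<circ> Phi) Q = (sm.Lam \<circ> Phi) Q'" if "Q \<in> topspace X" "Q' \<in> topspace X" for Q Q'
  proof -
    have Q: "Q \<in> C" "Q' \<in> C" "Q \<in> topspace IT" "Q' \<in> topspace IT" using that C_sub unfolding topspace_X by blast+
    have P: "Phi Q \<in> sm.Tp" "Phi Q' \<in> sm.Tp" using Q unfolding KC_Tp[symmetric] KC_def by blast+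
    have "f Q = f Q' \<longleftrightarrow> (\<exists>w. even (length w) \<and> sm.act w (Phi Q) = Phi Q')"
    proof
      assume fQ: "f Q = f Q'"
      have "grp.wv [] ` Q' \<in> f Q'" unfolding f_eq by (intro CollectI exI[of _ "[]"]) simp
      then have "Q' \<in> f Q" unfolding fQ wv_Nil[OF Q(4)] .
      then obtain w where w: "even (length w)" "Q' = grp.wv w ` Q" unfolding f_eq by blast
      have "Phi Q' = sm.act w (Phi Q)" unfolding w(2) Phi_wv[OF Q(3)] by (rule act[OF P(1)])
      then show "\<exists>w. even (length w) \<and> sm.act w (Phi Q) = Phi Q'" using w(1) by metis
    next
      assume "\<exists>w. even (length w) \<and> sm.act w (Phi Q) = Phi Q'"
      then obtain w where w: "even (length w)" "sm.act w (Phi Q) = Phi Q'" by blast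
      have 1: "grp.wv w ` Q = Q'"
        by (rule Phi_inj[OF wv_IT[OF Q(3)] Q(4)]) (simp only: Phi_wv[OF Q(3)] act[OF P(1)] w(2))
      have "sm.act (rev w) (Phi Q') = Phi Q" unfolding w(2)[symmetric] by (rule sm.act_rev)
      then have 2: "grp.wv (rev w) ` Q' = Q"
        by (intro Phi_inj[OF wv_IT[OF Q(4)] Q(3)]) (simp only: Phi_wv[OF Q(4)] act[OF P(2)])
      have ev: "even (length (rev w))" using w(1) by simp
      show "f Q = f Q'" by (rule equalityI[OF f_sub[OF Q(4) ev 2] f_sub[OF Q(3) w(1) 1]])
    qed
    then show ?thesis unfolding o_apply sm.Lam_fibres[OF P] .
  qed
  obtain \<phi> where "homeomorphic_map (orbit_space (M3_even h al) X) (top_of_set (- {1, -1 :: complex})) \<phi>"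
  proof (rule quotient_maps_homeomorphic[OF f g])
    show "f Q = f Q' \<longleftrightarrow> (sm.Lam \<circ> Phi) Q = (sm.Lam \<circ> Phi) Q'" if "Q \<in> topspace X" "Q' \<in> topspace X" for Q Q'
      using that by (rule fib)
  qed (rule that)
  then show "three_holed_sphere (orbit_space (M3_even h al) X)"
    by (intro three_holed_sphere_plane[of _ 1 "-1"] homeomorphic_map_imp_homeomorphic_space) simp_all
qed

end

end

theorem theorem4p6p3:
  fixes h :: "complex^2 \<Rightarrow> complex^2 \<Rightarrow> complex"
    and a :: "nat \<Rightarrow> real"
    and C :: "hexagon set set set"
  assumes "hermitian_form h" and "signature_1_1 h"
    and "\<forall>j\<in>{0..3}. 0 < a j \<and> a j < pi"
    and "C \<in> connected_components_of (ident_topology h a)"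
    and "\<not> is_singleton C"
  defines "X \<equiv> subtopology (ident_topology h a) C"
  shows "(acts_discretely (M3 h a) X \<longleftrightarrow>
            \<not> compact_space X \<and>
            ((\<forall>j\<in>{0..3}. \<forall>k\<in>{0..3}. j \<noteq> k \<longrightarrow> a j + a k \<le> pi) \<or>
             (\<forall>j\<in>{0..3}. \<forall>k\<in>{0..3}. j \<noteq> k \<longrightarrow> pi \<le> a j + a k)) \<and>
            (\<exists>j\<in>{0..3}. a j \<noteq> pi / 2))
         \<and> (acts_discretely (M3 h a) X \<longrightarrow>
              three_holed_sphere (orbit_space (M3_even h a) X) \<and>
              free_group_of_rank (M3_even_group h a) 2)"
proof -
  obtain e0 e1 where e: "h e0 e0 = 1" "h e1 e1 = -1" "h e0 e1 = 0"
    using assms(2) unfolding signature_1_1_def by blast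
  have h: "\<And>u v w. h (u + v) w = h u w + h v w" "\<And>z u v. h (z *s u) v = z * h u v" "\<And>u v. h v u = cnj (h u v)"
    using assms(1) unfolding hermitian_form_def by blast+
  interpret hexagons h e0 e1 a
  proof
    show "h (u + v) w = h u w + h v w" for u v w by (rule h(1))
    show "h (z *s u) v = z * h u v" for z u v by (rule h(2))
    show "h v u = cnj (h u v)" for u v by (rule h(3))
    show "0 < a j \<and> a j < pi" if "j \<le> 3" for j using assms(3) that by simp
  qed (fact e)+
  note imp = discrete_imp[OF assms(4,5), folded X_def]
  note conv = discrete_converse[OF assms(4,5), folded X_def]
  have conv': "acts_discretely (M3 h a) X \<and> three_holed_sphere (orbit_space (M3_even h a) X) \<and>
      free_group_of_rank (M3_even_group h a) 2"
    if nc: "\<not> compact_space X" and right: "\<exists>j\<in>{0..3}. a j \<noteq> pi / 2"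
      and sums: "(\<forall>j\<in>{0..3}. \<forall>k\<in>{0..3}. j \<noteq> k \<longrightarrow> a j + a k \<le> pi) \<or>
        (\<forall>j\<in>{0..3}. \<forall>k\<in>{0..3}. j \<noteq> k \<longrightarrow> pi \<le> a j + a k)"
    using sums
  proof
    assume *: "\<forall>j\<in>{0..3}. \<forall>k\<in>{0..3}. j \<noteq> k \<longrightarrow> a j + a k \<le> pi"
    have p: "0 \<le> 1 * cos (a j) + 1 * cos (a k)" if "j \<le> 3" "k \<le> 3" "j \<noteq> k" for j k
      using * that pair_sum_iff(1)[OF that(1,2)] by simp
    have "\<forall>j k. j \<le> 3 \<longrightarrow> k \<le> 3 \<longrightarrow> j \<noteq> k \<longrightarrow> 0 \<le> 1 * cos (a j) + 1 * cos (a k)" by (intro allI impI) (rule p)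
    from conv[OF disjI1[OF refl] this right nc] show ?thesis by blast
  next
    assume *: "\<forall>j\<in>{0..3}. \<forall>k\<in>{0..3}. j \<noteq> k \<longrightarrow> pi \<le> a j + a k"
    have p: "0 \<le> (-1) * cos (a j) + (-1) * cos (a k)" if "j \<le> 3" "k \<le> 3" "j \<noteq> k" for j k
      using * that pair_sum_iff(2)[OF that(1,2)] by simp
    have "\<forall>j k. j \<le> 3 \<longrightarrow> k \<le> 3 \<longrightarrow> j \<noteq> k \<longrightarrow> 0 \<le> (-1) * cos (a j) + (-1) * cos (a k)" by (intro allI impI) (rule p)
    from conv[OF disjI2[OF refl] this right nc] show ?thesis by blast
  qed
  show ?thesis using imp conv' by blast
qed

end
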